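(* The problem \textsc{Independent Set/Pseudoforest modulator} admits a kernel with $\mathcal{O}(|X|^{12})$ vertices. That is, there is a polynomial-time algorithm that, given an instance $(G,X,k)$, outputs an instance $(G',X',k')$ of the same problem such that $G$ has an independent set of size at least $k$ if and only if $G'$ has an independent set of size at least $k'$, and $|V(G')| = \mathcal{O}(|X|^{12})$.
   Context: All graphs are finite, simple and undirected. A pseudoforest is a graph in which every connected component contains at most one cycle. \textsc{Independent Set/Pseudoforest modulator}: the input is a graph $G$, a set $X \subseteq V(G)$ such that $G - X$ is a pseudoforest (a pseudoforest modulator), and an integer $k$; the parameter is $|X|$; the question is whether $G$ has an independent set of size at least $k$. In the output instance, $X'$ is likewise a pseudoforest modulator of $G'$. *)

theory Defs
  imports Main "HOL-Library.Product_Lexorder"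
begin

definition graph :: "nat set \<Rightarrow> nat set set \<Rightarrow> bool" where
  "graph V E \<longleftrightarrow> finite V \<and> (\<forall>e\<in>E. \<exists>u v. u \<noteq> v \<and> e = {u, v} \<and> u \<in> V \<and> v \<in> V)"

definition independent_set :: "nat set \<Rightarrow> nat set set \<Rightarrow> nat set \<Rightarrow> bool" where
  "independent_set V E S \<longleftrightarrow> S \<subseteq> V \<and> (\<forall>u\<in>S. \<forall>v\<in>S. {u, v} \<notin> E)"

definition has_indep_set :: "nat set \<Rightarrow> nat set set \<Rightarrow> nat \<Rightarrow> bool" where
  "has_indep_set V E k \<longleftrightarrow> (\<exists>S. independent_set V E S \<and> card S \<ge> k)"

definition del_verts_V :: "nat set \<Rightarrow> nat set \<Rightarrow> nat set" where
  "del_verts_V V X = V - X"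

definition del_verts_E :: "nat set set \<Rightarrow> nat set \<Rightarrow> nat set set" where
  "del_verts_E E X = {e \<in> E. e \<inter> X = {}}"

definition reach :: "nat set set \<Rightarrow> nat \<Rightarrow> nat \<Rightarrow> bool" where
  "reach E = (\<lambda>u v. {u, v} \<in> E)\<^sup>*\<^sup>*"

text \<open>A cycle is given by a list of at least 3 distinct vertices, consecutive
  ones (cyclically) adjacent; as a subgraph it is identified with its edge set.\<close>
definition is_cycle :: "nat set set \<Rightarrow> nat list \<Rightarrow> bool" where
  "is_cycle E vs \<longleftrightarrow> length vs \<ge> 3 \<and> distinct vs \<and>
     (\<forall>i < length vs. {vs ! i, vs ! ((i + 1) mod length vs)} \<in> E)"

definition cycle_edges :: "nat list \<Rightarrow> nat set set" where
  "cycle_edges vs = {{vs ! i, vs ! ((i + 1) mod length vs)} | i. i < length vs}"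

definition pseudoforest :: "nat set \<Rightarrow> nat set set \<Rightarrow> bool" where
  "pseudoforest V E \<longleftrightarrow> graph V E \<and>
     (\<forall>c1 c2. is_cycle E c1 \<and> is_cycle E c2 \<and> reach E (hd c1) (hd c2)
        \<longrightarrow> cycle_edges c1 = cycle_edges c2)"

definition valid_instance :: "nat set \<Rightarrow> nat set set \<Rightarrow> nat set \<Rightarrow> nat \<Rightarrow> bool" where
  "valid_instance V E X k \<longleftrightarrow> graph V E \<and> X \<subseteq> V \<and>
     pseudoforest (del_verts_V V X) (del_verts_E E X)"

text \<open>Symbols: 0 = blank, 1 = bit 0, 2 = bit 1, 3 = separator.
  Numbers are written in binary, least significant bit first.\<close>
fun bin :: "nat \<Rightarrow> nat list" where
  "bin n = (if n < 2 then [n + 1] else (n mod 2 + 1) # bin (n div 2))"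

definition enc_nats :: "nat list \<Rightarrow> nat list" where
  "enc_nats ns = concat (map (\<lambda>n. bin n @ [3]) ns)"

definition edge_list :: "nat set set \<Rightarrow> (nat \<times> nat) list" where
  "edge_list E = sorted_list_of_set {(u, v). {u, v} \<in> E \<and> u < v}"

definition enc_instance :: "nat set \<Rightarrow> nat set set \<Rightarrow> nat set \<Rightarrow> nat \<Rightarrow> nat list" where
  "enc_instance V E X k = enc_nats
     ([k, card V] @ sorted_list_of_set V @ [card X] @ sorted_list_of_set X
      @ [length (edge_list E)] @ concat (map (\<lambda>(u, v). [u, v]) (edge_list E)))"

datatype dir = Left | Right

text \<open>A machine with states {0..<Q} (start state 0) and tape symbols {0..<S}
  (0 = blank) is a transition table delta; delta q a = None means halting.\<close>
definition tm_ok :: "nat \<Rightarrow> nat \<Rightarrow> (nat \<Rightarrow> nat \<Rightarrow> (nat \<times> nat \<times> dir) option) \<Rightarrow> bool" where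
  "tm_ok Q S delta \<longleftrightarrow> 0 < Q \<and> 4 \<le> S \<and>
     (\<forall>q a. (q \<ge> Q \<or> a \<ge> S) \<longrightarrow> delta q a = None) \<and>
     (\<forall>q a q' b d. delta q a = Some (q', b, d) \<longrightarrow> q' < Q \<and> b < S)"

type_synonym config = "nat \<times> (nat \<Rightarrow> nat) \<times> nat"

definition tm_step :: "(nat \<Rightarrow> nat \<Rightarrow> (nat \<times> nat \<times> dir) option) \<Rightarrow> config \<Rightarrow> config" where
  "tm_step delta c = (case c of (q, tp, p) \<Rightarrow>
     (case delta q (tp p) of
        None \<Rightarrow> (q, tp, p)
      | Some (q', b, d) \<Rightarrow> (q', tp(p := b), (case d of Left \<Rightarrow> p - 1 | Right \<Rightarrow> p + 1))))"

definition tape_of :: "nat list \<Rightarrow> nat \<Rightarrow> nat" where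
  "tape_of w = (\<lambda>i. if i < length w then w ! i else 0)"

definition tm_run :: "(nat \<Rightarrow> nat \<Rightarrow> (nat \<times> nat \<times> dir) option) \<Rightarrow> nat list \<Rightarrow> nat \<Rightarrow> config" where
  "tm_run delta w t = (tm_step delta ^^ t) (0, tape_of w, 0)"

definition halts_with :: "(nat \<Rightarrow> nat \<Rightarrow> (nat \<times> nat \<times> dir) option) \<Rightarrow> nat list \<Rightarrow> nat \<Rightarrow> nat list \<Rightarrow> bool" where
  "halts_with delta w t out \<longleftrightarrow>
     (case tm_run delta w t of (q, tp, p) \<Rightarrow> delta q (tp p) = None \<and> tp = tape_of out)"

end

theory Submission
  imports Defs "HOL-Library.Countable"
begin

text \<open>
  The whole vertex set is a pseudoforest modulator, so only the graph has to become small.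

  Minimum blocking sets in a component \<open>C\<close> of \<open>G - X\<close> have at most four vertices: a forest has
  blocking pairs, since the majority of three maximum independent sets is again one, and \<open>C\<close> is a
  forest after deletion of one vertex, which is either used or not. A set of four vertices of \<open>X\<close>
  that blocks more than \<open>|X|\<close> components is useless, because omitting \<open>X\<close> altogether is at least as
  good. So all but \<open>|X|^5\<close> components \<open>C\<close> may be deleted at the price of their independence number, and
  \<open>X\<close> together with one vertex of the cycle of each remaining component is a modulator \<open>M\<close> to a
  forest with \<open>O(|X|^5)\<close> vertices.

  Four rules shrink the forest: remove an isolated vertex; make two vertices \<open>a\<close>, \<open>b\<close> of \<open>M\<close>
  (or one vertex with itself) adjacent if their neighbourhood costs the forest at least \<open>|M|\<close> vertices;
  fold an edge \<open>uv\<close> of low degree whose neighbours in \<open>M\<close> are completely joined; cut an edge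
  between two vertices with leaves whose neighbours in \<open>M\<close> are completely joined. Afterwards consider a
  clique cover of the forest with as many cliques as its independence number. The sum of the degrees
  shows that a constant fraction of the cliques, or of the edges between them, is blocked by two
  non-adjacent vertices of \<open>M\<close>; only pairs with a member in \<open>X\<close> occur, as vertices of \<open>M - X\<close> lie in
  different components. Each of these \<open>O(|X| |M|)\<close> pairs meets fewer than \<open>|M|\<close> cliques completely, so that
  \<open>O(|X| |M|^2) = O(|X|^11)\<close> vertices remain.
\<close>

section \<open>Stack programs on a single tape\<close>

text \<open>The theorem speaks of a single-tape Turing machine, so "polynomial time" has to be a
  closure property and not a remark: the algorithm is assembled from functions that have a stack
  program with a polynomial time bound (\<open>PT\<close>), and one compiler turns the final program
  into a transition table. The weak point of such a class is iteration, which may let sizes explode;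
  therefore every iterated function carries a bound on all its intermediate values. The tests for
  deleting a component and for adding an edge compare independence numbers inside a pseudoforest.
  They are computed greedily: a vertex of degree at most one lies in a maximum independent set, and
  so does every vertex of a pseudoforest of minimum degree two, which is a union of cycles. Cycles
  are awkward under deletion, contraction and rewiring. After one translation from
  \<open>pseudoforest\<close>, only edge counts on vertex sets (\<open>e2\<close>) are used; they
  pass to subsets at once and turn each rule into a small calculation.\<close>

datatype com = Skip | Push nat nat | Pop nat | Seq com com
  | Branch nat nat com com | Loop nat nat com
instance com :: countable by countable_datatype

datatype mode = Start | Go | Ret | Halt | Psh nat nat | PopR nat | PopL nat nat
instance mode :: countable by countable_datatype

text \<open>The value 0 stands for the empty stack: well-formed programs push only 1, 2 and 3, so
  \<open>Loop i 0 c\<close> runs until stack \<open>i\<close> is empty.\<close>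

definition peek :: "nat list \<Rightarrow> nat" where
  "peek l = (case l of [] \<Rightarrow> 0 | x # _ \<Rightarrow> x)"

lemma peek_simps [simp]: "peek [] = 0" "peek (x # l) = x"
  by (simp_all add: peek_def)

type_synonym stacks = "nat \<Rightarrow> nat list"

fun cstep :: "com list \<times> stacks \<Rightarrow> com list \<times> stacks" where
  "cstep ([], s) = ([], s)"
| "cstep (Skip # k, s) = (k, s)"
| "cstep (Push i a # k, s) = (k, s(i := a # s i))"
| "cstep (Pop i # k, s) = (k, s(i := tl (s i)))"
| "cstep (Seq c d # k, s) = (c # d # k, s)"
| "cstep (Branch i a c d # k, s) = ((if peek (s i) = a then c else d) # k, s)"
| "cstep (Loop i a c # k, s) = ((if peek (s i) = a then k else c # Loop i a c # k), s)"

fun wf_com :: "com \<Rightarrow> bool" where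
  "wf_com Skip = True"
| "wf_com (Push i a) = (i < 4 \<and> a \<in> {1,2,3})"
| "wf_com (Pop i) = (i < 4)"
| "wf_com (Seq c d) = (wf_com c \<and> wf_com d)"
| "wf_com (Branch i a c d) = (i < 4 \<and> wf_com c \<and> wf_com d)"
| "wf_com (Loop i a c) = (i < 4 \<and> wf_com c)"

text \<open>All continuations that can arise while the command runs in front of \<open>k\<close>.
  The body of a loop continues with the loop itself, so the set is finite although executions are
  unbounded; it supplies the finite control of the machine.\<close>

fun conts :: "com \<Rightarrow> com list \<Rightarrow> com list set" where
  "conts Skip k = {Skip # k}"
| "conts (Push i a) k = {Push i a # k}"
| "conts (Pop i) k = {Pop i # k}"
| "conts (Seq c d) k = insert (Seq c d # k) (conts c (d # k) \<union> conts d k)"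
| "conts (Branch i a c d) k = insert (Branch i a c d # k) (conts c k \<union> conts d k)"
| "conts (Loop i a c) k = insert (Loop i a c # k) (conts c (Loop i a c # k))"

lemma finite_conts: "finite (conts c k)"
  by (induction c arbitrary: k) auto

lemma Cons_in_conts: "c # k \<in> conts c k"
  by (cases c) auto

lemma conts_closed:
  "k \<in> conts c k0 \<Longrightarrow> fst (cstep (k, s)) \<in> insert k0 (conts c k0)"
proof (induction c arbitrary: k0)
  case (Seq c d)
  then show ?case using Cons_in_conts[of c "d # k0"] Cons_in_conts[of d k0] by fastforce
next
  case (Branch i a c d)
  then show ?case using Cons_in_conts[of c k0] Cons_in_conts[of d k0] by (auto split: if_splits)
next
  case (Loop i a c)
  then show ?case using Cons_in_conts[of c "Loop i a c # k0"] by (auto split: if_splits)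
qed auto

lemma conts_wf: "wf_com c \<Longrightarrow> list_all wf_com k0 \<Longrightarrow> k \<in> conts c k0 \<Longrightarrow> list_all wf_com k"
proof (induction c arbitrary: k0)
  case (Seq c d)
  have "list_all wf_com (d # k0)" using Seq.prems by simp
  from Seq.IH(1)[OF _ this] Seq.IH(2)[of k0] Seq.prems show ?case
    by (simp) (elim disjE; simp)
next
  case (Branch i b c d)
  from Branch.IH(1)[of k0] Branch.IH(2)[of k0] Branch.prems show ?case
    by (simp) (elim disjE; simp)
next
  case (Loop i b c)
  have "list_all wf_com (Loop i b c # k0)" using Loop.prems by simp
  from Loop.IH[OF _ this] Loop.prems show ?case
    by (simp) (elim disjE; simp)
qed auto

text \<open>Track \<open>i\<close> of the tape stores stack \<open>i\<close> with its top in cell \<open>0\<close>, so that a push or a pop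
  shifts the whole track. The summand \<open>256\<close> marks cell \<open>0\<close>, where the head rests between commands.\<close>

definition digit :: "nat \<Rightarrow> nat \<Rightarrow> nat" where
  "digit i a = a div 4 ^ i mod 4"

definition set_digit :: "nat \<Rightarrow> nat \<Rightarrow> nat \<Rightarrow> nat" where
  "set_digit i c a = a - digit i a * 4 ^ i + c * 4 ^ i"

definition cell :: "(nat \<Rightarrow> nat) \<Rightarrow> bool \<Rightarrow> nat" where
  "cell d f = d 0 + 4 * (d 1 + 4 * (d 2 + 4 * (d 3 + 4 * of_bool f)))"

definition small :: "(nat \<Rightarrow> nat) \<Rightarrow> bool" where
  "small d \<longleftrightarrow> (\<forall>i<4. d i < 4)"

lemma less_4_cases: "(i::nat) < 4 \<Longrightarrow> i = 0 \<or> i = 1 \<or> i = 2 \<or> i = 3"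
  by auto

lemma smallD: "small d \<Longrightarrow> d 0 < 4 \<and> d 1 < 4 \<and> d 2 < 4 \<and> d 3 < 4"
  by (simp add: small_def)

lemma digit_simps: "digit 0 a = a mod 4" "x < 4 \<Longrightarrow> digit (Suc i) (x + 4 * y) = digit i y"
  by (simp_all add: digit_def div_mult2_eq)

lemma digit_cell: "small d \<Longrightarrow> i < 4 \<Longrightarrow> digit i (cell d f) = d i"
  by (drule smallD, drule less_4_cases) (auto simp: cell_def digit_simps numeral_2_eq_2 numeral_3_eq_3 simp del: distrib_left_numeral)

lemma set_digit_cell: "small d \<Longrightarrow> i < 4 \<Longrightarrow> set_digit i c (cell d f) = cell (d(i := c)) f"
  by (simp only: set_digit_def digit_cell, drule less_4_cases) (auto simp: cell_def)

lemma cell_less: "small d \<Longrightarrow> cell d f < 512"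
  by (drule smallD) (auto simp: cell_def)

lemma cell_flag: "small d \<Longrightarrow> 256 \<le> cell d f \<longleftrightarrow> f"
  by (drule smallD) (auto simp: cell_def)

text \<open>The sweep to the right carries one symbol: each cell receives the symbol of its left
  neighbour, and a digit 0 signals the end of the stack. Then the head returns to the marked
  cell.\<close>

fun psh :: "nat \<Rightarrow> nat \<Rightarrow> com list \<Rightarrow> nat \<Rightarrow> ((mode \<times> com list) \<times> nat \<times> dir) option" where
  "psh i c k a = (if digit i a = 0 then Some ((Ret, k), set_digit i c a, Left)
     else Some ((Psh i (digit i a), k), set_digit i c a, Right))"

text \<open>A pop walks to the first empty cell and shifts on the way back, starting with carry 0;
  on an empty stack this rewrites the 0 in cell 0 and changes nothing.\<close>

fun popr :: "nat \<Rightarrow> com list \<Rightarrow> nat \<Rightarrow> ((mode \<times> com list) \<times> nat \<times> dir) option" where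
  "popr i k a = (if digit i a = 0 then Some ((PopL i 0, k), a, Left) else Some ((PopR i, k), a, Right))"

text \<open>In mode \<open>Go\<close> the head is at cell 0, where a move to the left has no effect;
  hence \<open>Left\<close> serves as the stationary move. \<open>Start\<close> sets the mark 256
  and the empty continuation clears it.\<close>

fun dstep :: "mode \<times> com list \<Rightarrow> nat \<Rightarrow> ((mode \<times> com list) \<times> nat \<times> dir) option" where
  "dstep (Start, k) a = Some ((Go, k), a + 256, Left)"
| "dstep (Halt, k) a = None"
| "dstep (Ret, k) a = (if 256 \<le> a then Some ((Go, k), a, Left) else Some ((Ret, k), a, Left))"
| "dstep (Psh i c, k) a = psh i c k a"
| "dstep (PopR i, k) a = popr i k a"
| "dstep (PopL i c, k) a = (if 256 \<le> a then Some ((Go, k), set_digit i c a, Left)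
     else Some ((PopL i (digit i a), k), set_digit i c a, Left))"
| "dstep (Go, []) a = Some ((Halt, []), a - 256, Left)"
| "dstep (Go, Skip # k) a = Some ((Go, k), a, Left)"
| "dstep (Go, Push i c # k) a = psh i c k a"
| "dstep (Go, Pop i # k) a = popr i k a"
| "dstep (Go, Seq c d # k) a = Some ((Go, c # d # k), a, Left)"
| "dstep (Go, Branch i b c d # k) a = Some ((Go, (if digit i a = b then c else d) # k), a, Left)"
| "dstep (Go, Loop i b c # k) a = Some ((Go, if digit i a = b then k else c # Loop i b c # k), a, Left)"

text \<open>Machines start in state 0, whatever the numbering of a countable type says; hence the
  exception for the start state and the shift of all others.\<close>

definition state_enc :: "com \<Rightarrow> mode \<times> com list \<Rightarrow> nat" where
  "state_enc c s = (if s = (Start, [c]) then 0 else Suc (to_nat s))"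

definition state_dec :: "com \<Rightarrow> nat \<Rightarrow> mode \<times> com list" where
  "state_dec c q = (if q = 0 then (Start, [c]) else from_nat (q - 1))"

lemma state_dec_enc [simp]: "state_dec c (state_enc c s) = s"
  by (simp add: state_enc_def state_dec_def)

definition modes :: "mode set" where
  "modes = {Start, Go, Ret, Halt} \<union> (\<lambda>(i, c). Psh i c) ` ({..<4} \<times> {..<4}) \<union> PopR ` {..<4}
     \<union> (\<lambda>(i, c). PopL i c) ` ({..<4} \<times> {..<4})"

definition states :: "com \<Rightarrow> (mode \<times> com list) set" where
  "states c = modes \<times> insert [] (conts c [])"

definition num_states :: "com \<Rightarrow> nat" where
  "num_states c = Suc (Max (state_enc c ` states c))"

lemma finite_states: "finite (states c)"
  by (auto simp: states_def modes_def finite_conts)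

lemma state_enc_less: "s \<in> states c \<Longrightarrow> state_enc c s < num_states c"
  by (simp add: num_states_def less_Suc_eq_le finite_states)

text \<open>Many numbers below the bound encode no state of the program. Testing the range of every
  result makes \<open>tm_ok\<close> hold without any argument about reachability.\<close>

definition compile :: "com \<Rightarrow> nat \<Rightarrow> nat \<Rightarrow> (nat \<times> nat \<times> dir) option" where
  "compile c q a = (if q < num_states c \<and> a < 512 then
     (case dstep (state_dec c q) a of None \<Rightarrow> None
      | Some (s, b, d) \<Rightarrow> if state_enc c s < num_states c \<and> b < 512
          then Some (state_enc c s, b, d) else None) else None)"

lemma tm_ok_compile: "tm_ok (num_states c) 512 (compile c)"
  unfolding tm_ok_def
proof (intro conjI allI impI)
  show "0 < num_states c" by (simp add: num_states_def)
  show "4 \<le> (512::nat)" by simp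
  show "compile c q a = None" if "num_states c \<le> q \<or> 512 \<le> a" for q a
    using that by (auto simp: compile_def)
  fix q a q' b d assume "compile c q a = Some (q', b, d)"
  then show "q' < num_states c" "b < 512"
    by (auto simp: compile_def split: if_splits option.splits)
qed

lemma tm_step_compile:
  assumes "s \<in> states c" "s' \<in> states c" "tp p < 512" "b < 512"
    and "dstep s (tp p) = Some (s', b, d)"
  shows "tm_step (compile c) (state_enc c s, tp, p) =
    (state_enc c s', tp(p := b), (case d of Left \<Rightarrow> p - 1 | Right \<Rightarrow> p + 1))"
  using assms by (simp add: tm_step_def compile_def state_enc_less)

section \<open>Simulation of one program step by sweeps over the tape\<close>

definition tracks :: "(nat \<Rightarrow> nat \<Rightarrow> nat) \<Rightarrow> nat \<Rightarrow> nat" where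
  "tracks D = (\<lambda>p. cell (\<lambda>i. D i p) (p = 0))"

definition smalls :: "(nat \<Rightarrow> nat \<Rightarrow> nat) \<Rightarrow> bool" where
  "smalls D \<longleftrightarrow> (\<forall>i<4. \<forall>p. D i p < 4)"

lemma smallsD: "smalls D \<Longrightarrow> small (\<lambda>i. D i p)"
  by (simp add: smalls_def small_def)

lemma tracks_less: "smalls D \<Longrightarrow> tracks D p < 512"
  by (simp add: tracks_def cell_less smallsD)

lemma digit_tracks: "smalls D \<Longrightarrow> i < 4 \<Longrightarrow> digit i (tracks D p) = D i p"
  by (simp add: tracks_def digit_cell smallsD)

lemma tracks_flag: "smalls D \<Longrightarrow> 256 \<le> tracks D p \<longleftrightarrow> p = 0"
  by (simp add: tracks_def cell_flag smallsD)

lemma tracks_upd: "smalls D \<Longrightarrow> i < 4 \<Longrightarrow>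
  (tracks D)(p := set_digit i c (tracks D p)) = tracks (D(i := (D i)(p := c)))"
proof (rule ext)
  fix q assume a: "smalls D" "i < 4"
  have e: "(\<lambda>j. D j p)(i := c) = (\<lambda>j. (D(i := (D i)(p := c))) j p)" by auto
  show "((tracks D)(p := set_digit i c (tracks D p))) q = tracks (D(i := (D i)(p := c))) q"
  proof (cases "q = p")
    case True
    then show ?thesis using a e by (simp add: tracks_def set_digit_cell smallsD)
  next
    case False
    then have "(\<lambda>j. (D(i := (D i)(p := c))) j q) = (\<lambda>j. D j q)" by auto
    with False show ?thesis by (simp add: tracks_def)
  qed
qed

lemma set_digit_tracks_less: "smalls D \<Longrightarrow> i < 4 \<Longrightarrow> c < 4 \<Longrightarrow> set_digit i c (tracks D p) < 512"
  unfolding tracks_def by (subst set_digit_cell) (auto simp: smallsD intro!: cell_less simp: small_def smalls_def)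

lemma smalls_upd: "smalls D \<Longrightarrow> c < 4 \<Longrightarrow> smalls (D(i := (D i)(p := c)))"
  by (auto simp: smalls_def)

lemma modes_simps [simp]:
  "Start \<in> modes" "Go \<in> modes" "Ret \<in> modes" "Halt \<in> modes"
  "i < 4 \<Longrightarrow> c < 4 \<Longrightarrow> Psh i c \<in> modes" "i < 4 \<Longrightarrow> PopR i \<in> modes"
  "i < 4 \<Longrightarrow> c < 4 \<Longrightarrow> PopL i c \<in> modes"
  by (auto simp: modes_def)

text \<open>In the sweeps, \<open>k\<close> is a continuation of the program \<open>c0\<close>, and the state \<open>s\<close> behaves on
  its first step like the sweeping state.\<close>

lemma ret_run:
  assumes "smalls D" "k \<in> insert [] (conts c0 [])"
  shows "(tm_step (compile c0) ^^ Suc p) (state_enc c0 (Ret, k), tracks D, p)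
    = (state_enc c0 (Go, k), tracks D, 0)"
proof (induction p)
  case 0
  have "tm_step (compile c0) (state_enc c0 (Ret, k), tracks D, 0)
    = (state_enc c0 (Go, k), (tracks D)(0 := tracks D 0), 0)"
    using assms by (subst tm_step_compile[where s'="(Go, k)" and b="tracks D 0" and d=Left])
      (auto simp: states_def tracks_less tracks_flag)
  then show ?case by simp
next
  case (Suc p)
  have "tm_step (compile c0) (state_enc c0 (Ret, k), tracks D, Suc p)
    = (state_enc c0 (Ret, k), (tracks D)(Suc p := tracks D (Suc p)), p)"
    using assms by (subst tm_step_compile[where s'="(Ret, k)" and b="tracks D (Suc p)" and d=Left])
      (auto simp: states_def tracks_less tracks_flag)
  then show ?case using Suc by (simp add: funpow_Suc_right del: funpow.simps)
qed

lemma push_run: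
  assumes "k \<in> insert [] (conts c0 [])" "i < 4"
    and "smalls D" "0 < c" "c < 4" "p \<le> n" "\<And>q. D i q \<noteq> 0 \<longleftrightarrow> q < n"
    and "s \<in> states c0" "\<And>a. dstep s a = psh i c k a"
  shows "(tm_step (compile c0) ^^ Suc (n - p)) (state_enc c0 s, tracks D, p)
    = (state_enc c0 (Ret, k),
       tracks (D(i := (\<lambda>q. if q < p then D i q else if q = p then c else D i (q - 1)))), n - 1)"
  using assms(3-)
proof (induction "n - p" arbitrary: p D c s)
  case 0
  then have pn: "p = n" by simp
  have "D i n = 0" using 0(6)[of n] by simp
  moreover have z: "D i (q - 1) = 0 \<and> D i q = 0" if "q > n" for q using 0(6) that
    by (metis Suc_pred' diff_less less_nat_zero_code linorder_not_less neq0_conv not_less_eq order_less_imp_le zero_less_Suc)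
  ultimately have "tm_step (compile c0) (state_enc c0 s, tracks D, n)
    = (state_enc c0 (Ret, k), (tracks D)(n := set_digit i c (tracks D n)), n - 1)"
    using 0 assms(1,2) by (subst tm_step_compile[where s'="(Ret, k)" and b="set_digit i c (tracks D n)" and d=Left])
      (auto simp: states_def tracks_less digit_tracks set_digit_tracks_less)
  moreover have "(D i)(n := c) = (\<lambda>q. if q < p then D i q else if q = p then c else D i (q - 1))"
    using z pn by (auto simp: fun_eq_iff)
  ultimately show ?case using pn 0 assms(2) by (simp add: tracks_upd) (simp add: fun_upd_def)
next
  case (Suc m)
  then have pn: "p < n" by simp
  let ?D = "D(i := (D i)(p := c))"
  have ne: "D i p \<noteq> 0" using Suc.prems(5) pn by simp
  have l4: "D i p < 4" using Suc.prems(1) assms(2) by (simp add: smalls_def)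
  have "tm_step (compile c0) (state_enc c0 s, tracks D, p)
    = (state_enc c0 (Psh i (D i p), k), tracks ?D, Suc p)"
    using Suc.prems assms(1,2) ne l4
    by (subst tm_step_compile[where s'="(Psh i (D i p), k)" and b="set_digit i c (tracks D p)" and d=Right])
      (auto simp: states_def tracks_less digit_tracks set_digit_tracks_less tracks_upd)
  moreover have "(tm_step (compile c0) ^^ Suc (n - Suc p)) (state_enc c0 (Psh i (D i p), k), tracks ?D, Suc p)
    = (state_enc c0 (Ret, k), tracks (?D(i := (\<lambda>q. if q < Suc p then ?D i q else if q = Suc p then D i p else ?D i (q - 1)))), n - 1)"
    using Suc.prems assms(1,2) ne l4 pn Suc.hyps(2) Suc.prems(5)
    by (intro Suc.hyps(1)) (auto simp: states_def smalls_upd)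
  moreover have "?D(i := (\<lambda>q. if q < Suc p then ?D i q else if q = Suc p then D i p else ?D i (q - 1)))
    = D(i := (\<lambda>q. if q < p then D i q else if q = p then c else D i (q - 1)))"
    by (auto simp: fun_eq_iff)
  moreover have "Suc (n - p) = Suc (Suc (n - Suc p))" using pn by simp
  ultimately show ?case by (simp only: funpow_Suc_right o_apply)
qed

lemma popr_run:
  assumes "k \<in> insert [] (conts c0 [])" "i < 4"
    and "smalls D" "p \<le> n" "\<And>q. D i q \<noteq> 0 \<longleftrightarrow> q < n"
    and "s \<in> states c0" "\<And>a. dstep s a = popr i k a"
  shows "(tm_step (compile c0) ^^ Suc (n - p)) (state_enc c0 s, tracks D, p)
    = (state_enc c0 (PopL i 0, k), tracks D, n - 1)"
  using assms(4,6-)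
proof (induction "n - p" arbitrary: p s)
  case 0
  then have pn: "p = n" by simp
  have "D i n = 0" using assms(5)[of n] by simp
  then have "tm_step (compile c0) (state_enc c0 s, tracks D, n)
    = (state_enc c0 (PopL i 0, k), (tracks D)(n := tracks D n), n - 1)"
    using 0 assms(1,2,3) by (subst tm_step_compile[where s'="(PopL i 0, k)" and b="tracks D n" and d=Left])
      (auto simp: states_def tracks_less digit_tracks)
  then show ?case using pn by simp
next
  case (Suc m)
  then have pn: "p < n" by simp
  then have "D i p \<noteq> 0" using assms(5) by simp
  then have "tm_step (compile c0) (state_enc c0 s, tracks D, p)
    = (state_enc c0 (PopR i, k), (tracks D)(p := tracks D p), Suc p)"
    using Suc.prems assms(1,2,3) by (subst tm_step_compile[where s'="(PopR i, k)" and b="tracks D p" and d=Right])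
      (auto simp: states_def tracks_less digit_tracks)
  moreover have "(tm_step (compile c0) ^^ Suc (n - Suc p)) (state_enc c0 (PopR i, k), tracks D, Suc p)
    = (state_enc c0 (PopL i 0, k), tracks D, n - 1)"
    using Suc.prems Suc.hyps(2) assms(1,2) pn by (intro Suc.hyps(1)) (auto simp: states_def)
  moreover have "Suc (n - p) = Suc (Suc (n - Suc p))" using pn by simp
  ultimately show ?case by (simp add: funpow_Suc_right del: funpow.simps)
qed

lemma popl_run:
  assumes "k \<in> insert [] (conts c0 [])" "i < 4" and "smalls D" "c < 4"
  shows "(tm_step (compile c0) ^^ Suc p) (state_enc c0 (PopL i c, k), tracks D, p)
    = (state_enc c0 (Go, k), tracks (D(i := (\<lambda>q. if q < p then D i (Suc q) else if q = p then c else D i q))), 0)"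
  using assms(3,4)
proof (induction p arbitrary: D c)
  case 0
  have "tm_step (compile c0) (state_enc c0 (PopL i c, k), tracks D, 0)
    = (state_enc c0 (Go, k), (tracks D)(0 := set_digit i c (tracks D 0)), 0)"
    using 0 assms(1,2) by (subst tm_step_compile[where s'="(Go, k)" and b="set_digit i c (tracks D 0)" and d=Left])
      (auto simp: states_def tracks_less tracks_flag set_digit_tracks_less)
  moreover have "(D i)(0 := c) = (\<lambda>q. if q = 0 then c else D i q)" by auto
  ultimately show ?case using 0 assms(2) by (simp add: tracks_upd) (simp add: fun_upd_def)
next
  case (Suc p)
  let ?D = "D(i := (D i)(Suc p := c))"
  have l4: "D i (Suc p) < 4" using Suc.prems assms(2) by (simp add: smalls_def)
  have "tm_step (compile c0) (state_enc c0 (PopL i c, k), tracks D, Suc p)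
    = (state_enc c0 (PopL i (D i (Suc p)), k), tracks ?D, p)"
    using Suc.prems assms(1,2) l4
    by (subst tm_step_compile[where s'="(PopL i (D i (Suc p)), k)" and b="set_digit i c (tracks D (Suc p))" and d=Left])
      (auto simp: states_def tracks_less tracks_flag digit_tracks set_digit_tracks_less tracks_upd)
  moreover have "(tm_step (compile c0) ^^ Suc p) (state_enc c0 (PopL i (D i (Suc p)), k), tracks ?D, p)
    = (state_enc c0 (Go, k), tracks (?D(i := (\<lambda>q. if q < p then ?D i (Suc q) else if q = p then D i (Suc p) else ?D i q))), 0)"
    using Suc.prems l4 by (intro Suc.IH) (simp_all add: smalls_def)
  moreover have "?D(i := (\<lambda>q. if q < p then ?D i (Suc q) else if q = p then D i (Suc p) else ?D i q))
    = D(i := (\<lambda>q. if q < Suc p then D i (Suc q) else if q = Suc p then c else D i q))"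
    by (auto simp: fun_eq_iff less_Suc_eq)
  ultimately show ?case by (simp only: funpow_Suc_right[of "Suc p"] o_apply)
qed

definition contents :: "stacks \<Rightarrow> nat \<Rightarrow> nat \<Rightarrow> nat" where
  "contents s i p = (if p < length (s i) then s i ! p else 0)"

definition good :: "stacks \<Rightarrow> bool" where
  "good s \<longleftrightarrow> (\<forall>i<4. \<forall>a\<in>set (s i). a \<in> {1,2,3})"

lemma good_nth: "good s \<Longrightarrow> i < 4 \<Longrightarrow> p < length (s i) \<Longrightarrow> s i ! p \<in> {1,2,3}"
  unfolding good_def using nth_mem by blast

lemma smalls_contents: "good s \<Longrightarrow> smalls (contents s)"
  unfolding smalls_def contents_def using good_nth by fastforce

lemma contents_nonzero: "good s \<Longrightarrow> i < 4 \<Longrightarrow> contents s i q \<noteq> 0 \<longleftrightarrow> q < length (s i)"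
  unfolding contents_def using good_nth[of s i q] by auto

lemma contents_peek: "contents s i 0 = peek (s i)"
  by (cases "s i") (auto simp: contents_def)

definition machine :: "com \<Rightarrow> com list \<Rightarrow> stacks \<Rightarrow> config" where
  "machine c0 k s = (state_enc c0 (Go, k), tracks (contents s), 0)"

lemma machine_simple_step:
  assumes "good s" "k \<in> insert [] (conts c0 [])" "k' \<in> insert [] (conts c0 [])"
    and "dstep (Go, k) (tracks (contents s) 0) = Some ((Go, k'), tracks (contents s) 0, Left)"
  shows "tm_step (compile c0) (machine c0 k s) = machine c0 k' s"
  using assms unfolding machine_def
  by (subst tm_step_compile[where s'="(Go, k')" and b="tracks (contents s) 0" and d=Left])
    (auto simp: states_def tracks_less smalls_contents)

text \<open>A push or a pop crosses its stack once in each direction; every other command takes one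
  machine step.\<close>

lemma machine_cstep:
  assumes s: "good s" and k: "k \<in> conts c0 []" and wf: "wf_com c0"
    and len: "\<And>i. i < 4 \<Longrightarrow> length (s i) \<le> n" and eq: "cstep (k, s) = (k', s')"
  shows "\<exists>t \<le> 2 * n + 4. (tm_step (compile c0) ^^ t) (machine c0 k s) = machine c0 k' s'"
proof -
  have k': "k' \<in> insert [] (conts c0 [])" using conts_closed[OF k, of s] eq by auto
  have kin: "k \<in> insert [] (conts c0 [])" using k by simp
  have wfk: "list_all wf_com k" using conts_wf[OF wf _ k] by simp
  have sm: "smalls (contents s)" using s by (rule smalls_contents)
  note step1 = machine_simple_step[OF s kin k']
  have one: ?thesis if "tm_step (compile c0) (machine c0 k s) = machine c0 k' s'"
    using that by (intro exI[of _ 1]) auto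
  show ?thesis
  proof (cases k)
    case Nil
    then show ?thesis using eq by (intro exI[of _ 0]) auto
  next
    case (Cons c r)
    show ?thesis
    proof (cases c)
      case Skip
      then show ?thesis using one step1 Cons eq by auto
    next
      case (Seq c d)
      then show ?thesis using one step1 Cons eq by auto
    next
      case (Branch i a c d)
      then have "i < 4" using wfk Cons by auto
      then show ?thesis using one step1 Cons eq Branch by (auto simp: digit_tracks sm contents_peek split: if_splits)
    next
      case (Loop i a c)
      then have "i < 4" using wfk Cons by auto
      then show ?thesis using one step1 Cons eq Loop by (auto simp: digit_tracks sm contents_peek split: if_splits)
    next
      case (Push i a)
      then have i: "i < 4" and a: "0 < a" "a < 4" using wfk Cons by auto
      have kk: "k' = r" and ss: "s' = s(i := a # s i)" using Push Cons eq by auto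
      let ?l = "length (s i)"
      have A: "(tm_step (compile c0) ^^ Suc (?l - 0)) (state_enc c0 (Go, k), tracks (contents s), 0)
        = (state_enc c0 (Ret, r),
           tracks ((contents s)(i := (\<lambda>q. if q < 0 then contents s i q else if q = 0 then a else contents s i (q - 1)))), ?l - 1)"
        using k' kk kin Cons Push contents_nonzero[OF s i]
        by (intro push_run) (auto simp: i a sm states_def)
      have B: "(contents s)(i := (\<lambda>q. if q < 0 then contents s i q else if q = 0 then a else contents s i (q - 1))) = contents s'"
        by (auto simp: contents_def fun_eq_iff ss nth_Cons')
      have sm': "smalls (contents s')" using s a unfolding ss
        by (intro smalls_contents) (auto simp: good_def)
      have C: "(tm_step (compile c0) ^^ Suc (?l - 1)) (state_enc c0 (Ret, r), tracks (contents s'), ?l - 1)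
        = (state_enc c0 (Go, r), tracks (contents s'), 0)"
        using ret_run[OF sm'] k' kk by simp
      have "(tm_step (compile c0) ^^ (Suc (?l - 1) + Suc (?l - 0))) (machine c0 k s) = machine c0 k' s'"
        unfolding funpow_add o_apply machine_def A[unfolded B] C kk ..
      moreover have "Suc (?l - 1) + Suc (?l - 0) \<le> 2 * n + 4" using len[OF i] by simp
      ultimately show ?thesis by blast
    next
      case (Pop i)
      then have i: "i < 4" using wfk Cons by auto
      have kk: "k' = r" and ss: "s' = s(i := tl (s i))" using Pop Cons eq by auto
      let ?l = "length (s i)"
      have A: "(tm_step (compile c0) ^^ Suc (?l - 0)) (state_enc c0 (Go, k), tracks (contents s), 0)
        = (state_enc c0 (PopL i 0, r), tracks (contents s), ?l - 1)"
        using k' kk kin Cons Pop contents_nonzero[OF s i]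
        by (intro popr_run) (auto simp: i sm states_def)
      have B: "(tm_step (compile c0) ^^ Suc (?l - 1)) (state_enc c0 (PopL i 0, r), tracks (contents s), ?l - 1)
        = (state_enc c0 (Go, r), tracks ((contents s)(i := (\<lambda>q. if q < ?l - 1 then contents s i (Suc q) else if q = ?l - 1 then 0 else contents s i q))), 0)"
        using k' kk by (intro popl_run) (auto simp: i sm)
      have C: "(contents s)(i := (\<lambda>q. if q < ?l - 1 then contents s i (Suc q) else if q = ?l - 1 then 0 else contents s i q)) = contents s'"
        by (auto simp: contents_def fun_eq_iff ss nth_tl)
      have "(tm_step (compile c0) ^^ (Suc (?l - 1) + Suc (?l - 0))) (machine c0 k s) = machine c0 k' s'"
        unfolding funpow_add o_apply machine_def A B C kk ..
      moreover have "Suc (?l - 1) + Suc (?l - 0) \<le> 2 * n + 4" using len[OF i] by simp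
      ultimately show ?thesis by blast
    qed
  qed
qed

lemma cstep_good:
  assumes "good s" "list_all wf_com k" "cstep (k, s) = (k', s')"
  shows "good s' \<and> (\<forall>i. length (s' i) \<le> Suc (length (s i)))"
  using assms
proof (cases "(k, s)" rule: cstep.cases)
  case (3 i a r u)
  then have [simp]: "s' = s(i := a # s i)" and a: "a \<in> {1,2,3}" using assms by auto
  have "set (s' j) \<subseteq> insert a (set (s j))" for j by auto
  then have "good s'" using assms(1) a unfolding good_def by blast
  then show ?thesis by simp
next
  case (4 i r u)
  then have [simp]: "s' = s(i := tl (s i))" and i: "i < 4" using assms by auto
  have "set (tl l) \<subseteq> set l" for l :: "nat list" by (cases l) auto
  then have "set (s' j) \<subseteq> set (s j)" for j by simp
  then have "good s'" using assms(1) unfolding good_def by blast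
  then show ?thesis by simp
qed (use assms in simp_all)

section \<open>Execution times\<close>

text \<open>Quantifying over the continuation makes executions composable: the same number of steps
  works in every context.\<close>

definition runs :: "com \<Rightarrow> stacks \<Rightarrow> nat \<Rightarrow> stacks \<Rightarrow> bool" where
  "runs c s t s' \<longleftrightarrow> (\<forall>k. (cstep ^^ t) (c # k, s) = (k, s'))"

text \<open>A program step lengthens a stack by at most one symbol, so no stack exceeds
  \<open>n + t\<close> during \<open>t\<close> steps, and the simulation costs quadratic time
  only.\<close>

lemma machine_csteps:
  assumes s: "good s" and k: "k \<in> insert [] (conts c0 [])" and wf: "wf_com c0"
    and len: "\<And>i. i < 4 \<Longrightarrow> length (s i) \<le> n" and eq: "(cstep ^^ t) (k, s) = (k', s')"
  shows "good s' \<and> k' \<in> insert [] (conts c0 []) \<and>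
     (\<exists>t' \<le> t * (2 * (n + t) + 4). (tm_step (compile c0) ^^ t') (machine c0 k s) = machine c0 k' s')"
  using s k len eq
proof (induction t arbitrary: k s n)
  case 0
  then show ?case by auto
next
  case (Suc t)
  obtain k1 s1 where 1: "cstep (k, s) = (k1, s1)" by fastforce
  have rest: "(cstep ^^ t) (k1, s1) = (k', s')" using Suc.prems(4) 1 by (simp add: funpow_Suc_right del: funpow.simps)
  have wfk: "list_all wf_com k" using conts_wf[OF wf, of "[]" k] Suc.prems(2) by auto
  note g = cstep_good[OF Suc.prems(1) wfk 1]
  have len1: "length (s1 i) \<le> Suc n" if "i < 4" for i using g Suc.prems(3)[OF that] le_trans Suc_le_mono by meson
  have k1: "k1 \<in> insert [] (conts c0 [])" using conts_closed[of k c0 "[]" s] Suc.prems(2) 1 by auto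
  have "\<exists>t' \<le> 2 * n + 4. (tm_step (compile c0) ^^ t') (machine c0 k s) = machine c0 k1 s1"
  proof (cases "k = []")
    case True
    then show ?thesis using 1 by (intro exI[of _ 0]) auto
  next
    case False
    then show ?thesis using machine_cstep[OF Suc.prems(1) _ wf Suc.prems(3) 1] Suc.prems(2) by auto
  qed
  then obtain t1 where t1: "t1 \<le> 2 * n + 4" "(tm_step (compile c0) ^^ t1) (machine c0 k s) = machine c0 k1 s1" by blast
  obtain t2 where t2: "good s'" "k' \<in> insert [] (conts c0 [])" "t2 \<le> t * (2 * (Suc n + t) + 4)"
    "(tm_step (compile c0) ^^ t2) (machine c0 k1 s1) = machine c0 k' s'"
    using Suc.IH[OF _ k1 len1 rest] g by auto
  have "(tm_step (compile c0) ^^ (t2 + t1)) (machine c0 k s) = machine c0 k' s'"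
    using t1 t2 by (simp add: funpow_add)
  moreover have "t2 + t1 \<le> Suc t * (2 * (n + Suc t) + 4)"
    using t1(1) t2(3) by (simp add: algebra_simps)
  ultimately show ?case using t2 by blast
qed

definition stk :: "nat list \<Rightarrow> stacks" where
  "stk w = (\<lambda>i. if i = 0 then w else [])"

theorem compile_halts:
  assumes w: "set w \<subseteq> {1,2,3}" and wf: "wf_com c0" and run: "runs c0 (stk w) t (stk out)"
  shows "\<exists>t' \<le> 2 + t * (2 * (length w + t) + 4). halts_with (compile c0) w t' out"
proof -
  have g: "good (stk w)" using w by (auto simp: good_def stk_def)
  have k: "[c0] \<in> insert [] (conts c0 [])" using Cons_in_conts[of c0 "[]"] by simp
  have eq: "(cstep ^^ t) ([c0], stk w) = ([], stk out)" using run by (simp add: runs_def)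
  have len: "length (stk w i) \<le> length w" for i by (simp add: stk_def)
  obtain t' where go: "good (stk out)" and t': "t' \<le> t * (2 * (length w + t) + 4)"
    "(tm_step (compile c0) ^^ t') (machine c0 [c0] (stk w)) = machine c0 [] (stk out)"
    using machine_csteps[OF g k wf len eq] by blast
  \<comment> \<open>A word over 1, 2, 3 is already the tape on which stack 0 holds the input and the
    other stacks are empty; only the mark in cell 0 is missing.\<close>
  have raw: "(tracks (contents (stk v)))(0 := tracks (contents (stk v)) 0 - 256) = tape_of v"
    "tracks (contents (stk v)) = (tape_of v)(0 := tape_of v 0 + 256)" for v
    by (auto simp: tracks_def contents_def stk_def cell_def tape_of_def fun_eq_iff)
  have sm: "smalls (contents (stk w))" "smalls (contents (stk out))" using g go by (simp_all add: smalls_contents)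
  have lt: "tape_of w 0 + 256 < 512" using tracks_less[OF sm(1), of 0] raw(2)[of w] by simp
  have "tm_step (compile c0) (0, tape_of w, 0) = machine c0 [c0] (stk w)"
    using tm_step_compile[of "(Start, [c0])" c0 "(Go, [c0])" "tape_of w" 0 "tape_of w 0 + 256" Left] k lt
    by (simp add: state_enc_def states_def machine_def raw(2))
  moreover have "tm_step (compile c0) (machine c0 [] (stk out)) = (state_enc c0 (Halt, []), tape_of out, 0)"
    using tm_step_compile[of "(Go, [])" c0 "(Halt, [])" "tracks (contents (stk out))" 0 "tracks (contents (stk out)) 0 - 256" Left]
      tracks_less[OF sm(2), of 0] by (simp add: states_def machine_def raw)
  moreover have "(f ^^ Suc (t' + 1)) x = f ((f ^^ t') (f x))" for f :: "config \<Rightarrow> config" and x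
    by (simp add: funpow_swap1)
  ultimately have "tm_run (compile c0) w (Suc (t' + 1)) = (state_enc c0 (Halt, []), tape_of out, 0)"
    using t'(2) unfolding tm_run_def by (simp only: )
  moreover have "compile c0 (state_enc c0 (Halt, [])) a = None" for a
    by (simp add: compile_def)
  ultimately have "halts_with (compile c0) w (Suc (t' + 1)) out" by (simp add: halts_with_def)
  then show ?thesis using t'(1) by (intro exI[of _ "Suc (t' + 1)"]) auto
qed

text \<open>An upper bound instead of the exact time, so that branches with different costs can
  share one bound.\<close>

definition exec :: "com \<Rightarrow> stacks \<Rightarrow> nat \<Rightarrow> stacks \<Rightarrow> bool" where
  "exec c s T s' \<longleftrightarrow> (\<exists>t\<le>T. runs c s t s')"

lemma exec_mono: "exec c s T s' \<Longrightarrow> T \<le> T' \<Longrightarrow> exec c s T' s'"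
  unfolding exec_def using le_trans by blast

lemma exec_Skip: "exec Skip s 1 s"
  and exec_Push: "exec (Push i a) s 1 (s(i := a # s i))"
  and exec_Pop: "exec (Pop i) s 1 (s(i := tl (s i)))"
  unfolding exec_def by (rule exI[of _ 1], simp add: runs_def)+

lemma funpow_add_apply: "(f ^^ (n + m)) x = (f ^^ m) ((f ^^ n) x)"
  by (simp add: funpow_add add.commute[of n])

lemma exec_Seq: "exec c s T1 s1 \<Longrightarrow> exec d s1 T2 s2 \<Longrightarrow> exec (Seq c d) s (1 + T1 + T2) s2"
  unfolding exec_def runs_def
proof (elim exE conjE)
  fix t1 t2 assume "t1 \<le> T1" "\<forall>k. (cstep ^^ t1) (c # k, s) = (k, s1)"
    "t2 \<le> T2" "\<forall>k. (cstep ^^ t2) (d # k, s1) = (k, s2)"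
  then show "\<exists>t\<le>1 + T1 + T2. \<forall>k. (cstep ^^ t) (Seq c d # k, s) = (k, s2)"
    by (intro exI[of _ "1 + t1 + t2"]) (simp add: funpow_add_apply del: funpow.simps(2) add: funpow_simps_right)
qed

lemma exec_Branch:
  "exec (if peek (s i) = a then c else d) s T s' \<Longrightarrow> exec (Branch i a c d) s (1 + T) s'"
  unfolding exec_def runs_def
proof (elim exE conjE)
  fix t assume "t \<le> T" "\<forall>k. (cstep ^^ t) ((if peek (s i) = a then c else d) # k, s) = (k, s')"
  then show "\<exists>t\<le>1 + T. \<forall>k. (cstep ^^ t) (Branch i a c d # k, s) = (k, s')"
    by (intro exI[of _ "1 + t"]) (simp del: funpow.simps(2) add: funpow_simps_right)
qed

lemma exec_Loop_end: "peek (s i) = a \<Longrightarrow> exec (Loop i a c) s 1 s"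
  unfolding exec_def by (rule exI[of _ 1]) (simp add: runs_def)

lemma exec_Loop_step:
  "peek (s i) \<noteq> a \<Longrightarrow> exec c s T1 s1 \<Longrightarrow> exec (Loop i a c) s1 T2 s2 \<Longrightarrow> exec (Loop i a c) s (1 + T1 + T2) s2"
  unfolding exec_def runs_def
proof (elim exE conjE)
  fix t1 t2 assume "peek (s i) \<noteq> a" "t1 \<le> T1" "\<forall>k. (cstep ^^ t1) (c # k, s) = (k, s1)"
    "t2 \<le> T2" "\<forall>k. (cstep ^^ t2) (Loop i a c # k, s1) = (k, s2)"
  then show "\<exists>t\<le>1 + T1 + T2. \<forall>k. (cstep ^^ t) (Loop i a c # k, s) = (k, s2)"
    by (intro exI[of _ "1 + t1 + t2"]) (simp add: funpow_add_apply del: funpow.simps(2) add: funpow_simps_right)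
qed

lemma length_cstep: "length (snd (cstep (k, s)) i) \<le> Suc (length (s i))"
  by (cases "(k, s)" rule: cstep.cases) auto

lemma length_csteps: "length (snd ((cstep ^^ t) (k, s)) i) \<le> length (s i) + t"
proof (induction t)
  case (Suc t)
  then show ?case using length_cstep[of "fst ((cstep ^^ t) (k, s))" "snd ((cstep ^^ t) (k, s))" i] by simp
qed simp

lemma exec_length: "exec c s T s' \<Longrightarrow> length (s' i) \<le> length (s i) + T"
  unfolding exec_def runs_def
proof (elim exE conjE)
  fix t assume t: "t \<le> T" "\<forall>k. (cstep ^^ t) (c # k, s) = (k, s')"
  have "(cstep ^^ t) ([c], s) = ([], s')" using t(2) by blast
  then show "length (s' i) \<le> length (s i) + T"
    using length_csteps[of t "[c]" s i] t(1) by simp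
qed

section \<open>Programs on trees\<close>

text \<open>Values are binary trees. Their prefix code is self-delimiting, so that stack \<open>0\<close> can hold
  a stack of trees.\<close>

datatype tree = Lf | Nd tree tree

fun code :: "tree \<Rightarrow> nat list" where
  "code Lf = [1]"
| "code (Nd l r) = 2 # code l @ code r"

lemma code_pos: "0 < length (code t)"
  by (cases t) auto

lemma set_code: "set (code t) \<subseteq> {1,2}"
  by (induction t) auto

lemma zero_notin_code: "0 \<notin> set (code t)"
  by (induction t) auto

lemma stk_simps [simp]: "stk w 0 = w" "stk w (Suc i) = []" "(stk w)(0 := v) = stk v" "stk w 2 = []" "stk w 3 = []"
  by (auto simp: stk_def)

lemma stk_upd [simp]: "(stk w)(i := []) = (if i = 0 then stk [] else stk w)"
  by (auto simp: stk_def)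

text \<open>Stack 2 counts in unary the subtrees that are still to be read: a node replaces one
  pending tree by two, a leaf completes one. So a prefix code is parsed without recursion.\<close>

definition take_loop :: "nat \<Rightarrow> com" where
  "take_loop j = Loop 2 0 (Branch 0 2 (Seq (Pop 0) (Seq (Push j 2) (Push 2 1)))
                                     (Seq (Pop 0) (Seq (Push j 1) (Pop 2))))"

text \<open>The claim is relative to the rest of the run, of cost \<open>T\<close>: the loop does
  not stop between two subtrees, and this form lets the induction chain them.\<close>

lemma take_loop:
  assumes "j \<noteq> 0" "j \<noteq> 2" "s 0 = code t @ a" "s 2 = 1 # c"
    and "exec (take_loop j) (s(0 := a, j := rev (code t) @ s j, 2 := c)) T s'"
  shows "exec (take_loop j) s (7 * length (code t) + T) s'"
  using assms(3-)
proof (induction t arbitrary: s a c T)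
  case Lf
  have "exec (Seq (Pop 0) (Seq (Push j 1) (Pop 2))) s (1 + 1 + (1 + 1 + 1))
     (s(0 := a, j := rev (code Lf) @ s j, 2 := c))"
    using exec_Seq[OF exec_Pop[of 0 s] exec_Seq[OF exec_Push[of j 1] exec_Pop[of 2]]] Lf assms(1,2)
    by (simp add: fun_upd_twist)
  then have "exec (Branch 0 2 (Seq (Pop 0) (Seq (Push j 2) (Push 2 1))) (Seq (Pop 0) (Seq (Push j 1) (Pop 2)))) s
     (1 + (1 + 1 + (1 + 1 + 1))) (s(0 := a, j := rev (code Lf) @ s j, 2 := c))"
    using Lf by (intro exec_Branch) simp
  from exec_Loop_step[OF _ this Lf.prems(3)[unfolded take_loop_def]]
  have "exec (take_loop j) s (1 + (1 + (1 + 1 + (1 + 1 + 1))) + T) s'"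
    unfolding take_loop_def using Lf.prems(2) by simp
  then show ?case by (rule exec_mono) simp
next
  case (Nd l r)
  let ?s1 = "s(0 := code l @ code r @ a, j := 2 # s j, 2 := 1 # 1 # c)"
  have "exec (Seq (Pop 0) (Seq (Push j 2) (Push 2 1))) s (1 + 1 + (1 + 1 + 1)) ?s1"
    using exec_Seq[OF exec_Pop[of 0 s] exec_Seq[OF exec_Push[of j 2] exec_Push[of 2 1]]] Nd.prems assms(1,2)
    by (simp add: fun_upd_twist)
  then have "exec (Branch 0 2 (Seq (Pop 0) (Seq (Push j 2) (Push 2 1))) (Seq (Pop 0) (Seq (Push j 1) (Pop 2)))) s
     (1 + (1 + 1 + (1 + 1 + 1))) ?s1"
    using Nd.prems by (intro exec_Branch) simp
  note step = exec_Loop_step[OF _ this]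
  let ?s2 = "?s1(0 := code r @ a, j := rev (code l) @ 2 # s j, 2 := 1 # c)"
  have "?s2(0 := a, j := rev (code r) @ ?s2 j, 2 := c) = s(0 := a, j := rev (code (Nd l r)) @ s j, 2 := c)"
    using assms(1,2) by (auto simp: fun_eq_iff)
  with Nd.prems(3) have "exec (take_loop j) (?s2(0 := a, j := rev (code r) @ ?s2 j, 2 := c)) T s'"
    by (simp only: )
  then have "exec (take_loop j) ?s2 (7 * length (code r) + T) s'"
    by (rule Nd.IH(2)[rotated 2]) (use assms(1,2) in auto)
  then have "exec (take_loop j) (?s1(0 := code r @ a, j := rev (code l) @ ?s1 j, 2 := 1 # c)) (7 * length (code r) + T) s'"
    using assms(1,2) by simp
  then have "exec (take_loop j) ?s1 (7 * length (code l) + (7 * length (code r) + T)) s'"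
    by (rule Nd.IH(1)[rotated 2]) (use assms(1,2) in auto)
  from step[OF _ this[unfolded take_loop_def]] have "exec (take_loop j) s (1 + (1 + (1 + 1 + (1 + 1 + 1))) + (7 * length (code l) + (7 * length (code r) + T))) s'"
    unfolding take_loop_def using Nd.prems(2) by simp
  then show ?case by (rule exec_mono) simp
qed

definition take_tree :: "nat \<Rightarrow> com" where
  "take_tree j = Seq (Push 2 1) (take_loop j)"

lemma exec_take_tree:
  assumes "j \<noteq> 0" "j \<noteq> 2" "s 0 = code t @ a" "s 2 = []"
  shows "exec (take_tree j) s (7 * length (code t) + 3) (s(0 := a, j := rev (code t) @ s j))"
proof -
  let ?s' = "s(0 := a, j := rev (code t) @ s j)"
  have "exec (take_loop j) ?s' 1 ?s'"
    unfolding take_loop_def by (rule exec_Loop_end) (use assms in simp)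
  then have "exec (take_loop j) ((s(2 := [1]))(0 := a, j := rev (code t) @ (s(2 := [1])) j, 2 := [])) 1 ?s'"
    using assms by (simp add: fun_upd_twist fun_upd_idem)
  then have "exec (take_loop j) (s(2 := [1])) (7 * length (code t) + 1) ?s'"
    by (rule take_loop[rotated 4]) (use assms in auto)
  then have "exec (take_loop j) (s(2 := 1 # s 2)) (7 * length (code t) + 1) ?s'"
    using assms(4) by simp
  from exec_Seq[OF exec_Push this] show ?thesis
    unfolding take_tree_def by (rule exec_mono) simp
qed

definition move :: "nat \<Rightarrow> nat \<Rightarrow> com" where
  "move i j = Loop i 0 (Branch i 1 (Seq (Pop i) (Push j 1))
     (Branch i 2 (Seq (Pop i) (Push j 2)) (Seq (Pop i) (Push j 3))))"

lemma exec_move: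
  assumes "i \<noteq> j" "s i = w" "set w \<subseteq> {1,2,3}"
  shows "exec (move i j) s (6 * length w + 1) (s(i := [], j := rev w @ s j))"
  using assms(2,3)
proof (induction w arbitrary: s)
  case Nil
  then have e: "s(i := [], j := rev [] @ s j) = s" by auto
  show ?case unfolding move_def e by (rule exec_mono[OF exec_Loop_end]) (use Nil in simp_all)
next
  case (Cons x w)
  let ?s1 = "s(i := w, j := x # s j)"
  have b: "exec (Seq (Pop i) (Push j x)) s (1 + 1 + 1) ?s1"
    using exec_Seq[OF exec_Pop[of i s] exec_Push[of j x]] Cons.prems assms(1) by simp
  have x: "x = 1 \<or> x = 2 \<or> x = 3" using Cons.prems by simp
  have "exec (Branch i 1 (Seq (Pop i) (Push j 1)) (Branch i 2 (Seq (Pop i) (Push j 2)) (Seq (Pop i) (Push j 3)))) s (1 + (1 + (1 + 1 + 1))) ?s1"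
  proof (rule exec_Branch, cases "x = 1")
    case True
    then show "exec (if peek (s i) = 1 then Seq (Pop i) (Push j 1) else Branch i 2 (Seq (Pop i) (Push j 2)) (Seq (Pop i) (Push j 3))) s (1 + (1 + 1 + 1)) ?s1"
      using b Cons.prems by (auto intro: exec_mono)
  next
    case False
    have "exec (Branch i 2 (Seq (Pop i) (Push j 2)) (Seq (Pop i) (Push j 3))) s (1 + (1 + 1 + 1)) ?s1"
      by (rule exec_Branch) (use b x False Cons.prems in auto)
    then show "exec (if peek (s i) = 1 then Seq (Pop i) (Push j 1) else Branch i 2 (Seq (Pop i) (Push j 2)) (Seq (Pop i) (Push j 3))) s (1 + (1 + 1 + 1)) ?s1"
      using False Cons.prems by simp
  qed
  moreover have "exec (move i j) ?s1 (6 * length w + 1) (?s1(i := [], j := rev w @ ?s1 j))"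
    by (rule Cons.IH) (use Cons.prems assms(1) in auto)
  ultimately have "exec (move i j) s (1 + (1 + (1 + (1 + 1 + 1))) + (6 * length w + 1)) (?s1(i := [], j := rev w @ ?s1 j))"
    unfolding move_def by (intro exec_Loop_step) (use Cons.prems x in auto)
  moreover have "?s1(i := [], j := rev w @ ?s1 j) = s(i := [], j := rev (x # w) @ s j)"
    using assms(1) by auto
  ultimately show ?case by (simp only:) (erule exec_mono, simp)
qed

definition clear :: "nat \<Rightarrow> com" where
  "clear i = Loop i 0 (Pop i)"

lemma exec_clear: "s i = w \<Longrightarrow> 0 \<notin> set w \<Longrightarrow> exec (clear i) s (2 * length w + 1) (s(i := []))"
proof (induction w arbitrary: s)
  case Nil
  then have e: "s(i := []) = s" by auto
  show ?case unfolding clear_def e by (rule exec_mono[OF exec_Loop_end]) (use Nil in simp_all)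
next
  case (Cons x w)
  have "exec (clear i) (s(i := w)) (2 * length w + 1) ((s(i := w))(i := []))"
    by (rule Cons.IH) (use Cons.prems in auto)
  then have "exec (Loop i 0 (Pop i)) (s(i := w)) (2 * length w + 1) (s(i := []))"
    by (simp add: clear_def)
  moreover have "exec (Pop i) s 1 (s(i := w))" using exec_Pop[of i s] Cons.prems by simp
  moreover have "peek (s i) \<noteq> 0" using Cons.prems by simp
  ultimately have "exec (Loop i 0 (Pop i)) s (1 + 1 + (2 * length w + 1)) (s(i := []))"
    by (intro exec_Loop_step)
  then have "exec (clear i) s (1 + 1 + (2 * length w + 1)) (s(i := []))"
    by (simp add: clear_def)
  then show ?case by (rule exec_mono) simp
qed

definition drop_tree :: com where
  "drop_tree = Seq (take_tree 1) (clear 1)"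

lemma exec_drop: "exec drop_tree (stk (code t @ r)) (20 * length (code t)) (stk r)"
proof -
  have 1: "exec (take_tree 1) (stk (code t @ r)) (7 * length (code t) + 3) ((stk r)(1 := rev (code t)))"
    using exec_take_tree[of 1 "stk (code t @ r)" t r] by simp
  have "exec (clear 1) ((stk r)(1 := rev (code t))) (2 * length (rev (code t)) + 1) (stk r)"
    using exec_clear[of "(stk r)(1 := rev (code t))" 1 "rev (code t)"] zero_notin_code[of t] by simp
  from exec_Seq[OF 1 this] show ?thesis
    unfolding drop_tree_def length_rev by (rule exec_mono) (use code_pos[of t] in linarith)
qed

definition dup_loop :: com where
  "dup_loop = Loop 1 0 (Branch 1 1 (Seq (Pop 1) (Seq (Push 0 1) (Push 3 1)))
     (Seq (Pop 1) (Seq (Push 0 2) (Push 3 2))))"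

lemma exec_dup_loop:
  "s 1 = w \<Longrightarrow> set w \<subseteq> {1,2} \<Longrightarrow> exec dup_loop s (7 * length w + 1) (s(0 := rev w @ s 0, 1 := [], 3 := rev w @ s 3))"
proof (induction w arbitrary: s)
  case Nil
  then have e: "s(0 := rev [] @ s 0, 1 := [], 3 := rev [] @ s 3) = s" by auto
  show ?case unfolding dup_loop_def e by (rule exec_mono[OF exec_Loop_end]) (use Nil in simp_all)
next
  case (Cons x w)
  let ?s1 = "s(1 := w, 0 := x # s 0, 3 := x # s 3)"
  have b: "exec (Seq (Pop 1) (Seq (Push 0 x) (Push 3 x))) s (1 + 1 + (1 + 1 + 1)) ?s1"
    using exec_Seq[OF exec_Pop[of 1 s] exec_Seq[OF exec_Push[of 0 x] exec_Push[of 3 x]]] Cons.prems by simp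
  have "exec (Branch 1 1 (Seq (Pop 1) (Seq (Push 0 1) (Push 3 1))) (Seq (Pop 1) (Seq (Push 0 2) (Push 3 2)))) s (1 + (1 + 1 + (1 + 1 + 1))) ?s1"
    by (rule exec_Branch) (use Cons.prems b in auto)
  moreover have "exec dup_loop ?s1 (7 * length w + 1) (?s1(0 := rev w @ ?s1 0, 1 := [], 3 := rev w @ ?s1 3))"
    by (rule Cons.IH) (use Cons.prems in auto)
  ultimately have "exec dup_loop s (1 + (1 + (1 + 1 + (1 + 1 + 1))) + (7 * length w + 1)) (?s1(0 := rev w @ ?s1 0, 1 := [], 3 := rev w @ ?s1 3))"
    unfolding dup_loop_def by (intro exec_Loop_step) (use Cons.prems in auto)
  moreover have "?s1(0 := rev w @ ?s1 0, 1 := [], 3 := rev w @ ?s1 3) = s(0 := rev (x # w) @ s 0, 1 := [], 3 := rev (x # w) @ s 3)"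
    by auto
  ultimately show ?case by (simp only:) (erule exec_mono, simp)
qed

text \<open>Every transfer reverses a code. \<open>dup_loop\<close> restores the orientation on
  stacks 0 and 3, and the second copy is moved twice in order to keep it.\<close>

definition dup_tree :: com where
  "dup_tree = Seq (take_tree 1) (Seq dup_loop (Seq (move 3 1) (move 1 0)))"

lemma set_code3: "set (code t) \<subseteq> {1,2,3}"
  using set_code[of t] by blast

lemma exec_dup: "exec dup_tree (stk (code t @ r)) (40 * length (code t)) (stk (code t @ code t @ r))"
proof -
  let ?n = "length (code t)"
  have 1: "exec (take_tree 1) (stk (code t @ r)) (7 * ?n + 3) ((stk r)(1 := rev (code t)))"
    using exec_take_tree[of 1 "stk (code t @ r)" t r] by simp
  have 2: "exec dup_loop ((stk r)(1 := rev (code t))) (7 * ?n + 1) ((stk (code t @ r))(3 := code t))"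
    using exec_dup_loop[of "(stk r)(1 := rev (code t))" "rev (code t)"] set_code[of t] by (simp add: fun_upd_twist)
  have 3: "exec (move 3 1) ((stk (code t @ r))(3 := code t)) (6 * ?n + 1) ((stk (code t @ r))(1 := rev (code t)))"
    using exec_move[of 3 1 "(stk (code t @ r))(3 := code t)" "code t"] set_code3[of t] by simp
  have 4: "exec (move 1 0) ((stk (code t @ r))(1 := rev (code t))) (6 * ?n + 1) (stk (code t @ code t @ r))"
    using exec_move[of 1 0 "(stk (code t @ r))(1 := rev (code t))" "rev (code t)"] set_code3[of t] by simp
  show ?thesis using exec_Seq[OF 1 exec_Seq[OF 2 exec_Seq[OF 3 4]]] unfolding dup_tree_def length_rev
    by (rule exec_mono) (use code_pos[of t] in linarith)
qed

definition swap_tree :: com where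
  "swap_tree = Seq (take_tree 1) (Seq (take_tree 3) (Seq (move 1 0) (move 3 0)))"

lemma exec_swap: "exec swap_tree (stk (code t @ code u @ r)) (20 * (length (code t) + length (code u))) (stk (code u @ code t @ r))"
proof -
  let ?n = "length (code t)" and ?m = "length (code u)"
  have 1: "exec (take_tree 1) (stk (code t @ code u @ r)) (7 * ?n + 3) ((stk (code u @ r))(1 := rev (code t)))"
    using exec_take_tree[of 1 "stk (code t @ code u @ r)" t] by simp
  have 2: "exec (take_tree 3) ((stk (code u @ r))(1 := rev (code t))) (7 * ?m + 3) ((stk r)(1 := rev (code t), 3 := rev (code u)))"
    using exec_take_tree[of 3 "(stk (code u @ r))(1 := rev (code t))" u r] by (simp add: fun_upd_twist)
  have 3: "exec (move 1 0) ((stk r)(1 := rev (code t), 3 := rev (code u))) (6 * ?n + 1) ((stk (code t @ r))(3 := rev (code u)))"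
    using exec_move[of 1 0 "(stk r)(1 := rev (code t), 3 := rev (code u))" "rev (code t)"] set_code3[of t] by (simp add: fun_upd_twist)
  have 4: "exec (move 3 0) ((stk (code t @ r))(3 := rev (code u))) (6 * ?m + 1) (stk (code u @ code t @ r))"
    using exec_move[of 3 0 "(stk (code t @ r))(3 := rev (code u))" "rev (code u)"] set_code3[of u] by simp
  show ?thesis using exec_Seq[OF 1 exec_Seq[OF 2 exec_Seq[OF 3 4]]] unfolding swap_tree_def length_rev
    by (rule exec_mono) (use code_pos[of t] code_pos[of u] in arith)
qed

fun pushes :: "nat list \<Rightarrow> com" where
  "pushes [] = Skip"
| "pushes (a # w) = Seq (pushes w) (Push 0 a)"

lemma exec_pushes: "exec (pushes w) (stk r) (2 * length w + 1) (stk (w @ r))"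
proof (induction w)
  case Nil
  then show ?case using exec_Skip by (simp add: exec_mono)
next
  case (Cons a w)
  have "exec (Push 0 a) (stk (w @ r)) 1 (stk (a # w @ r))" using exec_Push[of 0 a "stk (w @ r)"] by simp
  from exec_Seq[OF Cons this] show ?case by (simp add: exec_mono)
qed

lemma wf_pushes: "set w \<subseteq> {1,2,3} \<Longrightarrow> wf_com (pushes w)"
  by (induction w) auto

lemma wf_trees: "wf_com drop_tree" "wf_com dup_tree" "wf_com swap_tree"
  by (simp_all add: drop_tree_def dup_tree_def swap_tree_def take_tree_def take_loop_def clear_def move_def dup_loop_def)

section \<open>Polynomial-time functions\<close>

class enc =
  fixes tr :: "'a \<Rightarrow> tree"

definition enc :: "'a::enc \<Rightarrow> nat list" where
  "enc x = code (tr x)"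

definition sz :: "'a::enc \<Rightarrow> nat" where
  "sz x = length (enc x)"

lemma sz_pos: "0 < sz x"
  by (simp only: sz_def enc_def code_pos)

instantiation bool :: enc begin
definition "tr b = (if b then Nd Lf Lf else Lf)"
instance ..
end

instantiation prod :: (enc, enc) enc begin
definition "tr p = Nd (tr (fst p)) (tr (snd p))"
instance ..
end

instantiation list :: (enc) enc begin
fun tr_list :: "'a list \<Rightarrow> tree" where
  "tr_list [] = Lf" | "tr_list (x # xs) = Nd (tr x) (tr_list xs)"
instance ..
end

fun nbits :: "nat \<Rightarrow> bool list" where
  "nbits n = (if n = 0 then [] else odd n # nbits (n div 2))"
declare nbits.simps [simp del]

instantiation nat :: enc begin
definition "tr n = tr (nbits n)"
instance ..
end

lemma sz_simps [simp]:
  "sz ([] :: 'a::enc list) = 1" "sz (x # xs) = 1 + sz x + sz xs" "sz (x, y) = 1 + sz x + sz y"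
  by (simp_all add: sz_def enc_def tr_prod_def)

lemma sz_bool: "sz (b::bool) \<le> 3" "1 \<le> sz (b::bool)"
  by (simp_all add: sz_def enc_def tr_bool_def)

lemma sz_nat: "sz (n::nat) = sz (nbits n)"
  by (simp add: sz_def enc_def tr_nat_def)

text \<open>The base is at least 2, so constants, sums and products are absorbed by raising the
  exponent, without any coefficients.\<close>

definition polyb :: "(nat \<Rightarrow> nat) \<Rightarrow> bool" where
  "polyb p \<longleftrightarrow> (\<exists>d. \<forall>n. p n \<le> (n + 2) ^ d)"

lemma polyb_mono: "polyb q \<Longrightarrow> (\<And>n. p n \<le> q n) \<Longrightarrow> polyb p"
  unfolding polyb_def using le_trans by blast

lemma polyb_const: "polyb (\<lambda>n. k)"
  unfolding polyb_def
proof (intro exI allI)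
  fix n
  have "k \<le> 2 ^ k" by (simp add: less_imp_le)
  also have "\<dots> \<le> (n + 2) ^ k" by (rule power_mono) auto
  finally show "k \<le> (n + 2) ^ k" .
qed

lemma polyb_id: "polyb (\<lambda>n. n)"
  unfolding polyb_def by (rule exI[of _ 1]) simp

lemma polyb_mult: "polyb p \<Longrightarrow> polyb q \<Longrightarrow> polyb (\<lambda>n. p n * q n)"
  unfolding polyb_def
proof (elim exE)
  fix d e assume "\<forall>n. p n \<le> (n + 2) ^ d" "\<forall>n. q n \<le> (n + 2) ^ e"
  then show "\<exists>d. \<forall>n. p n * q n \<le> (n + 2) ^ d"
    by (intro exI[of _ "d + e"]) (simp add: power_add mult_mono)
qed

lemma polyb_add: "polyb p \<Longrightarrow> polyb q \<Longrightarrow> polyb (\<lambda>n. p n + q n)"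
proof -
  assume "polyb p" "polyb q"
  then have "polyb (\<lambda>n. (p n + 1) * (q n + 1))"
    unfolding polyb_def
  proof (elim exE)
    fix d e assume p: "\<forall>n. p n \<le> (n + 2) ^ d" and q: "\<forall>n. q n \<le> (n + 2) ^ e"
    have "x + 1 \<le> (n + 2) ^ Suc k" if "x \<le> (n + 2) ^ k" for x n k :: nat
    proof -
      have "1 \<le> (n + 2) ^ k" by simp
      then have "x + 1 \<le> 2 * (n + 2) ^ k" using that by linarith
      also have "\<dots> \<le> (n + 2) ^ Suc k" by simp
      finally show ?thesis .
    qed
    then have "(p n + 1) * (q n + 1) \<le> (n + 2) ^ Suc d * (n + 2) ^ Suc e" for n
      using p q by (intro mult_mono) auto
    then show "\<exists>d. \<forall>n. (p n + 1) * (q n + 1) \<le> (n + 2) ^ d"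
      by (intro exI[of _ "Suc d + Suc e"] allI) (simp only: power_add)
  qed
  then show ?thesis by (rule polyb_mono) simp
qed

lemma polyb_power: "polyb p \<Longrightarrow> polyb (\<lambda>n. p n ^ k)"
  by (induction k) (simp_all add: polyb_const polyb_mult)

definition psz :: "('a::enc \<Rightarrow> nat) \<Rightarrow> bool" where
  "psz h \<longleftrightarrow> (\<exists>d. \<forall>x. h x \<le> (sz x + 2) ^ d)"

lemma psz_iff: "psz h \<longleftrightarrow> (\<exists>p. polyb p \<and> (\<forall>x. h x \<le> p (sz x)))"
proof
  assume "psz h"
  then obtain d where "\<forall>x. h x \<le> (sz x + 2) ^ d" unfolding psz_def by blast
  moreover have "polyb (\<lambda>n. (n + 2) ^ d)" unfolding polyb_def by blast
  ultimately show "\<exists>p. polyb p \<and> (\<forall>x. h x \<le> p (sz x))" by (intro exI[of _ "\<lambda>n. (n + 2) ^ d"]) simp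
next
  assume "\<exists>p. polyb p \<and> (\<forall>x. h x \<le> p (sz x))"
  then show "psz h" unfolding psz_def polyb_def using le_trans by blast
qed

lemma psz_mono: "psz q \<Longrightarrow> (\<And>x. p x \<le> q x) \<Longrightarrow> psz p"
  unfolding psz_def using le_trans by blast

lemma psz_sz: "psz (\<lambda>x. sz x)"
  unfolding psz_iff using polyb_id by blast

lemma psz_const: "psz (\<lambda>x. k)"
  unfolding psz_iff using polyb_const by blast

lemma psz_add: "psz p \<Longrightarrow> psz q \<Longrightarrow> psz (\<lambda>x. p x + q x)"
  unfolding psz_iff
proof (elim exE conjE)
  fix a b assume "polyb a" "\<forall>x. p x \<le> a (sz x)" "polyb b" "\<forall>x. q x \<le> b (sz x)"
  then show "\<exists>c. polyb c \<and> (\<forall>x. p x + q x \<le> c (sz x))"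
    by (intro exI[of _ "\<lambda>n. a n + b n"]) (simp add: polyb_add add_mono)
qed

lemma psz_mult: "psz p \<Longrightarrow> psz q \<Longrightarrow> psz (\<lambda>x. p x * q x)"
  unfolding psz_iff
proof (elim exE conjE)
  fix a b assume "polyb a" "\<forall>x. p x \<le> a (sz x)" "polyb b" "\<forall>x. q x \<le> b (sz x)"
  then show "\<exists>c. polyb c \<and> (\<forall>x. p x * q x \<le> c (sz x))"
    by (intro exI[of _ "\<lambda>n. a n * b n"]) (simp add: polyb_mult mult_mono)
qed

lemma psz_power: "psz p \<Longrightarrow> psz (\<lambda>x. p x ^ k)"
  by (induction k) (simp_all add: psz_const psz_mult)

lemma psz_comp: "polyb p \<Longrightarrow> psz q \<Longrightarrow> psz (\<lambda>x. p (q x))"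
proof -
  assume "polyb p" and q: "psz q"
  then obtain d where "p (q n) \<le> (q n + 2) ^ d" for n unfolding polyb_def by blast
  then show ?thesis
    by (rule psz_mono[where q="\<lambda>n. (q n + 2) ^ d", rotated]) (intro psz_power psz_add psz_const q)
qed

lemmas psz_intros = psz_add psz_mult psz_power psz_const

text \<open>An arbitrary remainder \<open>r\<close> of stack 0 has to survive. This is what allows
  values to be stored below the argument while a subprogram runs.\<close>

definition PT :: "('a::enc \<Rightarrow> 'b::enc) \<Rightarrow> bool" where
  "PT f \<longleftrightarrow> (\<exists>c T. wf_com c \<and> psz T \<and>
     (\<forall>x r. exec c (stk (enc x @ r)) (T x) (stk (enc (f x) @ r))))"

lemma PTI: "wf_com c \<Longrightarrow> psz T \<Longrightarrow> (\<And>x r. exec c (stk (enc x @ r)) (T x) (stk (enc (f x) @ r))) \<Longrightarrow> PT f"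
  unfolding PT_def by blast

text \<open>A step writes at most one symbol, so a time bound is also a size bound; composition
  depends on this.\<close>

lemma PT_size: "PT f \<Longrightarrow> psz (\<lambda>x. sz (f x))"
proof -
  assume "PT f"
  then obtain c T where T: "psz T" and e: "\<forall>x r. exec c (stk (enc x @ r)) (T x) (stk (enc (f x) @ r))"
    unfolding PT_def by blast
  have "sz (f x) \<le> sz x + T x" for x
    using exec_length[OF e[rule_format, of x "[]"], of 0] unfolding sz_def by simp
  then show ?thesis by (rule psz_mono[OF psz_add[OF psz_sz T]])
qed

text \<open>Programs see only the tree of a value, so a change of type is free.\<close>

lemma PT_coerce: "PT f \<Longrightarrow> (\<And>x. tr (f x) = tr (g x)) \<Longrightarrow> PT g"
  unfolding PT_def enc_def by simp

lemma PT_id: "PT (\<lambda>x. x)"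
  by (rule PTI[where c=Skip and T="\<lambda>_. 1"]) (auto simp: psz_const intro: exec_Skip[simplified])

lemma PT_compose:
  assumes f: "PT f" and g: "PT g" shows "PT (\<lambda>x. f (g x))"
proof -
  obtain c T where c: "wf_com c" "psz T" "\<And>x r. exec c (stk (enc x @ r)) (T x) (stk (enc (g x) @ r))"
    using g unfolding PT_def by blast
  obtain d U where d: "wf_com d" "psz U" "\<And>x r. exec d (stk (enc x @ r)) (U x) (stk (enc (f x) @ r))"
    using f unfolding PT_def by blast
  obtain p where p: "polyb p" "\<And>x. U x \<le> p (sz x)" using d(2) unfolding psz_iff by blast
  show ?thesis
  proof (rule PTI[where c="Seq c d" and T="\<lambda>x. 1 + T x + p (sz (g x))"])
    show "psz (\<lambda>x. 1 + T x + p (sz (g x)))"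
      by (intro psz_intros c(2) psz_comp[OF p(1)] PT_size[OF g])
    show "exec (Seq c d) (stk (enc x @ r)) (1 + T x + p (sz (g x))) (stk (enc (f (g x)) @ r))" for x r
      by (rule exec_Seq[OF c(3) exec_mono[OF d(3) p(2)]])
  qed (use c d in simp)
qed

lemma PT_const: "PT (\<lambda>x. k)"
proof (rule PTI[where c="Seq drop_tree (pushes (enc k))" and T="\<lambda>x. 1 + 20 * sz x + (2 * sz k + 1)"])
  show "wf_com (Seq drop_tree (pushes (enc k)))"
    using set_code3[of "tr k"] by (simp only: wf_com.simps wf_trees wf_pushes enc_def)
  show "psz (\<lambda>x::'a. 1 + 20 * sz x + (2 * sz k + 1))" by (intro psz_intros psz_sz)
  show "exec (Seq drop_tree (pushes (enc k))) (stk (enc x @ r)) (1 + 20 * sz x + (2 * sz k + 1)) (stk (enc k @ r))" for x :: 'a and r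
    unfolding sz_def enc_def by (rule exec_Seq[OF exec_drop exec_pushes])
qed

lemma exec_copy:
  assumes "\<And>x r. exec c (stk (enc x @ r)) (T x) (stk (enc (g x) @ r))"
  shows "exec (Seq dup_tree c) (stk (enc x @ r)) (1 + 40 * sz x + T x) (stk (enc (g x) @ enc x @ r))"
proof -
  have "exec dup_tree (stk (enc x @ r)) (40 * sz x) (stk (enc x @ enc x @ r))"
    unfolding sz_def enc_def by (rule exec_dup)
  from exec_Seq[OF this assms] show ?thesis .
qed

lemma exec_Push0: "exec (Push 0 a) (stk w) 1 (stk (a # w))"
  using exec_Push[of 0 a "stk w"] by simp

lemma exec_Pop0: "exec (Pop 0) (stk (a # w)) 1 (stk w)"
  using exec_Pop[of 0 "stk (a # w)"] by simp

lemma exec_swap_enc: "exec swap_tree (stk (enc x @ enc y @ r)) (20 * (sz x + sz y)) (stk (enc y @ enc x @ r))"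
  unfolding sz_def enc_def by (rule exec_swap)

lemma exec_drop_enc: "exec drop_tree (stk (enc x @ r)) (20 * sz x) (stk r)"
  unfolding sz_def enc_def by (rule exec_drop)

text \<open>Pairs and cons cells are the same tree node, so one program serves both
  \<open>PT_Pair\<close> and \<open>PT_Cons\<close>.\<close>

lemma PT_node:
  assumes f: "PT f" and g: "PT g" and h: "\<And>x. tr (h x) = Nd (tr (f x)) (tr (g x))"
  shows "PT h"
proof -
  obtain c T where c: "wf_com c" "psz T" "\<And>x r. exec c (stk (enc x @ r)) (T x) (stk (enc (f x) @ r))"
    using f unfolding PT_def by blast
  obtain d U where d: "wf_com d" "psz U" "\<And>x r. exec d (stk (enc x @ r)) (U x) (stk (enc (g x) @ r))"
    using g unfolding PT_def by blast
  have h': "enc (h x) = 2 # enc (f x) @ enc (g x)" for x by (simp add: enc_def h)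
  show ?thesis
  proof (rule PTI[where c="Seq (Seq dup_tree d) (Seq swap_tree (Seq c (Push 0 2)))"
        and T="\<lambda>x. 1 + (1 + 40 * sz x + U x) + (1 + 20 * (sz (g x) + sz x) + (1 + T x + 1))"])
    show "psz (\<lambda>x. 1 + (1 + 40 * sz x + U x) + (1 + 20 * (sz (g x) + sz x) + (1 + T x + 1)))"
      by (intro psz_intros c(2) d(2) psz_sz PT_size[OF g])
    show "exec (Seq (Seq dup_tree d) (Seq swap_tree (Seq c (Push 0 2)))) (stk (enc x @ r))
      (1 + (1 + 40 * sz x + U x) + (1 + 20 * (sz (g x) + sz x) + (1 + T x + 1))) (stk (enc (h x) @ r))" for x r
      unfolding h' using exec_Seq[OF exec_copy[OF d(3)] exec_Seq[OF exec_swap_enc exec_Seq[OF c(3) exec_Push0]]]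
      by simp
  qed (use c d wf_trees in simp)
qed

lemma PT_Pair: "PT f \<Longrightarrow> PT g \<Longrightarrow> PT (\<lambda>x. (f x, g x))"
  by (erule (1) PT_node) (simp add: tr_prod_def)

lemma PT_Cons: "PT f \<Longrightarrow> PT g \<Longrightarrow> PT (\<lambda>x. f x # g x)"
  by (erule (1) PT_node) simp

lemma enc_pair: "enc (x, y) = 2 # enc x @ enc y"
  by (simp add: enc_def tr_prod_def)

lemma PT_fst0: "PT (fst :: 'a::enc \<times> 'b::enc \<Rightarrow> 'a)"
proof (rule PTI[where c="Seq (Pop 0) (Seq swap_tree drop_tree)" and T="\<lambda>x. 1 + 1 + (1 + 20 * sz x + 20 * sz x)"])
  show "psz (\<lambda>x::'a \<times> 'b. 1 + 1 + (1 + 20 * sz x + 20 * sz x))" by (intro psz_intros psz_sz)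
  fix x :: "'a \<times> 'b" and r
  obtain a b where x: "x = (a, b)" by fastforce
  have 1: "exec swap_tree (stk (enc a @ enc b @ r)) (20 * sz x) (stk (enc b @ enc a @ r))"
    by (rule exec_mono[OF exec_swap_enc]) (simp add: x)
  have 2: "exec drop_tree (stk (enc b @ enc a @ r)) (20 * sz x) (stk (enc a @ r))"
    by (rule exec_mono[OF exec_drop_enc]) (simp add: x)
  have 3: "exec (Pop 0) (stk (enc x @ r)) 1 (stk (enc a @ enc b @ r))"
    by (simp only: x enc_pair append_Cons append_assoc exec_Pop0)
  show "exec (Seq (Pop 0) (Seq swap_tree drop_tree)) (stk (enc x @ r)) (1 + 1 + (1 + 20 * sz x + 20 * sz x)) (stk (enc (fst x) @ r))"
    using exec_Seq[OF 3 exec_Seq[OF 1 2]] by (simp only: x fst_conv)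
qed (simp add: wf_trees)

lemma PT_snd0: "PT (snd :: 'a::enc \<times> 'b::enc \<Rightarrow> 'b)"
proof (rule PTI[where c="Seq (Pop 0) drop_tree" and T="\<lambda>x. 1 + 1 + 20 * sz x"])
  show "psz (\<lambda>x::'a \<times> 'b. 1 + 1 + 20 * sz x)" by (intro psz_intros psz_sz)
  fix x :: "'a \<times> 'b" and r
  obtain a b where x: "x = (a, b)" by fastforce
  have 2: "exec drop_tree (stk (enc a @ enc b @ r)) (20 * sz x) (stk (enc b @ r))"
    by (rule exec_mono[OF exec_drop_enc]) (simp add: x)
  have 3: "exec (Pop 0) (stk (enc x @ r)) 1 (stk (enc a @ enc b @ r))"
    by (simp only: x enc_pair append_Cons append_assoc exec_Pop0)
  show "exec (Seq (Pop 0) drop_tree) (stk (enc x @ r)) (1 + 1 + 20 * sz x) (stk (enc (snd x) @ r))"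
    using exec_Seq[OF 3 2] by (simp only: x snd_conv)
qed (simp add: wf_trees)

lemma PT_fst: "PT f \<Longrightarrow> PT (\<lambda>x. fst (f x))"
  by (rule PT_compose[OF PT_fst0])

lemma PT_snd: "PT f \<Longrightarrow> PT (\<lambda>x. snd (f x))"
  by (rule PT_compose[OF PT_snd0])

lemma PT_if:
  assumes p: "PT p" and f: "PT f" and g: "PT g" shows "PT (\<lambda>x. if p x then f x else g x)"
proof -
  obtain b V where b: "wf_com b" "psz V" "\<And>x r. exec b (stk (enc x @ r)) (V x) (stk (enc (p x) @ r))"
    using p unfolding PT_def by blast
  obtain c T where c: "wf_com c" "psz T" "\<And>x r. exec c (stk (enc x @ r)) (T x) (stk (enc (f x) @ r))"
    using f unfolding PT_def by blast
  obtain d U where d: "wf_com d" "psz U" "\<And>x r. exec d (stk (enc x @ r)) (U x) (stk (enc (g x) @ r))"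
    using g unfolding PT_def by blast
  show ?thesis
  proof (rule PTI[where c="Seq (Seq dup_tree b) (Branch 0 1 (Seq drop_tree d) (Seq drop_tree c))"
        and T="\<lambda>x. 1 + (1 + 40 * sz x + V x) + (1 + (1 + 60 + (T x + U x)))"])
    show "psz (\<lambda>x. 1 + (1 + 40 * sz x + V x) + (1 + (1 + 60 + (T x + U x))))"
      by (intro psz_intros b(2) c(2) d(2) psz_sz)
    fix x r
    \<comment> \<open>The code of a truth value has at most three symbols, hence 60 = 20 *
      3.\<close>
    have dr: "exec drop_tree (stk (enc (p x) @ enc x @ r)) 60 (stk (enc x @ r))"
      by (rule exec_mono[OF exec_drop_enc]) (use sz_bool(1)[of "p x"] in linarith)
    have "exec (Branch 0 1 (Seq drop_tree d) (Seq drop_tree c)) (stk (enc (p x) @ enc x @ r))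
       (1 + (1 + 60 + (T x + U x))) (stk (enc (if p x then f x else g x) @ r))"
    proof (rule exec_Branch, cases "p x")
      case True
      have "exec (Seq drop_tree c) (stk (enc (p x) @ enc x @ r)) (1 + 60 + T x) (stk (enc (f x) @ r))"
        by (rule exec_Seq[OF dr c(3)])
      then show "exec (if peek (stk (enc (p x) @ enc x @ r) 0) = 1 then Seq drop_tree d else Seq drop_tree c)
        (stk (enc (p x) @ enc x @ r)) (1 + 60 + (T x + U x)) (stk (enc (if p x then f x else g x) @ r))"
        using True by (auto simp: enc_def tr_bool_def elim: exec_mono)
    next
      case False
      have "exec (Seq drop_tree d) (stk (enc (p x) @ enc x @ r)) (1 + 60 + U x) (stk (enc (g x) @ r))"
        by (rule exec_Seq[OF dr d(3)])
      then show "exec (if peek (stk (enc (p x) @ enc x @ r) 0) = 1 then Seq drop_tree d else Seq drop_tree c)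
        (stk (enc (p x) @ enc x @ r)) (1 + 60 + (T x + U x)) (stk (enc (if p x then f x else g x) @ r))"
        using False by (auto simp: enc_def tr_bool_def elim: exec_mono)
    qed
    from exec_Seq[OF exec_copy[OF b(3)] this]
    show "exec (Seq (Seq dup_tree b) (Branch 0 1 (Seq drop_tree d) (Seq drop_tree c))) (stk (enc x @ r))
      (1 + (1 + 40 * sz x + V x) + (1 + (1 + 60 + (T x + U x)))) (stk (enc (if p x then f x else g x) @ r))" .
  qed (use b c d wf_trees in simp)
qed

lemma enc_list: "enc [] = [1]" "enc (y # ys) = 2 # enc y @ enc ys"
  by (simp_all add: enc_def)

text \<open>A cons cell is at the same time the code of the pair of its head and its tail. After a
  swap, one symbol 2 pushed in front turns argument and list into the triple that the program for
  \<open>h\<close> expects.\<close>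

lemma PT_case_list:
  fixes g :: "'a::enc \<Rightarrow> 'b::enc list" and f :: "'a \<Rightarrow> 'c::enc"
  assumes g: "PT g" and f: "PT f" and h: "PT (\<lambda>p. h (fst p) (fst (snd p)) (snd (snd p)))"
  shows "PT (\<lambda>x. case g x of [] \<Rightarrow> f x | y # ys \<Rightarrow> h x y ys)"
proof -
  obtain b V where b: "wf_com b" "psz V" "\<And>x r. exec b (stk (enc x @ r)) (V x) (stk (enc (g x) @ r))"
    using g unfolding PT_def by blast
  obtain c T where c: "wf_com c" "psz T" "\<And>x r. exec c (stk (enc x @ r)) (T x) (stk (enc (f x) @ r))"
    using f unfolding PT_def by blast
  obtain d U where d: "wf_com d" "psz U" "\<And>x r. exec d (stk (enc x @ r)) (U x) (stk (enc (h (fst x) (fst (snd x)) (snd (snd x))) @ r))"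
    using h unfolding PT_def by blast
  obtain p where p: "polyb p" "\<And>x. U x \<le> p (sz x)" using d(2) unfolding psz_iff by blast
  define W where "W x = 20 * (sz (g x) + sz x) + p (1 + sz x + sz (g x))" for x
  define body where "body = Branch 0 1 (Seq (Pop 0) c) (Seq swap_tree (Seq (Push 0 2) d))"
  have W: "psz W" unfolding W_def
    by (intro psz_intros psz_comp[OF p(1)] psz_sz PT_size[OF g])
  show ?thesis
  proof (rule PTI[where c="Seq (Seq dup_tree b) body"
        and T="\<lambda>x. 1 + (1 + 40 * sz x + V x) + (1 + (3 + (T x + W x)))"])
    show "psz (\<lambda>x. 1 + (1 + 40 * sz x + V x) + (1 + (3 + (T x + W x))))"
      by (intro psz_intros b(2) c(2) W psz_sz)
    fix x r
    have "exec body (stk (enc (g x) @ enc x @ r)) (1 + (3 + (T x + W x)))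
      (stk (enc (case g x of [] \<Rightarrow> f x | y # ys \<Rightarrow> h x y ys) @ r))"
      unfolding body_def
    proof (rule exec_Branch, cases "g x")
      case Nil
      have "exec (Seq (Pop 0) c) (stk (1 # enc x @ r)) (1 + 1 + T x) (stk (enc (f x) @ r))"
        by (rule exec_Seq[OF exec_Pop0 c(3)])
      then show "exec (if peek (stk (enc (g x) @ enc x @ r) 0) = 1 then Seq (Pop 0) c else Seq swap_tree (Seq (Push 0 2) d))
        (stk (enc (g x) @ enc x @ r)) (3 + (T x + W x)) (stk (enc (case g x of [] \<Rightarrow> f x | y # ys \<Rightarrow> h x y ys) @ r))"
        using Nil by (auto simp: enc_list elim: exec_mono)
    next
      case (Cons y ys)
      let ?p = "(x, y, ys)"
      have e: "2 # enc x @ enc (g x) @ r = enc ?p @ r" by (simp add: enc_pair Cons enc_list)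
      have "exec d (stk (2 # enc x @ enc (g x) @ r)) (p (1 + sz x + sz (g x))) (stk (enc (h x y ys) @ r))"
        unfolding e using exec_mono[OF d(3)[of ?p r] p(2)[of ?p]] by (simp add: Cons)
      from exec_Seq[OF exec_swap_enc exec_Seq[OF exec_Push0 this]]
      have "exec (Seq swap_tree (Seq (Push 0 2) d)) (stk (enc (g x) @ enc x @ r))
         (1 + 20 * (sz (g x) + sz x) + (1 + 1 + p (1 + sz x + sz (g x)))) (stk (enc (h x y ys) @ r))" .
      moreover have "1 + 20 * (sz (g x) + sz x) + (1 + 1 + p (1 + sz x + sz (g x))) \<le> 3 + (T x + W x)"
        by (simp add: W_def)
      ultimately have "exec (Seq swap_tree (Seq (Push 0 2) d)) (stk (enc (g x) @ enc x @ r))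
         (3 + (T x + W x)) (stk (enc (h x y ys) @ r))" by (rule exec_mono)
      then show "exec (if peek (stk (enc (g x) @ enc x @ r) 0) = 1 then Seq (Pop 0) c else Seq swap_tree (Seq (Push 0 2) d))
        (stk (enc (g x) @ enc x @ r)) (3 + (T x + W x)) (stk (enc (case g x of [] \<Rightarrow> f x | y # ys \<Rightarrow> h x y ys) @ r))"
        using Cons by (simp add: enc_list)
    qed
    from exec_Seq[OF exec_copy[OF b(3)] this]
    show "exec (Seq (Seq dup_tree b) body) (stk (enc x @ r)) (1 + (1 + 40 * sz x + V x) + (1 + (3 + (T x + W x))))
      (stk (enc (case g x of [] \<Rightarrow> f x | y # ys \<Rightarrow> h x y ys) @ r))" .
  qed (use b c d wf_trees body_def in simp)
qed

definition iter_body :: "com \<Rightarrow> com" where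
  "iter_body c = Seq (Pop 0) (Seq drop_tree (Seq swap_tree (Seq c swap_tree)))"

text \<open>The list on top is a counter: each round removes one cons cell, and the loop stops at
  symbol 1, the code of the empty list.\<close>

lemma exec_iter:
  fixes l :: "'b::enc list" and s :: "'a::enc" and f :: "'a \<Rightarrow> 'a"
  assumes c: "\<And>x r. exec c (stk (enc x @ r)) (p (sz x)) (stk (enc (f x) @ r))" and "mono p"
    and "sz l \<le> B" "\<And>i. i \<le> length l \<Longrightarrow> sz ((f ^^ i) s) \<le> B"
  shows "exec (Loop 0 1 (iter_body c)) (stk (enc l @ enc s @ r)) (1 + length l * (100 * B + p B + 9))
    (stk (1 # enc ((f ^^ length l) s) @ r))"
  using assms(3,4)
proof (induction l arbitrary: s)
  case Nil
  have "exec (Loop 0 1 (iter_body c)) (stk (1 # enc s @ r)) 1 (stk (1 # enc s @ r))"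
    by (rule exec_Loop_end) simp
  then show ?case by (simp add: enc_list)
next
  case (Cons x l)
  have B: "sz x + sz l \<le> B" "sz s \<le> B" "sz (f s) \<le> B"
    using Cons.prems(1) Cons.prems(2)[of 0] Cons.prems(2)[of 1] by simp_all
  have 1: "exec drop_tree (stk (enc x @ enc l @ enc s @ r)) (20 * B) (stk (enc l @ enc s @ r))"
    by (rule exec_mono[OF exec_drop_enc]) (use B in simp)
  have 2: "exec swap_tree (stk (enc l @ enc s @ r)) (40 * B) (stk (enc s @ enc l @ r))"
    by (rule exec_mono[OF exec_swap_enc]) (use B in simp)
  have 3: "exec c (stk (enc s @ enc l @ r)) (p B) (stk (enc (f s) @ enc l @ r))"
    by (rule exec_mono[OF c monoD[OF \<open>mono p\<close> B(2)]])
  have 4: "exec swap_tree (stk (enc (f s) @ enc l @ r)) (40 * B) (stk (enc l @ enc (f s) @ r))"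
    by (rule exec_mono[OF exec_swap_enc]) (use B in simp)
  have body: "exec (iter_body c) (stk (enc (x # l) @ enc s @ r)) (1 + 1 + (1 + 20 * B + (1 + 40 * B + (1 + p B + 40 * B))))
     (stk (enc l @ enc (f s) @ r))"
    unfolding iter_body_def using exec_Seq[OF exec_Pop0 exec_Seq[OF 1 exec_Seq[OF 2 exec_Seq[OF 3 4]]]]
    by (simp add: enc_list)
  have "exec (Loop 0 1 (iter_body c)) (stk (enc l @ enc (f s) @ r)) (1 + length l * (100 * B + p B + 9))
    (stk (1 # enc ((f ^^ length l) (f s)) @ r))"
  proof (rule Cons.IH)
    show "sz l \<le> B" using B by simp
    show "sz ((f ^^ i) (f s)) \<le> B" if "i \<le> length l" for i
      using Cons.prems(2)[of "Suc i"] that by (simp add: funpow_swap1)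
  qed
  from exec_Loop_step[OF _ body this]
  have "exec (Loop 0 1 (iter_body c)) (stk (enc (x # l) @ enc s @ r))
    (1 + (1 + 1 + (1 + 20 * B + (1 + 40 * B + (1 + p B + 40 * B)))) + (1 + length l * (100 * B + p B + 9)))
    (stk (1 # enc ((f ^^ length l) (f s)) @ r))"
    by (simp add: enc_list)
  moreover have "(f ^^ length (x # l)) s = (f ^^ length l) (f s)" by (simp add: funpow_swap1)
  ultimately show ?case by (simp only:) (erule exec_mono, simp add: algebra_simps)
qed

lemma length_le_sz: "length l \<le> sz l"
  by (induction l) auto

text \<open>Polynomial time is not closed under iteration, since sizes may grow exponentially. The
  bound \<open>q\<close> on all iterates excludes this, and then the cost is the number of rounds
  times the cost of one call at the common size bound.\<close>

lemma PT_iter: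
  fixes h :: "'a::enc \<Rightarrow> 'b::enc list" and f :: "'c::enc \<Rightarrow> 'c"
  assumes f: "PT f" and g: "PT g" and h: "PT h"
    and q: "psz q" "\<And>x i. i \<le> length (h x) \<Longrightarrow> sz ((f ^^ i) (g x)) \<le> q x"
  shows "PT (\<lambda>x. (f ^^ length (h x)) (g x))"
proof -
  obtain c T where c: "wf_com c" "psz T" "\<And>x r. exec c (stk (enc x @ r)) (T x) (stk (enc (f x) @ r))"
    using f unfolding PT_def by blast
  obtain a U where a: "wf_com a" "psz U" "\<And>x r. exec a (stk (enc x @ r)) (U x) (stk (enc (g x) @ r))"
    using g unfolding PT_def by blast
  obtain b V where b: "wf_com b" "psz V" "\<And>x r. exec b (stk (enc x @ r)) (V x) (stk (enc (h x) @ r))"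
    using h unfolding PT_def by blast
  obtain e where e: "\<And>x. T x \<le> (sz x + 2) ^ e" using c(2) unfolding psz_def by blast
  \<comment> \<open>A monotone majorant of the time of \<open>f\<close>, to be evaluated at the
    common bound of all iterates.\<close>
  define p where "p n = (n + 2) ^ e" for n :: nat
  have p: "mono p" by (auto simp: p_def mono_def power_mono)
  have pb: "polyb p" unfolding polyb_def p_def by blast
  define B where "B x = q x + sz (h x)" for x
  have B: "psz B" unfolding B_def by (intro psz_intros q(1) PT_size[OF h])
  define prog where "prog = Seq (Seq dup_tree b) (Seq swap_tree (Seq a (Seq swap_tree (Seq (Loop 0 1 (iter_body c)) (Pop 0)))))"
  let ?T = "\<lambda>x. 1 + (1 + 40 * sz x + V x) + (1 + 20 * (sz (h x) + sz x) + (1 + U x + (1 + 20 * (sz (g x) + sz (h x))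
     + (1 + (1 + B x * (100 * B x + p (B x) + 9)) + 1))))"
  show ?thesis
  proof (rule PTI[where c=prog and T="?T"])
    show "psz ?T"
      by (intro psz_intros psz_sz a(2) b(2) B psz_comp[OF pb] PT_size[OF h] PT_size[OF g])
    show "wf_com prog" using a(1) b(1) c(1) wf_trees by (simp add: prog_def iter_body_def)
    fix x r
    have "exec (Loop 0 1 (iter_body c)) (stk (enc (h x) @ enc (g x) @ r)) (1 + length (h x) * (100 * B x + p (B x) + 9))
      (stk (1 # enc ((f ^^ length (h x)) (g x)) @ r))"
    proof (rule exec_iter[where p=p])
      show "exec c (stk (enc y @ r)) (p (sz y)) (stk (enc (f y) @ r))" for y r
        using exec_mono[OF c(3) e] by (simp add: p_def)
      show "sz (h x) \<le> B x" by (simp add: B_def)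
      show "sz ((f ^^ i) (g x)) \<le> B x" if "i \<le> length (h x)" for i
        using q(2)[OF that] by (simp add: B_def)
    qed (rule p)
    moreover have "length (h x) \<le> B x" using length_le_sz[of "h x"] by (simp add: B_def)
    then have "length (h x) * (100 * B x + p (B x) + 9) \<le> B x * (100 * B x + p (B x) + 9)"
      by (rule mult_right_mono) simp
    ultimately have loop: "exec (Loop 0 1 (iter_body c)) (stk (enc (h x) @ enc (g x) @ r))
      (1 + B x * (100 * B x + p (B x) + 9)) (stk (1 # enc ((f ^^ length (h x)) (g x)) @ r))"
      by (elim exec_mono) simp
    show "exec prog (stk (enc x @ r)) (?T x) (stk (enc ((f ^^ length (h x)) (g x)) @ r))"
      unfolding prog_def
      by (rule exec_Seq[OF exec_copy[OF b(3)] exec_Seq[OF exec_swap_enc exec_Seq[OF a(3)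
        exec_Seq[OF exec_swap_enc exec_Seq[OF loop exec_Pop0]]]]])
  qed
qed

section \<open>Closure under operations on lists\<close>

named_theorems pt

lemmas [pt] = PT_id PT_const PT_Pair PT_Cons PT_if PT_case_list
declare PT_fst [pt] PT_snd [pt]

lemma PT_comp2: "PT (\<lambda>p. F (fst p) (snd p)) \<Longrightarrow> PT f \<Longrightarrow> PT g \<Longrightarrow> PT (\<lambda>x. F (f x) (g x))"
  using PT_compose[of "\<lambda>p. F (fst p) (snd p)" "\<lambda>x. (f x, g x)"] PT_Pair[of f g] by simp

lemma PT_comp3: "PT (\<lambda>p. F (fst p) (fst (snd p)) (snd (snd p))) \<Longrightarrow> PT f \<Longrightarrow> PT g \<Longrightarrow> PT h
    \<Longrightarrow> PT (\<lambda>x. F (f x) (g x) (h x))"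
  using PT_compose[of "\<lambda>p. F (fst p) (fst (snd p)) (snd (snd p))" "\<lambda>x. (f x, g x, h x)"]
    PT_Pair[of f "\<lambda>x. (g x, h x)"] PT_Pair[of g h] by simp

lemma PT_comp4: "PT (\<lambda>p. F (fst p) (fst (snd p)) (fst (snd (snd p))) (snd (snd (snd p)))) \<Longrightarrow> PT f \<Longrightarrow> PT g
    \<Longrightarrow> PT h \<Longrightarrow> PT k \<Longrightarrow> PT (\<lambda>x. F (f x) (g x) (h x) (k x))"
  using PT_compose[of "\<lambda>p. F (fst p) (fst (snd p)) (fst (snd (snd p))) (snd (snd (snd p)))" "\<lambda>x. (f x, g x, h x, k x)"]
    PT_Pair[of f "\<lambda>x. (g x, h x, k x)"] PT_Pair[of g "\<lambda>x. (h x, k x)"] PT_Pair[of h k] by simp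

lemma PT_eqI: "PT f \<Longrightarrow> (\<And>x. f x = g x) \<Longrightarrow> PT g"
  by (rule PT_coerce[of f g]) simp_all

lemma PT_not [pt]: "PT f \<Longrightarrow> PT (\<lambda>x. \<not> f x)"
  by (rule PT_eqI[OF PT_if[OF _ PT_const PT_const, of f False True]]) auto

lemma PT_conj [pt]: "PT f \<Longrightarrow> PT g \<Longrightarrow> PT (\<lambda>x. f x \<and> g x)"
  by (rule PT_eqI[OF PT_if[OF _ _ PT_const, of f g False]]) auto

lemma PT_disj [pt]: "PT f \<Longrightarrow> PT g \<Longrightarrow> PT (\<lambda>x. f x \<or> g x)"
  by (rule PT_eqI[OF PT_if[OF _ PT_const, of f g True]]) auto

lemma PT_eq_bool [pt]: "PT f \<Longrightarrow> PT g \<Longrightarrow> PT (\<lambda>x. (f x :: bool) = g x)"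
  by (rule PT_eqI[OF PT_if[OF _ _ PT_not, of f g g]]) auto

lemma PT_eq_Nil [pt]: "PT f \<Longrightarrow> PT (\<lambda>x. f x = [])"
  by (rule PT_eqI[OF PT_case_list[OF _ PT_const PT_const, of f True False]]) (auto split: list.split)

lemma PT_tl [pt]: "PT f \<Longrightarrow> PT (\<lambda>x. tl (f x))"
  unfolding tl_def by (intro pt)

lemma sz_list: "sz xs = 1 + (\<Sum>x\<leftarrow>xs. 1 + sz x)"
  by (induction xs) auto

lemma sz_elem: "x \<in> set xs \<Longrightarrow> sz x < sz xs"
  by (induction xs) auto

lemma sz_list_le: "(\<And>x. x \<in> set xs \<Longrightarrow> sz x \<le> m) \<Longrightarrow> length xs \<le> n \<Longrightarrow> sz xs \<le> 1 + n * (1 + m)"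
proof -
  assume m: "\<And>x. x \<in> set xs \<Longrightarrow> sz x \<le> m" and n: "length xs \<le> n"
  have "sz xs \<le> 1 + length xs * (1 + m)" using m
  proof (induction xs)
    case (Cons a xs)
    then have "sz a \<le> m" "sz xs \<le> 1 + length xs * (1 + m)" by simp_all
    then show ?case by simp
  qed simp
  also have "\<dots> \<le> 1 + n * (1 + m)" using mult_le_mono1[OF n, of "1 + m"] by simp
  finally show ?thesis .
qed

lemma sz_append: "sz (xs @ ys) + 1 = sz xs + sz ys"
  by (induction xs) auto

lemma sz_drop_take: "sz (drop i l) \<le> sz l" "sz (take i l) \<le> sz l"
  using sz_append[of "take i l" "drop i l"] sz_pos[of "take i l"] sz_pos[of "drop i l"] by simp_all

lemma sz_rev: "sz (rev l) = sz l"
  by (simp add: sz_list sum_list_rev rev_map[symmetric])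

text \<open>The fold runs as an iteration on triples of context, remaining list and accumulator; the
  list also supplies the number of rounds.\<close>

lemma PT_fold:
  fixes f :: "'z::enc \<Rightarrow> 'x::enc \<Rightarrow> 'a::enc \<Rightarrow> 'a"
  assumes f: "PT (\<lambda>p. f (fst p) (fst (snd p)) (snd (snd p)))" and g: "PT g" and a: "PT a"
    and q: "psz q" "\<And>z k. k \<le> length (g z) \<Longrightarrow> sz (fold (f z) (take k (g z)) (a z)) \<le> q z"
  shows "PT (\<lambda>z. fold (f z) (g z) (a z))"
proof -
  define step where "step s = (case fst (snd s) of [] \<Rightarrow> s
    | x # l \<Rightarrow> (fst s, l, f (fst s) x (snd (snd s))))" for s :: "'z \<times> 'x list \<times> 'a"
  have s: "PT step"
    unfolding step_def by (intro pt PT_comp3[OF f])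
  have it: "(step ^^ i) (z, l, b) = (z, drop i l, fold (f z) (take i l) b)" if "i \<le> length l" for i z l b
    using that
  proof (induction i)
    case (Suc i)
    then have "i < length l" by simp
    then have d: "drop i l = l ! i # drop (Suc i) l" "take (Suc i) l = take i l @ [l ! i]"
      by (simp_all add: Cons_nth_drop_Suc take_Suc_conv_app_nth)
    show ?case using Suc d by (simp add: step_def)
  qed simp
  have "PT (\<lambda>z. (step ^^ length (g z)) (z, g z, a z))"
  proof (rule PT_iter[OF s _ g])
    show "PT (\<lambda>z. (z, g z, a z))" by (intro pt g a)
    show "psz (\<lambda>z. 2 + sz z + sz (g z) + q z)"
      by (intro psz_intros psz_sz PT_size[OF g] q)
    show "sz ((step ^^ i) (z, g z, a z)) \<le> 2 + sz z + sz (g z) + q z" if "i \<le> length (g z)" for z i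
      using it[OF that] q(2)[OF that] sz_drop_take(1)[of i "g z"] by simp
  qed
  then have "PT (\<lambda>z. snd (snd ((step ^^ length (g z)) (z, g z, a z))))" by (intro pt)
  moreover have "snd (snd ((step ^^ length (g z)) (z, g z, a z))) = fold (f z) (g z) (a z)" for z
    using it[of "length (g z)" "g z" z] by simp
  ultimately show ?thesis by simp
qed

lemma PT_fold_bool:
  fixes f :: "'z::enc \<Rightarrow> 'x::enc \<Rightarrow> bool \<Rightarrow> bool"
  assumes "PT (\<lambda>p. f (fst p) (fst (snd p)) (snd (snd p)))" "PT g" "PT a"
  shows "PT (\<lambda>z. fold (f z) (g z) (a z))"
  by (rule PT_fold[where q="\<lambda>_. 3"]) (use assms sz_bool in \<open>auto intro: psz_const\<close>)

lemma PT_list_ex [pt]: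
  assumes P: "PT (\<lambda>p. P (fst p) (snd p))" and g: "PT g"
  shows "PT (\<lambda>z. list_ex (P z) (g z))"
proof -
  have "fold (\<lambda>x a. P z x \<or> a) xs a = (list_ex (P z) xs \<or> a)" for z xs a
    by (induction xs arbitrary: a) auto
  moreover have "PT (\<lambda>z. fold (\<lambda>x a. P z x \<or> a) (g z) False)"
    by (intro PT_fold_bool pt PT_comp2[OF P] g)
  ultimately show ?thesis by simp
qed

lemma PT_list_all [pt]:
  assumes P: "PT (\<lambda>p. P (fst p) (snd p))" and g: "PT g"
  shows "PT (\<lambda>z. list_all (P z) (g z))"
proof -
  have "PT (\<lambda>z. \<not> list_ex (\<lambda>x. \<not> P z x) (g z))" by (intro pt P g)
  moreover have "(\<not> list_ex (\<lambda>x. \<not> P z x) (g z)) = list_all (P z) (g z)" for z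
    by (simp add: list_ex_iff list_all_iff)
  ultimately show ?thesis by simp
qed

lemma PT_rev [pt]: assumes g: "PT g" shows "PT (\<lambda>z. rev (g z))"
proof -
  have "PT (\<lambda>z. fold Cons (g z) [])"
  proof (rule PT_fold[where q="\<lambda>z. sz (g z)"])
    show "psz (\<lambda>z. sz (g z))" by (rule PT_size[OF g])
    show "sz (fold Cons (take k (g z)) []) \<le> sz (g z)" for z k
      by (simp add: fold_Cons_rev sz_rev sz_drop_take)
  qed (intro pt g)+
  then show ?thesis by (simp add: fold_Cons_rev)
qed

lemma PT_append [pt]: assumes f: "PT f" and g: "PT g" shows "PT (\<lambda>z. f z @ g z)"
proof -
  have "PT (\<lambda>z. fold Cons (rev (f z)) (g z))"
  proof (rule PT_fold[where q="\<lambda>z. sz (f z) + sz (g z)"])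
    show "psz (\<lambda>z. sz (f z) + sz (g z))" by (intro psz_intros PT_size[OF f] PT_size[OF g])
    fix z k
    have "sz (rev (take k (rev (f z)))) \<le> sz (f z)"
      using sz_drop_take(2)[of k "rev (f z)"] by (simp only: sz_rev)
    then show "sz (fold Cons (take k (rev (f z))) (g z)) \<le> sz (f z) + sz (g z)"
      using sz_append[of "rev (take k (rev (f z)))" "g z"] by (simp add: fold_Cons_rev)
  qed (intro pt f g)+
  then show ?thesis by (simp add: fold_Cons_rev)
qed

lemma PT_map [pt]:
  fixes f :: "'z::enc \<Rightarrow> 'x::enc \<Rightarrow> 'y::enc"
  assumes f: "PT (\<lambda>p. f (fst p) (snd p))" and g: "PT g"
  shows "PT (\<lambda>z. map (f z) (g z))"
proof -
  obtain d where d: "\<And>p. sz (f (fst p) (snd p)) \<le> (sz p + 2) ^ d"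
    using PT_size[OF f] unfolding psz_def by blast
  define q where "q z = 1 + sz (g z) * (1 + (1 + sz z + sz (g z) + 2) ^ d)" for z
  have e: "fold (\<lambda>x a. f z x # a) xs a = rev (map (f z) xs) @ a" for z xs a
    by (induction xs arbitrary: a) auto
  have b: "sz (f z x) \<le> (1 + sz z + sz (g z) + 2) ^ d" if "x \<in> set (g z)" for z x
  proof -
    have "sz (f z x) \<le> (1 + sz z + sz x + 2) ^ d" using d[of "(z, x)"] by simp
    also have "\<dots> \<le> (1 + sz z + sz (g z) + 2) ^ d"
      using sz_elem[OF that] by (intro power_mono) auto
    finally show ?thesis .
  qed
  have "PT (\<lambda>z. fold (\<lambda>x a. f z x # a) (g z) [])"
  proof (rule PT_fold[where q=q])
    show "psz q" unfolding q_def by (intro psz_intros PT_size[OF g] psz_sz)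
    show "sz (fold (\<lambda>x a. f z x # a) (take k (g z)) []) \<le> q z" for z k
      unfolding q_def e
      by (rule sz_list_le) (use b length_le_sz[of "g z"] in \<open>auto dest: in_set_takeD\<close>)
  qed (intro pt PT_comp2[OF f] g)+
  then have "PT (\<lambda>z. rev (fold (\<lambda>x a. f z x # a) (g z) []))" by (rule PT_rev)
  then show ?thesis by (simp add: e)
qed

lemma PT_filter [pt]:
  fixes P :: "'z::enc \<Rightarrow> 'x::enc \<Rightarrow> bool"
  assumes P: "PT (\<lambda>p. P (fst p) (snd p))" and g: "PT g"
  shows "PT (\<lambda>z. filter (P z) (g z))"
proof -
  have e: "fold (\<lambda>x a. if P z x then x # a else a) xs a = rev (filter (P z) xs) @ a" for z xs a
    by (induction xs arbitrary: a) auto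
  have sf: "sz (filter Q l) \<le> sz l" for Q and l :: "'x list"
    by (induction l) auto
  have "PT (\<lambda>z. fold (\<lambda>x a. if P z x then x # a else a) (g z) [])"
  proof (rule PT_fold[where q="\<lambda>z. sz (g z)"])
    show "psz (\<lambda>z. sz (g z))" by (rule PT_size[OF g])
    show "sz (fold (\<lambda>x a. if P z x then x # a else a) (take k (g z)) []) \<le> sz (g z)" for z k
      using le_trans[OF sf[of "P z" "take k (g z)"] sz_drop_take(2)] by (simp add: e sz_rev)
  qed (intro pt PT_comp2[OF P] g)+
  then have "PT (\<lambda>z. rev (fold (\<lambda>x a. if P z x then x # a else a) (g z) []))" by (rule PT_rev)
  then show ?thesis by (simp add: e)
qed

lemma PT_concat [pt]: assumes g: "PT g" shows "PT (\<lambda>z. concat (g z))"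
proof -
  have e: "fold (\<lambda>x a. a @ x) xs a = a @ concat xs" for xs :: "'b list list" and a
    by (induction xs arbitrary: a) auto
  have s: "sz (concat xs) \<le> sz xs" for xs :: "'b list list"
  proof (induction xs)
    case (Cons x xs)
    then show ?case using sz_append[of x "concat xs"] by simp
  qed simp
  have "PT (\<lambda>z. fold (\<lambda>x a. a @ x) (g z) [])"
  proof (rule PT_fold[where q="\<lambda>z. sz (g z)"])
    show "psz (\<lambda>z. sz (g z))" by (rule PT_size[OF g])
    show "sz (fold (\<lambda>x a. a @ x) (take k (g z)) []) \<le> sz (g z)" for z k
      using le_trans[OF s[of "take k (g z)"] sz_drop_take(2)] by (simp add: e)
  qed (intro pt g)+
  then show ?thesis by (simp add: e)
qed

lemma PT_product [pt]: "PT f \<Longrightarrow> PT g \<Longrightarrow> PT (\<lambda>z. List.product (f z) (g z))"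
  unfolding product_concat_map by (intro pt PT_compose[of g fst])

text \<open>Taking \<open>tl\<close> as often as the second list has elements empties the first one
  exactly if it is not longer; so lengths are compared without arithmetic.\<close>

lemma PT_len_le [pt]:
  fixes f :: "'z::enc \<Rightarrow> 'x::enc list" and g :: "'z \<Rightarrow> 'y::enc list"
  assumes f: "PT f" and g: "PT g" shows "PT (\<lambda>z. length (f z) \<le> length (g z))"
proof -
  have t: "(tl ^^ n) xs = drop n xs" for n and xs :: "'x list"
    by (induction n) (simp_all add: drop_Suc tl_drop)
  have "PT (\<lambda>z. (tl ^^ length (g z)) (f z))"
    by (rule PT_iter[OF _ f g, where q="\<lambda>z. sz (f z)"]) (simp_all add: t sz_drop_take PT_size[OF f] PT_tl PT_id)
  then have "PT (\<lambda>z. (tl ^^ length (g z)) (f z) = [])" by (rule PT_eq_Nil)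
  then show ?thesis by (simp add: t)
qed

section \<open>Binary arithmetic\<close>

definition bcons :: "bool \<Rightarrow> nat \<Rightarrow> nat" where
  "bcons b n = of_bool b + 2 * n"

definition bval :: "bool list \<Rightarrow> nat" where
  "bval bs = foldr bcons bs 0"

lemma bval_simps [simp]: "bval [] = 0" "bval (b # bs) = of_bool b + 2 * bval bs"
  by (simp_all add: bval_def bcons_def)

lemma nbits_0 [simp]: "nbits 0 = []"
  by (simp add: nbits.simps)

lemma nbits_bcons: "nbits (bcons b n) = (if n = 0 \<and> \<not> b then [] else b # nbits n)"
  by (subst nbits.simps) (auto simp: bcons_def)

lemma bval_nbits [simp]: "bval (nbits n) = n"
  by (induction n rule: nbits.induct) (subst nbits.simps, auto)

lemma nbits_eq_Nil: "nbits n = [] \<longleftrightarrow> n = 0"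
  by (subst nbits.simps) auto

lemma PT_nbits [pt]: "PT f \<Longrightarrow> PT (\<lambda>x. nbits (f x))"
  by (rule PT_compose[of nbits]) (rule PT_coerce[OF PT_id], simp add: tr_nat_def)

lemma PT_bcons [pt]:
  assumes "PT f" "PT g" shows "PT (\<lambda>x. bcons (f x) (g x))"
proof (rule PT_coerce)
  show "PT (\<lambda>x. if nbits (g x) = [] \<and> \<not> f x then [] else f x # nbits (g x))"
    by (intro pt assms)
  show "tr (if nbits (g x) = [] \<and> \<not> f x then [] else f x # nbits (g x)) = tr (bcons (f x) (g x))" for x
    unfolding tr_nat_def nbits_bcons by (simp add: nbits_eq_Nil)
qed

lemma length_nbits_bval: "length (nbits (bval bs)) \<le> length bs"
proof (induction bs)
  case (Cons b bs)
  then show ?case using nbits_bcons[of b "bval bs"] by (simp add: bcons_def)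
qed simp

lemma length_nbits_mono: "m \<le> n \<Longrightarrow> length (nbits m) \<le> length (nbits n)"
proof (induction n arbitrary: m rule: nbits.induct)
  case (1 n)
  show ?case
  proof (cases "m = 0")
    case False
    then show ?thesis using 1 by (subst (1 2) nbits.simps) (auto simp: div_le_mono)
  qed simp
qed

lemma sz_bits: "sz (bs :: bool list) \<le> 1 + length bs * 4"
  using sz_list_le[of bs 3 "length bs"] sz_bool by simp

lemma sz_nat_bits: "sz (n::nat) \<le> 1 + length (nbits n) * 4" "length (nbits n) \<le> sz n"
  unfolding sz_nat using sz_bits length_le_sz by blast+

lemma PT_bval [pt]: assumes g: "PT g" shows "PT (\<lambda>x. bval (g x))"
proof -
  have "PT (\<lambda>x. fold bcons (rev (g x)) 0)"
  proof (rule PT_fold[where q="\<lambda>x. 1 + sz (g x) * 4"])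
    show "psz (\<lambda>x. 1 + sz (g x) * 4)" by (intro psz_intros PT_size[OF g])
    fix x k
    have "fold bcons (take k (rev (g x))) 0 = bval (rev (take k (rev (g x))))"
      by (simp add: bval_def foldr_conv_fold)
    moreover have "length (nbits (bval (rev (take k (rev (g x)))))) \<le> sz (g x)"
      using length_nbits_bval[of "rev (take k (rev (g x)))"] length_le_sz[of "g x"] by simp
    ultimately show "sz (fold bcons (take k (rev (g x))) 0) \<le> 1 + sz (g x) * 4"
      using sz_nat_bits(1)[of "fold bcons (take k (rev (g x))) 0"] by simp
  qed (intro pt g)+
  then show ?thesis by (simp add: bval_def foldr_conv_fold)
qed

fun inc_bits :: "bool \<Rightarrow> bool list \<Rightarrow> bool list" where
  "inc_bits c [] = [c]"
| "inc_bits c (b # bs) = (b \<noteq> c) # inc_bits (b \<and> c) bs"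

fun dec_bits :: "bool \<Rightarrow> bool list \<Rightarrow> bool list" where
  "dec_bits c [] = []"
| "dec_bits c (b # bs) = (b \<noteq> c) # dec_bits (\<not> b \<and> c) bs"

lemma bval_inc: "bval (inc_bits c bs) = bval bs + of_bool c"
  by (induction c bs rule: inc_bits.induct) auto

lemma bval_dec: "bval bs \<noteq> 0 \<or> \<not> c \<Longrightarrow> bval (dec_bits c bs) + of_bool c = bval bs"
proof (induction c bs rule: dec_bits.induct)
  case (2 c b bs)
  then show ?case by (cases b; cases c) auto
qed simp

text \<open>The fold carries the carry and the bits produced so far in reverse order. The last carry
  becomes the top bit; \<open>bval\<close> removes it again if it is zero.\<close>

lemma PT_Suc [pt]: assumes g: "PT g" shows "PT (\<lambda>x. Suc (g x))"
proof -
  define F where "F = (\<lambda>b (s :: bool \<times> bool list). (b \<and> fst s, (b \<noteq> fst s) # snd s))"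
  have e: "rev (fst (fold F bs (c, o')) # snd (fold F bs (c, o'))) = rev o' @ inc_bits c bs" for c bs o'
    by (induction c bs arbitrary: o' rule: inc_bits.induct) (auto simp: F_def)
  have len: "length (snd (fold F bs s)) = length bs + length (snd s)" for bs s
    by (induction bs arbitrary: s) (auto simp: F_def)
  have "PT (\<lambda>x. fold F (nbits (g x)) (True, []))"
  proof (rule PT_fold[where q="\<lambda>x. 5 + sz (g x) * 4"])
    show "psz (\<lambda>x. 5 + sz (g x) * 4)" by (intro psz_intros PT_size[OF g])
    show "PT (\<lambda>p. F (fst (snd p)) (snd (snd p)))" unfolding F_def by (intro pt)
    fix x k
    let ?s = "fold F (take k (nbits (g x))) (True, [])"
    have "length (snd ?s) \<le> sz (g x)" using len[of "take k (nbits (g x))"] sz_nat_bits(2)[of "g x"] by simp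
    then show "sz ?s \<le> 5 + sz (g x) * 4"
      using sz_bits[of "snd ?s"] sz_bool(1)[of "fst ?s"] by (cases ?s) simp
  qed (intro pt g)+
  then have "PT (\<lambda>x. bval (rev (fst (fold F (nbits (g x)) (True, [])) # snd (fold F (nbits (g x)) (True, [])))))"
    by (intro pt)
  then show ?thesis by (simp only: e) (simp add: bval_inc)
qed

lemma PT_pred [pt]: assumes g: "PT g" shows "PT (\<lambda>x. g x - (1::nat))"
proof -
  define F where "F = (\<lambda>b (s :: bool \<times> bool list). (\<not> b \<and> fst s, (b \<noteq> fst s) # snd s))"
  have e: "rev (snd (fold F bs (c, o'))) = rev o' @ dec_bits c bs" for c bs o'
    by (induction c bs arbitrary: o' rule: dec_bits.induct) (auto simp: F_def)
  have len: "length (snd (fold F bs s)) = length bs + length (snd s)" for bs s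
    by (induction bs arbitrary: s) (auto simp: F_def)
  have "PT (\<lambda>x. fold F (nbits (g x)) (True, []))"
  proof (rule PT_fold[where q="\<lambda>x. 5 + sz (g x) * 4"])
    show "psz (\<lambda>x. 5 + sz (g x) * 4)" by (intro psz_intros PT_size[OF g])
    show "PT (\<lambda>p. F (fst (snd p)) (snd (snd p)))" unfolding F_def by (intro pt)
    fix x k
    let ?s = "fold F (take k (nbits (g x))) (True, [])"
    have "length (snd ?s) \<le> sz (g x)" using len[of "take k (nbits (g x))"] sz_nat_bits(2)[of "g x"] by simp
    then show "sz ?s \<le> 5 + sz (g x) * 4"
      using sz_bits[of "snd ?s"] sz_bool(1)[of "fst ?s"] by (cases ?s) simp
  qed (intro pt g)+
  then have "PT (\<lambda>x. bval (rev (snd (fold F (nbits (g x)) (True, [])))))"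
    by (intro pt)
  moreover have "bval (dec_bits True (nbits n)) = n - 1" for n
    using bval_dec[of "nbits n" True] by (cases "n = 0") auto
  ultimately show ?thesis by (simp only: e) simp
qed

lemma PT_eq_nat [pt]: assumes f: "PT f" and g: "PT g" shows "PT (\<lambda>x. (f x :: nat) = g x)"
proof -
  define F where "F = (\<lambda>b (s :: bool \<times> bool list). case snd s of [] \<Rightarrow> (False, [])
     | c # cs \<Rightarrow> (fst s \<and> b = c, cs))"
  have nf: "fst (fold F bs (False, cs)) = False" for bs cs
    by (induction bs arbitrary: cs) (auto simp: F_def split: list.splits)
  have e: "(fst (fold F bs (True, cs)) \<and> snd (fold F bs (True, cs)) = []) \<longleftrightarrow> bs = cs" for bs cs
  proof (induction bs arbitrary: cs)
    case (Cons b bs)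
    show ?case
    proof (cases cs)
      case Nil
      then show ?thesis using nf[of bs "[]"] by (simp add: F_def)
    next
      case (Cons c cs')
      then show ?thesis using Cons.IH[of cs'] nf[of bs cs'] by (cases "b = c") (auto simp: F_def)
    qed
  qed auto
  have len: "length (snd (fold F bs s)) \<le> length (snd s)" for bs s
  proof (induction bs arbitrary: s)
    case (Cons b bs)
    have "length (snd (F b s)) \<le> length (snd s)" by (auto simp: F_def split: list.splits)
    then show ?case using Cons[of "F b s"] by simp
  qed simp
  have "PT (\<lambda>x. fold F (nbits (f x)) (True, nbits (g x)))"
  proof (rule PT_fold[where q="\<lambda>x. 5 + sz (g x) * 4"])
    show "psz (\<lambda>x. 5 + sz (g x) * 4)" by (intro psz_intros PT_size[OF g])
    show "PT (\<lambda>p. F (fst (snd p)) (snd (snd p)))" unfolding F_def by (intro pt)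
    fix x k
    let ?s = "fold F (take k (nbits (f x))) (True, nbits (g x))"
    have "length (snd ?s) \<le> sz (g x)" using len[of "take k (nbits (f x))" "(True, nbits (g x))"] sz_nat_bits(2)[of "g x"] by simp
    then show "sz ?s \<le> 5 + sz (g x) * 4"
      using sz_bits[of "snd ?s"] sz_bool(1)[of "fst ?s"] by (cases ?s) simp
  qed (intro pt f g)+
  then have "PT (\<lambda>x. fst (fold F (nbits (f x)) (True, nbits (g x))) \<and> snd (fold F (nbits (f x)) (True, nbits (g x))) = [])"
    by (intro pt)
  moreover have "nbits a = nbits b \<longleftrightarrow> a = b" for a b by (metis bval_nbits)
  ultimately show ?thesis by (simp only: e)
qed

lemma PT_member [pt]: assumes "PT f" "PT g" shows "PT (\<lambda>x. (f x :: nat) \<in> set (g x))"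
proof -
  have "PT (\<lambda>x. list_ex (\<lambda>y. y = f x) (g x))" by (intro pt assms PT_compose[of f fst])
  moreover have "list_ex (\<lambda>y. y = f x) (g x) \<longleftrightarrow> f x \<in> set (g x)" for x by (auto simp: list_ex_iff)
  ultimately show ?thesis by simp
qed

lemma PT_length [pt]: fixes g :: "'a::enc \<Rightarrow> 'b::enc list" assumes g: "PT g" shows "PT (\<lambda>x. length (g x))"
proof -
  have l: "length (nbits n) \<le> n" for n
  proof (induction n rule: nbits.induct)
    case (1 n)
    then show ?case by (subst nbits.simps) auto
  qed
  have s: "sz n \<le> 1 + n * 4" for n :: nat using sz_nat_bits(1)[of n] l[of n] by linarith
  have e: "(Suc ^^ k) 0 = k" for k by (induction k) auto
  have "PT (\<lambda>x. (Suc ^^ length (g x)) 0)"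
  proof (rule PT_iter[where q="\<lambda>x. 1 + sz (g x) * 4"])
    show "psz (\<lambda>x. 1 + sz (g x) * 4)" by (intro psz_intros PT_size[OF g])
    show "sz ((Suc ^^ k) 0) \<le> 1 + sz (g x) * 4" if "k \<le> length (g x)" for x k
      using s[of k] that length_le_sz[of "g x"] by (simp add: e)
  qed (intro pt g)+
  then show ?thesis by (simp add: e)
qed

lemma PT_minus_length [pt]:
  fixes g :: "'a::enc \<Rightarrow> 'b::enc list"
  assumes f: "PT f" and g: "PT g" shows "PT (\<lambda>x. f x - length (g x))"
proof -
  have e: "((\<lambda>n. n - 1) ^^ k) m = m - k" for k m :: nat by (induction k) auto
  have "PT (\<lambda>x. ((\<lambda>n. n - 1) ^^ length (g x)) (f x))"
  proof (rule PT_iter[where q="\<lambda>x. 1 + sz (f x) * 4"])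
    show "psz (\<lambda>x. 1 + sz (f x) * 4)" by (intro psz_intros PT_size[OF f])
    show "sz (((\<lambda>n. n - 1) ^^ k) (f x)) \<le> 1 + sz (f x) * 4" for x k
      unfolding e using sz_nat_bits(1)[of "f x - k"] sz_nat_bits(2)[of "f x"] length_nbits_mono[of "f x - k" "f x"]
      by linarith
  qed (intro PT_pred PT_id f g)+
  then show ?thesis unfolding e .
qed

section \<open>Reading and writing the tape\<close>

definition tsym :: "nat \<Rightarrow> bool list" where
  "tsym a = (if a = 1 then [] else if a = 2 then [False] else [True])"

lemma enc_sym: "enc (tsym 1) = [1]" "enc (tsym 2) = [2,1,1]" "enc (tsym 3) = [2,2,1,1,1]"
  by (simp_all add: tsym_def enc_def tr_bool_def)

lemma stk_twist [simp]: "(stk w)(Suc 0 := v, 0 := x) = (stk x)(Suc 0 := v)"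
  by (auto simp: stk_def)

definition read_loop :: com where
  "read_loop = Loop 1 0 (Branch 1 1 (Seq (Pop 1) (pushes [2,1]))
     (Branch 1 2 (Seq (Pop 1) (pushes [2,2,1,1])) (Seq (Pop 1) (pushes [2,2,2,1,1,1]))))"

lemma exec_pushes': "s 0 = r \<Longrightarrow> exec (pushes w) s (2 * length w + 1) (s(0 := w @ r))"
proof (induction w)
  case Nil
  then have e: "s(0 := [] @ r) = s" by auto
  show ?case unfolding e pushes.simps by (rule exec_mono[OF exec_Skip]) simp
next
  case (Cons a w)
  have "exec (pushes (a # w)) s (1 + (2 * length w + 1) + 1) (s(0 := a # w @ r))"
    using exec_Seq[OF Cons.IH[OF Cons.prems] exec_Push[of 0 a "s(0 := w @ r)"]] by simp
  then show ?case unfolding append_Cons by (rule exec_mono) simp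
qed

lemma exec_read_loop:
  "set v \<subseteq> {1,2,3} \<Longrightarrow> exec read_loop ((stk (enc l))(1 := v)) (20 * length v + 1) (stk (enc (map tsym (rev v) @ l)))"
proof (induction v arbitrary: l)
  case Nil
  have e: "(stk (enc l))(1 := []) = stk (enc (map tsym (rev []) @ l))" by simp
  show ?case unfolding e read_loop_def
    by (rule exec_mono[OF exec_Loop_end]) (simp_all add: stk_def)
next
  case (Cons a v)
  let ?s = "(stk (enc l))(1 := a # v)" and ?s' = "(stk (enc (tsym a # l)))(1 := v)"
  have pop: "exec (Pop 1) ?s 1 ((stk (enc l))(1 := v))"
    using exec_Pop[of 1 ?s] by simp
  have step: "exec (Seq (Pop 1) (pushes w)) ?s 15 ?s'" if "w = 2 # enc (tsym a)" "length w \<le> 6" for w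
  proof -
    have "exec (pushes w) ((stk (enc l))(1 := v)) (2 * length w + 1) ?s'"
      using exec_pushes'[of "(stk (enc l))(1 := v)" "enc l" w] that by (simp add: enc_list)
    from exec_Seq[OF pop this] show ?thesis by (rule exec_mono) (use that(2) in simp)
  qed
  have a: "a = 1 \<or> a = 2 \<or> a = 3" using Cons.prems by simp
  have pk: "peek (?s 1) = a" by simp
  have "exec (Branch 1 1 (Seq (Pop 1) (pushes [2,1]))
     (Branch 1 2 (Seq (Pop 1) (pushes [2,2,1,1])) (Seq (Pop 1) (pushes [2,2,2,1,1,1])))) ?s (1 + (1 + 15)) ?s'"
  proof (cases "a = 1")
    case True
    have "exec (Seq (Pop 1) (pushes [2,1])) ?s 15 ?s'" by (rule step) (simp_all only: True enc_sym, simp)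
    then show ?thesis using True by (intro exec_Branch) (simp add: exec_mono)
  next
    case False
    have "exec (Branch 1 2 (Seq (Pop 1) (pushes [2,2,1,1])) (Seq (Pop 1) (pushes [2,2,2,1,1,1]))) ?s (1 + 15) ?s'"
    proof (cases "a = 2")
      case True
      have "exec (Seq (Pop 1) (pushes [2,2,1,1])) ?s 15 ?s'" by (rule step) (simp_all only: True enc_sym, simp)
      then show ?thesis using True by (intro exec_Branch) simp
    next
      case F: False
      then have a3: "a = 3" using a False by simp
      have "exec (Seq (Pop 1) (pushes [2,2,2,1,1,1])) ?s 15 ?s'" by (rule step) (simp_all only: a3 enc_sym, simp)
      then show ?thesis using a3 by (intro exec_Branch) simp
    qed
    then show ?thesis using False by (intro exec_Branch) simp
  qed
  moreover have "exec read_loop ?s' (20 * length v + 1) (stk (enc (map tsym (rev v) @ (tsym a # l))))"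
    by (rule Cons.IH) (use Cons.prems in simp)
  ultimately have "exec read_loop ?s (1 + (1 + (1 + 15)) + (20 * length v + 1)) (stk (enc (map tsym (rev v) @ (tsym a # l))))"
    unfolding read_loop_def by (intro exec_Loop_step) (use a pk in auto)
  moreover have "map tsym (rev v) @ (tsym a # l) = map tsym (rev (a # v)) @ l" by simp
  ultimately show ?case by (simp only:) (erule exec_mono, simp)
qed

definition read_input :: com where
  "read_input = Seq (move 0 1) (Seq (Push 0 1) read_loop)"

lemma exec_read_input:
  assumes "set w \<subseteq> {1,2,3}"
  shows "exec read_input (stk w) (26 * length w + 5) (stk (enc (map tsym w)))"
proof -
  have 1: "exec (move 0 1) (stk w) (6 * length w + 1) ((stk [])(1 := rev w))"
    using exec_move[of 0 1 "stk w" w] assms by simp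
  have 2: "exec (Push 0 1) ((stk [])(1 := rev w)) 1 ((stk (enc ([] :: bool list list)))(1 := rev w))"
    using exec_Push[of 0 1 "(stk [])(1 := rev w)"] by (simp add: enc_list)
  have 3: "exec read_loop ((stk (enc ([] :: bool list list)))(1 := rev w)) (20 * length w + 1) (stk (enc (map tsym w)))"
    using exec_read_loop[of "rev w" "[]"] assms by simp
  show ?thesis using exec_Seq[OF 1 exec_Seq[OF 2 3]] unfolding read_input_def
    by (rule exec_mono) simp
qed

definition pop0s :: "nat \<Rightarrow> com" where
  "pop0s n = ((Seq (Pop 0)) ^^ n) Skip"

lemma exec_pop0s: "exec (pop0s n) s (2 * n + 1) (s(0 := drop n (s 0)))"
proof (induction n arbitrary: s)
  case 0
  show ?case unfolding pop0s_def using exec_Skip[of s] by simp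
next
  case (Suc n)
  have "exec (pop0s n) (s(0 := tl (s 0))) (2 * n + 1) (s(0 := drop n (tl (s 0))))"
    using Suc.IH[of "s(0 := tl (s 0))"] by (simp only: fun_upd_upd fun_upd_same)
  from exec_Seq[OF exec_Pop this]
  have "exec (pop0s (Suc n)) s (1 + 1 + (2 * n + 1)) (s(0 := drop n (tl (s 0))))"
    by (simp only: pop0s_def funpow.simps o_apply)
  then show ?case unfolding drop_Suc by (rule exec_mono) simp
qed

text \<open>The codes of the three symbols are \<open>[1]\<close>, \<open>[2,1,1]\<close> and
  \<open>[2,2,1,1,1]\<close>. The numbers 1, 2 and 4 are the lengths of what is left when the symbol
  has been recognised.\<close>

definition write_body :: com where
  "write_body = Seq (Pop 0) (Branch 0 1 (Seq (pop0s 1) (Push 1 1))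
     (Seq (Pop 0) (Branch 0 1 (Seq (pop0s 2) (Push 1 2)) (Seq (pop0s 4) (Push 1 3)))))"

lemma exec_write_body:
  assumes "a \<in> {1,2,3}"
  shows "exec write_body ((stk (2 # enc (tsym a) @ r))(1 := v)) 20 ((stk r)(1 := a # v))"
proof -
  let ?s = "\<lambda>w. (stk w)(1 := v)"
  have pop: "exec (Pop 0) (?s (x # w)) 1 (?s w)" for x w
    using exec_Pop[of 0 "?s (x # w)"] by simp
  have fin: "exec (Seq (pop0s n) (Push 1 a)) (?s w) 11 ((stk r)(1 := a # v))" if "drop n w = r" "n \<le> 4" for n w
  proof -
    have "exec (pop0s n) (?s w) (2 * n + 1) (?s r)"
      using exec_pop0s[of n "?s w"] that by simp
    moreover have "exec (Push 1 a) (?s r) 1 ((stk r)(1 := a # v))" using exec_Push[of 1 a "?s r"] by simp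
    ultimately have "exec (Seq (pop0s n) (Push 1 a)) (?s w) (1 + (2 * n + 1) + 1) ((stk r)(1 := a # v))"
      by (rule exec_Seq)
    then show ?thesis by (rule exec_mono) (use that(2) in simp)
  qed
  have pk: "peek (?s w 0) = peek w" for w by simp
  let ?B = "Branch 0 1 (Seq (pop0s 2) (Push 1 2)) (Seq (pop0s 4) (Push 1 3))"
  have "exec (Branch 0 1 (Seq (pop0s 1) (Push 1 1)) (Seq (Pop 0) ?B)) (?s (enc (tsym a) @ r)) (1 + (1 + 1 + (1 + 11))) ((stk r)(1 := a # v))"
  proof (cases "a = 1")
    case True
    have e: "enc (tsym a) @ r = 1 # r" by (simp only: True enc_sym) simp
    have "exec (Seq (pop0s 1) (Push 1 a)) (?s (1 # r)) 11 ((stk r)(1 := a # v))" by (rule fin) simp_all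
    then show ?thesis unfolding e by (intro exec_Branch) (simp add: True exec_mono)
  next
    case False
    then consider "a = 2" | "a = 3" using assms by auto
    then obtain w where e: "enc (tsym a) @ r = 2 # w" and w: "w = 1 # 1 # r \<and> a = 2 \<or> w = 2 # 1 # 1 # 1 # r \<and> a = 3"
    proof cases
      case 1
      have "enc (tsym a) @ r = 2 # 1 # 1 # r" by (simp only: 1 enc_sym) simp
      then show ?thesis using that 1 by blast
    next
      case 2
      have "enc (tsym a) @ r = 2 # 2 # 1 # 1 # 1 # r" by (simp only: 2 enc_sym) simp
      then show ?thesis using that 2 by blast
    qed
    have "exec ?B (?s w) (1 + 11) ((stk r)(1 := a # v))"
    proof (rule exec_Branch)
      show "exec (if peek (?s w 0) = 1 then Seq (pop0s 2) (Push 1 2) else Seq (pop0s 4) (Push 1 3)) (?s w) 11 ((stk r)(1 := a # v))"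
        using w fin[of 2 w] fin[of 4 w] unfolding pk by (elim disjE conjE) (simp_all only: peek_simps, simp_all)
    qed
    from exec_Seq[OF pop this] have "exec (Seq (Pop 0) ?B) (?s (2 # w)) (1 + 1 + (1 + 11)) ((stk r)(1 := a # v))" .
    then show ?thesis unfolding e by (intro exec_Branch) simp
  qed
  from exec_Seq[OF pop this] show ?thesis unfolding write_body_def
    by (rule exec_mono) simp
qed

definition write_loop :: com where
  "write_loop = Loop 0 1 write_body"

lemma exec_write_loop:
  "set w \<subseteq> {1,2,3} \<Longrightarrow> exec write_loop ((stk (enc (map tsym w)))(1 := v)) (30 * length w + 1) ((stk [1])(1 := rev w @ v))"
proof (induction w arbitrary: v)
  case Nil
  have e: "(stk (enc (map tsym [])))(1 := v) = (stk [1])(1 := rev [] @ v)" by (simp add: enc_list)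
  show ?case unfolding e write_loop_def by (rule exec_mono[OF exec_Loop_end]) simp_all
next
  case (Cons a w)
  let ?s = "(stk (enc (map tsym (a # w))))(1 := v)"
  have "enc (map tsym (a # w)) = 2 # enc (tsym a) @ enc (map tsym w)" by (simp add: enc_list)
  then have 1: "exec write_body ?s 20 ((stk (enc (map tsym w)))(1 := a # v))"
    using exec_write_body[of a "enc (map tsym w)" v] Cons.prems by simp
  have 2: "exec write_loop ((stk (enc (map tsym w)))(1 := a # v)) (30 * length w + 1) ((stk [1])(1 := rev w @ a # v))"
    by (rule Cons.IH) (use Cons.prems in simp)
  have pk: "peek (?s 0) \<noteq> 1" by (simp add: enc_list)
  have "exec write_loop ?s (1 + 20 + (30 * length w + 1)) ((stk [1])(1 := rev w @ a # v))"
    unfolding write_loop_def by (rule exec_Loop_step[OF pk 1 2[unfolded write_loop_def]])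
  moreover have "rev w @ a # v = rev (a # w) @ v" by simp
  ultimately show ?case by (simp only:) (erule exec_mono, simp)
qed

definition write_output :: com where
  "write_output = Seq write_loop (Seq (Pop 0) (move 1 0))"

lemma exec_write_output:
  assumes "set w \<subseteq> {1,2,3}"
  shows "exec write_output (stk (enc (map tsym w))) (36 * length w + 5) (stk w)"
proof -
  have 1: "exec write_loop (stk (enc (map tsym w))) (30 * length w + 1) ((stk [1])(1 := rev w))"
    using exec_write_loop[OF assms, of "[]"] by simp
  have 2: "exec (Pop 0) ((stk [1])(1 := rev w)) 1 ((stk [])(1 := rev w))"
    using exec_Pop[of 0 "(stk [1])(1 := rev w)"] by simp
  have 3: "exec (move 1 0) ((stk [])(1 := rev w)) (6 * length w + 1) (stk w)"
    using exec_move[of 1 0 "(stk [])(1 := rev w)" "rev w"] assms by simp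
  show ?thesis using exec_Seq[OF 1 exec_Seq[OF 2 3]] unfolding write_output_def
    by (rule exec_mono) simp
qed

lemma wf_io: "wf_com read_input" "wf_com write_output"
  by (simp_all add: read_input_def write_output_def move_def read_loop_def write_loop_def write_body_def
    pop0s_def numeral_2_eq_2 numeral_eq_Suc)

lemma length_le_sz_tsym: "length w \<le> sz (map tsym w)" "sz (map tsym w) \<le> 6 * length w + 1"
proof -
  show "length w \<le> sz (map tsym w)" using length_le_sz[of "map tsym w"] by simp
  have "sz (tsym a) \<le> 5" for a using sz_bool(1)[of "True"] sz_bool(1)[of False] by (auto simp: tsym_def sz_def enc_def tr_bool_def)
  then show "sz (map tsym w) \<le> 6 * length w + 1" using sz_list_le[of "map tsym w" 5 "length w"] by force
qed

theorem PT_machine: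
  assumes "PT (F :: bool list list \<Rightarrow> bool list list)"
  shows "\<exists>Q S delta c d. tm_ok Q S delta \<and> (\<forall>w out. set w \<subseteq> {1,2,3} \<and> set out \<subseteq> {1,2,3} \<and> F (map tsym w) = map tsym out
    \<longrightarrow> (\<exists>t \<le> c * (length w + 1) ^ d. halts_with delta w t out))"
proof -
  obtain p T where p: "wf_com p" "psz T" "\<And>x r. exec p (stk (enc x @ r)) (T x) (stk (enc (F x) @ r))"
    using assms unfolding PT_def by blast
  define c0 where "c0 = Seq read_input (Seq p write_output)"
  have wf: "wf_com c0" using p(1) wf_io by (simp add: c0_def)
  obtain e where e: "\<And>x. T x \<le> (sz x + 2) ^ e" using p(2) unfolding psz_def by blast
  obtain f where f: "\<And>x. sz (F x) \<le> (sz x + 2) ^ f" using PT_size[OF assms] unfolding psz_def by blast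
  \<comment> \<open>The code of a word of length \<open>n\<close> has at most
    \<open>6 * n + 1\<close> symbols. \<open>G\<close> adds up reading, computing and writing;
    \<open>H\<close> adds the quadratic cost of the simulation.\<close>
  define G where "G n = 1 + (26 * n + 5) + (1 + (6 * n + 1 + 2) ^ e + (36 * (6 * n + 1 + 2) ^ f + 5))" for n :: nat
  define H where "H n = 2 + G n * (2 * (n + G n) + 4)" for n
  have "polyb H" unfolding H_def G_def
    by (intro polyb_add polyb_mult polyb_power polyb_const polyb_id)
  then obtain d where d: "\<And>n. H n \<le> (n + 2) ^ d" unfolding polyb_def by blast
  have "\<exists>t \<le> 2 ^ d * (length w + 1) ^ d. halts_with (compile c0) w t out"
    if w: "set w \<subseteq> {1,2,3}" and out: "set out \<subseteq> {1,2,3}" and F: "F (map tsym w) = map tsym out" for w out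
  proof -
    let ?n = "length w"
    have pw: "(sz (map tsym w) + 2) ^ k \<le> (6 * ?n + 1 + 2) ^ k" for k
      using length_le_sz_tsym(2)[of w] by (intro power_mono) auto
    have 1: "exec p (stk (enc (map tsym w))) ((6 * ?n + 1 + 2) ^ e) (stk (enc (map tsym out)))"
      using exec_mono[OF p(3)[of "map tsym w" "[]"] le_trans[OF e pw]] F by simp
    have "length out \<le> (6 * ?n + 1 + 2) ^ f"
      using length_le_sz_tsym(1)[of out] f[of "map tsym w"] pw[of f] F by simp
    then have 2: "exec write_output (stk (enc (map tsym out))) (36 * (6 * ?n + 1 + 2) ^ f + 5) (stk out)"
      using exec_mono[OF exec_write_output[OF out]] by simp
    have "exec c0 (stk w) (G ?n) (stk out)"
      unfolding c0_def G_def by (rule exec_Seq[OF exec_read_input[OF w] exec_Seq[OF 1 2]])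
    then obtain t where t: "t \<le> G ?n" "runs c0 (stk w) t (stk out)" unfolding exec_def by blast
    obtain t' where t': "t' \<le> 2 + t * (2 * (?n + t) + 4)" "halts_with (compile c0) w t' out"
      using compile_halts[OF w wf t(2)] by blast
    have "t * (2 * (?n + t) + 4) \<le> G ?n * (2 * (?n + G ?n) + 4)"
      using t(1) by (intro mult_mono) auto
    then have "t' \<le> H ?n" using t'(1) unfolding H_def by linarith
    also have "\<dots> \<le> (?n + 2) ^ d" by (rule d)
    also have "\<dots> \<le> (2 * (?n + 1)) ^ d" by (intro power_mono) auto
    also have "\<dots> = 2 ^ d * (?n + 1) ^ d" by (rule power_mult_distrib)
    finally show ?thesis using t'(2) by blast
  qed
  then show ?thesis using tm_ok_compile[of c0] by blast
qed

section \<open>Independence numbers of sparse graphs\<close>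

definition indep :: "('a \<Rightarrow> 'a \<Rightarrow> bool) \<Rightarrow> 'a set \<Rightarrow> bool" where
  "indep R S \<longleftrightarrow> (\<forall>u\<in>S. \<forall>v\<in>S. \<not> R u v)"

definition alp :: "('a \<Rightarrow> 'a \<Rightarrow> bool) \<Rightarrow> 'a set \<Rightarrow> nat" where
  "alp R W = Max (card ` {S. S \<subseteq> W \<and> indep R S})"

lemma indep_mono: "indep R S \<Longrightarrow> T \<subseteq> S \<Longrightarrow> indep R T"
  unfolding indep_def by blast

lemma alp_ge: "finite W \<Longrightarrow> S \<subseteq> W \<Longrightarrow> indep R S \<Longrightarrow> card S \<le> alp R W"
  unfolding alp_def by (rule Max_ge) auto

lemma alp_obtain:
  assumes "finite W"
  obtains S where "S \<subseteq> W" "indep R S" "card S = alp R W"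
proof -
  have "alp R W \<in> card ` {S. S \<subseteq> W \<and> indep R S}"
    unfolding alp_def using assms by (intro Max_in) (auto simp: indep_def)
  then show ?thesis using that by auto
qed

lemma alp_le:
  assumes "finite W" "\<And>S. S \<subseteq> W \<Longrightarrow> indep R S \<Longrightarrow> card S \<le> k"
  shows "alp R W \<le> k"
  using assms alp_obtain[OF assms(1), of R] by metis

lemma alp_mono: "finite W \<Longrightarrow> U \<subseteq> W \<Longrightarrow> alp R U \<le> alp R W"
  by (rule alp_le) (auto intro: alp_ge finite_subset)

lemma alp_anti: "finite W \<Longrightarrow> (\<And>u v. u \<in> W \<Longrightarrow> v \<in> W \<Longrightarrow> R u v \<Longrightarrow> R' u v) \<Longrightarrow> alp R' W \<le> alp R W"
  by (rule alp_le, assumption, rule alp_ge) (auto simp: indep_def, blast)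

lemma alp_cong: "finite W \<Longrightarrow> (\<And>u v. u \<in> W \<Longrightarrow> v \<in> W \<Longrightarrow> R u v = R' u v) \<Longrightarrow> alp R W = alp R' W"
  by (intro antisym alp_anti) auto

lemma alp_empty [simp]: "alp R {} = 0"
  by (rule antisym[OF alp_le]) auto

lemma alp_union_le: "finite A \<Longrightarrow> finite B \<Longrightarrow> alp R (A \<union> B) \<le> alp R A + alp R B"
proof (rule alp_le)
  fix S assume f: "finite A" "finite B" and S: "S \<subseteq> A \<union> B" "indep R S"
  have "card S \<le> card (S \<inter> A) + card (S \<inter> B)"
    using S(1) card_Un_le[of "S \<inter> A" "S \<inter> B"] by (metis Int_Un_distrib inf.absorb1)
  moreover have "card (S \<inter> A) \<le> alp R A" "card (S \<inter> B) \<le> alp R B"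
    using f S(2) by (auto intro!: alp_ge intro: indep_mono)
  ultimately show "card S \<le> alp R A + alp R B" by linarith
qed auto

lemma alp_union_separate:
  assumes "finite A" "finite B" "A \<inter> B = {}" "\<And>a b. a \<in> A \<Longrightarrow> b \<in> B \<Longrightarrow> \<not> R a b \<and> \<not> R b a"
  shows "alp R (A \<union> B) = alp R A + alp R B"
proof (rule antisym[OF alp_union_le[OF assms(1,2)]])
  obtain S where S: "S \<subseteq> A" "indep R S" "card S = alp R A" by (rule alp_obtain[OF assms(1)])
  obtain T where T: "T \<subseteq> B" "indep R T" "card T = alp R B" by (rule alp_obtain[OF assms(2)])
  have "indep R (S \<union> T)" using S T assms(4) unfolding indep_def by blast
  moreover have "card (S \<union> T) = card S + card T"
    using S T assms by (intro card_Un_disjoint) (auto intro: finite_subset)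
  ultimately show "alp R A + alp R B \<le> alp R (A \<union> B)"
    using alp_ge[of "A \<union> B" "S \<union> T" R] S T assms(1,2) by auto
qed

lemma alp_insert_ge:
  assumes "finite W" "symp R" "v \<in> W" "\<not> R v v"
  shows "Suc (alp R (W - insert v {u. R v u})) \<le> alp R W"
proof -
  obtain S where S: "S \<subseteq> W - insert v {u. R v u}" "indep R S" "card S = alp R (W - insert v {u. R v u})"
    by (rule alp_obtain[of "W - insert v {u. R v u}"]) (use assms in auto)
  have "indep R (insert v S)" using S assms(2,4) unfolding indep_def by (auto dest: sympD)
  moreover have "card (insert v S) = Suc (card S)"
    using S assms(1) by (intro card_insert_disjoint) (auto intro: finite_subset)
  ultimately show ?thesis using alp_ge[of W "insert v S" R] S assms by auto
qed

text \<open>If a maximum independent set meets the closed neighbourhood of \<open>v\<close> in at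
  most one vertex, that vertex can be traded for \<open>v\<close>. The second alternative leaves
  room for sets that need another argument.\<close>

lemma alp_exchange:
  assumes "finite W" "v \<in> W"
    and "\<And>S. S \<subseteq> W \<Longrightarrow> indep R S \<Longrightarrow> card S = alp R W \<Longrightarrow> card (S \<inter> insert v {u. R v u}) \<le> 1 \<or> alp R W \<le> Suc (alp R (W - insert v {u. R v u}))"
  shows "alp R W \<le> Suc (alp R (W - insert v {u. R v u}))"
proof -
  obtain S where S: "S \<subseteq> W" "indep R S" "card S = alp R W" by (rule alp_obtain[OF assms(1)])
  consider "card (S \<inter> insert v {u. R v u}) \<le> 1" | "alp R W \<le> Suc (alp R (W - insert v {u. R v u}))"
    using assms(3)[OF S] by blast
  then show ?thesis
  proof cases
    case 1
    have "card S \<le> card (S \<inter> insert v {u. R v u}) + card (S - insert v {u. R v u})"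
      using card_Un_le[of "S \<inter> insert v {u. R v u}" "S - insert v {u. R v u}"] by (simp add: Int_Diff_Un)
    moreover have "card (S - insert v {u. R v u}) \<le> alp R (W - insert v {u. R v u})"
      using S assms(1) by (intro alp_ge) (auto intro: indep_mono)
    ultimately show ?thesis using 1 S(3) by linarith
  qed
qed

section \<open>Vertices that belong to a maximum independent set\<close>

definition deg :: "('a \<Rightarrow> 'a \<Rightarrow> bool) \<Rightarrow> 'a set \<Rightarrow> 'a \<Rightarrow> nat" where
  "deg R U u = card {v \<in> U. R u v}"

definition e2 :: "('a \<Rightarrow> 'a \<Rightarrow> bool) \<Rightarrow> 'a set \<Rightarrow> nat" where
  "e2 R U = (\<Sum>u\<in>U. deg R U u)"

text \<open>An independent set without \<open>v\<close> contains at most the one neighbour of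
  \<open>v\<close> from the closed neighbourhood, so the exchange applies to every maximum
  independent set.\<close>

lemma alp_low_degree:
  assumes "finite W" "symp R" "v \<in> W" "\<not> R v v" "deg R W v \<le> 1"
  shows "alp R W = Suc (alp R (W - insert v {u. R v u}))"
proof (rule antisym[OF alp_exchange alp_insert_ge])
  fix S assume S: "S \<subseteq> W" "indep R S" "card S = alp R W"
  have "card (S \<inter> insert v {u. R v u}) \<le> 1"
  proof (cases "v \<in> S")
    case True
    then have "S \<inter> insert v {u. R v u} \<subseteq> {v}" using S unfolding indep_def by auto
    then show ?thesis using card_mono[of "{v}"] by fastforce
  next
    case False
    then have "S \<inter> insert v {u. R v u} \<subseteq> {u \<in> W. R v u}" using S by auto
    then have "card (S \<inter> insert v {u. R v u}) \<le> deg R W v" unfolding deg_def using assms(1) by (intro card_mono) auto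
    then show ?thesis using assms(5) by linarith
  qed
  then show "card (S \<inter> insert v {u. R v u}) \<le> 1 \<or> alp R W \<le> Suc (alp R (W - insert v {u. R v u}))" ..
qed (use assms in auto)

text \<open>The degrees force a path from \<open>a\<close> to \<open>b\<close> and disjoint cycles.
  Taking \<open>a\<close> and deleting its neighbour \<open>a2\<close> leaves a graph of the same
  kind with end \<open>a3\<close>, while on the other side \<open>a2\<close> is taken and
  \<open>a3\<close> deleted; both sides drop by one.\<close>

lemma alp_path_ends:
  assumes "finite W" "symp R" "\<And>v. v \<in> W \<Longrightarrow> \<not> R v v" "a \<in> W" "b \<in> W" "a \<noteq> b"
    and "deg R W a = 1" "deg R W b = 1" "\<And>v. v \<in> W \<Longrightarrow> v \<noteq> a \<Longrightarrow> v \<noteq> b \<Longrightarrow> deg R W v = 2"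
  shows "alp R W \<le> Suc (alp R (W - {a, b}))"
  using assms
proof (induction "card W" arbitrary: W a rule: less_induct)
  case less
  have sy: "R x y \<longleftrightarrow> R y x" for x y using less.prems(2) by (auto dest: sympD)
  obtain a2 where a2: "{v \<in> W. R a v} = {a2}"
    using less.prems(7) unfolding deg_def by (auto simp: card_1_singleton_iff)
  have a2W: "a2 \<in> W" "R a a2" and a2a: "a2 \<noteq> a" using a2 less.prems(3,4) by auto
  have Wa: "W - insert a {u. R a u} = W - {a, a2}" using a2 by auto
  have al: "alp R W = Suc (alp R (W - {a, a2}))"
    using alp_low_degree[of W R a] less.prems Wa by simp
  show ?case
  proof (cases "a2 = b")
    case True
    then show ?thesis using al by simp
  next
    case False
    have "card {v \<in> W. R a2 v} = 2" using less.prems(9)[OF a2W(1) a2a False] by (simp add: deg_def)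
    then obtain x y where xy: "{v \<in> W. R a2 v} = {x, y}" "x \<noteq> y" by (auto simp: card_2_iff)
    have "a \<in> {v \<in> W. R a2 v}" using a2W less.prems(4) sy by auto
    then obtain a3 where a3: "{v \<in> W. R a2 v} = {a, a3}" "a3 \<noteq> a" using xy by auto
    have a3W: "a3 \<in> W" "R a2 a3" using a3 by auto
    have a32: "a3 \<noteq> a2" using a3W less.prems(3) a2W by auto
    have ins: "Suc (alp R (W - {a, b} - insert a2 {u. R a2 u})) \<le> alp R (W - {a, b})"
      using less.prems a2W a2a False by (intro alp_insert_ge) auto
    let ?W = "W - {a, a2}"
    show ?thesis
    proof (cases "a3 = b")
      \<comment> \<open>A path with three vertices: without \<open>a\<close> and \<open>a2\<close>
        the other end is isolated.\<close>
      case True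
      obtain x where x: "{v \<in> W. R b v} = {x}"
        using less.prems(8) unfolding deg_def by (auto simp: card_1_singleton_iff)
      moreover have "a2 \<in> {v \<in> W. R b v}" using a3W True sy a2W by auto
      ultimately have bnb: "{v \<in> W. R b v} = {a2}" by auto
      then have "{v \<in> ?W. R b v} = {}" by auto
      then have "deg R ?W b = 0" by (simp only: deg_def card.empty)
      then have "alp R ?W = Suc (alp R (?W - insert b {u. R b u}))"
        using less.prems False by (intro alp_low_degree) auto
      moreover have "?W - insert b {u. R b u} = W - {a, b} - insert a2 {u. R a2 u}"
        using bnb a3 True by auto
      ultimately show ?thesis using al ins by simp
    next
      case False3: False
      have nb: "{v \<in> ?W. R w v} = {v \<in> W. R w v} - {a, a2}" for w by auto
      have nab: "\<not> R a w" if "w \<in> W" "w \<noteq> a2" for w using a2 that by auto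
      have na2: "\<not> R a2 w" if "w \<in> W" "w \<noteq> a" "w \<noteq> a3" for w using a3 that by auto
      have same: "deg R ?W w = deg R W w" if "w \<in> W" "w \<noteq> a" "w \<noteq> a2" "w \<noteq> a3" for w
      proof -
        have "{v \<in> W. R w v} - {a, a2} = {v \<in> W. R w v}"
          using nab[of w] na2[of w] that sy by blast
        then show ?thesis unfolding deg_def nb by simp
      qed
      have "deg R W a3 = 2" using less.prems(9)[OF a3W(1) a3(2) False3] .
      moreover have "{v \<in> W. R a3 v} - {a, a2} = {v \<in> W. R a3 v} - {a2}"
        using nab[OF a3W(1) a32] sy by blast
      moreover have "a2 \<in> {v \<in> W. R a3 v}" using a2W a3W sy by auto
      ultimately have d3: "deg R ?W a3 = 1" unfolding deg_def nb using less.prems(1) by simp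
      have "alp R ?W \<le> Suc (alp R (?W - {a3, b}))"
      proof (rule less.hyps)
        show "card ?W < card W" using less.prems(1,4) by (intro psubset_card_mono) auto
        show "deg R ?W v = 2" if "v \<in> ?W" "v \<noteq> a3" "v \<noteq> b" for v
          using that same[of v] less.prems(9)[of v] by auto
        show "deg R ?W b = 1" using same[of b] less.prems False False3 by simp
      qed (use less.prems a3W a3 a32 False False3 d3 in auto)
      also have "?W - {a3, b} = W - {a, b} - insert a2 {u. R a2 u}" using a3 by auto
      finally show ?thesis using al ins by simp
    qed
  qed
qed

text \<open>The exchange fails only for a set that contains both neighbours of \<open>v\<close>. It
  lies in \<open>W - {v}\<close>, where the cycle through \<open>v\<close> has become a path with
  these two ends, and \<open>alp_path_ends\<close> saves one of them.\<close>

lemma alp_two_regular: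
  assumes "finite W" "symp R" "\<And>v. v \<in> W \<Longrightarrow> \<not> R v v" "\<And>v. v \<in> W \<Longrightarrow> deg R W v = 2" "v \<in> W"
  shows "alp R W = Suc (alp R (W - insert v {u. R v u}))"
proof (rule antisym[OF alp_exchange alp_insert_ge])
  have sy: "R x y \<longleftrightarrow> R y x" for x y using assms(2) by (auto dest: sympD)
  fix S assume S: "S \<subseteq> W" "indep R S" "card S = alp R W"
  have "card {u \<in> W. R v u} = 2" using assms(4)[OF assms(5)] by (simp add: deg_def)
  then obtain a b where ab: "{u \<in> W. R v u} = {a, b}" "a \<noteq> b" by (auto simp: card_2_iff)
  have abW: "a \<in> W" "b \<in> W" "R v a" "R v b" using ab by auto
  then have abv: "a \<noteq> v" "b \<noteq> v" using assms(3) by auto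
  show "card (S \<inter> insert v {u. R v u}) \<le> 1 \<or> alp R W \<le> Suc (alp R (W - insert v {u. R v u}))"
  proof (cases "v \<notin> S \<and> a \<in> S \<and> b \<in> S")
    case True
    then have nab: "\<not> R a b" using S unfolding indep_def by blast
    let ?W = "W - {v}"
    have nb: "{u \<in> ?W. R w u} = {u \<in> W. R w u} - {v}" for w by auto
    have "alp R ?W \<le> Suc (alp R (?W - {a, b}))"
    proof (rule alp_path_ends)
      have "deg R ?W w = 1" if "w \<in> W" "R v w" for w
        using assms(4)[OF that(1)] that sy assms(1,5) unfolding deg_def nb by simp
      then show "deg R ?W a = 1" "deg R ?W b = 1" using abW by auto
      show "deg R ?W w = 2" if w: "w \<in> ?W" "w \<noteq> a" "w \<noteq> b" for w
      proof -
        have "\<not> R v w" using ab w by auto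
        then have "{u \<in> W. R w u} - {v} = {u \<in> W. R w u}" using sy by blast
        then show ?thesis using assms(4)[of w] w unfolding deg_def nb by simp
      qed
    qed (use assms abW abv ab in auto)
    moreover have "alp R W \<le> alp R ?W" using alp_ge[of ?W S R] S True assms(1) by auto
    moreover have "?W - {a, b} = W - insert v {u. R v u}" using ab by auto
    ultimately show ?thesis by simp
  next
    case False
    have sub: "S \<inter> insert v {u. R v u} \<subseteq> {v, a, b}" using ab S by auto
    have "v \<in> S \<Longrightarrow> a \<notin> S \<and> b \<notin> S" using S abW unfolding indep_def by blast
    with False sub have "S \<inter> insert v {u. R v u} \<subseteq> {v} \<or> S \<inter> insert v {u. R v u} \<subseteq> {a} \<or> S \<inter> insert v {u. R v u} \<subseteq> {b}"
      by blast
    then have "card (S \<inter> insert v {u. R v u}) \<le> 1" by (auto dest!: card_mono[rotated])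
    then show ?thesis ..
  qed
qed (use assms in auto)

text \<open>\<open>e2\<close> counts every edge twice: a pseudoforest spans at most \<open>|U|\<close> edges on every vertex
  set \<open>U\<close>, a forest at most \<open>|U| - 1\<close>.\<close>

definition pseudo :: "('a \<Rightarrow> 'a \<Rightarrow> bool) \<Rightarrow> 'a set \<Rightarrow> bool" where
  "pseudo R W \<longleftrightarrow> (\<forall>v\<in>W. \<not> R v v) \<and> (\<forall>U\<subseteq>W. e2 R U \<le> 2 * card U)"

definition forest :: "('a \<Rightarrow> 'a \<Rightarrow> bool) \<Rightarrow> 'a set \<Rightarrow> bool" where
  "forest R W \<longleftrightarrow> (\<forall>U\<subseteq>W. U \<noteq> {} \<longrightarrow> e2 R U + 2 \<le> 2 * card U)"

lemma pseudo_subset: "pseudo R W \<Longrightarrow> U \<subseteq> W \<Longrightarrow> pseudo R U"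
  unfolding pseudo_def by blast

lemma forest_subset: "forest R W \<Longrightarrow> U \<subseteq> W \<Longrightarrow> forest R U"
  unfolding forest_def by blast

lemma forest_irrefl: "forest R W \<Longrightarrow> v \<in> W \<Longrightarrow> \<not> R v v"
proof
  assume f: "forest R W" "v \<in> W" and "R v v"
  then have "{u \<in> {v}. R v u} = {v}" by auto
  then have "e2 R {v} = 1" by (simp add: e2_def deg_def)
  moreover have "e2 R {v} + 2 \<le> 2 * card {v}" using f unfolding forest_def by blast
  ultimately show False by simp
qed

lemma sum_eq_const:
  fixes f :: "'a \<Rightarrow> nat"
  assumes "finite U" "(\<Sum>u\<in>U. f u) \<le> k * card U" "\<And>u. u \<in> U \<Longrightarrow> k \<le> f u" "u \<in> U"
  shows "f u = k"
proof (rule ccontr)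
  assume "f u \<noteq> k"
  then have "(\<Sum>u\<in>U. k) < (\<Sum>u\<in>U. f u)"
    using assms le_neq_implies_less[of k "f u"] by (intro sum_strict_mono_ex1) auto
  then show False using assms(2) by (simp add: mult.commute)
qed

lemma pseudo_two_regular:
  assumes "finite W" "pseudo R W" "\<And>v. v \<in> W \<Longrightarrow> 2 \<le> deg R W v" "v \<in> W"
  shows "deg R W v = 2"
proof (rule sum_eq_const[where U=W and f="deg R W"])
  show "(\<Sum>u\<in>W. deg R W u) \<le> 2 * card W" using assms(2) unfolding pseudo_def e2_def by auto
qed (use assms in auto)

lemma forest_low_degree:
  assumes "finite W" "forest R W" "W \<noteq> {}"
  obtains v where "v \<in> W" "deg R W v \<le> 1"
proof -
  have "\<exists>v\<in>W. deg R W v \<le> 1"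
  proof (rule ccontr)
    assume "\<not> (\<exists>v\<in>W. deg R W v \<le> 1)"
    then have "(\<Sum>v\<in>W. 2) \<le> (\<Sum>v\<in>W. deg R W v)" by (intro sum_mono) auto
    moreover have "e2 R W + 2 \<le> 2 * card W" using assms unfolding forest_def by blast
    ultimately show False by (simp add: e2_def)
  qed
  then show ?thesis using that by blast
qed

text \<open>In a pseudoforest minimum degree two forces 2-regularity, so the two alternatives cover
  every choice that \<open>greedy\<close> makes.\<close>

lemma alp_pick:
  assumes "finite W" "symp R" "pseudo R W" "v \<in> W"
    and "deg R W v \<le> 1 \<or> (\<forall>u\<in>W. 2 \<le> deg R W u)"
  shows "alp R W = Suc (alp R (W - insert v {u. R v u}))"
  using assms(5)
proof
  assume "deg R W v \<le> 1"
  then show ?thesis using assms unfolding pseudo_def by (intro alp_low_degree) auto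
next
  assume "\<forall>u\<in>W. 2 \<le> deg R W u"
  then show ?thesis using assms pseudo_two_regular[of W R] unfolding pseudo_def
    by (intro alp_two_regular) auto
qed

section \<open>Counting edges by degrees\<close>

lemma deg_sum: "finite U \<Longrightarrow> deg R U u = (\<Sum>v\<in>U. of_bool (R u v))"
  by (simp add: deg_def sum.If_cases Int_def of_bool_def)

lemma deg_union: "finite A \<Longrightarrow> finite B \<Longrightarrow> A \<inter> B = {} \<Longrightarrow> deg R (A \<union> B) u = deg R A u + deg R B u"
  by (simp only: deg_sum finite_Un sum.union_disjoint)

lemma sum_deg_swap:
  assumes "finite A" "finite B" "symp R"
  shows "(\<Sum>a\<in>A. deg R B a) = (\<Sum>b\<in>B. deg R A b)"
proof -
  have sy: "R x y = R y x" for x y using assms(3) by (auto dest: sympD)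
  have "(\<Sum>a\<in>A. deg R B a) = (\<Sum>a\<in>A. \<Sum>b\<in>B. of_bool (R a b))" using assms(2) by (simp only: deg_sum)
  also have "\<dots> = (\<Sum>b\<in>B. \<Sum>a\<in>A. of_bool (R a b))" by (rule sum.swap)
  also have "\<dots> = (\<Sum>b\<in>B. deg R A b)" using assms(1) by (simp only: deg_sum sy)
  finally show ?thesis .
qed

lemma e2_union:
  assumes "finite A" "finite B" "A \<inter> B = {}" "symp R"
  shows "e2 R (A \<union> B) = e2 R A + e2 R B + 2 * (\<Sum>a\<in>A. deg R B a)"
  using sum_deg_swap[OF assms(1,2,4)] assms
  by (simp add: e2_def sum.union_disjoint deg_union sum.distrib)

lemma e2_insert:
  assumes "finite U" "x \<notin> U" "symp R" "\<not> R x x"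
  shows "e2 R (insert x U) = e2 R U + 2 * deg R U x"
proof -
  have "{v. v = x \<and> R x v} = {}" using assms(4) by auto
  then have "e2 R {x} = 0" by (simp add: e2_def deg_def)
  then show ?thesis using e2_union[of "{x}" U R] assms by simp
qed

lemma e2_pairs: "finite U \<Longrightarrow> e2 R U = card {(x, y). x \<in> U \<and> y \<in> U \<and> R x y}"
proof -
  assume "finite U"
  moreover have "{(x, y). x \<in> U \<and> y \<in> U \<and> R x y} = Sigma U (\<lambda>x. {y \<in> U. R x y})" by auto
  ultimately show ?thesis by (simp add: e2_def deg_def)
qed

lemma e2_mono: "finite W \<Longrightarrow> U \<subseteq> W \<Longrightarrow> e2 R U \<le> e2 R W"
  unfolding e2_def deg_def
  by (rule order_trans[OF sum_mono sum_mono2]) (auto intro!: card_mono)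

lemma e2_anti: "finite W \<Longrightarrow> (\<And>u v. u \<in> W \<Longrightarrow> v \<in> W \<Longrightarrow> R' u v \<Longrightarrow> R u v) \<Longrightarrow> e2 R' W \<le> e2 R W"
  unfolding e2_def deg_def by (intro sum_mono card_mono) auto

section \<open>Clique covers and blocking sets\<close>

definition clique_cover :: "('a \<Rightarrow> 'a \<Rightarrow> bool) \<Rightarrow> 'a set set \<Rightarrow> 'a set \<Rightarrow> bool" where
  "clique_cover R K W \<longleftrightarrow> \<Union>K = W \<and> pairwise disjnt K \<and>
     (\<forall>c\<in>K. (\<exists>u. c = {u}) \<or> (\<exists>u v. u \<noteq> v \<and> R u v \<and> c = {u, v}))"

lemma clique_cover_finite: "finite W \<Longrightarrow> clique_cover R K W \<Longrightarrow> finite K"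
  unfolding clique_cover_def by (metis finite_UnionD)

lemma clique_cover_sum:
  fixes f :: "'a \<Rightarrow> 'b::comm_monoid_add"
  assumes "finite W" "clique_cover R K W"
  shows "(\<Sum>w\<in>W. f w) = (\<Sum>c\<in>K. \<Sum>w\<in>c. f w)"
proof -
  have "W = \<Union>K" "\<forall>c\<in>K. finite c" "\<forall>c\<in>K. \<forall>d\<in>K. c \<noteq> d \<longrightarrow> c \<inter> d = {}"
    using assms unfolding clique_cover_def pairwise_def disjnt_def by auto
  then show ?thesis using sum.Union_disjoint[of K f] by simp
qed

lemma clique_cover_card:
  assumes "finite W" "clique_cover R K W" "S \<subseteq> W"
  shows "card S = (\<Sum>c\<in>K. card (S \<inter> c))"
proof -
  have fin: "finite c" if "c \<in> K" for c using assms(2) that unfolding clique_cover_def by auto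
  have "card S = (\<Sum>w\<in>W. of_bool (w \<in> S))"
    using assms(1,3) by (simp add: sum.If_cases of_bool_def Int_absorb1)
  also have "\<dots> = (\<Sum>c\<in>K. \<Sum>w\<in>c. of_bool (w \<in> S))" by (rule clique_cover_sum[OF assms(1,2)])
  also have "\<dots> = (\<Sum>c\<in>K. card (S \<inter> c))"
    using fin by (intro sum.cong refl) (simp add: sum.If_cases of_bool_def Int_commute)
  finally show ?thesis .
qed

lemma clique_cover_hit:
  assumes "symp R" "clique_cover R K W" "indep R S" "c \<in> K"
  shows "card (S \<inter> c) \<le> 1"
proof -
  consider u where "c = {u}" | u v where "c = {u, v}" "R u v" using assms(2,4) unfolding clique_cover_def by blast
  then show ?thesis
  proof cases
    case 1
    then show ?thesis using card_mono[of "{u}" "S \<inter> c"] by auto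
  next
    case 2
    then have "S \<inter> c \<subseteq> {u} \<or> S \<inter> c \<subseteq> {v}" using assms(3) unfolding indep_def by auto
    then show ?thesis using card_mono[of "{u}" "S \<inter> c"] card_mono[of "{v}" "S \<inter> c"] by auto
  qed
qed

lemma clique_cover_insert:
  assumes "clique_cover R K W" "c \<inter> W = {}" "(\<exists>u. c = {u}) \<or> (\<exists>u v. u \<noteq> v \<and> R u v \<and> c = {u, v})"
  shows "clique_cover R (insert c K) (c \<union> W)" "c \<notin> K"
proof -
  have d: "c \<inter> d = {}" if "d \<in> K" for d using assms(1,2) that unfolding clique_cover_def by blast
  have "c \<noteq> {}" using assms(3) by auto
  then show "c \<notin> K" using d by blast
  show "clique_cover R (insert c K) (c \<union> W)"
    using assms d unfolding clique_cover_def pairwise_def disjnt_def by (auto simp: Int_commute)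
qed

text \<open>A vertex of degree at most one together with its neighbour is a clique whose removal
  lowers the independence number by exactly one. This is the forest case of Koenig's
  theorem.\<close>

lemma forest_clique_cover:
  assumes "finite W" "symp R" "forest R W"
  shows "\<exists>K. clique_cover R K W \<and> card K = alp R W"
  using assms(1,3)
proof (induction "card W" arbitrary: W rule: less_induct)
  case less
  show ?case
  proof (cases "W = {}")
    case True
    then show ?thesis by (intro exI[of _ "{}"]) (simp add: clique_cover_def)
  next
    case False
    obtain v where v: "v \<in> W" "deg R W v \<le> 1" using forest_low_degree[OF less.prems False] .
    have irr: "\<not> R v v" using forest_irrefl[OF less.prems(2) v(1)] .
    let ?N = "insert v {u \<in> W. R v u}"
    have sub: "?N \<subseteq> W" using v by auto
    have W': "W - insert v {u. R v u} = W - ?N" by auto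
    have al: "alp R W = Suc (alp R (W - ?N))"
      using alp_low_degree[OF less.prems(1) assms(2) v(1) irr v(2)] W' by simp
    have "card (W - ?N) < card W" using less.prems(1) v by (intro psubset_card_mono) auto
    moreover have "forest R (W - ?N)" using forest_subset[OF less.prems(2)] by blast
    ultimately obtain K where K: "clique_cover R K (W - ?N)" "card K = alp R (W - ?N)"
      using less.hyps[of "W - ?N"] less.prems(1) by auto
    have "(\<exists>u. ?N = {u}) \<or> (\<exists>u w. u \<noteq> w \<and> R u w \<and> ?N = {u, w})"
    proof (cases "{u \<in> W. R v u} = {}")
      case True
      then have "?N = {v}" by blast
      then show ?thesis by blast
    next
      case False
      then have "0 < card {u \<in> W. R v u}" using less.prems(1) by (subst card_gt_0_iff) auto
      then have "card {u \<in> W. R v u} = 1" using v(2) unfolding deg_def by linarith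
      then obtain u where "{u \<in> W. R v u} = {u}" by (auto simp: card_1_singleton_iff)
      moreover then have "R v u" by auto
      ultimately show ?thesis using irr by metis
    qed
    note ins = clique_cover_insert[OF K(1) _ this]
    have "?N \<union> (W - ?N) = W" using sub by blast
    then show ?thesis using ins al K(2) clique_cover_finite[OF _ K(1)] less.prems(1)
      by (intro exI[of _ "insert ?N K"]) auto
  qed
qed

text \<open>Maximum independent sets of a forest meet every clique of an optimal cover exactly once, so
  the majority of three of them is one again; a median-closed family is \<open>2\<close>-Helly.\<close>

lemma forest_two_blocking:
  assumes "finite W" "symp R" "forest R W" "finite Y"
    and "\<And>x y. x \<in> Y \<Longrightarrow> y \<in> Y \<Longrightarrow> alp R W \<le> alp R (W - {x, y})"
  shows "alp R W \<le> alp R (W - Y)"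
  using assms(4,5)
proof (induction "card Y" arbitrary: Y rule: less_induct)
  case less
  obtain K where K: "clique_cover R K W" and cK: "card K = alp R W"
    using forest_clique_cover[OF assms(1-3)] by blast
  consider "Y = {}" | x y where "Y = {x, y}" | "3 \<le> card Y"
  proof -
    consider "card Y = 0" | "card Y = 1" | "card Y = 2" | "3 \<le> card Y" by linarith
    then show ?thesis
    proof cases
      case 1
      then show ?thesis using that(1) less.prems(1) by simp
    next
      case 2
      then obtain x where "Y = {x}" by (auto simp: card_1_singleton_iff)
      then show ?thesis using that(2)[of x x] by simp
    next
      case 3
      then show ?thesis using that(2) by (auto simp: card_2_iff)
    qed (rule that(3))
  qed
  then show ?case
  proof cases
    case 2
    then show ?thesis using less.prems(2)[of x y] by simp
  next
    case 3
    obtain T where "T \<subseteq> Y" "card T = 3" using obtain_subset_with_card_n[OF 3] by metis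
    then obtain a b c where abc: "a \<in> Y" "b \<in> Y" "c \<in> Y" "a \<noteq> b" "a \<noteq> c" "b \<noteq> c"
      by (auto simp: card_3_iff)
    \<comment> \<open>By induction \<open>Y - {x}\<close> does not block. An independent set with as
      many vertices as the cover has cliques meets each of them.\<close>
    have ex: "\<exists>S. S \<subseteq> W - (Y - {x}) \<and> indep R S \<and> (\<forall>d\<in>K. S \<inter> d \<noteq> {})" if "x \<in> Y" for x
    proof -
      have "card (Y - {x}) < card Y" using that less.prems(1) by (rule card_Diff1_less[rotated])
      then have "alp R W \<le> alp R (W - (Y - {x}))"
        using less.hyps[of "Y - {x}"] less.prems by auto
      moreover obtain S where S: "S \<subseteq> W - (Y - {x})" "indep R S" "card S = alp R (W - (Y - {x}))"
        by (rule alp_obtain[of "W - (Y - {x})" R]) (use assms(1) in auto)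
      ultimately have le: "card K \<le> card S" using cK by simp
      have "S \<inter> d \<noteq> {}" if "d \<in> K" for d
      proof
        assume e: "S \<inter> d = {}"
        have "card S = (\<Sum>c\<in>K. card (S \<inter> c))" using S by (intro clique_cover_card[OF assms(1) K]) auto
        also have "\<dots> < (\<Sum>c\<in>K. 1)"
        proof (rule sum_strict_mono_ex1)
          show "\<exists>c\<in>K. card (S \<inter> c) < 1" using that e by (intro bexI[of _ d]) simp_all
        qed (use clique_cover_hit[OF assms(2) K S(2)] clique_cover_finite[OF assms(1) K] in auto)
        finally show False using le by simp
      qed
      then show ?thesis using S by blast
    qed
    obtain A where A: "A \<subseteq> W - (Y - {a})" "indep R A" "\<forall>d\<in>K. A \<inter> d \<noteq> {}" using ex[OF abc(1)] by blast
    obtain B where B: "B \<subseteq> W - (Y - {b})" "indep R B" "\<forall>d\<in>K. B \<inter> d \<noteq> {}" using ex[OF abc(2)] by blast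
    obtain C where C: "C \<subseteq> W - (Y - {c})" "indep R C" "\<forall>d\<in>K. C \<inter> d \<noteq> {}" using ex[OF abc(3)] by blast
    define M where "M = (A \<inter> B) \<union> (A \<inter> C) \<union> (B \<inter> C)"
    \<comment> \<open>From \<open>Y\<close>, the sets \<open>A\<close>, \<open>B\<close> and
      \<open>C\<close> may contain only \<open>a\<close>, \<open>b\<close> and \<open>c\<close>
      respectively, so no vertex of \<open>Y\<close> has a majority.\<close>
    have MY: "M \<subseteq> W - Y" using A(1) B(1) C(1) abc unfolding M_def by blast
    have Mi: "indep R M"
      unfolding indep_def
    proof (intro ballI)
      fix u v assume "u \<in> M" "v \<in> M"
      then have "u \<in> A \<and> v \<in> A \<or> u \<in> B \<and> v \<in> B \<or> u \<in> C \<and> v \<in> C" unfolding M_def by blast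
      then show "\<not> R u v" using A(2) B(2) C(2) unfolding indep_def by blast
    qed
    have hit: "1 \<le> card (M \<inter> d)" if "d \<in> K" for d
    proof -
      have "(\<exists>u. d = {u}) \<or> (\<exists>u v. u \<noteq> v \<and> R u v \<and> d = {u, v})"
        using K that unfolding clique_cover_def by blast
      then obtain u v where d: "d = {u, v}" by (metis insert_absorb2)
      have "u \<in> A \<or> v \<in> A" "u \<in> B \<or> v \<in> B" "u \<in> C \<or> v \<in> C"
        using bspec[OF A(3) that] bspec[OF B(3) that] bspec[OF C(3) that] by (auto simp: d)
      then have "M \<inter> d \<noteq> {}" unfolding M_def d by blast
      moreover have "finite (M \<inter> d)" using MY assms(1) by (metis finite_Diff finite_Int finite_subset)
      ultimately show ?thesis by (simp add: Suc_le_eq card_gt_0_iff)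
    qed
    have "card K = (\<Sum>d\<in>K. 1)" by simp
    also have "\<dots> \<le> (\<Sum>d\<in>K. card (M \<inter> d))" using hit by (rule sum_mono)
    also have "\<dots> = card M" using clique_cover_card[OF assms(1) K, of M] MY by (metis Diff_subset order_trans)
    also have "\<dots> \<le> alp R (W - Y)" using MY Mi assms(1) by (intro alp_ge) auto
    finally show ?thesis using cK by simp
  qed simp
qed

text \<open>Independent sets without \<open>w\<close> live in the forest \<open>C - {w}\<close>,
  those with \<open>w\<close> in \<open>w\<close> and the forest outside its closed neighbourhood.
  Two vertices of \<open>Y\<close> exclude the maximum sets of either kind.\<close>

lemma four_blocking:
  assumes "finite C" "symp R" "\<not> R w w" "forest R (C - {w})" "alp R (C - Y) < alp R C"
  shows "\<exists>x1\<in>Y. \<exists>x2\<in>Y. \<exists>x3\<in>Y. \<exists>x4\<in>Y. alp R (C - {x1, x2, x3, x4}) < alp R C"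
proof -
  define Z where "Z = Y \<inter> C"
  have CZ: "C - Z = C - Y" by (auto simp: Z_def)
  have fZ: "finite Z" using assms(1) by (simp add: Z_def)
  have Zne: "Z \<noteq> {}" using assms(5) CZ by auto
  then obtain z where z: "z \<in> Z" by blast
  have sing: "alp R (C - T) < alp R C" if "alp R (C - {x, y}) < alp R C" "x \<in> T" "y \<in> T" for x y T
  proof -
    have "alp R (C - T) \<le> alp R (C - {x, y})" using that assms(1) by (intro alp_mono) auto
    then show ?thesis using that by simp
  qed
  have "\<exists>x\<in>Z. \<exists>y\<in>Z. \<forall>S \<subseteq> C - {x, y}. indep R S \<longrightarrow> w \<notin> S \<longrightarrow> card S < alp R C"
  proof (cases "alp R (C - {w}) < alp R C")
    \<comment> \<open>Every maximum independent set uses \<open>w\<close>, so nothing has to be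
      excluded and \<open>z\<close> merely fills the two places.\<close>
    case True
    have "card S < alp R C" if "S \<subseteq> C - {z, z}" "indep R S" "w \<notin> S" for S
    proof -
      have "card S \<le> alp R (C - {w})" using that assms(1) by (intro alp_ge) auto
      then show ?thesis using True by simp
    qed
    then show ?thesis using z by blast
  next
    case False
    then have eq: "alp R (C - {w}) = alp R C" using alp_mono[OF assms(1), of "C - {w}" R] by auto
    have "alp R (C - {w} - Z) \<le> alp R (C - Z)" using assms(1) by (intro alp_mono) auto
    then have "\<not> alp R (C - {w}) \<le> alp R (C - {w} - Z)" using assms(5) eq CZ by simp
    then obtain x y where xy: "x \<in> Z" "y \<in> Z" "\<not> alp R (C - {w}) \<le> alp R (C - {w} - {x, y})"
      using forest_two_blocking[OF _ assms(2,4) fZ] assms(1) by blast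
    have "card S < alp R C" if "S \<subseteq> C - {x, y}" "indep R S" "w \<notin> S" for S
    proof -
      have "card S \<le> alp R (C - {w} - {x, y})" using that assms(1) by (intro alp_ge) auto
      then show ?thesis using xy(3) eq by simp
    qed
    then show ?thesis using xy by blast
  qed
  then obtain x1 x2 where x12: "x1 \<in> Z" "x2 \<in> Z"
    "\<And>S. S \<subseteq> C - {x1, x2} \<Longrightarrow> indep R S \<Longrightarrow> w \<notin> S \<Longrightarrow> card S < alp R C" by blast
  have "\<exists>x\<in>Z. \<exists>y\<in>Z. \<forall>S \<subseteq> C - {x, y}. indep R S \<longrightarrow> w \<in> S \<longrightarrow> card S < alp R C"
  proof (cases "w \<in> Z")
    case True
    then show ?thesis by blast
  next
    case wZ: False
    define D where "D = C - insert w {u. R w u}"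
    have fD: "finite D" using assms(1) by (simp add: D_def)
    have fo: "forest R D" using forest_subset[OF assms(4)] by (auto simp: D_def)
    have rest: "S - {w} \<subseteq> D - T" "card S = Suc (card (S - {w}))"
      if "S \<subseteq> C - T" "indep R S" "w \<in> S" for S T
    proof -
      show "S - {w} \<subseteq> D - T" using that unfolding D_def indep_def by blast
      have "finite S" using that(1) assms(1) finite_subset by blast
      then show "card S = Suc (card (S - {w}))" using that(3) by (metis card.remove)
    qed
    show ?thesis
    proof (cases "alp R D + 1 < alp R C")
      case True
      have "card S < alp R C" if "S \<subseteq> C - {z, z}" "indep R S" "w \<in> S" for S
      proof -
        have "card (S - {w}) \<le> alp R D" using rest(1)[OF that] that fD
          by (intro alp_ge) (auto intro: indep_mono)
        then show ?thesis using True rest(2)[OF that] by simp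
      qed
      then show ?thesis using z by blast
    next
      case False
      \<comment> \<open>Otherwise \<open>w\<close> and an optimal set of \<open>D - Z\<close> would
        form a maximum independent set of \<open>C\<close> that avoids \<open>Y\<close>.\<close>
      have "\<not> alp R D \<le> alp R (D - Z)" if "w \<in> C"
      proof
        assume le: "alp R D \<le> alp R (D - Z)"
        have "D - Z = (C - Z) - insert w {u. R w u}" unfolding D_def by auto
        moreover have "w \<in> C - Z" using that wZ by simp
        ultimately have "Suc (alp R (D - Z)) \<le> alp R (C - Z)"
          using alp_insert_ge[of "C - Z" R w] assms by simp
        then show False using le False assms(5) CZ by simp
      qed
      then consider "w \<notin> C" | x y where "x \<in> Z" "y \<in> Z" "\<not> alp R D \<le> alp R (D - {x, y})"
        using forest_two_blocking[OF fD assms(2) fo fZ] by blast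
      then show ?thesis
      proof cases
        case 1
        then show ?thesis using z by blast
      next
        case 2
        have "card S < alp R C" if S: "S \<subseteq> C - {x, y}" "indep R S" "w \<in> S" for S
        proof -
          have "card (S - {w}) \<le> alp R (D - {x, y})" using rest(1)[OF S] S fD
            by (intro alp_ge) (auto intro: indep_mono)
          moreover have "w \<in> C" "\<not> R w w" using S assms(3) by auto
          then have "Suc (alp R D) \<le> alp R C" unfolding D_def
            by (intro alp_insert_ge) (use assms in auto)
          ultimately show ?thesis using 2(3) rest(2)[OF S] by simp
        qed
        then show ?thesis using 2 by blast
      qed
    qed
  qed
  then obtain x3 x4 where x34: "x3 \<in> Z" "x4 \<in> Z"
    "\<And>S. S \<subseteq> C - {x3, x4} \<Longrightarrow> indep R S \<Longrightarrow> w \<in> S \<Longrightarrow> card S < alp R C" by blast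
  obtain S where S: "S \<subseteq> C - {x1, x2, x3, x4}" "indep R S" "card S = alp R (C - {x1, x2, x3, x4})"
    by (rule alp_obtain[of "C - {x1, x2, x3, x4}" R]) (use assms(1) in auto)
  have "card S < alp R C" using x12(3)[of S] x34(3)[of S] S by blast
  then show ?thesis using S(3) x12 x34 unfolding Z_def by (metis IntD1)
qed

definition nbrs :: "('a \<Rightarrow> 'a \<Rightarrow> bool) \<Rightarrow> 'a set \<Rightarrow> 'a set" where
  "nbrs R S = {v. \<exists>x\<in>S. R x v}"

text \<open>\<open>del\<close> speaks of four vertices only, but by \<open>four_blocking\<close> it
  controls all of \<open>I \<inter> X\<close>: if the neighbours of \<open>I \<inter> X\<close>
  block \<open>C\<close>, those of four of its vertices do, and then the other components lose so
  much that an optimal set without \<open>X\<close> can take over. Otherwise \<open>I\<close>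
  extends by an optimal set of \<open>C\<close>.\<close>

lemma delete_component:
  assumes fin: "finite F" "finite X" "X \<inter> F = {}" and sy: "symp R"
    and C: "C \<subseteq> F" "\<And>u v. u \<in> C \<Longrightarrow> v \<in> F - C \<Longrightarrow> \<not> R u v" and w: "\<not> R w w" "forest R (C - {w})"
    and del: "\<And>x1 x2 x3 x4. x1 \<in> X \<Longrightarrow> x2 \<in> X \<Longrightarrow> x3 \<in> X \<Longrightarrow> x4 \<in> X \<Longrightarrow>
      alp R (C - nbrs R {x1,x2,x3,x4}) = alp R C \<or>
      alp R (F - C - nbrs R {x1,x2,x3,x4}) + card X \<le> alp R (F - C)"
  shows "alp R (X \<union> F) = alp R (X \<union> (F - C)) + alp R C"
proof (rule antisym)
  have fC: "finite C" using C(1) fin(1) finite_subset by blast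
  have "X \<union> F = (X \<union> (F - C)) \<union> C" using C(1) by blast
  then show "alp R (X \<union> F) \<le> alp R (X \<union> (F - C)) + alp R C"
    using alp_union_le[of "X \<union> (F - C)" C R] fin fC by simp
  obtain I where I: "I \<subseteq> X \<union> (F - C)" "indep R I" "card I = alp R (X \<union> (F - C))"
    by (rule alp_obtain[of "X \<union> (F - C)" R]) (use fin in auto)
  have fI: "finite I" using I(1) fin finite_subset by blast
  show "alp R (X \<union> (F - C)) + alp R C \<le> alp R (X \<union> F)"
  proof (cases "alp R (C - nbrs R (I \<inter> X)) < alp R C")
    case False
    obtain J where J: "J \<subseteq> C - nbrs R (I \<inter> X)" "indep R J" "card J = alp R (C - nbrs R (I \<inter> X))"
      by (rule alp_obtain[of "C - nbrs R (I \<inter> X)" R]) (use fC in auto)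
    have no: "\<not> R x v" if "x \<in> I" "v \<in> J" for x v
    proof (cases "x \<in> X")
      case True
      then show ?thesis using J(1) that unfolding nbrs_def by blast
    next
      case False
      then show ?thesis using C(2)[of v x] I(1) J(1) that sy by (auto dest: sympD)
    qed
    have "indep R (I \<union> J)"
      unfolding indep_def
    proof (intro ballI)
      fix u v assume uv: "u \<in> I \<union> J" "v \<in> I \<union> J"
      show "\<not> R u v"
        using uv no[of u v] no[of v u] I(2) J(2) sympD[OF sy, of u v] unfolding indep_def by blast
    qed
    moreover have "card (I \<union> J) = card I + card J"
      using I(1) J(1) C(1) fin(3) fI fC by (intro card_Un_disjoint) (auto intro: finite_subset)
    moreover have "card (I \<union> J) \<le> alp R (X \<union> F)" if "indep R (I \<union> J)"
      using I(1) J(1) C(1) fin that by (intro alp_ge) auto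
    ultimately show ?thesis using I(3) J(3) False by simp
  next
    case True
    then obtain y1 y2 y3 y4 where y: "y1 \<in> nbrs R (I \<inter> X)" "y2 \<in> nbrs R (I \<inter> X)" "y3 \<in> nbrs R (I \<inter> X)"
      "y4 \<in> nbrs R (I \<inter> X)" "alp R (C - {y1, y2, y3, y4}) < alp R C"
      using four_blocking[OF fC sy w] by blast
    obtain x1 x2 x3 x4 where x: "x1 \<in> I \<inter> X" "x2 \<in> I \<inter> X" "x3 \<in> I \<inter> X" "x4 \<in> I \<inter> X"
      "R x1 y1" "R x2 y2" "R x3 y3" "R x4 y4" using y unfolding nbrs_def by blast
    let ?N = "nbrs R {x1, x2, x3, x4}"
    have "{y1, y2, y3, y4} \<subseteq> ?N" using x unfolding nbrs_def by blast
    then have "alp R (C - ?N) \<le> alp R (C - {y1, y2, y3, y4})" using fC by (intro alp_mono) auto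
    then have *: "alp R (F - C - ?N) + card X \<le> alp R (F - C)" using del[of x1 x2 x3 x4] y(5) x by auto
    have "card I \<le> card (I \<inter> X) + card (I \<inter> (F - C))"
      using I(1) card_Un_le[of "I \<inter> X" "I \<inter> (F - C)"] by (metis Int_Un_distrib inf.absorb1)
    moreover have "card (I \<inter> X) \<le> card X" using fin by (intro card_mono) auto
    moreover have "card (I \<inter> (F - C)) \<le> alp R (F - C - ?N)"
    proof (rule alp_ge)
      show "I \<inter> (F - C) \<subseteq> F - C - ?N" using I(2) x unfolding indep_def nbrs_def by blast
    qed (use fin I(2) in \<open>auto intro: indep_mono\<close>)
    ultimately have "alp R (X \<union> (F - C)) \<le> alp R (F - C)" using * I(3) by linarith
    moreover have "alp R ((F - C) \<union> C) = alp R (F - C) + alp R C"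
    proof (rule alp_union_separate)
      fix a b assume "a \<in> F - C" "b \<in> C"
      then show "\<not> R a b \<and> \<not> R b a" using C(2)[of b a] sy by (auto dest: sympD)
    qed (use fin fC in auto)
    moreover have "alp R ((F - C) \<union> C) \<le> alp R (X \<union> F)" using C(1) fin by (intro alp_mono) auto
    ultimately show ?thesis by linarith
  qed
qed

section \<open>Connected components\<close>

definition comp :: "('a \<Rightarrow> 'a \<Rightarrow> bool) \<Rightarrow> 'a set \<Rightarrow> 'a \<Rightarrow> 'a set" where
  "comp R F w = {v. (\<lambda>a b. a \<in> F \<and> b \<in> F \<and> R a b)\<^sup>*\<^sup>* w v}"

lemma comp_self: "w \<in> comp R F w"
  by (simp add: comp_def)

lemma comp_step: "u \<in> comp R F w \<Longrightarrow> u \<in> F \<Longrightarrow> v \<in> F \<Longrightarrow> R u v \<Longrightarrow> v \<in> comp R F w"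
  unfolding comp_def by (simp add: rtranclp.rtrancl_into_rtrancl)

lemma comp_subset: "w \<in> F \<Longrightarrow> comp R F w \<subseteq> F"
proof
  fix v assume w: "w \<in> F" and "v \<in> comp R F w"
  then have "(\<lambda>a b. a \<in> F \<and> b \<in> F \<and> R a b)\<^sup>*\<^sup>* w v" by (simp add: comp_def)
  then show "v \<in> F" using w by (induction rule: rtranclp_induct) auto
qed

lemma comp_least:
  assumes "w \<in> A" "\<And>u v. u \<in> A \<Longrightarrow> u \<in> F \<Longrightarrow> v \<in> F \<Longrightarrow> R u v \<Longrightarrow> v \<in> A"
  shows "comp R F w \<subseteq> A"
proof
  fix v assume "v \<in> comp R F w"
  then have "(\<lambda>a b. a \<in> F \<and> b \<in> F \<and> R a b)\<^sup>*\<^sup>* w v" by (simp add: comp_def)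
  then show "v \<in> A" using assms by (induction rule: rtranclp_induct) auto
qed

lemma comp_sym: "symp R \<Longrightarrow> v \<in> comp R F w \<Longrightarrow> w \<in> comp R F v"
proof -
  assume "symp R" "v \<in> comp R F w"
  then have "symp (\<lambda>a b. a \<in> F \<and> b \<in> F \<and> R a b)" by (auto intro!: sympI dest: sympD)
  then show ?thesis using \<open>v \<in> comp R F w\<close> unfolding comp_def by (auto dest: sympD[OF symp_rtranclp])
qed

lemma comp_eq: "symp R \<Longrightarrow> v \<in> comp R F w \<Longrightarrow> comp R F v = comp R F w"
proof -
  assume s: "symp R" "v \<in> comp R F w"
  have "comp R F b \<subseteq> comp R F a" if "b \<in> comp R F a" for a b
    using that unfolding comp_def by auto
  then show ?thesis using s(2) comp_sym[OF s] by blast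
qed

lemma comp_connected:
  assumes "symp R" "w \<in> F" "U \<subseteq> comp R F w" "U \<noteq> {}" "U \<noteq> comp R F w"
  shows "\<exists>u\<in>U. \<exists>v\<in>comp R F w - U. R u v"
proof -
  have *: "\<exists>u\<in>U. \<exists>v\<in>comp R F w - U. R u v" if "w \<in> U" "U \<subset> comp R F w" for U
  proof (rule ccontr)
    assume n: "\<not> (\<exists>u\<in>U. \<exists>v\<in>comp R F w - U. R u v)"
    have "comp R F w \<subseteq> U"
    proof (rule comp_least)
      fix u v assume uv: "u \<in> U" "u \<in> F" "v \<in> F" "R u v"
      then have "v \<in> comp R F w" using that comp_step[of u R F w v] by blast
      then show "v \<in> U" using n uv by blast
    qed (rule that(1))
    then show False using that(2) by blast
  qed
  show ?thesis
  proof (cases "w \<in> U")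
    case True
    then show ?thesis using *[of U] assms by blast
  next
    case False
    then have "w \<in> comp R F w - U" by (simp add: comp_self)
    moreover have "comp R F w - U \<subset> comp R F w" using assms(3,4) by blast
    ultimately obtain u v where uv: "u \<in> comp R F w - U" "v \<in> comp R F w - (comp R F w - U)" "R u v"
      using *[of "comp R F w - U"] by blast
    have "R v u" using assms(1) uv(3) by (rule sympD)
    then show ?thesis using uv by blast
  qed
qed

text \<open>The counting form of "no two disjoint cycles in one component". Take a largest dense set
  that contains \<open>A\<close> and avoids \<open>B\<close>. An edge leaving it either extends it
  by one vertex, or leads to \<open>B\<close> and gives the union one edge too many.\<close>

lemma no_two_dense:
  assumes fin: "finite C" and sy: "symp R" and ps: "pseudo R C"
    and conn: "\<And>U. U \<subseteq> C \<Longrightarrow> U \<noteq> {} \<Longrightarrow> U \<noteq> C \<Longrightarrow> \<exists>u\<in>U. \<exists>v\<in>C - U. R u v"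
    and A: "A \<subseteq> C" "A \<noteq> {}" "2 * card A \<le> e2 R A" and B: "B \<subseteq> C" "B \<noteq> {}" "2 * card B \<le> e2 R B"
    and AB: "A \<inter> B = {}"
  shows False
proof -
  define P where "P U \<longleftrightarrow> A \<subseteq> U \<and> U \<subseteq> C - B \<and> 2 * card U \<le> e2 R U" for U
  have "P A" using A AB by (auto simp: P_def)
  moreover have "finite {U. P U}" by (rule finite_subset[of _ "Pow C"]) (use fin P_def in auto)
  ultimately obtain U where U: "P U" "\<And>U'. P U' \<Longrightarrow> U \<subseteq> U' \<Longrightarrow> U' = U"
    using finite_has_maximal2[of "{U. P U}" A] by (metis mem_Collect_eq)
  have fU: "finite U" "finite B" using U(1) fin B(1) finite_subset unfolding P_def by blast+
  have "U \<noteq> C" "U \<noteq> {}" "U \<subseteq> C" using U(1) B A unfolding P_def by blast+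
  then obtain u v where uv: "u \<in> U" "v \<in> C - U" "R u v" using conn by blast
  have irr: "\<not> R v v" using ps uv(2) unfolding pseudo_def by blast
  have vu: "R v u" using sy uv(3) by (rule sympD)
  show False
  proof (cases "v \<in> B")
    case False
    have "1 \<le> deg R U v" unfolding deg_def using vu uv(1) fU(1) by (auto simp: Suc_le_eq card_gt_0_iff)
    then have "P (insert v U)" using U(1) False uv e2_insert[of U v R] fU sy irr unfolding P_def by auto
    then show False using U(2)[of "insert v U"] uv(2) by blast
  next
    case True
    have "1 \<le> deg R B u" unfolding deg_def using True uv(3) fU(2) by (auto simp: Suc_le_eq card_gt_0_iff)
    also have "\<dots> \<le> (\<Sum>a\<in>U. deg R B a)" using uv(1) fU(1) by (intro member_le_sum) auto
    finally have "1 \<le> (\<Sum>a\<in>U. deg R B a)" .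
    moreover have "U \<inter> B = {}" "2 * card U \<le> e2 R U" using U(1) unfolding P_def by auto
    ultimately have "2 * card U + 2 * card B + 2 \<le> e2 R (U \<union> B)"
      using e2_union[of U B R] fU sy B(3) by simp
    moreover have "card (U \<union> B) = card U + card B" using U(1) fU unfolding P_def by (intro card_Un_disjoint) auto
    moreover have "e2 R (U \<union> B) \<le> 2 * card (U \<union> B)" using ps U(1) B(1) unfolding pseudo_def P_def by blast
    ultimately show False by simp
  qed
qed

section \<open>Reduction rules\<close>

text \<open>A loop at a vertex of \<open>M\<close> excludes it from all independent sets, so that banning a vertex
  and banning a pair of vertices are both the addition of an edge.\<close>

definition NM :: "('a \<Rightarrow> 'a \<Rightarrow> bool) \<Rightarrow> 'a set \<Rightarrow> 'a \<Rightarrow> 'a set" where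
  "NM R M u = {a \<in> M. \<not> R a a \<and> R a u}"

definition NF :: "('a \<Rightarrow> 'a \<Rightarrow> bool) \<Rightarrow> 'a set \<Rightarrow> 'a \<Rightarrow> 'a set" where
  "NF R F u = {w \<in> F. R u w}"

lemma deg_NF: "deg R F u = card (NF R F u)"
  by (simp add: deg_def NF_def)

definition full :: "('a \<Rightarrow> 'a \<Rightarrow> bool) \<Rightarrow> 'a set \<Rightarrow> 'a set \<Rightarrow> bool" where
  "full R A B \<longleftrightarrow> (\<forall>a\<in>A. \<forall>b\<in>B. R a b)"

definition join :: "('a \<Rightarrow> 'a \<Rightarrow> bool) \<Rightarrow> 'a set \<Rightarrow> 'a set \<Rightarrow> 'a \<Rightarrow> 'a \<Rightarrow> bool" where
  "join R A B x y \<longleftrightarrow> R x y \<or> x \<in> A \<and> y \<in> B \<or> x \<in> B \<and> y \<in> A"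

definition unlink :: "('a \<Rightarrow> 'a \<Rightarrow> bool) \<Rightarrow> 'a \<Rightarrow> 'a \<Rightarrow> 'a \<Rightarrow> 'a \<Rightarrow> bool" where
  "unlink R u v x y \<longleftrightarrow> R x y \<and> {x, y} \<noteq> {u, v}"

lemma join_pairs:
  assumes "P \<inter> U \<subseteq> A" "Q \<inter> U \<subseteq> B"
  shows "{(x, y). x \<in> U \<and> y \<in> U \<and> join R P Q x y} \<subseteq> {(x, y). x \<in> U \<and> y \<in> U \<and> R x y} \<union> (A \<times> B \<union> B \<times> A)"
  using assms unfolding join_def by auto

lemma indep_nbr_cases:
  assumes "indep R S" "S \<subseteq> M \<union> F" "symp R" "x \<in> S" "R u x"
  shows "x \<in> NM R M u \<or> x \<in> NF R F u"
  using assms unfolding indep_def NM_def NF_def by (auto dest: sympD)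

lemma indep_insert:
  assumes "indep R S" "S \<subseteq> M \<union> F" "symp R" "\<not> R u u" "S \<inter> NM R M u = {}" "S \<inter> NF R F u = {}"
  shows "indep R (insert u S)"
proof -
  have no: "\<not> R u x" if "x \<in> S" for x
    using indep_nbr_cases[OF assms(1-3) that, of u] assms(5,6) that by blast
  then have "\<not> R x u" if "x \<in> S" for x using that assms(3) by (auto dest: sympD)
  with no show ?thesis using assms(1,4) unfolding indep_def by blast
qed

locale instance_graph =
  fixes R :: "'a \<Rightarrow> 'a \<Rightarrow> bool" and M F :: "'a set"
  assumes fin: "finite M" "finite F" and disj: "M \<inter> F = {}" and sy: "symp R" and forest: "forest R F"
begin

lemma R_sym: "R x y \<Longrightarrow> R y x"
  using sy by (rule sympD)

lemma irrefl: "v \<in> F \<Longrightarrow> \<not> R v v"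
  by (rule forest_irrefl[OF forest])

lemma alp_isolated:
  assumes "v \<in> F" "NM R M v = {}" "NF R F v = {}"
  shows "alp R (M \<union> F) = Suc (alp R (M \<union> (F - {v})))"
proof (rule antisym)
  have "M \<union> F = (M \<union> (F - {v})) \<union> {v}" using assms by blast
  moreover have "alp R {v} \<le> 1" using card_mono[of "{v}"] by (intro alp_le) fastforce+
  ultimately show "alp R (M \<union> F) \<le> Suc (alp R (M \<union> (F - {v})))"
    using alp_union_le[of "M \<union> (F - {v})" "{v}" R] fin by simp
  obtain S where S: "S \<subseteq> M \<union> (F - {v})" "indep R S" "card S = alp R (M \<union> (F - {v}))"
    by (rule alp_obtain[of "M \<union> (F - {v})" R]) (use fin in auto)
  have "indep R (insert v S)"
    using S(1) assms irrefl by (intro indep_insert[OF S(2) _ sy, of M F]) auto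
  moreover have "card (insert v S) = Suc (card S)" using S(1) fin disj assms(1)
    by (intro card_insert_disjoint) (auto intro: finite_subset)
  ultimately show "Suc (alp R (M \<union> (F - {v}))) \<le> alp R (M \<union> F)"
    using alp_ge[of "M \<union> F" "insert v S" R] S assms(1) fin by auto
qed

text \<open>An independent set with \<open>a\<close> and \<open>b\<close> gains at most
  \<open>card M\<close> vertices in \<open>M\<close> and loses as many in \<open>F\<close>. A
  maximum independent set of \<open>F\<close> alone is no smaller, and the new edge does not touch
  it.\<close>

lemma alp_ban:
  assumes ab: "a \<in> M" "b \<in> M" and conf: "alp R (F - nbrs R {a, b}) + card M \<le> alp R F"
  shows "alp (join R {a} {b}) (M \<union> F) = alp R (M \<union> F)"
proof (rule antisym)
  show "alp (join R {a} {b}) (M \<union> F) \<le> alp R (M \<union> F)"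
    using fin by (intro alp_anti) (auto simp: join_def)
  obtain S where S: "S \<subseteq> M \<union> F" "indep R S" "card S = alp R (M \<union> F)"
    by (rule alp_obtain[of "M \<union> F" R]) (use fin in auto)
  show "alp R (M \<union> F) \<le> alp (join R {a} {b}) (M \<union> F)"
  proof (cases "a \<in> S \<and> b \<in> S")
    case False
    then have "indep (join R {a} {b}) S" using S(2) unfolding indep_def join_def by blast
    then show ?thesis using alp_ge[of "M \<union> F" S "join R {a} {b}"] S fin by simp
  next
    case True
    have "card S \<le> card (S \<inter> M) + card (S \<inter> F)"
      using S(1) card_Un_le[of "S \<inter> M" "S \<inter> F"] by (metis Int_Un_distrib inf.absorb1)
    moreover have "card (S \<inter> M) \<le> card M" using fin by (intro card_mono) auto
    moreover have "card (S \<inter> F) \<le> alp R (F - nbrs R {a, b})"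
    proof (rule alp_ge)
      show "S \<inter> F \<subseteq> F - nbrs R {a, b}" using S(2) True unfolding indep_def nbrs_def by blast
    qed (use fin S(2) in \<open>auto intro: indep_mono\<close>)
    moreover have "alp R F = alp (join R {a} {b}) F"
      using fin disj ab by (intro alp_cong) (auto simp: join_def)
    moreover have "\<dots> \<le> alp (join R {a} {b}) (M \<union> F)" using fin by (intro alp_mono) auto
    ultimately show ?thesis using conf S(3) by linarith
  qed
qed

lemma ban_preserves:
  assumes "a \<in> M" "b \<in> M"
  shows "forest (join R {a} {b}) F" "e2 (join R {a} {b}) F = e2 R F"
proof -
  have *: "e2 (join R {a} {b}) U = e2 R U" if "U \<subseteq> F" for U
  proof -
    have "finite U" using that fin(2) finite_subset by blast
    then show ?thesis using that assms disj
      by (intro antisym e2_anti) (auto simp: join_def)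
  qed
  then show "e2 (join R {a} {b}) F = e2 R F" by simp
  show "forest (join R {a} {b}) F" using * forest unfolding forest_def by simp
qed

section \<open>Folding an edge of the forest\<close>

context
  fixes u v
  assumes uv: "u \<in> F" "v \<in> F" "R u v" and resolved: "full R (NM R M u) (NM R M v)"
    and dv: "card (NF R F v) \<le> 2" and du: "card (NF R F u) \<le> 2 \<or> NM R M v = {}"
begin

abbreviation "NA \<equiv> NM R M u \<union> (NF R F u - {v})"
abbreviation "NB \<equiv> NM R M v \<union> (NF R F v - {u})"
abbreviation "R' \<equiv> join R NA NB"

lemma uv_ne: "u \<noteq> v"
  using uv(1,3) irrefl[of u] by auto

lemma finNF: "finite (NF R F x)"
  using fin by (simp add: NF_def)

lemma card_NFv: "card (NF R F v - {u}) \<le> 1"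
proof -
  have "u \<in> NF R F v" using uv R_sym unfolding NF_def by blast
  then show ?thesis using dv by simp
qed

lemma card_NFu: "card (NF R F u) \<le> 2 \<Longrightarrow> card (NF R F u - {v}) \<le> 1"
proof -
  assume "card (NF R F u) \<le> 2"
  moreover have "v \<in> NF R F u" using uv unfolding NF_def by blast
  ultimately show ?thesis by simp
qed

text \<open>An independent set of the new graph avoids \<open>NA\<close> or \<open>NB\<close>, which
  leaves room for \<open>u\<close> or \<open>v\<close>. Conversely, a maximum independent set
  without \<open>u\<close> and \<open>v\<close> meets one of \<open>NA\<close>, \<open>NB\<close> in
  at most one vertex: by \<open>resolved\<close> it avoids \<open>NM\<close> on one side, and there
  the forest contributes at most one further neighbour. Deleting that vertex costs what
  \<open>u\<close> or \<open>v\<close> would have paid.\<close>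

lemma alp_eliminate: "alp R (M \<union> F) = Suc (alp R' (M \<union> (F - {u, v})))"
proof (rule antisym)
  let ?V = "M \<union> (F - {u, v})"
  have fV: "finite ?V" using fin by auto
  have uM: "u \<notin> M" "v \<notin> M" using uv disj by auto
  obtain S where S: "S \<subseteq> M \<union> F" "indep R S" "card S = alp R (M \<union> F)"
    by (rule alp_obtain[of "M \<union> F" R]) (use fin in auto)
  have fS: "finite S" using S(1) fin finite_subset by blast
  have free: "indep R' T" if "T \<subseteq> S" "T \<inter> NA = {} \<or> T \<inter> NB = {}" for T
    using that S(2) unfolding indep_def join_def by blast
  have free_le: "card T \<le> alp R' ?V" if "T \<subseteq> S" "u \<notin> T" "v \<notin> T" "T \<inter> NA = {} \<or> T \<inter> NB = {}" for T
  proof (rule alp_ge[OF fV _ free[OF that(1,4)]])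
    show "T \<subseteq> ?V" using that(1-3) S(1) by blast
  qed
  have drop_le: "alp R (M \<union> F) \<le> Suc (alp R' ?V)"
    if "u \<notin> S" "v \<notin> S" "card D \<le> 1" "(S - D) \<inter> NA = {} \<or> (S - D) \<inter> NB = {}" "finite D" for D
  proof -
    have "card S - card D \<le> card (S - D)" by (rule diff_card_le_card_Diff) (rule that(5))
    moreover have "card (S - D) \<le> alp R' ?V" by (rule free_le[OF _ _ _ that(4)]) (use that in auto)
    ultimately show ?thesis using S(3) that(3) by linarith
  qed
  show "alp R (M \<union> F) \<le> Suc (alp R' ?V)"
  proof (cases "u \<in> S \<or> v \<in> S")
    case True
    then obtain w where w: "w = u \<or> w = v" "w \<in> S" by blast
    have "\<not> (u \<in> S \<and> v \<in> S)" using S(2) uv(3) unfolding indep_def by blast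
    then have nin: "u \<notin> S - {w}" "v \<notin> S - {w}" using w by auto
    have "\<not> R w x" "\<not> R x w" if "x \<in> S" for x using S(2) w(2) that unfolding indep_def by blast+
    then have "(S - {w}) \<inter> NA = {} \<or> (S - {w}) \<inter> NB = {}" using w(1) unfolding NM_def NF_def by blast
    then have "card (S - {w}) \<le> alp R' ?V" using nin by (intro free_le) auto
    moreover have "card S = Suc (card (S - {w}))" using fS w(2) by (metis card.remove)
    ultimately show ?thesis using S(3) by simp
  next
    case False
    show ?thesis
    proof (cases "S \<inter> NM R M v = {}")
      case True
      then have "(S - (NF R F v - {u})) \<inter> NB = {}" by blast
      then show ?thesis using False card_NFv finNF by (intro drop_le[of "NF R F v - {u}"]) auto
    next
      case ne: False
      then obtain b where b: "b \<in> S" "b \<in> NM R M v" by blast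
      have "S \<inter> NM R M u = {}"
        using resolved b S(2) unfolding full_def indep_def by blast
      then have "(S - (NF R F u - {v})) \<inter> NA = {}" by blast
      \<comment> \<open>\<open>b\<close> is a neighbour of \<open>v\<close> in \<open>M\<close>, so
        only the first alternative of \<open>du\<close> remains.\<close>
      moreover have "card (NF R F u - {v}) \<le> 1" using du b by (intro card_NFu) auto
      ultimately show ?thesis using False finNF by (intro drop_le[of "NF R F u - {v}"]) auto
    qed
  qed
  obtain T where T: "T \<subseteq> ?V" "indep R' T" "card T = alp R' ?V" by (rule alp_obtain[OF fV])
  have iT: "indep R T" using T(2) unfolding indep_def join_def by blast
  have "T \<inter> NA = {} \<or> T \<inter> NB = {}" using T(2) unfolding indep_def join_def by blast
  moreover have uvT: "u \<notin> T" "v \<notin> T" using T(1) uM by auto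
  ultimately have "indep R (insert u T) \<or> indep R (insert v T)"
    using indep_insert[OF iT _ sy, of M F u] indep_insert[OF iT _ sy, of M F v] T(1) irrefl uv by blast
  then obtain w where w: "w = u \<or> w = v" "indep R (insert w T)" by blast
  moreover have "finite T" using T(1) fV by (rule finite_subset)
  then have "card (insert w T) = Suc (card T)" using w(1) uvT by auto
  moreover have "card (insert w T) \<le> alp R (M \<union> F)" using w T(1) uv fin by (intro alp_ge) auto
  ultimately show "Suc (alp R' ?V) \<le> alp R (M \<union> F)" using T(3) by simp
qed

text \<open>At most \<open>card A * card B\<close> edges inside \<open>U\<close> are new, and
  \<open>card B \<le> 1\<close>. If \<open>B\<close> is empty, nothing is added. Otherwise
  \<open>card A\<close> new edges stand against \<open>card A + 2\<close> edges at \<open>u\<close>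
  and \<open>v\<close>; the surplus of two pays for the two deleted vertices in the forest
  bound.\<close>

lemma e2_eliminate:
  assumes "U \<subseteq> F - {u, v}"
  shows "e2 R' U \<le> e2 R U \<or> e2 R' U + 4 \<le> e2 R (insert u (insert v U))"
proof -
  have fU: "finite U" using assms fin finite_subset by blast
  have irr: "\<not> R u u" "\<not> R v v" using irrefl uv by auto
  define A where "A = {x \<in> U. R u x}"
  define B where "B = {x \<in> U. R v x}"
  have fAB: "finite A" "finite B" using fU by (auto simp: A_def B_def)
  have "B \<subseteq> NF R F v - {u}" using assms unfolding B_def NF_def by auto
  then have cB: "card B \<le> 1" using card_NFv card_mono[OF _ \<open>B \<subseteq> _\<close>] finNF by (meson finite_Diff le_trans)
  have NA: "NA \<inter> U \<subseteq> A" "NB \<inter> U \<subseteq> B" using assms disj unfolding A_def B_def NM_def NF_def by auto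
  note pairs = e2_pairs[OF fU]
  have "{(x, y). x \<in> U \<and> y \<in> U \<and> R' x y} \<subseteq> {(x, y). x \<in> U \<and> y \<in> U \<and> R x y} \<union> (A \<times> B \<union> B \<times> A)"
    by (rule join_pairs[OF NA])
  moreover have "finite {(x, y). x \<in> U \<and> y \<in> U \<and> R x y}"
    by (rule finite_subset[of _ "U \<times> U"]) (use fU in auto)
  then have "finite ({(x, y). x \<in> U \<and> y \<in> U \<and> R x y} \<union> (A \<times> B \<union> B \<times> A))"
    using fAB by simp
  ultimately have "e2 R' U \<le> card ({(x, y). x \<in> U \<and> y \<in> U \<and> R x y} \<union> (A \<times> B \<union> B \<times> A))"
    unfolding pairs by (intro card_mono)
  also have "\<dots> \<le> e2 R U + (card (A \<times> B) + card (B \<times> A))"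
    unfolding pairs by (rule order_trans[OF card_Un_le add_left_mono[OF card_Un_le]])
  also have "card (A \<times> B) + card (B \<times> A) = 2 * (card A * card B)" by (simp add: card_cartesian_product)
  finally have "e2 R' U \<le> e2 R U + 2 * (card A * card B)" .
  moreover have "deg R (insert v U) u = Suc (card A)"
  proof -
    have "{x \<in> insert v U. R u x} = insert v A" using uv(3) unfolding A_def by auto
    moreover have "v \<notin> A" using assms unfolding A_def by auto
    ultimately show ?thesis using fAB by (simp add: deg_def)
  qed
  moreover have "e2 R (insert v U) = e2 R U + 2 * card B"
    using e2_insert[OF fU _ sy irr(2)] assms unfolding B_def deg_def by auto
  moreover have "e2 R (insert u (insert v U)) = e2 R (insert v U) + 2 * deg R (insert v U) u"
    using assms uv_ne fU irr by (intro e2_insert sy) auto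
  moreover have "card B = 0 \<or> card B = 1" using cB by linarith
  ultimately show ?thesis by auto
qed

lemma forest_eliminate: "forest R' (F - {u, v})"
  unfolding forest_def
proof (intro allI impI)
  fix U assume U: "U \<subseteq> F - {u, v}" "U \<noteq> {}"
  have "finite U" using U(1) fin finite_subset by blast
  moreover have "u \<notin> U" "v \<notin> U" using U(1) by auto
  ultimately have "card (insert u (insert v U)) = card U + 2" using uv_ne by simp
  moreover have "e2 R (insert u (insert v U)) + 2 \<le> 2 * card (insert u (insert v U))"
    using forest U(1) uv unfolding forest_def by (metis Diff_subset insert_not_empty insert_subset order_trans)
  moreover have "e2 R U + 2 \<le> 2 * card U" using forest U unfolding forest_def by blast
  ultimately show "e2 R' U + 2 \<le> 2 * card U" using e2_eliminate[OF U(1)] by auto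
qed

lemma e2_eliminate_le: "e2 R' (F - {u, v}) \<le> e2 R F"
proof -
  have "insert u (insert v (F - {u, v})) = F" using uv by auto
  moreover have "e2 R (F - {u, v}) \<le> e2 R F" using fin by (intro e2_mono) auto
  ultimately show ?thesis using e2_eliminate[of "F - {u, v}"] by auto
qed

end

section \<open>Cutting an edge between two vertices with leaves\<close>

context
  fixes u v u' v'
  assumes e: "u \<in> F" "u' \<in> F" "v \<in> F" "v' \<in> F" "R u u'"
    and leaf: "NF R F v = {u}" "NF R F v' = {u'}" "v \<noteq> u'" "v' \<noteq> u"
    and full: "full R (NM R M v) (NM R M v')"
begin

text \<open>A set that uses both ends of the cut edge misses all neighbours in \<open>M\<close> of
  one of the two leaves, since these neighbourhoods are completely joined. At that leaf the end of
  the edge is exchanged for the leaf.\<close>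

lemma alp_unlink: "alp (unlink R u u') (M \<union> F) = alp R (M \<union> F)"
proof (rule antisym)
  let ?R = "unlink R u u'"
  have ne: "u \<noteq> u'" using e(1,5) irrefl by blast
  show "alp R (M \<union> F) \<le> alp ?R (M \<union> F)" using fin by (intro alp_anti) (auto simp: unlink_def)
  obtain S where S: "S \<subseteq> M \<union> F" "indep ?R S" "card S = alp ?R (M \<union> F)"
    by (rule alp_obtain[of "M \<union> F" ?R]) (use fin in auto)
  have fS: "finite S" using S(1) fin finite_subset by blast
  have swap: "card S \<le> alp R (M \<union> F)"
    if w: "(w, x) = (u, v) \<or> (w, x) = (u', v')" and both: "u \<in> S" "u' \<in> S" and n: "S \<inter> NM R M x = {}" for w x
  proof -
    have x: "x \<in> F" "NF R F x = {w}" "R x w" "{x, w} \<noteq> {u, u'}"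
      using w e leaf unfolding NF_def by (auto simp: doubleton_eq_iff)
    have wS: "w \<in> S" "x \<noteq> w" using w both x irrefl by auto
    have xS: "x \<notin> S" using S(2) wS x unfolding indep_def unlink_def by auto
    have iT: "indep R (S - {w})"
      unfolding indep_def
    proof (intro ballI)
      fix a b assume ab: "a \<in> S - {w}" "b \<in> S - {w}"
      then have "{a, b} \<noteq> {u, u'}" using w by (auto simp: doubleton_eq_iff)
      then show "\<not> R a b" using ab S(2) unfolding indep_def unlink_def by auto
    qed
    have "indep R (insert x (S - {w}))"
      by (rule indep_insert[OF iT _ sy, of M F]) (use S(1) x irrefl n in auto)
    moreover have "card (insert x (S - {w})) = card S"
      using fS xS wS by (metis Diff_iff card.remove card_insert_disjoint finite_Diff)
    ultimately show ?thesis using alp_ge[of "M \<union> F" "insert x (S - {w})" R] S(1) x(1) fin by auto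
  qed
  show "alp ?R (M \<union> F) \<le> alp R (M \<union> F)"
  proof (cases "u \<in> S \<and> u' \<in> S")
    case False
    then have "indep R S" using S(2) unfolding indep_def unlink_def by (auto simp: doubleton_eq_iff)
    then show ?thesis using alp_ge[of "M \<union> F" S R] S fin by simp
  next
    case True
    have "\<not> (a \<in> S \<inter> NM R M v \<and> b \<in> S \<inter> NM R M v')" for a b
    proof
      assume ab: "a \<in> S \<inter> NM R M v \<and> b \<in> S \<inter> NM R M v'"
      then have "R a b" using full unfolding full_def by blast
      moreover have "a \<noteq> u" "a \<noteq> u'" using ab e disj unfolding NM_def by auto
      ultimately show False using ab S(2) unfolding indep_def unlink_def by (auto simp: doubleton_eq_iff)
    qed
    then have "S \<inter> NM R M v = {} \<or> S \<inter> NM R M v' = {}" by blast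
    then show ?thesis using swap[of u v] swap[of u' v'] True S(3) by auto
  qed
qed

lemma unlink_preserves: "forest (unlink R u u') F" "e2 (unlink R u u') F < e2 R F"
proof -
  show "forest (unlink R u u') F"
    unfolding forest_def
  proof (intro allI impI)
    fix U assume U: "U \<subseteq> F" "U \<noteq> {}"
    have "finite U" using U(1) fin(2) by (rule finite_subset)
    then have "e2 (unlink R u u') U \<le> e2 R U" by (rule e2_anti) (simp add: unlink_def)
    moreover have "e2 R U + 2 \<le> 2 * card U" using forest U unfolding forest_def by blast
    ultimately show "e2 (unlink R u u') U + 2 \<le> 2 * card U" by linarith
  qed
  show "e2 (unlink R u u') F < e2 R F"
    unfolding e2_def
  proof (rule sum_strict_mono_ex1)
    show "\<forall>x\<in>F. deg (unlink R u u') F x \<le> deg R F x"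
      using fin(2) unfolding deg_def unlink_def by (intro ballI card_mono) auto
    have "{x \<in> F. unlink R u u' u x} \<subset> {x \<in> F. R u x}" using e(2,5) unfolding unlink_def by blast
    then show "\<exists>x\<in>F. deg (unlink R u u') F x < deg R F x"
      using fin(2) e(1) unfolding deg_def by (intro bexI[of _ u] psubset_card_mono) auto
  qed (use fin in auto)
qed

end

end

section \<open>The size of a reduced forest\<close>

text \<open>\<open>X\<close> is the given modulator, and \<open>L\<close> maps a vertex to its component of \<open>G - X\<close>, of which
  \<open>M - X\<close> contains at most one vertex.\<close>

locale reduced_graph = instance_graph +
  fixes X :: "'a set" and L :: "'a \<Rightarrow> 'b"
  assumes XM: "X \<subseteq> M"
    and label: "\<And>u w. u \<in> F \<Longrightarrow> w \<in> M \<union> F - X \<Longrightarrow> R u w \<Longrightarrow> L u = L w"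
    and label_inj: "inj_on L (M - X)"
    and no_isolated: "\<And>v. v \<in> F \<Longrightarrow> NM R M v \<noteq> {} \<or> NF R F v \<noteq> {}"
    and no_ban: "\<And>a b. a \<in> M \<Longrightarrow> b \<in> M \<Longrightarrow> \<not> R a a \<Longrightarrow> \<not> R b b \<Longrightarrow> \<not> R a b \<Longrightarrow>
        alp R F < alp R (F - nbrs R {a, b}) + card M"
    and no_eliminate: "\<And>u v. u \<in> F \<Longrightarrow> v \<in> F \<Longrightarrow> R u v \<Longrightarrow> full R (NM R M u) (NM R M v) \<Longrightarrow>
        card (NF R F v) \<le> 2 \<Longrightarrow> card (NF R F u) \<le> 2 \<or> NM R M v = {} \<Longrightarrow> False"
    and no_unlink: "\<And>u v u' v'. u \<in> F \<Longrightarrow> u' \<in> F \<Longrightarrow> v \<in> F \<Longrightarrow> v' \<in> F \<Longrightarrow> R u u' \<Longrightarrow>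
        NF R F v = {u} \<Longrightarrow> NF R F v' = {u'} \<Longrightarrow> v \<noteq> u' \<Longrightarrow> v' \<noteq> u \<Longrightarrow>
        full R (NM R M v) (NM R M v') \<Longrightarrow> False"
begin

text \<open>The case \<open>a = b\<close> stands for a single vertex. Apart from it, pairs inside
  \<open>M - X\<close> are left out, which keeps the number of pairs linear in \<open>card M\<close>
  for fixed \<open>X\<close>.\<close>

definition pairs :: "('a \<times> 'a) set" where
  "pairs = {(a, b). a \<in> M \<and> b \<in> M \<and> (a \<in> X \<or> b \<in> X \<or> a = b) \<and> \<not> R a a \<and> \<not> R b b \<and> \<not> R a b}"

lemma pairs_card: "finite pairs" "card pairs \<le> card M + 2 * card X * card M"
proof -
  have fX: "finite X" using XM fin finite_subset by blast
  have sub: "pairs \<subseteq> (X \<times> M \<union> M \<times> X) \<union> (\<lambda>a. (a, a)) ` M" by (auto simp: pairs_def)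
  have f: "finite ((X \<times> M \<union> M \<times> X) \<union> (\<lambda>a. (a, a)) ` M)" using fin fX by simp
  show "finite pairs" by (rule finite_subset[OF sub f])
  have "card pairs \<le> card ((X \<times> M \<union> M \<times> X) \<union> (\<lambda>a. (a, a)) ` M)" by (rule card_mono[OF f sub])
  also have "\<dots> \<le> card (X \<times> M \<union> M \<times> X) + card ((\<lambda>a. (a, a)) ` M)" by (rule card_Un_le)
  also have "\<dots> \<le> (card (X \<times> M) + card (M \<times> X)) + card M"
    by (rule add_mono[OF card_Un_le card_image_le[OF fin(1)]])
  finally show "card pairs \<le> card M + 2 * card X * card M" by (simp add: card_cartesian_product algebra_simps)
qed

text \<open>Outside \<open>X\<close>, neighbours inherit the label; so if both \<open>a\<close> and
  \<open>b\<close> were outside \<open>X\<close>, they would have the same label and coincide by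
  \<open>label_inj\<close>.\<close>

lemma pairs_relevant:
  assumes "u \<in> F" "v \<in> F" "L u = L v" "a \<in> NM R M u" "b \<in> NM R M v" "\<not> R a b"
  shows "(a, b) \<in> pairs"
proof -
  have ab: "a \<in> M" "b \<in> M" "\<not> R a a" "\<not> R b b" "R u a" "R v b"
    using assms R_sym unfolding NM_def by blast+
  have "a = b" if "a \<notin> X" "b \<notin> X"
  proof -
    have "L u = L a" "L v = L b" using label[of u a] label[of v b] ab assms(1,2) that by blast+
    then show ?thesis using label_inj ab that assms(3) unfolding inj_on_def by auto
  qed
  then show ?thesis using ab assms(6) unfolding pairs_def by blast
qed

lemma label_edge: "u \<in> F \<Longrightarrow> v \<in> F \<Longrightarrow> R u v \<Longrightarrow> L u = L v"
  using label[of u v] disj XM by blast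

definition cover :: "'a set set" where
  "cover = (SOME K. clique_cover R K F \<and> card K = alp R F)"

lemma cover: "clique_cover R cover F" "card cover = alp R F" "finite cover"
proof -
  have *: "clique_cover R cover F \<and> card cover = alp R F"
    unfolding cover_def by (rule someI_ex[OF forest_clique_cover[OF fin(2) sy forest]])
  then show "clique_cover R cover F" "card cover = alp R F" by simp_all
  then show "finite cover" using clique_cover_finite[OF fin(2)] by blast
qed

lemma cover_disjoint: "c \<in> cover \<Longrightarrow> d \<in> cover \<Longrightarrow> x \<in> c \<Longrightarrow> x \<in> d \<Longrightarrow> c = d"
  using cover(1) unfolding clique_cover_def pairwise_def disjnt_def by blast

lemma cover_sub: "c \<in> cover \<Longrightarrow> c \<subseteq> F"
  using cover(1) unfolding clique_cover_def by blast

lemma cover_cases: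
  assumes "c \<in> cover"
  obtains u where "c = {u}" "u \<in> F" | u v where "c = {u, v}" "u \<noteq> v" "R u v" "u \<in> F" "v \<in> F"
proof -
  have "(\<exists>u. c = {u}) \<or> (\<exists>u v. u \<noteq> v \<and> R u v \<and> c = {u, v})"
    using cover(1) assms unfolding clique_cover_def by blast
  then show ?thesis using that cover_sub[OF assms] by blast
qed

text \<open>A summand is 1 exactly for a clique that \<open>J\<close> misses. As the cover has
  \<open>alp R F\<close> cliques, the sum is the loss caused by the pair, and it stays below
  \<open>card M\<close> because otherwise the pair would have been made adjacent.\<close>

lemma deficiency:
  assumes "(a, b) \<in> pairs"
  obtains J where "J \<subseteq> F - nbrs R {a, b}" "indep R J" "(\<Sum>c\<in>cover. 1 - card (J \<inter> c)) \<le> card M"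
proof -
  obtain J where J: "J \<subseteq> F - nbrs R {a, b}" "indep R J" "card J = alp R (F - nbrs R {a, b})"
    by (rule alp_obtain[of "F - nbrs R {a, b}" R]) (use fin in auto)
  have "card J = (\<Sum>c\<in>cover. card (J \<inter> c))" using J(1) by (intro clique_cover_card[OF fin(2) cover(1)]) auto
  then have "(\<Sum>c\<in>cover. 1 - card (J \<inter> c)) + card J = (\<Sum>c\<in>cover. (1 - card (J \<inter> c)) + card (J \<inter> c))"
    by (simp only: sum.distrib)
  also have "\<dots> = (\<Sum>c\<in>cover. 1)"
    using clique_cover_hit[OF sy cover(1) J(2)] by (intro sum.cong refl) simp
  finally have "(\<Sum>c\<in>cover. 1 - card (J \<inter> c)) + card J = alp R F" using cover(2) by simp
  moreover have "alp R F < card J + card M" using no_ban[of a b] assms J(3) unfolding pairs_def by auto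
  ultimately show ?thesis using that J by auto
qed

definition hit :: "'a set set" where
  "hit = {c \<in> cover. \<exists>(a, b)\<in>pairs. c \<subseteq> nbrs R {a, b}}"

text \<open>A clique inside the neighbourhood of a pair is missed by the set \<open>J\<close> of
  that pair, so each pair accounts for at most \<open>card M\<close> cliques.\<close>

lemma card_hit: "card hit \<le> card pairs * card M"
proof -
  have "card {c \<in> cover. c \<subseteq> nbrs R {a, b}} \<le> card M" if ab: "(a, b) \<in> pairs" for a b
  proof -
    obtain J where J: "J \<subseteq> F - nbrs R {a, b}" "(\<Sum>c\<in>cover. 1 - card (J \<inter> c)) \<le> card M"
      using deficiency[OF ab] .
    have "card {c \<in> cover. c \<subseteq> nbrs R {a, b}} = (\<Sum>c | c \<in> cover \<and> c \<subseteq> nbrs R {a, b}. 1 - card (J \<inter> c))"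
    proof -
      have "J \<inter> c = {}" if "c \<subseteq> nbrs R {a, b}" for c using J(1) that by blast
      then show ?thesis by simp
    qed
    also have "\<dots> \<le> (\<Sum>c\<in>cover. 1 - card (J \<inter> c))" using cover(3) by (intro sum_mono2) auto
    finally show ?thesis using J(2) by simp
  qed
  then have "(\<Sum>p\<in>pairs. card {c \<in> cover. c \<subseteq> nbrs R {fst p, snd p}}) \<le> card pairs * card M"
    using sum_bounded_above[of pairs "\<lambda>p. card {c \<in> cover. c \<subseteq> nbrs R {fst p, snd p}}" "card M"] by auto
  moreover have "hit = (\<Union>p\<in>pairs. {c \<in> cover. c \<subseteq> nbrs R {fst p, snd p}})"
    unfolding hit_def split_def by blast
  then have "card hit \<le> (\<Sum>p\<in>pairs. card {c \<in> cover. c \<subseteq> nbrs R {fst p, snd p}})"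
    using card_UN_le[OF pairs_card(1)] by simp
  ultimately show ?thesis by linarith
qed

text \<open>The one kind of unhit clique with degree sum 1 + 3 = 4, which does not exceed two per
  vertex and so escapes the count of degrees.\<close>

definition pendant :: "'a set \<Rightarrow> 'a \<Rightarrow> 'a \<Rightarrow> bool" where
  "pendant c u v \<longleftrightarrow> c = {u, v} \<and> u \<noteq> v \<and> u \<in> F \<and> v \<in> F \<and> R u v \<and> NF R F v = {u} \<and> card (NF R F u) = 3"

definition total :: "'a set \<Rightarrow> nat" where
  "total c = (\<Sum>w\<in>c. card (NF R F w))"

lemma finite_NF: "finite (NF R F u)"
  using fin by (simp add: NF_def)

lemma card_NF_pos: "u \<in> F \<Longrightarrow> v \<in> F \<Longrightarrow> R u v \<Longrightarrow> 1 \<le> card (NF R F u)"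
proof -
  assume "u \<in> F" "v \<in> F" "R u v"
  then have "NF R F u \<noteq> {}" unfolding NF_def by blast
  then show ?thesis using finite_NF[of u] by (simp add: Suc_le_eq card_gt_0_iff)
qed

lemma total_ge: "c \<in> cover \<Longrightarrow> 2 * card c \<le> total c + 2"
proof (erule cover_cases)
  fix u v assume c: "c = {u, v}" "u \<noteq> v" "R u v" "u \<in> F" "v \<in> F"
  then show ?thesis using card_NF_pos[of u v] card_NF_pos[of v u] R_sym[of u v] by (simp add: total_def)
qed auto

text \<open>In an unhit clique a single vertex has no usable neighbours in \<open>M\<close>, and two
  vertices have completely joined ones. So only a degree of at least three can have prevented
  folding, and the sum exceeds two per vertex unless the degrees are 3 and 1.\<close>

lemma not_hit:
  assumes "c \<in> cover" "c \<notin> hit"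
  shows "2 * card c + 1 \<le> total c \<or> (\<exists>u v. pendant c u v)"
  using assms(1)
proof (cases rule: cover_cases)
  case (1 u)
  have nm: "NM R M u = {}"
  proof (rule ccontr)
    assume "NM R M u \<noteq> {}"
    then obtain a where a: "a \<in> NM R M u" by blast
    then have "(a, a) \<in> pairs" using 1 by (intro pairs_relevant[of u u]) (auto simp: NM_def)
    moreover have "c \<subseteq> nbrs R {a, a}" using a 1 unfolding NM_def nbrs_def by auto
    ultimately show False using assms unfolding hit_def by blast
  qed
  then obtain w where w: "w \<in> F" "R u w" using no_isolated[OF 1(2)] unfolding NF_def by blast
  \<comment> \<open>Folding with \<open>u\<close> in the second place requires no bound on the
    degree of \<open>w\<close>, because \<open>NM R M u\<close> is empty.\<close>
  have "\<not> card (NF R F u) \<le> 2"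
    using no_eliminate[of w u] w 1(2) R_sym nm by (auto simp: full_def)
  then show ?thesis using 1 by (simp add: total_def)
next
  case (2 u v)
  have f: "full R (NM R M u) (NM R M v)"
  proof (rule ccontr)
    assume "\<not> full R (NM R M u) (NM R M v)"
    then obtain a b where ab: "a \<in> NM R M u" "b \<in> NM R M v" "\<not> R a b" unfolding full_def by blast
    then have "(a, b) \<in> pairs" using 2 label_edge[of u v] by (intro pairs_relevant[of u v]) auto
    moreover have "c \<subseteq> nbrs R {a, b}" using ab 2 unfolding NM_def nbrs_def by auto
    ultimately show False using assms unfolding hit_def by blast
  qed
  have f': "full R (NM R M v) (NM R M u)" using f R_sym unfolding full_def by blast
  have vu: "R v u" using 2 R_sym by blast
  let ?a = "card (NF R F u)" and ?b = "card (NF R F v)"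
  have tot: "total c = ?a + ?b" "card c = 2" using 2 by (simp_all add: total_def)
  have pos: "1 \<le> ?a" "1 \<le> ?b" using card_NF_pos 2 vu by auto
  have big: "\<not> (?a \<le> 2 \<and> ?b \<le> 2)" using no_eliminate[OF 2(4,5,3) f] by blast
  have leaf: "NF R F y = {x}" if y: "card (NF R F y) = 1" "R y x" "x \<in> F" for x y
  proof -
    obtain z where "NF R F y = {z}" using y(1) by (auto simp: card_1_singleton_iff)
    moreover have "x \<in> NF R F y" using y by (simp add: NF_def)
    ultimately show ?thesis by simp
  qed
  consider "5 \<le> ?a + ?b" | "?a = 3" "?b = 1" | "?a = 1" "?b = 3" using pos big by linarith
  then show ?thesis
  proof cases
    case a: 1
    then show ?thesis using tot by simp
  next
    case b: 2
    then have "pendant c u v" using 2 leaf[of v u] vu unfolding pendant_def by auto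
    then show ?thesis by blast
  next
    case c: 3
    then have "pendant c v u" using 2 leaf[of u v] vu unfolding pendant_def by auto
    then show ?thesis by blast
  qed
qed

definition big :: "'a set set" where
  "big = {c \<in> cover - hit. 2 * card c + 1 \<le> total c}"

lemma sum_cover_card: "(\<Sum>c\<in>cover. card c) = card F"
  using clique_cover_card[OF fin(2) cover(1), of F] cover_sub by (simp add: Int_absorb1 cong: sum.cong)

text \<open>The degree sum of \<open>F\<close> is at most two per vertex. Clique by clique, big ones
  exceed this by at least one, pendant ones meet it exactly, and hit ones fall short by at most
  two.\<close>

lemma card_big: "card big \<le> 2 * card hit"
proof -
  have sub: "hit \<subseteq> cover" "big \<subseteq> cover" by (auto simp: hit_def big_def)
  have "2 * card c + of_bool (c \<in> big) \<le> total c + 2 * of_bool (c \<in> hit)" if "c \<in> cover" for c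
  proof (cases "c \<in> hit")
    case True
    then have "c \<notin> big" by (simp add: big_def)
    then show ?thesis using total_ge[OF that] True by simp
  next
    case False
    have "2 * card c \<le> total c" if "pendant c u v" for u v
      using that unfolding pendant_def total_def by auto
    then show ?thesis using not_hit[OF that False] False by (auto simp: big_def)
  qed
  then have "(\<Sum>c\<in>cover. 2 * card c + of_bool (c \<in> big)) \<le> (\<Sum>c\<in>cover. total c + 2 * of_bool (c \<in> hit))"
    by (rule sum_mono)
  moreover have "(\<Sum>c\<in>cover. total c) = e2 R F"
    unfolding total_def e2_def deg_NF by (rule clique_cover_sum[OF fin(2) cover(1), symmetric])
  moreover have "e2 R F \<le> 2 * card F"
  proof (cases "F = {}")
    case False
    then show ?thesis using forest unfolding forest_def by fastforce
  qed (simp add: e2_def)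
  moreover have "(\<Sum>c\<in>cover. of_bool (c \<in> T)) = card T" if "T \<subseteq> cover" for T
    using that cover(3) by (simp add: of_bool_def sum.If_cases Int_absorb1)
  ultimately show ?thesis
    using sub sum_cover_card by (simp add: sum.distrib flip: sum_distrib_left)
qed

section \<open>Links between pendant cliques\<close>

definition pend :: "'a set set" where
  "pend = cover - hit - big"

definition ctr :: "'a set \<Rightarrow> 'a" where
  "ctr c = (SOME u. \<exists>v. pendant c u v)"

definition lf :: "'a set \<Rightarrow> 'a" where
  "lf c = (SOME v. pendant c (ctr c) v)"

lemma pend: "c \<in> pend \<Longrightarrow> pendant c (ctr c) (lf c)"
proof -
  assume "c \<in> pend"
  then have "\<exists>u v. pendant c u v" using not_hit[of c] by (auto simp: pend_def big_def)
  then have "\<exists>v. pendant c (ctr c) v" unfolding ctr_def by (rule someI_ex)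
  then show ?thesis unfolding lf_def by (rule someI_ex)
qed

lemma pend_cover: "c \<in> pend \<Longrightarrow> c \<in> cover"
  by (simp add: pend_def)

lemma finite_pend: "finite pend"
  using cover(3) by (simp add: pend_def)

lemma inj_ctr: "inj_on ctr pend"
proof (rule inj_onI)
  fix c d assume "c \<in> pend" "d \<in> pend" "ctr c = ctr d"
  then show "c = d" using pend[of c] pend[of d] cover_disjoint[of c d "ctr c"] pend_cover
    unfolding pendant_def by auto
qed

text \<open>Ordered pairs, so that their number is a sum of degrees, \<open>e2\<close> on the
  centres.\<close>

definition links :: "('a set \<times> 'a set) set" where
  "links = {(c, d). c \<in> pend \<and> d \<in> pend \<and> R (ctr c) (ctr d)}"

lemma links_Sigma: "links = Sigma pend (\<lambda>c. {d \<in> pend. R (ctr c) (ctr d)})"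
  by (auto simp: links_def)

lemma finite_links: "finite links"
  unfolding links_Sigma using finite_pend by simp

lemma out_card: "card {d \<in> pend. R (ctr c) (ctr d)} = deg R (ctr ` pend) (ctr c)"
proof -
  have "{y \<in> ctr ` pend. R (ctr c) y} = ctr ` {d \<in> pend. R (ctr c) (ctr d)}" by auto
  moreover have "inj_on ctr {d \<in> pend. R (ctr c) (ctr d)}" using inj_ctr by (rule inj_on_subset) auto
  ultimately show ?thesis by (simp add: deg_def card_image)
qed

lemma card_links: "card links = e2 R (ctr ` pend)"
  unfolding links_Sigma e2_def using finite_pend inj_ctr by (simp add: sum.reindex out_card)

lemma ctr_F: "ctr ` pend \<subseteq> F"
  using pend unfolding pendant_def by auto

lemma out_le: "c \<in> pend \<Longrightarrow> card {d \<in> pend. R (ctr c) (ctr d)} \<le> 3"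
proof -
  assume "c \<in> pend"
  then have "card (NF R F (ctr c)) = 3" using pend unfolding pendant_def by blast
  moreover have "{v \<in> ctr ` pend. R (ctr c) v} \<subseteq> NF R F (ctr c)" using ctr_F unfolding NF_def by blast
  ultimately show ?thesis using card_mono[OF finite_NF] unfolding out_card deg_def by metis
qed

text \<open>A centre has degree three: one edge goes to its leaf, and the other two lead to centres
  or to vertices \<open>Z\<close> of hit and big cliques, never to another leaf. Since
  \<open>T \<union> Z\<close> spans a forest, the edges between \<open>T\<close> and
  \<open>Z\<close> cannot use up this supply. The factor 4 comes from cliques with two vertices,
  counted twice.\<close>

lemma many_links: "2 * card pend \<le> card links + 4 * (card hit + card big)"
proof -
  define T where "T = ctr ` pend"
  define Z where "Z = \<Union>(hit \<union> big)"
  have sub: "hit \<union> big \<subseteq> cover" by (auto simp: hit_def big_def)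
  have fT: "finite T" "T \<subseteq> F" using finite_pend ctr_F by (simp_all add: T_def)
  have ZF: "Z \<subseteq> F" using sub cover_sub unfolding Z_def by blast
  then have fZ: "finite Z" using fin finite_subset by blast
  have TZ: "T \<inter> Z = {}"
  proof (rule ccontr)
    assume "T \<inter> Z \<noteq> {}"
    then obtain c d where cd: "c \<in> pend" "d \<in> hit \<union> big" "ctr c \<in> d" unfolding T_def Z_def by blast
    then have "c = d" using pend[of c] cover_disjoint[of c d "ctr c"] pend_cover sub unfolding pendant_def by auto
    then show False using cd by (auto simp: pend_def)
  qed
  have cZ: "card Z \<le> 2 * (card hit + card big)"
  proof -
    have "card c \<le> 2" if "c \<in> cover" for c using that by (cases rule: cover_cases) (auto simp: card_insert_if)
    then have "(\<Sum>c\<in>hit \<union> big. card c) \<le> card (hit \<union> big) * 2"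
      using sub by (intro order_trans[OF sum_bounded_above[where K=2]]) auto
    moreover have "card Z \<le> (\<Sum>c\<in>hit \<union> big. card c)"
      unfolding Z_def using card_Union_le_sum_card by blast
    moreover have "card (hit \<union> big) \<le> card hit + card big" by (rule card_Un_le)
    ultimately show ?thesis by simp
  qed
  have deg: "2 \<le> deg R T x + deg R Z x" if xT: "x \<in> T" for x
  proof -
    obtain c where c: "c \<in> pend" "x = ctr c" using xT unfolding T_def by blast
    have p: "card (NF R F x) = 3" using pend[OF c(1)] c(2) unfolding pendant_def by blast
    have "NF R F x \<subseteq> insert (lf c) ({v \<in> T. R x v} \<union> {v \<in> Z. R x v})"
    proof
      fix w assume w: "w \<in> NF R F x"
      then have wF: "w \<in> F" "R x w" unfolding NF_def by auto
      then obtain d where d: "d \<in> cover" "w \<in> d" using cover(1) unfolding clique_cover_def by blast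
      show "w \<in> insert (lf c) ({v \<in> T. R x v} \<union> {v \<in> Z. R x v})"
      proof (cases "d \<in> pend")
        case False
        then have "d \<in> hit \<union> big" using d unfolding pend_def by blast
        then show ?thesis using d wF unfolding Z_def by blast
      next
        case True
        have pd: "d = {ctr d, lf d}" "NF R F (lf d) = {ctr d}" using pend[OF True] unfolding pendant_def by blast+
        show ?thesis
        proof (cases "w = ctr d")
          case True
          then show ?thesis using \<open>d \<in> pend\<close> wF unfolding T_def by blast
        next
          case False
          then have wl: "w = lf d" using d pd by blast
          have "x \<in> NF R F (lf d)" using wF wl R_sym xT fT unfolding NF_def by blast
          then have "ctr d = ctr c" using pd c by simp
          then have "d = c" using inj_ctr \<open>d \<in> pend\<close> c(1) by (simp add: inj_on_def)
          then show ?thesis using wl by simp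
        qed
      qed
    qed
    then have "card (NF R F x) \<le> card (insert (lf c) ({v \<in> T. R x v} \<union> {v \<in> Z. R x v}))"
      using fT fZ by (intro card_mono) auto
    also have "\<dots> \<le> Suc (card ({v \<in> T. R x v} \<union> {v \<in> Z. R x v}))" by (rule card_insert_le_m1) simp_all
    also have "\<dots> \<le> Suc (deg R T x + deg R Z x)" unfolding deg_def using card_Un_le by simp
    finally show ?thesis using p by simp
  qed
  have "(\<Sum>x\<in>T. 2) \<le> (\<Sum>x\<in>T. deg R T x + deg R Z x)" using deg by (rule sum_mono)
  then have 1: "2 * card T \<le> e2 R T + (\<Sum>x\<in>T. deg R Z x)" by (simp add: sum.distrib e2_def)
  have "e2 R (T \<union> Z) \<le> 2 * card (T \<union> Z)"
  proof (cases "T \<union> Z = {}")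
    case False
    have "T \<union> Z \<subseteq> F" using fT(2) ZF by simp
    with False have "e2 R (T \<union> Z) + 2 \<le> 2 * card (T \<union> Z)" using forest unfolding forest_def by metis
    then show ?thesis by simp
  qed (simp add: e2_def)
  moreover have "card (T \<union> Z) = card T + card Z" using fT fZ TZ by (intro card_Un_disjoint) auto
  ultimately have 2: "e2 R T + 2 * (\<Sum>x\<in>T. deg R Z x) \<le> 2 * (card T + card Z)"
    using e2_union[OF fT(1) fZ TZ sy] by simp
  have "card T = card pend" unfolding T_def by (rule card_image[OF inj_ctr])
  moreover have "card links = e2 R T" unfolding T_def by (rule card_links)
  ultimately show ?thesis using 1 2 cZ by simp
qed

text \<open>As no edge can be cut, the leaves of a link have non-adjacent neighbours
  \<open>a\<close>, \<open>b\<close> in \<open>M\<close>. The set \<open>J\<close> of that pair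
  avoids both leaves and cannot contain both centres, so it misses one of the two cliques.
  \<open>J\<close> misses at most \<open>card M\<close> cliques, and each lies in at most three
  links in either direction, hence the 6.\<close>

lemma few_links: "card links \<le> card pairs * (6 * card M)"
proof -
  define E where "E p = {(c, d) \<in> links. fst p \<in> NM R M (lf c) \<and> snd p \<in> NM R M (lf d)}" for p
  have "card (E (a, b)) \<le> 6 * card M" if ab: "(a, b) \<in> pairs" for a b
  proof -
    obtain J where J: "J \<subseteq> F - nbrs R {a, b}" "indep R J" "(\<Sum>c\<in>cover. 1 - card (J \<inter> c)) \<le> card M"
      using deficiency[OF ab] .
    define \<delta> where "\<delta> c = 1 - card (J \<inter> c)" for c
    have one: "1 \<le> \<delta> c + \<delta> d" if "(c, d) \<in> E (a, b)" for c d
    proof -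
      have cd: "c \<in> pend" "d \<in> pend" "R (ctr c) (ctr d)" "lf c \<in> nbrs R {a, b}" "lf d \<in> nbrs R {a, b}"
        using that unfolding E_def links_def NM_def nbrs_def by auto
      have "c = {ctr c, lf c}" "d = {ctr d, lf d}" using pend cd unfolding pendant_def by blast+
      then have "J \<inter> c \<subseteq> {ctr c}" "J \<inter> d \<subseteq> {ctr d}" using J(1) cd by blast+
      moreover have "\<not> (ctr c \<in> J \<and> ctr d \<in> J)" using J(2) cd(3) unfolding indep_def by blast
      ultimately have "J \<inter> c = {} \<or> J \<inter> d = {}" by blast
      then show ?thesis unfolding \<delta>_def by auto
    qed
    have Esub: "E (a, b) \<subseteq> links" by (auto simp: E_def)
    have "card (E (a, b)) = (\<Sum>p\<in>E (a, b). 1)" by simp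
    also have "\<dots> \<le> (\<Sum>p\<in>E (a, b). \<delta> (fst p) + \<delta> (snd p))"
      using one by (intro sum_mono) auto
    also have "\<dots> \<le> (\<Sum>p\<in>links. \<delta> (fst p) + \<delta> (snd p))"
      using Esub finite_links by (intro sum_mono2) auto
    also have "\<dots> = (\<Sum>p\<in>links. \<delta> (fst p)) + (\<Sum>p\<in>links. \<delta> (snd p))" by (rule sum.distrib)
    also have "(\<Sum>p\<in>links. \<delta> (snd p)) = (\<Sum>p\<in>links. \<delta> (fst p))"
      by (rule sum.reindex_bij_witness[of _ prod.swap prod.swap]) (auto simp: links_def R_sym)
    also have "(\<Sum>p\<in>links. \<delta> (fst p)) \<le> 3 * card M"
    proof -
      have "(\<Sum>p\<in>links. \<delta> (fst p)) = (\<Sum>c\<in>pend. \<Sum>d | d \<in> pend \<and> R (ctr c) (ctr d). \<delta> c)"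
        unfolding links_Sigma using finite_pend
          sum.Sigma[of pend "\<lambda>c. {d \<in> pend. R (ctr c) (ctr d)}" "\<lambda>c d. \<delta> c"] by (simp add: split_def)
      also have "\<dots> \<le> (\<Sum>c\<in>pend. 3 * \<delta> c)" using out_le by (intro sum_mono) simp
      also have "\<dots> \<le> (\<Sum>c\<in>cover. 3 * \<delta> c)" using cover(3) pend_cover by (intro sum_mono2) auto
      also have "\<dots> = 3 * (\<Sum>c\<in>cover. \<delta> c)" by (simp only: sum_distrib_left)
      also have "\<dots> \<le> 3 * card M" using J(3) unfolding \<delta>_def by simp
      finally show ?thesis .
    qed
    finally show ?thesis by simp
  qed
  then have "(\<Sum>p\<in>pairs. card (E p)) \<le> card pairs * (6 * card M)"
    using sum_bounded_above[of pairs "\<lambda>p. card (E p)" "6 * card M"] by auto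
  moreover have "links \<subseteq> (\<Union>p\<in>pairs. E p)"
  proof
    fix p assume p: "p \<in> links"
    then obtain c d where cd: "p = (c, d)" "c \<in> pend" "d \<in> pend" "R (ctr c) (ctr d)" unfolding links_def by blast
    have c: "ctr c \<in> F" "lf c \<in> F" "R (ctr c) (lf c)" "NF R F (lf c) = {ctr c}" "card (NF R F (ctr c)) = 3"
      using pend[OF cd(2)] unfolding pendant_def by auto
    have d: "ctr d \<in> F" "lf d \<in> F" "R (ctr d) (lf d)" "NF R F (lf d) = {ctr d}" "card (NF R F (ctr d)) = 3"
      using pend[OF cd(3)] unfolding pendant_def by auto
    \<comment> \<open>A leaf has degree one and a centre degree three.\<close>
    have "lf c \<noteq> ctr d" "lf d \<noteq> ctr c" using c d by auto
    then have "\<not> full R (NM R M (lf c)) (NM R M (lf d))"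
      using no_unlink[OF c(1) d(1) c(2) d(2) cd(4) c(4) d(4)] by blast
    then obtain a b where ab: "a \<in> NM R M (lf c)" "b \<in> NM R M (lf d)" "\<not> R a b" unfolding full_def by blast
    have "L (lf c) = L (lf d)" using label_edge c d cd(4) by metis
    then have "(a, b) \<in> pairs" using pairs_relevant[OF c(2) d(2) _ ab] by blast
    then show "p \<in> (\<Union>p\<in>pairs. E p)" using p ab cd unfolding E_def by force
  qed
  then have "card links \<le> card (\<Union>p\<in>pairs. E p)"
    using pairs_card(1) finite_links by (intro card_mono) (auto simp: E_def intro: finite_subset[of _ links])
  moreover have "\<dots> \<le> (\<Sum>p\<in>pairs. card (E p))" by (rule card_UN_le[OF pairs_card(1)])
  ultimately show ?thesis by linarith
qed

theorem card_reduced: "card F \<le> 24 * (card M + 2 * card X * card M) * card M"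
proof -
  define q where "q = card pairs * card M"
  have "cover = hit \<union> big \<union> pend" by (auto simp: pend_def hit_def big_def)
  then have "card cover \<le> card hit + card big + card pend"
    using card_Un_le[of "hit \<union> big" pend] card_Un_le[of hit big] by simp
  moreover have "card links \<le> 6 * q" using few_links by (simp add: q_def)
  moreover have "card hit \<le> q" using card_hit by (simp add: q_def)
  \<comment> \<open>At most \<open>q\<close> cliques are hit, \<open>2 * q\<close> are big and
    \<open>9 * q\<close> are pendant: twice the number of the last is at most
    \<open>6 * q + 4 * (q + 2 * q)\<close>.\<close>
  ultimately have "card cover \<le> 12 * q" using card_big many_links by simp
  moreover have "card F \<le> 2 * card cover"
  proof -
    have "card c \<le> 2" if "c \<in> cover" for c using that by (cases rule: cover_cases) (auto simp: card_insert_if)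
    then have "(\<Sum>c\<in>cover. card c) \<le> card cover * 2" using sum_bounded_above[of cover card 2] by simp
    then show ?thesis using sum_cover_card by simp
  qed
  moreover have "q \<le> (card M + 2 * card X * card M) * card M"
    unfolding q_def using pairs_card(2) by (rule mult_le_mono1)
  ultimately have "card F \<le> 24 * ((card M + 2 * card X * card M) * card M)" by linarith
  then show ?thesis by (simp only: mult.assoc)
qed

end

section \<open>Comparison of numbers and iteration with bounded growth\<close>

lemma PT_less_nat [pt]: assumes f: "PT f" and g: "PT g" shows "PT (\<lambda>x. (f x :: nat) < g x)"
proof -
  \<comment> \<open>Bits arrive from the least significant one: the first component answers the
    comparison of the low parts, and a difference in a higher bit overrides it. A 1 left over in the
    second number decides at the end.\<close>
  define F where "F = (\<lambda>b (s :: bool \<times> bool list). case snd s of [] \<Rightarrow> (fst s \<and> \<not> b, [])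
     | c # cs \<Rightarrow> (if b = c then fst s else c, cs))"
  have pos: "list_ex (\<lambda>b. b) cs \<longleftrightarrow> bval cs \<noteq> 0" for cs by (induction cs) auto
  have e: "(list_ex (\<lambda>b. b) (snd (fold F bs (l, cs))) \<or> fst (fold F bs (l, cs)))
    \<longleftrightarrow> bval bs < bval cs \<or> bval bs = bval cs \<and> l" for bs cs l
  proof (induction bs arbitrary: cs l)
    case Nil
    then show ?case by (auto simp: pos)
  next
    case (Cons b bs)
    show ?case
    proof (cases cs)
      case Nil
      have "fold F (b # bs) (l, cs) = fold F bs (l \<and> \<not> b, [])" using Nil by (simp add: F_def)
      then show ?thesis using Cons.IH[of "l \<and> \<not> b" "[]"] Nil by auto
    next
      case (Cons c cs')
      have "fold F (b # bs) (l, cs) = fold F bs (if b = c then l else c, cs')" using Cons by (simp add: F_def)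
      then show ?thesis using Cons.IH[of "if b = c then l else c" cs'] Cons by (cases b; cases c) auto
    qed
  qed
  have len: "length (snd (fold F bs s)) \<le> length (snd s)" for bs s
  proof (induction bs arbitrary: s)
    case (Cons b bs)
    have "length (snd (F b s)) \<le> length (snd s)" by (auto simp: F_def split: list.splits)
    then show ?case using Cons[of "F b s"] by simp
  qed simp
  have "PT (\<lambda>x. fold F (nbits (f x)) (False, nbits (g x)))"
  proof (rule PT_fold[where q="\<lambda>x. 5 + sz (g x) * 4"])
    show "psz (\<lambda>x. 5 + sz (g x) * 4)" by (intro psz_intros PT_size[OF g])
    show "PT (\<lambda>p. F (fst (snd p)) (snd (snd p)))" unfolding F_def by (intro pt)
    fix x k
    let ?s = "fold F (take k (nbits (f x))) (False, nbits (g x))"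
    have "length (snd ?s) \<le> sz (g x)" using len[of "take k (nbits (f x))" "(False, nbits (g x))"] sz_nat_bits(2)[of "g x"] by simp
    then show "sz ?s \<le> 5 + sz (g x) * 4"
      using sz_bits[of "snd ?s"] sz_bool(1)[of "fst ?s"] by (cases ?s) simp
  qed (intro pt f g)+
  then have "PT (\<lambda>x. list_ex (\<lambda>b. b) (snd (fold F (nbits (f x)) (False, nbits (g x)))) \<or> fst (fold F (nbits (f x)) (False, nbits (g x))))"
    by (intro pt)
  then show ?thesis by (simp only: e) simp
qed

lemma sz_filter: "sz (filter P l) \<le> sz l"
  by (induction l) auto

text \<open>Growth by an additive amount that does not depend on the accumulator stays polynomial.
  The invariant \<open>J\<close> is there because such an amount is often available only for states
  that occur.\<close>

lemma PT_fold_grow: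
  fixes f :: "'z::enc \<Rightarrow> 'x::enc \<Rightarrow> 'a::enc \<Rightarrow> 'a"
  assumes f: "PT (\<lambda>p. f (fst p) (fst (snd p)) (snd (snd p)))" and g: "PT g" and a: "PT a"
    and c: "psz c" and J0: "\<And>z. J z (a z)"
    and J: "\<And>z x s. J z s \<Longrightarrow> x \<in> set (g z) \<Longrightarrow> J z (f z x s) \<and> sz (f z x s) \<le> sz s + c z"
  shows "PT (\<lambda>z. fold (f z) (g z) (a z))"
proof (rule PT_fold[OF f g a])
  have s: "J z (fold (f z) xs s) \<and> sz (fold (f z) xs s) \<le> sz s + length xs * c z"
    if "J z s" "set xs \<subseteq> set (g z)" for z xs s
    using that
  proof (induction xs arbitrary: s)
    case (Cons x xs)
    note st = J[OF Cons.prems(1), of x]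
    then show ?case using Cons.IH[of "f z x s"] Cons.prems by fastforce
  qed simp
  show "psz (\<lambda>z. sz (a z) + sz (g z) * c z)" by (intro psz_intros PT_size[OF g] PT_size[OF a] c)
  fix z k assume "k \<le> length (g z)"
  then have "length (take k (g z)) \<le> sz (g z)" using length_le_sz[of "g z"] by simp
  then have "length (take k (g z)) * c z \<le> sz (g z) * c z" by (rule mult_le_mono1)
  then show "sz (fold (f z) (take k (g z)) (a z)) \<le> sz (a z) + sz (g z) * c z"
    using s[OF J0, of "take k (g z)" z] set_take_subset[of k "g z"] by linarith
qed

lemma PT_funpow_grow:
  fixes f :: "'z::enc \<Rightarrow> 'a::enc \<Rightarrow> 'a"
  assumes f: "PT (\<lambda>p. f (fst p) (snd p))" and g: "PT g" and a: "PT a"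
    and c: "psz c" and J0: "\<And>z. J z (a z)"
    and J: "\<And>z s. J z s \<Longrightarrow> J z (f z s) \<and> sz (f z s) \<le> sz s + c z"
  shows "PT (\<lambda>z. (f z ^^ length (g z)) (a z))"
proof -
  have e: "fold (\<lambda>_. h) xs b = (h ^^ length xs) b" for h :: "'a \<Rightarrow> 'a" and xs :: "'c list" and b
    by (induction xs arbitrary: b) (simp_all add: funpow_swap1)
  have "PT (\<lambda>z. fold (\<lambda>_. f z) (g z) (a z))"
  proof (rule PT_fold_grow[where J=J])
    show "PT (\<lambda>p. f (fst p) (snd (snd p)))" by (intro PT_comp2[OF f] pt)
  qed (use assms in auto)
  then show ?thesis by (simp add: e)
qed

section \<open>The algorithm\<close>

definition adj :: "(nat \<times> nat) list \<Rightarrow> nat \<Rightarrow> nat \<Rightarrow> bool" where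
  "adj E u v \<longleftrightarrow> list_ex (\<lambda>p. fst p = u \<and> snd p = v \<or> fst p = v \<and> snd p = u) E"

lemma PT_adj [pt]: "PT e \<Longrightarrow> PT f \<Longrightarrow> PT g \<Longrightarrow> PT (\<lambda>x. adj (e x) (f x) (g x))"
  by (rule PT_comp3[of adj]) (unfold adj_def, intro pt)

definition nbl :: "(nat \<times> nat) list \<Rightarrow> nat \<Rightarrow> nat list \<Rightarrow> nat list" where
  "nbl E v W = filter (\<lambda>u. adj E v u) W"

lemma PT_nbl [pt]: "PT e \<Longrightarrow> PT f \<Longrightarrow> PT g \<Longrightarrow> PT (\<lambda>x. nbl (e x) (f x) (g x))"
  by (rule PT_comp3[of nbl]) (unfold nbl_def, intro pt)

definition low :: "(nat \<times> nat) list \<Rightarrow> nat list \<Rightarrow> nat list" where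
  "low E W = filter (\<lambda>v. tl (nbl E v W) = []) W"

lemma PT_low [pt]: "PT e \<Longrightarrow> PT g \<Longrightarrow> PT (\<lambda>x. low (e x) (g x))"
  by (rule PT_comp2[of low]) (unfold low_def, intro pt)

definition hd0 :: "nat list \<Rightarrow> nat" where
  "hd0 l = (case l of [] \<Rightarrow> 0 | x # _ \<Rightarrow> x)"

lemma PT_hd0 [pt]: "PT g \<Longrightarrow> PT (\<lambda>x. hd0 (g x))"
  unfolding hd0_def by (intro pt)

text \<open>A vertex of degree at most one if there is one, and any vertex otherwise: appending
  \<open>W\<close> supplies the default.\<close>

definition pick :: "(nat \<times> nat) list \<Rightarrow> nat list \<Rightarrow> nat" where
  "pick E W = hd0 (low E W @ W)"

lemma PT_pick [pt]: "PT e \<Longrightarrow> PT g \<Longrightarrow> PT (\<lambda>x. pick (e x) (g x))"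
  by (rule PT_comp2[of pick]) (unfold pick_def, intro pt)

definition gstep :: "(nat \<times> nat) list \<Rightarrow> nat list \<times> nat list \<Rightarrow> nat list \<times> nat list" where
  "gstep E s = (if fst s = [] then s else
     (filter (\<lambda>u. \<not> (u = pick E (fst s) \<or> adj E (pick E (fst s)) u)) (fst s), pick E (fst s) # snd s))"

definition greedy :: "(nat \<times> nat) list \<Rightarrow> nat list \<Rightarrow> nat list" where
  "greedy E W = snd ((gstep E ^^ length W) (W, []))"

lemma sz_0: "sz (0::nat) = 1"
  by (simp add: sz_nat)

lemma sz_pick: "sz (pick E W) \<le> sz W"
proof -
  have "hd0 l = 0 \<or> hd0 l \<in> set l" for l by (cases l) (simp_all add: hd0_def)
  moreover have "set (low E W @ W) = set W" by (auto simp: low_def)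
  ultimately have "pick E W = 0 \<or> pick E W \<in> set W" unfolding pick_def by metis
  then show ?thesis using sz_elem[of "pick E W" W] sz_pos[of W] by (auto simp: sz_0)
qed

lemma PT_greedy [pt]: "PT e \<Longrightarrow> PT g \<Longrightarrow> PT (\<lambda>x. greedy (e x) (g x))"
proof (rule PT_comp2[of greedy])
  have "PT (\<lambda>p. (gstep (fst p) ^^ length (snd p)) (snd p, [] :: nat list))"
  proof (rule PT_funpow_grow[where c="\<lambda>z. 1 + sz z" and J="\<lambda>z s. sz (fst s) \<le> sz z"])
    show "PT (\<lambda>p. gstep (fst (fst p)) (snd p))" unfolding gstep_def by (intro pt)
    show "psz (\<lambda>z :: (nat \<times> nat) list \<times> nat list. 1 + sz z)" by (intro psz_intros psz_sz)
    show "sz (fst (gstep (fst z) s)) \<le> sz z \<and> sz (gstep (fst z) s) \<le> sz s + (1 + sz z)"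
      if "sz (fst s) \<le> sz z" for z :: "(nat \<times> nat) list \<times> nat list" and s
      using that sz_filter[of "\<lambda>u. \<not> (u = pick (fst z) (fst s) \<or> adj (fst z) (pick (fst z) (fst s)) u)" "fst s"]
        sz_pick[of "fst z" "fst s"] by (cases s) (auto simp: gstep_def)
    show "sz (fst (snd z, [] :: nat list)) \<le> sz z" for z :: "(nat \<times> nat) list \<times> nat list" by (cases z) simp
  qed (intro pt)+
  then show "PT (\<lambda>p. greedy (fst p) (snd p))" unfolding greedy_def by (intro pt)
qed

section \<open>Deleting components and recording cycle vertices\<close>

definition rem :: "(nat \<times> nat) list \<Rightarrow> nat list \<Rightarrow> nat list \<Rightarrow> nat list" where
  "rem E S W = filter (\<lambda>u. \<not> list_ex (\<lambda>x. adj E x u) S) W"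

lemma PT_rem [pt]: "PT e \<Longrightarrow> PT f \<Longrightarrow> PT g \<Longrightarrow> PT (\<lambda>x. rem (e x) (f x) (g x))"
  by (rule PT_comp3[of rem]) (unfold rem_def, intro pt)

definition minus_list :: "nat list \<Rightarrow> nat list \<Rightarrow> nat list" where
  "minus_list F C = filter (\<lambda>v. \<not> v \<in> set C) F"

lemma PT_minus_list [pt]: "PT f \<Longrightarrow> PT g \<Longrightarrow> PT (\<lambda>x. minus_list (f x) (g x))"
  by (rule PT_comp2[of minus_list]) (unfold minus_list_def, intro pt)

definition spread :: "(nat \<times> nat) list \<Rightarrow> nat list \<Rightarrow> nat list \<Rightarrow> nat list" where
  "spread E F C = filter (\<lambda>u. u \<in> set C \<or> list_ex (\<lambda>c. adj E c u) C) F"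

text \<open>\<open>length F\<close> rounds suffice because every round before saturation adds a
  vertex.\<close>

definition comp_list :: "(nat \<times> nat) list \<Rightarrow> nat list \<Rightarrow> nat \<Rightarrow> nat list" where
  "comp_list E F w = (spread E F ^^ length F) [w]"

lemma PT_comp_list [pt]: "PT e \<Longrightarrow> PT f \<Longrightarrow> PT g \<Longrightarrow> PT (\<lambda>x. comp_list (e x) (f x) (g x))"
proof (rule PT_comp3[of comp_list])
  show "PT (\<lambda>p. comp_list (fst p) (fst (snd p)) (snd (snd p)))" unfolding comp_list_def
  proof (rule PT_funpow_grow[where c="\<lambda>z. sz z" and J="\<lambda>_ _. True"])
    show "PT (\<lambda>p. spread (fst (fst p)) (fst (snd (fst p))) (snd p))" unfolding spread_def by (intro pt)
    show "True \<and> sz (spread (fst z) (fst (snd z)) s) \<le> sz s + sz z"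
      for z :: "(nat \<times> nat) list \<times> nat list \<times> nat" and s
      using sz_filter[of "\<lambda>u. u \<in> set s \<or> list_ex (\<lambda>c. adj (fst z) c u) s" "fst (snd z)"]
      by (cases z) (auto simp: spread_def)
  qed (intro pt psz_sz TrueI)+
qed

text \<open>Either \<open>S\<close> does not block the component \<open>C\<close>, or it costs the
  rest \<open>D\<close> at least \<open>card X\<close> vertices. Numbers are compared as lengths of
  lists; appending \<open>X\<close> adds its cardinality.\<close>

definition small_conflict :: "(nat \<times> nat) list \<Rightarrow> nat list \<Rightarrow> nat list \<Rightarrow> nat list \<Rightarrow> nat list \<Rightarrow> bool" where
  "small_conflict E X C D S \<longleftrightarrow> length (greedy E C) \<le> length (greedy E (rem E S C))
     \<or> length (greedy E (rem E S D) @ X) \<le> length (greedy E D)"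

lemma PT_small_conflict [pt]:
  "PT e \<Longrightarrow> PT f \<Longrightarrow> PT g \<Longrightarrow> PT h \<Longrightarrow> PT k \<Longrightarrow> PT (\<lambda>x. small_conflict (e x) (f x) (g x) (h x) (k x))"
  unfolding small_conflict_def by (intro pt)

definition deletable :: "(nat \<times> nat) list \<Rightarrow> nat list \<Rightarrow> nat list \<Rightarrow> nat list \<Rightarrow> bool" where
  "deletable E X C D \<longleftrightarrow> list_all (\<lambda>x1. list_all (\<lambda>x2. list_all (\<lambda>x3. list_all (\<lambda>x4.
     small_conflict E X C D [x1, x2, x3, x4]) X) X) X) X"

lemma PT_deletable [pt]: "PT e \<Longrightarrow> PT f \<Longrightarrow> PT g \<Longrightarrow> PT h \<Longrightarrow> PT (\<lambda>x. deletable (e x) (f x) (g x) (h x))"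
  by (rule PT_comp4[of deletable]) (unfold deletable_def, intro pt)

definition deletable_at :: "(nat \<times> nat) list \<Rightarrow> nat list \<Rightarrow> nat list \<Rightarrow> nat \<Rightarrow> bool" where
  "deletable_at E X F w \<longleftrightarrow> deletable E X (comp_list E F w) (minus_list F (comp_list E F w))"

lemma PT_deletable_at [pt]: "PT e \<Longrightarrow> PT f \<Longrightarrow> PT g \<Longrightarrow> PT h \<Longrightarrow> PT (\<lambda>x. deletable_at (e x) (f x) (g x) (h x))"
  by (rule PT_comp4[of deletable_at]) (unfold deletable_at_def, intro pt)

definition del_step :: "(nat \<times> nat) list \<Rightarrow> nat list \<Rightarrow> nat list \<Rightarrow> nat list" where
  "del_step E X F = (case filter (\<lambda>w. deletable_at E X F w) F of [] \<Rightarrow> F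
     | w # _ \<Rightarrow> minus_list F (comp_list E F w))"

definition del_components :: "(nat \<times> nat) list \<Rightarrow> nat list \<Rightarrow> nat list \<Rightarrow> nat list" where
  "del_components E X F = (del_step E X ^^ length F) F"

lemma PT_del_components [pt]: "PT e \<Longrightarrow> PT f \<Longrightarrow> PT g \<Longrightarrow> PT (\<lambda>x. del_components (e x) (f x) (g x))"
proof (rule PT_comp3[of del_components])
  show "PT (\<lambda>p. del_components (fst p) (fst (snd p)) (snd (snd p)))" unfolding del_components_def
  proof (rule PT_funpow_grow[where c="\<lambda>z. 0" and J="\<lambda>_ _. True"])
    show "PT (\<lambda>p. del_step (fst (fst p)) (fst (snd (fst p))) (snd p))" unfolding del_step_def by (intro pt)
    show "True \<and> sz (del_step (fst z) (fst (snd z)) s) \<le> sz s + 0"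
      for z :: "(nat \<times> nat) list \<times> nat list \<times> nat list" and s
      by (auto simp: del_step_def minus_list_def sz_filter split: list.split)
  qed (intro pt psz_const TrueI)+
qed

text \<open>When no vertex of degree at most one is left, the rest of a pseudoforest is 2-regular,
  and the vertex whose removal opens a cycle is recorded.\<close>

definition peel_step :: "(nat \<times> nat) list \<Rightarrow> nat list \<times> nat list \<Rightarrow> nat list \<times> nat list" where
  "peel_step E s = (filter (\<lambda>u. \<not> u = pick E (fst s)) (fst s),
     if low E (fst s) = [] \<and> \<not> fst s = [] then pick E (fst s) # snd s else snd s)"

definition peel :: "(nat \<times> nat) list \<Rightarrow> nat list \<Rightarrow> nat list" where
  "peel E F = snd ((peel_step E ^^ length F) (F, []))"

lemma PT_peel [pt]: "PT e \<Longrightarrow> PT g \<Longrightarrow> PT (\<lambda>x. peel (e x) (g x))"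
proof (rule PT_comp2[of peel])
  have "PT (\<lambda>p. (peel_step (fst p) ^^ length (snd p)) (snd p, [] :: nat list))"
  proof (rule PT_funpow_grow[where c="\<lambda>z. 1 + sz z" and J="\<lambda>z s. sz (fst s) \<le> sz z"])
    show "PT (\<lambda>p. peel_step (fst (fst p)) (snd p))" unfolding peel_step_def by (intro pt)
    show "psz (\<lambda>z :: (nat \<times> nat) list \<times> nat list. 1 + sz z)" by (intro psz_intros psz_sz)
    show "sz (fst (peel_step (fst z) s)) \<le> sz z \<and> sz (peel_step (fst z) s) \<le> sz s + (1 + sz z)"
      if "sz (fst s) \<le> sz z" for z :: "(nat \<times> nat) list \<times> nat list" and s
      using that sz_filter[of "\<lambda>u. \<not> u = pick (fst z) (fst s)" "fst s"]
        sz_pick[of "fst z" "fst s"] by (cases s) (auto simp: peel_step_def)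
    show "sz (fst (snd z, [] :: nat list)) \<le> sz z" for z :: "(nat \<times> nat) list \<times> nat list" by (cases z) simp
  qed (intro pt)+
  then show "PT (\<lambda>p. peel (fst p) (snd p))" unfolding peel_def by (intro pt)
qed

section \<open>The four rules on lists\<close>

definition nm :: "nat list \<Rightarrow> (nat \<times> nat) list \<Rightarrow> nat \<Rightarrow> nat list" where
  "nm M E u = filter (\<lambda>a. \<not> adj E a a \<and> adj E a u) M"

lemma PT_nm [pt]: "PT e \<Longrightarrow> PT f \<Longrightarrow> PT g \<Longrightarrow> PT (\<lambda>x. nm (e x) (f x) (g x))"
  by (rule PT_comp3[of nm]) (unfold nm_def, intro pt)

definition full_list :: "(nat \<times> nat) list \<Rightarrow> nat list \<Rightarrow> nat list \<Rightarrow> bool" where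
  "full_list E A B \<longleftrightarrow> list_all (\<lambda>a. list_all (\<lambda>b. adj E a b) B) A"

lemma PT_full_list [pt]: "PT e \<Longrightarrow> PT f \<Longrightarrow> PT g \<Longrightarrow> PT (\<lambda>x. full_list (e x) (f x) (g x))"
  by (rule PT_comp3[of full_list]) (unfold full_list_def, intro pt)

definition iso_cands :: "nat list \<Rightarrow> (nat \<times> nat) list \<Rightarrow> nat list \<Rightarrow> nat list" where
  "iso_cands M E F = filter (\<lambda>v. nm M E v = [] \<and> nbl E v F = []) F"

definition ban_cands :: "nat list \<Rightarrow> (nat \<times> nat) list \<Rightarrow> nat list \<Rightarrow> (nat \<times> nat) list" where
  "ban_cands M E F = filter (\<lambda>p. \<not> adj E (fst p) (fst p) \<and> \<not> adj E (snd p) (snd p) \<and> \<not> adj E (fst p) (snd p)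
     \<and> length (greedy E (rem E [fst p, snd p] F) @ M) \<le> length (greedy E F)) (List.product M M)"

definition elim_cands :: "nat list \<Rightarrow> (nat \<times> nat) list \<Rightarrow> nat list \<Rightarrow> (nat \<times> nat) list" where
  "elim_cands M E F = filter (\<lambda>p. adj E (fst p) (snd p) \<and> full_list E (nm M E (fst p)) (nm M E (snd p))
     \<and> tl (tl (nbl E (snd p) F)) = [] \<and> (tl (tl (nbl E (fst p) F)) = [] \<or> nm M E (snd p) = [])) (List.product F F)"

definition leaf_of :: "(nat \<times> nat) list \<Rightarrow> nat list \<Rightarrow> nat \<Rightarrow> nat \<Rightarrow> bool" where
  "leaf_of E F u v \<longleftrightarrow> adj E v u \<and> tl (nbl E v F) = []"

definition unlink_cands :: "nat list \<Rightarrow> (nat \<times> nat) list \<Rightarrow> nat list \<Rightarrow> (nat \<times> nat) list" where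
  "unlink_cands M E F = filter (\<lambda>p. adj E (fst p) (snd p) \<and> list_ex (\<lambda>v. list_ex (\<lambda>v'.
      leaf_of E F (fst p) v \<and> leaf_of E F (snd p) v' \<and> \<not> v = snd p \<and> \<not> v' = fst p
      \<and> full_list E (nm M E v) (nm M E v')) F) F) (List.product F F)"

lemma PT_leaf_of [pt]: "PT e \<Longrightarrow> PT f \<Longrightarrow> PT g \<Longrightarrow> PT h \<Longrightarrow> PT (\<lambda>x. leaf_of (e x) (f x) (g x) (h x))"
  by (rule PT_comp4[of leaf_of]) (unfold leaf_of_def, intro pt)

lemma PT_iso_cands [pt]: "PT e \<Longrightarrow> PT f \<Longrightarrow> PT g \<Longrightarrow> PT (\<lambda>x. iso_cands (e x) (f x) (g x))"
  by (rule PT_comp3[of iso_cands]) (unfold iso_cands_def, intro pt)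

lemma PT_ban_cands [pt]: "PT e \<Longrightarrow> PT f \<Longrightarrow> PT g \<Longrightarrow> PT (\<lambda>x. ban_cands (e x) (f x) (g x))"
  by (rule PT_comp3[of ban_cands]) (unfold ban_cands_def, intro pt)

lemma PT_elim_cands [pt]: "PT e \<Longrightarrow> PT f \<Longrightarrow> PT g \<Longrightarrow> PT (\<lambda>x. elim_cands (e x) (f x) (g x))"
  by (rule PT_comp3[of elim_cands]) (unfold elim_cands_def, intro pt)

lemma PT_unlink_cands [pt]: "PT e \<Longrightarrow> PT f \<Longrightarrow> PT g \<Longrightarrow> PT (\<lambda>x. unlink_cands (e x) (f x) (g x))"
  by (rule PT_comp3[of unlink_cands]) (unfold unlink_cands_def, intro pt)

definition join_list :: "nat list \<Rightarrow> (nat \<times> nat) list \<Rightarrow> nat list \<Rightarrow> nat \<times> nat \<Rightarrow> (nat \<times> nat) list" where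
  "join_list M E F p = List.product (nm M E (fst p) @ filter (\<lambda>w. \<not> w = snd p) (nbl E (fst p) F))
     (nm M E (snd p) @ filter (\<lambda>w. \<not> w = fst p) (nbl E (snd p) F)) @ E"

lemma PT_join_list [pt]: "PT e \<Longrightarrow> PT f \<Longrightarrow> PT g \<Longrightarrow> PT h \<Longrightarrow> PT (\<lambda>x. join_list (e x) (f x) (g x) (h x))"
  by (rule PT_comp4[of join_list]) (unfold join_list_def, intro pt)

definition remove_edge :: "(nat \<times> nat) list \<Rightarrow> nat \<times> nat \<Rightarrow> (nat \<times> nat) list" where
  "remove_edge E p = filter (\<lambda>e. \<not> (fst e = fst p \<and> snd e = snd p \<or> fst e = snd p \<and> snd e = fst p)) E"

lemma PT_remove_edge [pt]: "PT e \<Longrightarrow> PT f \<Longrightarrow> PT (\<lambda>x. remove_edge (e x) (f x))"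
  by (rule PT_comp2[of remove_edge]) (unfold remove_edge_def, intro pt)

text \<open>A state consists of the forest, the edges, and a list whose length is the number of
  vertices already committed to the independent set.\<close>

type_synonym rstate = "nat list \<times> (nat \<times> nat) list \<times> nat list"

definition red_step :: "nat list \<Rightarrow> rstate \<Rightarrow> rstate" where
  "red_step M s = (case iso_cands M (fst (snd s)) (fst s) of
     v # _ \<Rightarrow> (filter (\<lambda>w. \<not> w = v) (fst s), fst (snd s), 0 # snd (snd s))
   | [] \<Rightarrow> (case ban_cands M (fst (snd s)) (fst s) of
     p # _ \<Rightarrow> (fst s, p # fst (snd s), snd (snd s))
   | [] \<Rightarrow> (case elim_cands M (fst (snd s)) (fst s) of
     p # _ \<Rightarrow> (filter (\<lambda>w. \<not> (w = fst p \<or> w = snd p)) (fst s), join_list M (fst (snd s)) (fst s) p, 0 # snd (snd s))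
   | [] \<Rightarrow> (case unlink_cands M (fst (snd s)) (fst s) of
     p # _ \<Rightarrow> (fst s, remove_edge (fst (snd s)) p, snd (snd s))
   | [] \<Rightarrow> s))))"

lemma PT_red_step: "PT (\<lambda>p. red_step (fst p) (snd p))"
  unfolding red_step_def by (intro pt)

text \<open>Only the length matters. It is \<open>(3 + m + f) * (m + f)\<close> for lists of lengths
  \<open>m\<close> and \<open>f\<close>, hence at least \<open>3 * f + m * m\<close>, which bounds
  the initial weight and so the number of rounds.\<close>

definition fuel :: "nat list \<Rightarrow> nat list \<Rightarrow> (nat \<times> nat) list" where
  "fuel M F = List.product (0 # 0 # 0 # M @ F) (M @ F)"

definition reduce :: "nat list \<Rightarrow> (nat \<times> nat) list \<Rightarrow> nat list \<Rightarrow> rstate" where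
  "reduce M E F = (red_step M ^^ length (fuel M F)) (F, E, [])"

lemma sz_product: "sz (List.product A B) \<le> 1 + sz A * sz B * (2 + sz A + sz B)"
proof -
  have "sz (List.product A B) \<le> 1 + (sz A * sz B) * (1 + (1 + sz A + sz B))"
  proof (rule sz_list_le)
    show "sz x \<le> 1 + sz A + sz B" if "x \<in> set (List.product A B)" for x
    proof -
      obtain a b where x: "x = (a, b)" by fastforce
      then have "a \<in> set A" "b \<in> set B" using that by (simp_all only: set_product mem_Sigma_iff)
      then show ?thesis using sz_elem[of a A] sz_elem[of b B] x by simp
    qed
    show "length (List.product A B) \<le> sz A * sz B"
      using length_le_sz[of A] length_le_sz[of B] by (simp add: mult_le_mono)
  qed
  then show ?thesis by simp
qed

lemma PT_reduce [pt]: "PT e \<Longrightarrow> PT f \<Longrightarrow> PT g \<Longrightarrow> PT (\<lambda>x. reduce (e x) (f x) (g x))"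
proof (rule PT_comp3[of reduce])
  \<comment> \<open>The cubic term pays for folding, which adds the product of two lists of size at
    most \<open>2 * n\<close>. The edge list may grow, but the increase in one round depends only on
    \<open>M\<close> and the forest, and the latter never outgrows the input.\<close>
  define c where "c n = 20 + 20 * n + 2 * n * (2 * n) * (2 + 2 * n + 2 * n)" for n :: nat
  have app: "sz (A @ B) \<le> sz A + sz B" for A B :: "nat list" using sz_append[of A B] by simp
  show "PT (\<lambda>p. reduce (fst p) (fst (snd p)) (snd (snd p)))" unfolding reduce_def
  proof (rule PT_funpow_grow[where c="\<lambda>z. c (sz z)" and J="\<lambda>z s. sz (fst s) \<le> sz z"])
    show "PT (\<lambda>p. red_step (fst (fst p)) (snd p))" by (intro PT_comp2[OF PT_red_step] pt)
    show "PT (\<lambda>p. fuel (fst p) (snd (snd p)))" unfolding fuel_def by (intro pt)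
    show "psz (\<lambda>z :: nat list \<times> (nat \<times> nat) list \<times> nat list. c (sz z))"
      unfolding c_def by (intro psz_intros psz_sz)
    fix z :: "nat list \<times> (nat \<times> nat) list \<times> nat list" and s :: rstate
    assume s: "sz (fst s) \<le> sz z"
    obtain F E r where s': "s = (F, E, r)" by (cases s) auto
    let ?M = "fst z" and ?n = "sz z"
    have M: "sz ?M \<le> ?n" by (cases z) simp
    have F: "sz F \<le> ?n" using s s' by simp
    have J: "sz E' \<le> sz E + (1 + 2 * ?n * (2 * ?n) * (2 + 2 * ?n + 2 * ?n))" if "E' = join_list ?M E F p" for E' p
    proof -
      let ?A = "nm ?M E (fst p) @ filter (\<lambda>w. \<not> w = snd p) (nbl E (fst p) F)"
      let ?B = "nm ?M E (snd p) @ filter (\<lambda>w. \<not> w = fst p) (nbl E (snd p) F)"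
      have AB: "sz (nm ?M E x @ filter Q (nbl E x F)) \<le> 2 * ?n" for x Q
        using app[of "nm ?M E x" "filter Q (nbl E x F)"] M F sz_filter[of "\<lambda>a. \<not> adj E a a \<and> adj E a x" ?M]
          sz_filter[of Q "nbl E x F"] sz_filter[of "\<lambda>u. adj E x u" F] unfolding nm_def nbl_def by linarith
      have "sz ?A * sz ?B * (2 + sz ?A + sz ?B) \<le> 2 * ?n * (2 * ?n) * (2 + 2 * ?n + 2 * ?n)"
        by (intro mult_le_mono add_mono AB le_refl)
      then have "sz (List.product ?A ?B) \<le> 1 + 2 * ?n * (2 * ?n) * (2 + 2 * ?n + 2 * ?n)"
        using sz_product[of ?A ?B] by linarith
      then show ?thesis unfolding that join_list_def using sz_append[of "List.product ?A ?B" E] by linarith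
    qed
    have ban: "sz p \<le> 1 + 2 * ?n" if "ban_cands ?M E F = p # ps" for p ps
    proof -
      have "p \<in> set (ban_cands ?M E F)" unfolding that by simp
      then have "fst p \<in> set ?M" "snd p \<in> set ?M" unfolding ban_cands_def by auto
      then show ?thesis using sz_elem[of "fst p" ?M] sz_elem[of "snd p" ?M] M by (cases p) simp
    qed
    show "sz (fst (red_step ?M s)) \<le> sz z \<and> sz (red_step ?M s) \<le> sz s + c (sz z)"
    proof (cases "iso_cands ?M E F")
      case (Cons v vs)
      then show ?thesis using F sz_filter[of "\<lambda>w. w \<noteq> v" F] by (simp add: red_step_def s' c_def sz_0)
    next
      case iso: Nil
      show ?thesis
      proof (cases "ban_cands ?M E F")
        case (Cons p ps)
        then show ?thesis using F ban iso by (fastforce simp add: red_step_def s' c_def)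
      next
        case ban: Nil
        show ?thesis
        proof (cases "elim_cands ?M E F")
          case (Cons p ps)
          then show ?thesis using F iso ban J[OF refl, of p] sz_filter[of "\<lambda>w. \<not> (w = fst p \<or> w = snd p)" F]
            by (simp add: red_step_def s' c_def sz_0)
        next
          case elim: Nil
          then show ?thesis using F iso ban
            by (cases "unlink_cands ?M E F") (auto simp: red_step_def s' remove_edge_def intro: le_trans[OF sz_filter])
        qed
      qed
    qed
  next
    show "sz (fst (snd (snd z), fst (snd z), [] :: nat list)) \<le> sz z" for z :: "nat list \<times> (nat \<times> nat) list \<times> nat list"
      by (cases z) simp
  qed (intro pt)+
qed

section \<open>Parsing the input and writing the output\<close>

lemma PT_take [pt]:
  fixes l :: "'z::enc \<Rightarrow> 'a::enc list"
  assumes n: "PT n" and l: "PT l" shows "PT (\<lambda>x. take (n x) (l x))"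
proof -
  define F where "F = (\<lambda>(x :: 'a) (s :: nat \<times> 'a list). if fst s = 0 then s else (fst s - 1, x # snd s))"
  have e: "fold F xs (m, acc) = (m - length xs, rev (take m xs) @ acc)" for xs m acc
  proof (induction xs arbitrary: m acc)
    case (Cons x xs)
    show ?case
    proof (cases m)
      case 0
      have "fold F xs (0, acc) = (0, acc)" using Cons[of 0 acc] by simp
      then show ?thesis using 0 by (simp add: F_def)
    next
      case (Suc m')
      then show ?thesis using Cons[of m' "x # acc"] by (simp add: F_def)
    qed
  qed simp
  have "PT (\<lambda>x. fold F (l x) (n x, []))"
  proof (rule PT_fold[where q="\<lambda>x. 2 + sz (n x) * 4 + sz (l x)"])
    show "psz (\<lambda>x. 2 + sz (n x) * 4 + sz (l x))" by (intro psz_intros PT_size[OF n] PT_size[OF l])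
    show "PT (\<lambda>p. F (fst (snd p)) (snd (snd p)))" unfolding F_def by (intro pt)
    fix x k
    have "sz (n x - length (take k (l x))) \<le> 1 + sz (n x) * 4"
      using sz_nat_bits(1)[of "n x - length (take k (l x))"] sz_nat_bits(2)[of "n x"]
        length_nbits_mono[of "n x - length (take k (l x))" "n x"] by linarith
    moreover have "sz (rev (take (n x) (take k (l x)))) \<le> sz (l x)"
      using sz_drop_take(2)[of "min (n x) k" "l x"] by (simp only: sz_rev take_take)
    ultimately show "sz (fold F (take k (l x)) (n x, [])) \<le> 2 + sz (n x) * 4 + sz (l x)"
      by (simp only: e sz_simps append_Nil2)
  qed (intro pt n l)+
  then have "PT (\<lambda>x. rev (snd (fold F (l x) (n x, []))))" by (intro pt)
  then show ?thesis by (simp add: e)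
qed

text \<open>The binary number \<open>n x\<close> may be exponentially large and cannot be a number
  of rounds; \<open>take (n x) (l x)\<close> is a unary counter of admissible length.\<close>

lemma PT_drop [pt]: assumes n: "PT n" and l: "PT l" shows "PT (\<lambda>x. drop (n x) (l x))"
proof -
  have t: "(tl ^^ m) xs = drop m xs" for m and xs :: "'b list"
    by (induction m) (simp_all add: drop_Suc tl_drop)
  have "PT (\<lambda>x. (tl ^^ length (take (n x) (l x))) (l x))"
    by (rule PT_iter[where q="\<lambda>x. sz (l x)"]) (simp_all add: t sz_drop_take PT_size[OF l] l PT_take[OF n l] PT_tl PT_id)
  moreover have "drop (length (take m xs)) xs = drop m xs" for m and xs :: "'b list"
    by (cases "m \<le> length xs") (simp_all add: min_def)
  ultimately show ?thesis unfolding t by simp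
qed

text \<open>The first component holds an element that waits for its partner. The result is reversed,
  which is harmless since only adjacency is read from it.\<close>

definition pairs_of :: "nat list \<Rightarrow> (nat \<times> nat) list" where
  "pairs_of l = snd (fold (\<lambda>x s. if fst s = [] then ([x], snd s) else ([], (hd0 (fst s), x) # snd s)) l ([], []))"

lemma PT_pairs_of [pt]: "PT g \<Longrightarrow> PT (\<lambda>x. pairs_of (g x))"
proof (rule PT_compose[of pairs_of])
  have "PT (\<lambda>l. fold (\<lambda>x (s :: nat list \<times> (nat \<times> nat) list). if fst s = [] then ([x], snd s) else ([], (hd0 (fst s), x) # snd s)) l ([], []))"
  proof (rule PT_fold_grow[where c="\<lambda>l. 9 + 4 * sz l" and J="\<lambda>l s. sz (fst s) \<le> 3 + sz l"])
    show "psz (\<lambda>l :: nat list. 9 + 4 * sz l)" by (intro psz_intros psz_sz)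
    fix l :: "nat list" and x and s :: "nat list \<times> (nat \<times> nat) list"
    assume s: "sz (fst s) \<le> 3 + sz l" "x \<in> set l"
    obtain a b where ab: "s = (a, b)" by fastforce
    have "sz (hd0 a) \<le> sz a" by (cases a) (simp_all add: hd0_def sz_0)
    then show "sz (fst (if fst s = [] then ([x], snd s) else ([], (hd0 (fst s), x) # snd s))) \<le> 3 + sz l \<and>
      sz (if fst s = [] then ([x], snd s) else ([], (hd0 (fst s), x) # snd s)) \<le> sz s + (9 + 4 * sz l)"
      using s sz_elem[OF s(2)] ab by auto
  next
    show "sz (fst ([] :: nat list, [] :: (nat \<times> nat) list)) \<le> 3 + sz l" for l :: "nat list" by simp
  qed (intro pt)+
  then show "PT pairs_of" unfolding pairs_of_def by (intro pt)
qed

text \<open>The input format writes 0 as one zero bit, whereas \<open>nbits 0\<close> is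
  empty.\<close>

definition tbin :: "nat \<Rightarrow> bool list list" where
  "tbin n = (if n = 0 then [[]] else map (\<lambda>b. if b then [False] else []) (nbits n))"

definition tenc :: "nat list \<Rightarrow> bool list list" where
  "tenc ns = concat (map (\<lambda>n. tbin n @ [[True]]) ns)"

lemma PT_tenc [pt]: "PT g \<Longrightarrow> PT (\<lambda>x. tenc (g x))"
  by (rule PT_compose[of tenc]) (unfold tenc_def tbin_def, intro pt)

text \<open>The word is read from right to left: a separator opens a new number, and its bits, least
  significant first, are put in front of it.\<close>

definition tparse_step :: "bool list \<Rightarrow> bool list list \<Rightarrow> bool list list" where
  "tparse_step s a = (if (case s of [] \<Rightarrow> False | b # _ \<Rightarrow> b) then [] # a
     else (case a of [] \<Rightarrow> [] | b # bs \<Rightarrow> ((\<not> s = []) # b) # bs))"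

definition tparse :: "bool list list \<Rightarrow> nat list" where
  "tparse w = map bval (fold tparse_step (rev w) [])"

lemma PT_tparse: "PT tparse"
proof -
  have "PT (\<lambda>w. fold tparse_step (rev w) [])"
  proof (rule PT_fold_grow[where c="\<lambda>_. 5" and J="\<lambda>_ _. True"])
    show "PT (\<lambda>p. tparse_step (fst (snd p)) (snd (snd p)))" unfolding tparse_step_def by (intro pt)
    show "True \<and> sz (tparse_step x s) \<le> sz s + 5" for x s
      using sz_bool(1)[of "\<not> x = []"] by (auto simp: tparse_step_def split: list.splits)
  qed (intro psz_const pt TrueI)+
  then show ?thesis unfolding tparse_def by (intro pt)
qed

text \<open>For sorted \<open>V\<close> the product is in lexicographic order, so the output format
  is reached without sorting.\<close>

definition edges_of :: "nat list \<Rightarrow> (nat \<times> nat) list \<Rightarrow> (nat \<times> nat) list" where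
  "edges_of V E = filter (\<lambda>p. adj E (fst p) (snd p) \<and> fst p < snd p) (List.product V V)"

lemma PT_edges_of [pt]: "PT f \<Longrightarrow> PT g \<Longrightarrow> PT (\<lambda>x. edges_of (f x) (g x))"
  by (rule PT_comp2[of edges_of]) (unfold edges_of_def, intro pt)

definition encode_graph :: "nat \<Rightarrow> nat list \<Rightarrow> (nat \<times> nat) list \<Rightarrow> bool list list" where
  "encode_graph k V E = tenc (k # length V # V @ length V # V @ length (edges_of V E)
     # concat (map (\<lambda>p. [fst p, snd p]) (edges_of V E)))"

lemma PT_encode_graph [pt]: "PT f \<Longrightarrow> PT g \<Longrightarrow> PT h \<Longrightarrow> PT (\<lambda>x. encode_graph (f x) (g x) (h x))"
  by (rule PT_comp3[of encode_graph]) (unfold encode_graph_def, intro pt)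

text \<open>Filtering \<open>V\<close> keeps the sorted order of the input. A loop marks a vertex
  that lies in no independent set.\<close>

definition kept :: "nat list \<Rightarrow> nat list \<Rightarrow> rstate \<Rightarrow> nat list" where
  "kept V M s = filter (\<lambda>v. (v \<in> set M \<or> v \<in> set (fst s)) \<and> \<not> adj (fst (snd s)) v v) V"

lemma PT_kept [pt]: "PT f \<Longrightarrow> PT g \<Longrightarrow> PT h \<Longrightarrow> PT (\<lambda>x. kept (f x) (g x) (h x))"
  by (rule PT_comp3[of kept]) (unfold kept_def, intro pt)

definition emit :: "nat \<Rightarrow> nat list \<Rightarrow> nat list \<Rightarrow> rstate \<Rightarrow> bool list list" where
  "emit k V M s = encode_graph (k - length (snd (snd s))) (kept V M s) (fst (snd s))"

lemma PT_emit [pt]: "PT e \<Longrightarrow> PT f \<Longrightarrow> PT g \<Longrightarrow> PT h \<Longrightarrow> PT (\<lambda>x. emit (e x) (f x) (g x) (h x))"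
  by (rule PT_comp4[of emit]) (unfold emit_def, intro pt)

definition finish :: "nat \<Rightarrow> nat list \<Rightarrow> nat list \<Rightarrow> (nat \<times> nat) list \<times> nat list \<Rightarrow> bool list list" where
  "finish k V M p = emit k V M (reduce M (fst p) (minus_list (snd p) M))"

lemma PT_finish [pt]: "PT e \<Longrightarrow> PT f \<Longrightarrow> PT g \<Longrightarrow> PT h \<Longrightarrow> PT (\<lambda>x. finish (e x) (f x) (g x) (h x))"
  by (rule PT_comp4[of finish]) (unfold finish_def, intro pt)

text \<open>The part of the first greedy set beyond the length of the second is a list as long as
  the independence number of the deleted components, which is subtracted from
  \<open>k\<close>.\<close>

definition shrink :: "nat \<Rightarrow> nat list \<Rightarrow> nat list \<Rightarrow> (nat \<times> nat) list \<Rightarrow> bool list list" where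
  "shrink k V X E = finish
     (k - length (drop (length (greedy E (del_components E X (minus_list V X)))) (greedy E (minus_list V X))))
     V (X @ peel E (del_components E X (minus_list V X))) (E, del_components E X (minus_list V X))"

lemma PT_shrink [pt]: "PT e \<Longrightarrow> PT f \<Longrightarrow> PT g \<Longrightarrow> PT h \<Longrightarrow> PT (\<lambda>x. shrink (e x) (f x) (g x) (h x))"
  by (rule PT_comp4[of shrink]) (unfold shrink_def, intro pt)

definition parse_X :: "nat \<Rightarrow> nat list \<Rightarrow> nat list \<Rightarrow> bool list list" where
  "parse_X k V l = shrink k V (take (hd0 l) (tl l)) (pairs_of (tl (drop (hd0 l) (tl l))))"

lemma PT_parse_X [pt]: "PT e \<Longrightarrow> PT f \<Longrightarrow> PT g \<Longrightarrow> PT (\<lambda>x. parse_X (e x) (f x) (g x))"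
  by (rule PT_comp3[of parse_X]) (unfold parse_X_def, intro pt)

definition parse_V :: "nat list \<Rightarrow> bool list list" where
  "parse_V l = parse_X (hd0 l) (take (hd0 (tl l)) (tl (tl l))) (drop (hd0 (tl l)) (tl (tl l)))"

definition kernel :: "bool list list \<Rightarrow> bool list list" where
  "kernel w = parse_V (tparse w)"

lemma PT_kernel: "PT kernel"
  unfolding kernel_def by (rule PT_compose[OF _ PT_tparse]) (unfold parse_V_def, intro pt)

section \<open>The parser inverts the encoding\<close>

declare bin.simps [simp del]

lemma bin_eq: "map tsym (bin n) = tbin n"
proof (induction n rule: bin.induct)
  case (1 n)
  have n1: "nbits 1 = [True]" by (subst nbits.simps) simp
  have b01: "bin 0 = [1]" "bin 1 = [2]" by (subst bin.simps, simp)+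
  show ?case
  proof (cases "n < 2")
    case True
    then have "n = 0 \<or> n = 1" by auto
    then show ?thesis using n1 b01 by (auto simp: tbin_def tsym_def)
  next
    case False
    then have d: "n div 2 \<noteq> 0" "n \<noteq> 0" by auto
    have e: "bin n = (n mod 2 + 1) # bin (n div 2)" using False by (subst bin.simps) (simp only: if_False)
    have b: "nbits n = odd n # nbits (n div 2)" using d(2) by (subst nbits.simps) (simp only: if_False)
    have "tsym (n mod 2 + 1) = (if odd n then [False] else [])" by (cases "odd n") (auto simp: tsym_def odd_iff_mod_2_eq_one)
    then show ?thesis using d 1[OF False] by (simp only: e b tbin_def if_False list.map)
  qed
qed

lemma enc_nats_eq: "map tsym (enc_nats ns) = tenc ns"
proof -
  have t: "tsym 3 = [True]" by (simp add: tsym_def)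
  show ?thesis by (induction ns) (simp_all add: enc_nats_def tenc_def bin_eq t)
qed

lemma set_bin: "set (bin n) \<subseteq> {1,2,3}"
proof (induction n rule: bin.induct)
  case (1 n)
  have "n mod 2 + 1 = 1 \<or> n mod 2 + 1 = 2" by auto
  moreover have "n < 2 \<Longrightarrow> n + 1 = 1 \<or> n + 1 = 2" by auto
  ultimately show ?case using 1 by (subst bin.simps) auto
qed

lemma set_enc_nats: "set (enc_nats ns) \<subseteq> {1,2,3}"
  using set_bin unfolding enc_nats_def by (auto simp del: insert_iff)

lemma tparse_tenc: "tparse (tenc ns) = ns"
proof -
  have b: "foldr tparse_step (tbin n) ([] # a) = (if n = 0 then [False] else nbits n) # a" for n a
  proof -
    have "foldr tparse_step (map (\<lambda>b. if b then [False] else []) bs) ([] # a) = bs # a" for bs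
      by (induction bs) (auto simp: tparse_step_def)
    then show ?thesis by (auto simp: tbin_def tparse_step_def)
  qed
  have "map bval (foldr tparse_step (tenc ns) []) = ns"
  proof (induction ns)
    case (Cons n ns)
    have "foldr tparse_step (tenc (n # ns)) [] = foldr tparse_step (tbin n) ([] # foldr tparse_step (tenc ns) [])"
      by (simp add: tenc_def tparse_step_def)
    then show ?case using Cons by (simp add: b)
  qed (simp add: tenc_def)
  then show ?thesis by (simp add: tparse_def foldr_conv_fold)
qed

lemma pairs_of_flat: "pairs_of (concat (map (\<lambda>(u, v). [u, v]) es)) = rev es"
proof -
  have "fold (\<lambda>x s. if fst s = [] then ([x], snd s) else ([], (hd0 (fst s), x) # snd s))
      (concat (map (\<lambda>(u, v). [u, v]) es)) ([], acc) = ([], rev es @ acc)" for acc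
    by (induction es arbitrary: acc) (auto simp: hd0_def)
  then show ?thesis by (simp add: pairs_of_def)
qed

lemma parse_instance:
  "parse_V ([k, length V] @ V @ [length X] @ X @ [e] @ concat (map (\<lambda>(u, v). [u, v]) es)) = shrink k V X (rev es)"
  by (simp add: parse_V_def parse_X_def hd0_def pairs_of_flat)

section \<open>Correctness of the algorithm\<close>

text \<open>Steps are the identity on stuck states, so a fixed number of rounds, at least the
  initial measure, replaces a termination test.\<close>

lemma iterate_stuck:
  assumes "Inv s" "\<And>s. Inv s \<Longrightarrow> Inv (f s)" "\<And>s. Inv s \<Longrightarrow> stuck s \<or> m (f s) < (m s :: nat)"
    and "\<And>s. stuck s \<Longrightarrow> f s = s" "m s \<le> n"
  shows "Inv ((f ^^ n) s) \<and> stuck ((f ^^ n) s)"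
  using assms(1,5)
proof (induction n arbitrary: s)
  case 0
  then show ?case using assms(3)[of s] by auto
next
  case (Suc n)
  show ?case
  proof (cases "stuck s")
    case True
    have "(f ^^ k) s = s" for k by (induction k) (simp_all add: assms(4)[OF True])
    then show ?thesis using Suc.prems True by (simp add: assms(4)[OF True])
  next
    case False
    then have "m (f s) \<le> n" using assms(3)[OF Suc.prems(1)] Suc.prems(2) by simp
    then show ?thesis using Suc.IH[OF assms(2)[OF Suc.prems(1)]] by (simp add: funpow_swap1)
  qed
qed

text \<open>\<open>W\<close> is the unpeeled part and \<open>Y\<close> the set of recorded vertices.
  A peeled vertex outside \<open>Y\<close> had at most one neighbour left when it was removed, so it
  accounts for at most one edge, and there is one edge less once nothing of \<open>U\<close>
  remains; for empty \<open>W\<close> this is the forest bound on \<open>F - Y\<close>. The fourth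
  condition says that a recorded vertex has used up the cycle of its component, the fifth that no
  component is charged twice.\<close>

definition peel_inv :: "('a \<Rightarrow> 'a \<Rightarrow> bool) \<Rightarrow> 'a set \<Rightarrow> 'a set \<Rightarrow> 'a set \<Rightarrow> bool" where
  "peel_inv R F W Y \<longleftrightarrow> W \<subseteq> F \<and> Y \<subseteq> F - W
     \<and> (\<forall>U\<subseteq>F - Y. e2 R U \<le> 2 * card (U - W) + e2 R (U \<inter> W))
     \<and> (\<forall>U\<subseteq>F - Y. U \<noteq> {} \<longrightarrow> U \<inter> W = {} \<longrightarrow> e2 R U + 2 \<le> 2 * card U)
     \<and> (\<forall>y\<in>Y. \<forall>A\<subseteq>W. A \<subseteq> comp R F y \<longrightarrow> A \<noteq> {} \<longrightarrow> e2 R A < 2 * card A)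
     \<and> inj_on (comp R F) Y"

lemma peel_inv_start: "peel_inv R F F {}"
  unfolding peel_inv_def
proof (intro conjI allI impI)
  fix U assume U: "U \<subseteq> F - {}"
  then have "U \<inter> F = U" by blast
  then show "e2 R U \<le> 2 * card (U - F) + e2 R (U \<inter> F)" by simp
  assume "U \<noteq> {}" "U \<inter> F = {}"
  with \<open>U \<inter> F = U\<close> have False by simp
  then show "e2 R U + 2 \<le> 2 * card U" ..
qed simp_all

lemma peel_invD:
  assumes "peel_inv R F W Y"
  shows "W \<subseteq> F" "Y \<subseteq> F - W" "U \<subseteq> F - Y \<Longrightarrow> e2 R U \<le> 2 * card (U - W) + e2 R (U \<inter> W)"
    "U \<subseteq> F - Y \<Longrightarrow> U \<noteq> {} \<Longrightarrow> U \<inter> W = {} \<Longrightarrow> e2 R U + 2 \<le> 2 * card U"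
    "y \<in> Y \<Longrightarrow> A \<subseteq> W \<Longrightarrow> A \<subseteq> comp R F y \<Longrightarrow> A \<noteq> {} \<Longrightarrow> e2 R A < 2 * card A"
    "inj_on (comp R F) Y"
  using assms unfolding peel_inv_def by simp_all

lemma peel_inv_low:
  assumes "finite F" "symp R" "pseudo R F" "peel_inv R F W Y" "v \<in> W" "deg R W v \<le> 1"
  shows "peel_inv R F (W - {v}) Y"
proof -
  note inv = peel_invD[OF assms(4)]
  have irr: "\<not> R v v" using assms(3,5) inv(1) unfolding pseudo_def by blast
  have fW: "finite W" using inv(1) assms(1) by (rule finite_subset)
  note e1 = inv(3) and e2 = inv(4)
  have a: "e2 R U \<le> 2 * card (U - (W - {v})) + e2 R (U \<inter> (W - {v}))" if U: "U \<subseteq> F - Y" for U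
  proof (cases "v \<in> U")
    case False
    then have "U - (W - {v}) = U - W" "U \<inter> (W - {v}) = U \<inter> W" by auto
    then show ?thesis using e1[OF U] by simp
  next
    case True
    have fU: "finite U" using U assms(1) finite_subset by blast
    have "U \<inter> W = insert v (U \<inter> (W - {v}))" using True assms(5) by auto
    then have "e2 R (U \<inter> W) = e2 R (U \<inter> (W - {v})) + 2 * deg R (U \<inter> (W - {v})) v"
      using e2_insert[of "U \<inter> (W - {v})" v R] fU assms(2) irr by simp
    moreover have "deg R (U \<inter> (W - {v})) v \<le> deg R W v"
      unfolding deg_def using fW by (intro card_mono) auto
    moreover have "U - (W - {v}) = insert v (U - W)" "v \<notin> U - W" using True assms(5) by auto
    then have "card (U - (W - {v})) = Suc (card (U - W))" using fU by simp
    ultimately show ?thesis using e1[OF U] assms(6) by simp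
  qed
  have b: "e2 R U + 2 \<le> 2 * card U" if U: "U \<subseteq> F - Y" "U \<noteq> {}" "U \<inter> (W - {v}) = {}" for U
  proof (cases "v \<in> U")
    case False
    then show ?thesis using e2[OF U(1,2)] U(3) by auto
  next
    \<comment> \<open>Only \<open>v\<close> is unpeeled in \<open>U\<close>. It spans no edge, while
      the peeled vertices are one fewer than \<open>card U\<close>; this is the gain of one
      edge.\<close>
    case True
    have fU: "finite U" using U assms(1) finite_subset by blast
    have i: "U \<inter> W = {v}" "U - W = U - {v}" using True U(3) assms(5) by auto
    have "{u \<in> {v}. R v u} = {}" using irr by auto
    then have "e2 R {v} = 0" by (simp add: e2_def deg_def)
    then have "e2 R U \<le> 2 * card (U - {v})" using e1[OF U(1)] i by simp
    moreover have "card U = Suc (card (U - {v}))" using fU True by (metis card.remove)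
    ultimately show ?thesis by simp
  qed
  have "W - {v} \<subseteq> F" "Y \<subseteq> F - (W - {v})" "inj_on (comp R F) Y" using inv(1,2,6) assms(5) by blast+
  moreover have "e2 R A < 2 * card A" if "y \<in> Y" "A \<subseteq> W - {v}" "A \<subseteq> comp R F y" "A \<noteq> {}" for y A
  proof -
    have "A \<subseteq> W" using that(2) by blast
    then show ?thesis using inv(5) that(1,3,4) by simp
  qed
  ultimately show ?thesis using a b unfolding peel_inv_def by (intro conjI allI impI ballI)
qed

lemma deg_comp:
  assumes "symp R" "W \<subseteq> F" "u \<in> W" "u \<in> comp R F y"
  shows "deg R (W \<inter> comp R F y) u = deg R W u"
proof -
  have "{v \<in> W \<inter> comp R F y. R u v} = {v \<in> W. R u v}" using assms comp_step[of u R F y] by blast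
  then show ?thesis by (simp add: deg_def)
qed

text \<open>All remaining degrees are two, so the component of \<open>v\<close> still contains a
  dense set \<open>U\<close>; by the invariant none of its vertices was recorded before. A dense
  \<open>A\<close> without \<open>v\<close> that survives in it would be 2-regular and hence closed
  in \<open>U\<close>, so that \<open>A\<close> and \<open>U - A\<close> would be two disjoint dense
  sets in one component.\<close>

lemma peel_inv_pick:
  assumes "finite F" "symp R" "pseudo R F" "peel_inv R F W Y" "v \<in> W" and d2: "\<And>u. u \<in> W \<Longrightarrow> 2 \<le> deg R W u"
  shows "peel_inv R F (W - {v}) (insert v Y)"
proof -
  note inv = peel_invD[OF assms(4)]
  note WF = inv(1,2)
  have fW: "finite W" using assms(1) WF finite_subset by blast
  define U where "U = W \<inter> comp R F v"
  have fU: "finite U" "U \<subseteq> F" "v \<in> U" using fW WF assms(5) comp_self[of v R F] by (auto simp: U_def)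
  have dU: "deg R U u = deg R W u" if "u \<in> U" for u
    using deg_comp[OF assms(2) WF(1), of u v] that unfolding U_def by blast
  have "pseudo R U" using pseudo_subset[OF assms(3) fU(2)] .
  then have reg: "deg R U u = 2" if "u \<in> U" for u
    using pseudo_two_regular[OF fU(1), of R u] dU d2 that unfolding U_def by auto
  then have denseU: "e2 R U = 2 * card U" by (simp add: e2_def)
  have old: "comp R F y \<noteq> comp R F v" if "y \<in> Y" for y
  proof
    assume "comp R F y = comp R F v"
    then have "U \<subseteq> comp R F y" "U \<subseteq> W" by (auto simp: U_def)
    then have "e2 R U < 2 * card U" using inv(5)[OF that, of U] fU(3) by blast
    then show False using denseU by simp
  qed
  have new: "e2 R A < 2 * card A" if A: "A \<subseteq> W - {v}" "A \<subseteq> comp R F v" "A \<noteq> {}" for A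
  proof (rule ccontr)
    assume "\<not> e2 R A < 2 * card A"
    then have dA: "2 * card A \<le> e2 R A" by simp
    have AU: "A \<subseteq> U" "v \<notin> A" using A by (auto simp: U_def)
    have fA: "finite A" using AU fU finite_subset by blast
    have le: "deg R A u \<le> 2" if "u \<in> A" for u
      using that AU reg[of u] fU card_mono[of "{w \<in> U. R u w}" "{w \<in> A. R u w}"] unfolding deg_def by fastforce
    have "deg R A u = 2" if "u \<in> A" for u
    proof (rule ccontr)
      assume "deg R A u \<noteq> 2"
      then have "(\<Sum>u\<in>A. deg R A u) < (\<Sum>u\<in>A. 2)"
        using fA that le by (intro sum_strict_mono_ex1) (auto simp: order_le_less)
      then show False using dA by (simp add: e2_def)
    qed
    then have closed: "w \<in> A" if "u \<in> A" "w \<in> U" "R u w" for u w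
    proof -
      have "card {w \<in> A. R u w} = card {w \<in> U. R u w}"
        using \<open>\<And>u. u \<in> A \<Longrightarrow> deg R A u = 2\<close> reg[of u] that AU unfolding deg_def by auto
      then have "{w \<in> A. R u w} = {w \<in> U. R u w}" using AU fU by (intro card_subset_eq) auto
      then show ?thesis using that by blast
    qed
    have "{w \<in> U. R u w} = {w \<in> U - A. R u w}" if "u \<in> U - A" for u
      using closed that assms(2) by (auto dest: sympD)
    then have "deg R (U - A) u = 2" if "u \<in> U - A" for u
      using reg[of u] that unfolding deg_def by auto
    then have dB: "2 * card (U - A) \<le> e2 R (U - A)" by (simp add: e2_def)
    have vF: "v \<in> F" using assms(5) WF by blast
    note C = comp_subset[OF vF, of R]
    show False
    proof (rule no_two_dense[OF _ assms(2) _ _ _ A(3) dA _ _ dB])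
      show "finite (comp R F v)" using C assms(1) by (rule finite_subset)
      show "pseudo R (comp R F v)" using pseudo_subset[OF assms(3) C] .
      show "\<exists>u\<in>Z. \<exists>w\<in>comp R F v - Z. R u w" if "Z \<subseteq> comp R F v" "Z \<noteq> {}" "Z \<noteq> comp R F v" for Z
        by (rule comp_connected[OF assms(2) vF that])
      show "U - A \<noteq> {}" using fU(3) AU(2) by blast
    qed (use A in \<open>auto simp: U_def\<close>)
  qed
  have same: "V - (W - {v}) = V - W \<and> V \<inter> (W - {v}) = V \<inter> W" if "V \<subseteq> F - insert v Y" for V
    using that by auto
  have a: "e2 R V \<le> 2 * card (V - (W - {v})) + e2 R (V \<inter> (W - {v}))" if "V \<subseteq> F - insert v Y" for V
  proof -
    have "V \<subseteq> F - Y" using that by blast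
    then have "e2 R V \<le> 2 * card (V - W) + e2 R (V \<inter> W)" by (rule inv(3))
    then show ?thesis using same[OF that] by simp
  qed
  have b: "e2 R V + 2 \<le> 2 * card V" if "V \<subseteq> F - insert v Y" "V \<noteq> {}" "V \<inter> (W - {v}) = {}" for V
  proof -
    have "V \<subseteq> F - Y" "V \<inter> W = {}" using that same[OF that(1)] by blast+
    then show ?thesis using inv(4)[of V] that(2) by simp
  qed
  have c: "e2 R A < 2 * card A" if "y \<in> insert v Y" "A \<subseteq> W - {v}" "A \<subseteq> comp R F y" "A \<noteq> {}" for y A
  proof (cases "y = v")
    case True
    then show ?thesis using new that by blast
  next
    case False
    then have "y \<in> Y" "A \<subseteq> W" using that by auto
    then show ?thesis using inv(5)[of y A] that(3,4) by simp
  qed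
  have "inj_on (comp R F) (insert v Y)" using old inv(6) by (auto simp: inj_on_insert)
  moreover have "W - {v} \<subseteq> F" "insert v Y \<subseteq> F - (W - {v})" using WF assms(5) by blast+
  ultimately show ?thesis using a b c unfolding peel_inv_def by (intro conjI allI impI ballI)
qed

lemma peel_inv_end: "peel_inv R F {} Y \<Longrightarrow> forest R (F - Y)"
  unfolding forest_def using peel_invD(4)[of R F "{}" Y] by simp

text \<open>Independence numbers add up over separate parts, and each blocked part loses at least
  one.\<close>

lemma conflict_gain:
  assumes "finite Y" "finite D" "symp R"
    and "\<And>y. y \<in> Y \<Longrightarrow> C y \<subseteq> D" "\<And>y u v. y \<in> Y \<Longrightarrow> u \<in> C y \<Longrightarrow> v \<in> D - C y \<Longrightarrow> \<not> R u v"
    and "\<And>y y'. y \<in> Y \<Longrightarrow> y' \<in> Y \<Longrightarrow> y \<noteq> y' \<Longrightarrow> C y \<inter> C y' = {}"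
    and "\<And>y. y \<in> Y \<Longrightarrow> alp R (C y - N) < alp R (C y)"
  shows "alp R (D - N) + card Y \<le> alp R D"
  using assms
proof (induction Y arbitrary: D rule: finite_induct)
  case empty
  then show ?case by (simp add: alp_mono)
next
  case (insert y Y)
  let ?D = "D - C y"
  have fin: "finite ?D" "finite (C y)" using insert.prems(1,3) finite_subset by blast+
  have "alp R (?D - N) + card Y \<le> alp R ?D"
  proof (rule insert.IH[OF fin(1) insert.prems(2)])
    show "C z \<subseteq> ?D" if "z \<in> Y" for z
      using insert.prems(3)[of z] insert.prems(5)[of z y] that insert.hyps(2) by blast
    show "\<not> R u v" if "z \<in> Y" "u \<in> C z" "v \<in> ?D - C z" for z u v
      using insert.prems(4)[of z u v] that by blast
  qed (use insert.prems in auto)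
  moreover have "alp R (?D \<union> C y) = alp R ?D + alp R (C y)"
  proof (rule alp_union_separate[OF fin])
    fix a b assume "a \<in> ?D" "b \<in> C y"
    then have "\<not> R b a" using insert.prems(4)[of y b a] by blast
    then show "\<not> R a b \<and> \<not> R b a" using insert.prems(2) by (auto dest: sympD)
  qed auto
  moreover have "?D \<union> C y = D" using insert.prems(3)[of y] by blast
  moreover have "D - N = (?D - N) \<union> (C y - N)" using insert.prems(3)[of y] by blast
  then have "alp R (D - N) \<le> alp R (?D - N) + alp R (C y - N)"
    using alp_union_le[of "?D - N" "C y - N" R] fin by simp
  moreover have "alp R (C y - N) < alp R (C y)" using insert.prems(6) by simp
  ultimately show ?case using insert.hyps by simp
qed

text \<open>Suppose that one quadruple were the witness of more than \<open>card X\<close>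
  components. Leave out one of them: the others already cost the rest \<open>card X\<close>
  vertices, against the witness of the one left out. So each of the \<open>card X ^ 4\<close>
  quadruples serves at most \<open>card X\<close> components.\<close>

lemma few_components:
  assumes fin: "finite F" "finite X" and sy: "symp R" and YF: "Y \<subseteq> F" and inj: "inj_on (comp R F) Y"
    and wit: "\<And>y. y \<in> Y \<Longrightarrow> \<exists>x1\<in>X. \<exists>x2\<in>X. \<exists>x3\<in>X. \<exists>x4\<in>X.
      alp R (comp R F y - nbrs R {x1,x2,x3,x4}) < alp R (comp R F y) \<and>
      alp R (F - comp R F y) < alp R (F - comp R F y - nbrs R {x1,x2,x3,x4}) + card X"
  shows "card Y \<le> card X ^ 5"
proof -
  define N where "N t = nbrs R {fst t, fst (snd t), fst (snd (snd t)), snd (snd (snd t))}" for t :: "'a \<times> 'a \<times> 'a \<times> 'a"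
  define Z where "Z t = {y \<in> Y. alp R (comp R F y - N t) < alp R (comp R F y) \<and>
      alp R (F - comp R F y) < alp R (F - comp R F y - N t) + card X}" for t
  have fY: "finite Y" using YF fin finite_subset by blast
  have Zle: "card (Z t) \<le> card X" for t
  proof (rule ccontr)
    assume "\<not> card (Z t) \<le> card X"
    then have c: "card X < card (Z t)" by simp
    then obtain y0 where y0: "y0 \<in> Z t" by (metis card.empty equals0I less_nat_zero_code)
    have fZ: "finite (Z t)" using fY by (simp add: Z_def)
    have disj: "comp R F y \<inter> comp R F y' = {}" if "y \<in> Y" "y' \<in> Y" "y \<noteq> y'" for y y'
    proof (rule ccontr)
      assume "comp R F y \<inter> comp R F y' \<noteq> {}"
      then obtain z where "z \<in> comp R F y" "z \<in> comp R F y'" by blast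
      then have "comp R F y = comp R F y'" using comp_eq[OF sy] by metis
      then show False using inj that by (auto simp: inj_on_def)
    qed
    have ZY: "Z t \<subseteq> Y" by (auto simp: Z_def)
    have "alp R (F - comp R F y0 - N t) + card (Z t - {y0}) \<le> alp R (F - comp R F y0)"
    proof (rule conflict_gain)
      show "comp R F y \<subseteq> F - comp R F y0" if "y \<in> Z t - {y0}" for y
        using comp_subset[of y F R] disj[of y y0] that y0 ZY YF by blast
      show "\<not> R u v" if "y \<in> Z t - {y0}" "u \<in> comp R F y" "v \<in> F - comp R F y0 - comp R F y" for y u v
        using comp_step[of u R F y v] comp_subset[of y F R] that ZY YF by blast
      show "comp R F y \<inter> comp R F y' = {}" if "y \<in> Z t - {y0}" "y' \<in> Z t - {y0}" "y \<noteq> y'" for y y'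
        using disj that ZY by blast
      show "alp R (comp R F y - N t) < alp R (comp R F y)" if "y \<in> Z t - {y0}" for y
        using that by (auto simp: Z_def)
    qed (use fin fZ sy in auto)
    moreover have "card (Z t) = Suc (card (Z t - {y0}))" using fZ y0 by (metis card.remove)
    moreover have "alp R (F - comp R F y0) < alp R (F - comp R F y0 - N t) + card X" using y0 by (simp add: Z_def)
    ultimately show False using c by simp
  qed
  have "Y \<subseteq> (\<Union>t\<in>X \<times> X \<times> X \<times> X. Z t)"
  proof
    fix y assume "y \<in> Y"
    then obtain x1 x2 x3 x4 where "x1 \<in> X" "x2 \<in> X" "x3 \<in> X" "x4 \<in> X" "y \<in> Z (x1, x2, x3, x4)"
      using wit[of y] unfolding Z_def N_def by auto
    then show "y \<in> (\<Union>t\<in>X \<times> X \<times> X \<times> X. Z t)" by blast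
  qed
  then have "card Y \<le> card (\<Union>t\<in>X \<times> X \<times> X \<times> X. Z t)"
    using fin fY by (intro card_mono) (auto simp: Z_def)
  also have "\<dots> \<le> (\<Sum>t\<in>X \<times> X \<times> X \<times> X. card (Z t))" using fin by (intro card_UN_le) simp
  also have "\<dots> \<le> card (X \<times> X \<times> X \<times> X) * card X" using sum_bounded_above[of "X \<times> X \<times> X \<times> X" "\<lambda>t. card (Z t)"] Zle by simp
  also have "\<dots> = card X ^ 5" by (simp add: card_cartesian_product eval_nat_numeral)
  finally show ?thesis .
qed

section \<open>What the list functions compute\<close>

lemma adj_iff: "adj E u v \<longleftrightarrow> (u, v) \<in> set E \<or> (v, u) \<in> set E"
proof -
  have "fst p = u \<and> snd p = v \<or> fst p = v \<and> snd p = u \<longleftrightarrow> p = (u, v) \<or> p = (v, u)" for p :: "nat \<times> nat"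
    by (cases p) auto
  then show ?thesis unfolding adj_def list_ex_iff by auto
qed

lemma symp_adj: "symp (adj E)"
  by (auto simp: symp_def adj_iff)

lemma tl_Nil_iff: "tl l = [] \<longleftrightarrow> length l \<le> 1" "tl (tl l) = [] \<longleftrightarrow> length l \<le> 2"
  by (auto simp: length_Suc_conv le_Suc_eq numeral_2_eq_2 split: list.split simp flip: length_0_conv)

lemma length_nbl: "distinct W \<Longrightarrow> length (nbl E v W) = deg (adj E) (set W) v"
  unfolding nbl_def deg_def by (metis distinct_card distinct_filter set_filter)

lemma low_Nil: "distinct W \<Longrightarrow> low E W = [] \<longleftrightarrow> (\<forall>u\<in>set W. 2 \<le> deg (adj E) (set W) u)"
  by (auto simp: low_def filter_empty_conv tl_Nil_iff length_nbl)

lemma pick_in: "W \<noteq> [] \<Longrightarrow> pick E W \<in> set W"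
proof -
  assume "W \<noteq> []"
  moreover have "hd0 l \<in> set l" if "l \<noteq> []" for l using that by (cases l) (simp_all add: hd0_def)
  moreover have "set (low E W @ W) = set W" by (auto simp: low_def)
  ultimately show ?thesis unfolding pick_def by (metis append_is_Nil_conv)
qed

lemma pick_low: "distinct W \<Longrightarrow> low E W \<noteq> [] \<Longrightarrow> deg (adj E) (set W) (pick E W) \<le> 1"
proof -
  assume "distinct W" "low E W \<noteq> []"
  then have "pick E W \<in> set (low E W)" by (cases "low E W") (simp_all add: pick_def hd0_def)
  then show ?thesis using \<open>distinct W\<close> by (auto simp: low_def tl_Nil_iff length_nbl)
qed

lemma greedy_correct:
  assumes "distinct W" "pseudo (adj E) (set W)"
  shows "length (greedy E W) = alp (adj E) (set W)"
proof -
  have "length (snd ((gstep E ^^ n) (W, I))) = length I + alp (adj E) (set W)"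
    if "distinct W" "pseudo (adj E) (set W)" "length W \<le> n" for n W I
    using that
  proof (induction n arbitrary: W I)
    case (Suc n)
    show ?case
    proof (cases "W = []")
      case True
      have "(gstep E ^^ k) ([], I) = ([], I)" for k by (induction k) (simp_all add: gstep_def)
      from this[of "Suc n"] show ?thesis unfolding True by (simp only: snd_conv list.set alp_empty add_0_right)
    next
      case False
      let ?v = "pick E W" and ?W = "filter (\<lambda>u. \<not> (u = pick E W \<or> adj E (pick E W) u)) W"
      have v: "?v \<in> set W" using pick_in[OF False] .
      have s: "gstep E (W, I) = (?W, ?v # I)" using False by (simp add: gstep_def)
      have W': "set ?W = set W - insert ?v {u. adj E ?v u}" by auto
      have "length ?W < length W" using v by (intro length_filter_less[of ?v]) auto
      then have "length (snd ((gstep E ^^ n) (?W, ?v # I))) = length (?v # I) + alp (adj E) (set ?W)"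
        using Suc.prems pseudo_subset[of "adj E" "set W" "set ?W"] by (intro Suc.IH) auto
      moreover have "alp (adj E) (set W) = Suc (alp (adj E) (set ?W))"
        unfolding W' using pick_low[OF Suc.prems(1)] low_Nil[OF Suc.prems(1)]
        by (intro alp_pick symp_adj Suc.prems v) auto
      ultimately show ?thesis by (simp add: funpow_swap1 s)
    qed
  qed simp
  from this[OF assms order_refl, of "[]"] show ?thesis by (simp add: greedy_def)
qed

lemma set_spread: "set (spread E F C) = {u \<in> set F. u \<in> set C \<or> (\<exists>c\<in>set C. adj E c u)}"
  by (auto simp: spread_def list_ex_iff)

lemma comp_list_set:
  assumes "distinct F" "w \<in> set F"
  shows "set (comp_list E F w) = comp (adj E) (set F) w"
proof -
  let ?C = "\<lambda>n. (spread E F ^^ n) [w]" and ?K = "comp (adj E) (set F) w"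
  have sub: "w \<in> set (?C n) \<and> set (?C n) \<subseteq> set F \<and> set (?C n) \<subseteq> ?K" for n
  proof (induction n)
    case 0
    then show ?case using assms by (simp add: comp_self)
  next
    case (Suc n)
    then show ?case using assms comp_step[of _ "adj E" "set F" w] by (auto simp: set_spread)
  qed
  \<comment> \<open>Until saturation every round adds a vertex; after \<open>length F\<close> rounds
    there would be more vertices than \<open>F\<close> has.\<close>
  have grow: "?K \<subseteq> set (?C n) \<or> n < card (set (?C n))" for n
  proof (induction n)
    case 0
    then show ?case by simp
  next
    case (Suc n)
    have mono: "set (?C n) \<subseteq> set (?C (Suc n))" using sub[of n] by (auto simp: set_spread)
    show ?case
    proof (cases "?K \<subseteq> set (?C n)")
      case True
      then show ?thesis using mono by blast
    next
      case False
      have "\<exists>u\<in>set (?C n). \<exists>v\<in>set F - set (?C n). adj E u v"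
      proof (rule ccontr)
        assume no: "\<not> (\<exists>u\<in>set (?C n). \<exists>v\<in>set F - set (?C n). adj E u v)"
        have "?K \<subseteq> set (?C n)"
          by (rule comp_least) (use sub[of n] no in blast)+
        then show False using False by blast
      qed
      then have "set (?C n) \<subset> set (?C (Suc n))" using mono by (auto simp: set_spread)
      then have "card (set (?C n)) < card (set (?C (Suc n)))" by (intro psubset_card_mono) auto
      then show ?thesis using Suc False by simp
    qed
  qed
  have "card (set (?C (length F))) \<le> length F"
    using sub[of "length F"] card_mono[of "set F"] distinct_card[OF assms(1)] by (metis List.finite_set)
  then show ?thesis using grow[of "length F"] sub[of "length F"] unfolding comp_list_def by auto
qed

lemma distinct_comp_list: "distinct F \<Longrightarrow> w \<in> set F \<Longrightarrow> distinct (comp_list E F w)"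
  by (cases F) (simp_all add: comp_list_def spread_def)

lemma set_rem: "set (rem E S W) = set W - nbrs (adj E) (set S)"
  by (auto simp: rem_def nbrs_def list_ex_iff)

lemma distinct_rem: "distinct W \<Longrightarrow> distinct (rem E S W)"
  by (simp add: rem_def)

lemma set_minus_list: "set (minus_list F C) = set F - set C"
  by (auto simp: minus_list_def)

lemma distinct_minus_list: "distinct F \<Longrightarrow> distinct (minus_list F C)"
  by (simp add: minus_list_def)

lemma peel_correct:
  assumes "distinct F" "pseudo (adj E) (set F)"
  shows "peel_inv (adj E) (set F) {} (set (peel E F))" "distinct (peel E F)"
proof -
  let ?R = "adj E"
  have "peel_inv ?R (set F) {} (set (snd ((peel_step E ^^ n) (W, Y)))) \<and> distinct (snd ((peel_step E ^^ n) (W, Y)))"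
    if "distinct W" "distinct Y" "peel_inv ?R (set F) (set W) (set Y)" "length W \<le> n" for n W Y
    using that
  proof (induction n arbitrary: W Y)
    case (Suc n)
    show ?case
    proof (cases "W = []")
      case True
      have "(peel_step E ^^ k) ([], Y) = ([], Y)" for k by (induction k) (simp_all add: peel_step_def)
      from this[of "Suc n"] show ?thesis using Suc.prems unfolding True by (simp only: snd_conv) (simp add: True)
    next
      case False
      let ?v = "pick E W" and ?W = "filter (\<lambda>u. \<not> u = pick E W) W"
      have v: "?v \<in> set W" using pick_in[OF False] .
      have W': "set ?W = set W - {?v}" by auto
      have len: "length ?W < length W" using v by (intro length_filter_less[of ?v]) auto
      have vY: "?v \<notin> set Y" using Suc.prems(3) v unfolding peel_inv_def by blast
      show ?thesis
      proof (cases "low E W = []")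
        case True
        have "peel_inv ?R (set F) (set ?W) (set (?v # Y))"
          unfolding W' list.set(2) using low_Nil[OF Suc.prems(1), of E] True
          by (intro peel_inv_pick[OF _ symp_adj assms(2) Suc.prems(3) v]) auto
        moreover have "peel_step E (W, Y) = (?W, ?v # Y)" using False True by (simp add: peel_step_def)
        ultimately show ?thesis using Suc.IH[of ?W "?v # Y"] Suc.prems len vY by (simp add: funpow_swap1)
      next
        case low: False
        have "peel_inv ?R (set F) (set ?W) (set Y)"
          unfolding W' by (rule peel_inv_low[OF _ symp_adj assms(2) Suc.prems(3) v pick_low[OF Suc.prems(1) low]]) simp
        moreover have "peel_step E (W, Y) = (?W, Y)" using low by (simp add: peel_step_def)
        ultimately show ?thesis using Suc.IH[of ?W Y] Suc.prems len by (simp add: funpow_swap1)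
      qed
    qed
  qed simp
  from this[of F "[]" "length F"] show "peel_inv (adj E) (set F) {} (set (peel E F))" "distinct (peel E F)"
    using assms(1) peel_inv_start[of ?R "set F"] by (simp_all add: peel_def)
qed

lemma small_conflict_iff:
  assumes "distinct C" "distinct D" "distinct X" "pseudo (adj E) (set C)" "pseudo (adj E) (set D)"
  shows "small_conflict E X C D S \<longleftrightarrow>
    alp (adj E) (set C) \<le> alp (adj E) (set C - nbrs (adj E) (set S)) \<or>
    alp (adj E) (set D - nbrs (adj E) (set S)) + card (set X) \<le> alp (adj E) (set D)"
proof -
  have "pseudo (adj E) (set (rem E S W))" if "pseudo (adj E) (set W)" for W
    using pseudo_subset[OF that] by (simp add: set_rem)
  then show ?thesis unfolding small_conflict_def using assms
    by (simp add: greedy_correct distinct_rem set_rem[symmetric] distinct_card)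
qed

lemma deletable_at_iff:
  assumes "distinct F" "distinct X" "pseudo (adj E) (set F)" "w \<in> set F"
  shows "deletable_at E X F w \<longleftrightarrow> (\<forall>x1\<in>set X. \<forall>x2\<in>set X. \<forall>x3\<in>set X. \<forall>x4\<in>set X.
    let C = comp (adj E) (set F) w; N = nbrs (adj E) {x1, x2, x3, x4} in
    alp (adj E) C \<le> alp (adj E) (C - N) \<or> alp (adj E) (set F - C - N) + card (set X) \<le> alp (adj E) (set F - C))"
proof -
  let ?C = "comp_list E F w" and ?D = "minus_list F (comp_list E F w)"
  have C: "set ?C = comp (adj E) (set F) w" by (rule comp_list_set[OF assms(1,4)])
  have "set ?C \<subseteq> set F" unfolding C by (rule comp_subset[OF assms(4)])
  then have p: "pseudo (adj E) (set ?C)" "pseudo (adj E) (set ?D)"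
    using pseudo_subset[OF assms(3)] by (auto simp: set_minus_list)
  show ?thesis unfolding deletable_at_def deletable_def list_all_iff Let_def
    by (simp add: small_conflict_iff[OF distinct_comp_list[OF assms(1,4)] distinct_minus_list[OF assms(1)] assms(2) p]
        set_minus_list C)
qed

text \<open>\<open>delete_component\<close> asks for one vertex whose removal turns \<open>C\<close>
  into a forest. It exists because \<open>peel\<close> records at most one vertex per component and
  leaves a forest. The equation uses sums in place of differences so that it chains over several
  deletions.\<close>

lemma delete_at:
  assumes F: "distinct F" "distinct X" "pseudo (adj E) (set F)" "w \<in> set F" "set X \<inter> set F = {}"
    and del: "deletable_at E X F w"
  defines "C \<equiv> comp (adj E) (set F) w"
  shows "alp (adj E) (set X \<union> set F) + alp (adj E) (set F - C) = alp (adj E) (set X \<union> (set F - C)) + alp (adj E) (set F)"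
proof -
  let ?R = "adj E" and ?F = "set F"
  have CF: "C \<subseteq> ?F" unfolding C_def by (rule comp_subset[OF F(4)])
  have cl: "\<not> ?R u v" if "u \<in> C" "v \<in> ?F - C" for u v
    using comp_step[of u ?R ?F w v] that CF unfolding C_def by blast
  note pe = peel_correct(1)[OF F(1,3)]
  let ?Y = "set (peel E F)"
  have "\<exists>z. \<not> ?R z z \<and> forest ?R (C - {z})"
  proof -
    have "\<exists>z\<in>?F. ?Y \<inter> C \<subseteq> {z}"
    proof (cases "?Y \<inter> C = {}")
      case False
      then obtain z where z: "z \<in> ?Y" "z \<in> C" by blast
      have "y = z" if "y \<in> ?Y" "y \<in> C" for y
      proof -
        have "comp ?R ?F y = comp ?R ?F z" using comp_eq[OF symp_adj] z that unfolding C_def by metis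
        then show ?thesis using inj_onD[OF peel_invD(6)[OF pe]] z that by blast
      qed
      then show ?thesis using z CF by blast
    qed (use F(4) in auto)
    then obtain z where z: "z \<in> ?F" "?Y \<inter> C \<subseteq> {z}" by blast
    have "C - {z} \<subseteq> ?F - ?Y" using z CF by blast
    then have "forest ?R (C - {z})" by (rule forest_subset[OF peel_inv_end[OF pe]])
    moreover have "\<not> ?R z z" using F(3) z unfolding pseudo_def by blast
    ultimately show ?thesis by blast
  qed
  then obtain z where z: "\<not> ?R z z" "forest ?R (C - {z})" by blast
  have "alp ?R (set X \<union> ?F) = alp ?R (set X \<union> (?F - C)) + alp ?R C"
  proof (rule delete_component[OF _ _ F(5) symp_adj CF cl z])
    fix x1 x2 x3 x4 assume x: "x1 \<in> set X" "x2 \<in> set X" "x3 \<in> set X" "x4 \<in> set X"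
    have "alp ?R (C - nbrs ?R {x1, x2, x3, x4}) \<le> alp ?R C" using CF by (intro alp_mono) (auto intro: finite_subset)
    then show "alp ?R (C - nbrs ?R {x1, x2, x3, x4}) = alp ?R C \<or>
       alp ?R (?F - C - nbrs ?R {x1, x2, x3, x4}) + card (set X) \<le> alp ?R (?F - C)"
      using del x unfolding deletable_at_iff[OF F(1-4)] Let_def C_def[symmetric] by fastforce
  qed auto
  moreover have "alp ?R ((?F - C) \<union> C) = alp ?R (?F - C) + alp ?R C"
  proof (rule alp_union_separate)
    fix a b assume "a \<in> ?F - C" "b \<in> C"
    then have "\<not> ?R b a" using cl by blast
    then show "\<not> ?R a b \<and> \<not> ?R b a" using symp_adj[of E] by (auto dest: sympD)
  qed (use CF in \<open>auto intro: finite_subset\<close>)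
  moreover have "(?F - C) \<union> C = ?F" using CF by blast
  ultimately show ?thesis by simp
qed

lemma del_components_correct:
  assumes "distinct F" "distinct X" "pseudo (adj E) (set F)" "set X \<inter> set F = {}"
  defines "G \<equiv> del_components E X F"
  shows "distinct G" "set G \<subseteq> set F"
    "alp (adj E) (set X \<union> set F) + alp (adj E) (set G) = alp (adj E) (set X \<union> set G) + alp (adj E) (set F)"
    "w \<in> set G \<Longrightarrow> \<not> deletable_at E X G w"
proof -
  define Inv where "Inv G \<longleftrightarrow> distinct G \<and> set G \<subseteq> set F \<and>
    alp (adj E) (set X \<union> set F) + alp (adj E) (set G) = alp (adj E) (set X \<union> set G) + alp (adj E) (set F)" for G
  define stuck where "stuck G \<longleftrightarrow> filter (\<lambda>w. deletable_at E X G w) G = []" for G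
  have step: "Inv (del_step E X G) \<and> length (del_step E X G) < length G" if "Inv G" "\<not> stuck G" for G
  proof -
    obtain w ws where w: "filter (\<lambda>w. deletable_at E X G w) G = w # ws"
      using \<open>\<not> stuck G\<close> unfolding stuck_def by (metis list.exhaust)
    then have "w \<in> set (filter (\<lambda>w. deletable_at E X G w) G)" by simp
    then have wG: "w \<in> set G" "deletable_at E X G w" by auto
    have G: "distinct G" "set G \<subseteq> set F" using that unfolding Inv_def by auto
    have s: "del_step E X G = minus_list G (comp_list E G w)" by (simp add: del_step_def w)
    have st: "set (del_step E X G) = set G - comp (adj E) (set G) w"
      unfolding s set_minus_list comp_list_set[OF G(1) wG(1)] ..
    have "pseudo (adj E) (set G)" "set X \<inter> set G = {}" using pseudo_subset[OF assms(3) G(2)] assms(4) G(2) by blast+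
    note d = delete_at[OF G(1) assms(2) this(1) wG(1) this(2) wG(2), folded st]
    have "length (del_step E X G) < length G"
      unfolding s minus_list_def using wG(1) comp_self[of w "adj E" "set G"]
      by (intro length_filter_less[of w]) (auto simp: comp_list_set[OF G(1) wG(1)])
    moreover have "Inv (del_step E X G)"
      using that d G st unfolding Inv_def s by (auto simp: distinct_minus_list)
    ultimately show ?thesis by blast
  qed
  have st: "del_step E X G = G" if "stuck G" for G using that by (simp add: del_step_def stuck_def)
  have "Inv ((del_step E X ^^ length F) F) \<and> stuck ((del_step E X ^^ length F) F)"
  proof (rule iterate_stuck[where m=length])
    show "Inv F" using assms(1) by (simp add: Inv_def)
    show "Inv (del_step E X G)" if "Inv G" for G using that step[of G] st[of G] by (cases "stuck G") auto
    show "stuck G \<or> length (del_step E X G) < length G" if "Inv G" for G using that step[of G] by blast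
  qed (use st in auto)
  then have "Inv G" "stuck G" unfolding G_def del_components_def by auto
  then show "distinct G" "set G \<subseteq> set F"
    "alp (adj E) (set X \<union> set F) + alp (adj E) (set G) = alp (adj E) (set X \<union> set G) + alp (adj E) (set F)"
    "w \<in> set G \<Longrightarrow> \<not> deletable_at E X G w"
    unfolding Inv_def stuck_def by (auto simp: filter_empty_conv)
qed

lemma peel_bound:
  assumes "distinct F" "distinct X" "pseudo (adj E) (set F)" "\<And>w. w \<in> set F \<Longrightarrow> \<not> deletable_at E X F w"
  shows "card (set (peel E F)) \<le> card (set X) ^ 5"
proof (rule few_components[OF _ _ symp_adj])
  note pe = peel_correct(1)[OF assms(1,3)]
  show "set (peel E F) \<subseteq> set F" "inj_on (comp (adj E) (set F)) (set (peel E F))"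
    using pe unfolding peel_inv_def by auto
  fix y assume "y \<in> set (peel E F)"
  then have "y \<in> set F" using pe unfolding peel_inv_def by auto
  then show "\<exists>x1\<in>set X. \<exists>x2\<in>set X. \<exists>x3\<in>set X. \<exists>x4\<in>set X.
      alp (adj E) (comp (adj E) (set F) y - nbrs (adj E) {x1, x2, x3, x4}) < alp (adj E) (comp (adj E) (set F) y) \<and>
      alp (adj E) (set F - comp (adj E) (set F) y)
      < alp (adj E) (set F - comp (adj E) (set F) y - nbrs (adj E) {x1, x2, x3, x4}) + card (set X)"
    using assms(4)[of y] unfolding deletable_at_iff[OF assms(1-3) \<open>y \<in> set F\<close>] Let_def not_le de_Morgan_disj bex_simps
    by (auto simp: not_le)
qed auto

lemma forest_pseudo: "forest R W \<Longrightarrow> pseudo R W"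
  unfolding pseudo_def
proof (intro conjI ballI allI impI)
  assume f: "forest R W"
  show "\<not> R v v" if "v \<in> W" for v using forest_irrefl[OF f that] .
  show "e2 R U \<le> 2 * card U" if "U \<subseteq> W" for U
  proof (cases "U = {}")
    case False
    then have "e2 R U + 2 \<le> 2 * card U" using f that unfolding forest_def by blast
    then show ?thesis by simp
  qed (simp add: e2_def)
qed

lemma adj_Cons: "adj (p # E) = join (adj E) {fst p} {snd p}"
  by (intro ext) (auto simp: adj_iff join_def prod_eq_iff)

lemma adj_product: "adj (List.product A B @ E) = join (adj E) (set A) (set B)"
  by (intro ext) (auto simp: adj_iff join_def)

lemma adj_remove_edge: "adj (remove_edge E p) = unlink (adj E) (fst p) (snd p)"
  by (intro ext) (auto simp: adj_iff unlink_def remove_edge_def doubleton_eq_iff)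

lemma set_nm: "set (nm M E u) = NM (adj E) (set M) u"
  by (auto simp: nm_def NM_def)

lemma set_nbl: "set (nbl E u F) = NF (adj E) (set F) u"
  by (auto simp: nbl_def NF_def)

lemma length_nbl_NF: "distinct F \<Longrightarrow> length (nbl E u F) = card (NF (adj E) (set F) u)"
  by (simp add: length_nbl deg_NF)

lemma nbl_Nil_iff:
  assumes "distinct F"
  shows "tl (nbl E u F) = [] \<longleftrightarrow> card (NF (adj E) (set F) u) \<le> 1"
    "tl (tl (nbl E u F)) = [] \<longleftrightarrow> card (NF (adj E) (set F) u) \<le> 2"
  using tl_Nil_iff[of "nbl E u F"] by (simp_all only: length_nbl_NF[OF assms])

lemma nm_Nil_iff: "nm M E v = [] \<longleftrightarrow> NM (adj E) (set M) v = {}"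
  by (simp flip: set_nm)

lemma full_list_iff: "full_list E A B \<longleftrightarrow> full (adj E) (set A) (set B)"
  by (simp add: full_list_def full_def list_all_iff)

lemma adj_join_list: "adj (join_list M E F (u, v)) = join (adj E)
    (NM (adj E) (set M) u \<union> (NF (adj E) (set F) u - {v})) (NM (adj E) (set M) v \<union> (NF (adj E) (set F) v - {u}))"
proof -
  have "{w \<in> S. w \<noteq> x} = S - {x}" for x :: nat and S by auto
  then show ?thesis unfolding join_list_def adj_product by (simp add: set_nm set_nbl)
qed

section \<open>Invariant and termination of the reduction\<close>

definition nonadj :: "nat set \<Rightarrow> (nat \<Rightarrow> nat \<Rightarrow> bool) \<Rightarrow> nat" where
  "nonadj M R = card {p \<in> M \<times> M. \<not> R (fst p) (snd p)}"

lemma nonadj_mono: "finite M \<Longrightarrow> (\<And>a b. a \<in> M \<Longrightarrow> b \<in> M \<Longrightarrow> R a b \<Longrightarrow> R' a b) \<Longrightarrow> nonadj M R' \<le> nonadj M R"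
  unfolding nonadj_def by (rule card_mono) auto

text \<open>\<open>a0\<close> is the independence number to be preserved, up to the committed
  vertices. The labels \<open>L\<close> stay fixed throughout: no rule connects a forest vertex with
  a vertex outside \<open>X\<close> that has another label.\<close>

locale reduction =
  fixes M :: "nat list" and X :: "nat set" and L :: "nat \<Rightarrow> 'b" and a0 :: nat
  assumes XM: "X \<subseteq> set M" and label_inj: "inj_on L (set M - X)" and dM: "distinct M"
begin

definition Inv :: "rstate \<Rightarrow> bool" where
  "Inv s \<longleftrightarrow> (case s of (F, E, r) \<Rightarrow> distinct F \<and> instance_graph (adj E) (set M) (set F)
     \<and> (\<forall>u\<in>set F. \<forall>w\<in>set M \<union> set F - X. adj E u w \<longrightarrow> L u = L w)
     \<and> a0 = alp (adj E) (set M \<union> set F) + length r)"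

definition stuck :: "rstate \<Rightarrow> bool" where
  "stuck s \<longleftrightarrow> (case s of (F, E, r) \<Rightarrow> iso_cands M E F = [] \<and> ban_cands M E F = []
     \<and> elim_cands M E F = [] \<and> unlink_cands M E F = [])"

text \<open>Removing an isolated vertex and folding decrease the first summand, cutting an edge the
  second, and adding an edge in \<open>M\<close> the third; no rule increases any of them.\<close>

definition weight :: "rstate \<Rightarrow> nat" where
  "weight s = (case s of (F, E, r) \<Rightarrow> card (set F) + e2 (adj E) (set F) + nonadj (set M) (adj E))"

lemma InvD:
  assumes "Inv (F, E, r)"
  shows "distinct F" "instance_graph (adj E) (set M) (set F)"
    "u \<in> set F \<Longrightarrow> w \<in> set M \<union> set F - X \<Longrightarrow> adj E u w \<Longrightarrow> L u = L w"
    "a0 = alp (adj E) (set M \<union> set F) + length r"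
  using assms unfolding Inv_def by simp_all

lemma InvI:
  assumes "distinct F" "instance_graph (adj E) (set M) (set F)"
    "\<And>u w. u \<in> set F \<Longrightarrow> w \<in> set M \<union> set F - X \<Longrightarrow> adj E u w \<Longrightarrow> L u = L w"
    "a0 = alp (adj E) (set M \<union> set F) + length r"
  shows "Inv (F, E, r)"
  using assms unfolding Inv_def by simp

lemma iso_step:
  assumes "Inv (F, E, r)" "v \<in> set (iso_cands M E F)"
  defines "G \<equiv> filter (\<lambda>w. \<not> w = v) F"
  shows "Inv (G, E, 0 # r) \<and> weight (G, E, 0 # r) < weight (F, E, r)"
proof -
  note I = InvD[OF assms(1)]
  interpret instance_graph "adj E" "set M" "set F" by (rule I(2))
  have v: "v \<in> set F" "NM (adj E) (set M) v = {}" "NF (adj E) (set F) v = {}"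
    using assms(2) unfolding iso_cands_def by (auto simp flip: set_nm set_nbl)
  have G: "set G = set F - {v}" by (auto simp: G_def)
  have "Inv (G, E, 0 # r)"
  proof (rule InvI)
    show "distinct G" using I(1) by (simp add: G_def)
    show "instance_graph (adj E) (set M) (set G)"
      using disj sy forest_subset[OF forest, of "set G"] by unfold_locales (auto simp: G)
    show "L u = L w" if "u \<in> set G" "w \<in> set M \<union> set G - X" "adj E u w" for u w
      using that I(3)[of u w] by (auto simp: G)
    show "a0 = alp (adj E) (set M \<union> set G) + length (0 # r)"
      using alp_isolated[OF v] I(4) by (simp add: G)
  qed
  moreover have "e2 (adj E) (set G) \<le> e2 (adj E) (set F)" by (rule e2_mono) (auto simp: G)
  moreover have "card (set G) < card (set F)" using v(1) by (intro psubset_card_mono) (auto simp: G)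
  ultimately show ?thesis by (simp add: weight_def)
qed

lemma ban_step:
  assumes "Inv (F, E, r)" "p \<in> set (ban_cands M E F)"
  shows "Inv (F, p # E, r) \<and> weight (F, p # E, r) < weight (F, E, r)"
proof -
  note I = InvD[OF assms(1)]
  interpret instance_graph "adj E" "set M" "set F" by (rule I(2))
  obtain a b where p: "p = (a, b)" by fastforce
  have ab: "a \<in> set M" "b \<in> set M" "\<not> adj E a b" using assms(2) unfolding ban_cands_def p by auto
  have ps: "pseudo (adj E) (set F)" by (rule forest_pseudo[OF forest])
  have "length (greedy E (rem E [a, b] F)) = alp (adj E) (set F - nbrs (adj E) {a, b})"
    using greedy_correct[OF distinct_rem[OF I(1)], of E E "[a, b]"] pseudo_subset[OF ps] by (simp add: set_rem)
  moreover have "length (greedy E F) = alp (adj E) (set F)" by (rule greedy_correct[OF I(1) ps])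
  moreover have "length (greedy E (rem E [a, b] F) @ M) \<le> length (greedy E F)"
    using assms(2) unfolding ban_cands_def p by simp
  ultimately have c: "alp (adj E) (set F - nbrs (adj E) {a, b}) + card (set M) \<le> alp (adj E) (set F)"
    using distinct_card[OF dM] by simp
  have R: "adj (p # E) = join (adj E) {a} {b}" by (simp add: adj_Cons p)
  have "Inv (F, p # E, r)"
  proof (rule InvI)
    show "instance_graph (adj (p # E)) (set M) (set F)"
      using disj symp_adj[of "p # E"] ban_preserves(1)[OF ab(1,2)] by unfold_locales (auto simp: R)
    show "L u = L w" if "u \<in> set F" "w \<in> set M \<union> set F - X" "adj (p # E) u w" for u w
      using that I(3)[of u w] ab disj unfolding R join_def by blast
    show "a0 = alp (adj (p # E)) (set M \<union> set F) + length r"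
      using alp_ban[OF ab(1,2) c] I(4) by (simp add: R)
  qed (rule I(1))
  moreover have "nonadj (set M) (adj (p # E)) < nonadj (set M) (adj E)"
    unfolding nonadj_def
  proof (rule psubset_card_mono)
    have "(a, b) \<in> {q \<in> set M \<times> set M. \<not> adj E (fst q) (snd q)}" using ab by simp
    moreover have "(a, b) \<notin> {q \<in> set M \<times> set M. \<not> adj (p # E) (fst q) (snd q)}" by (simp add: R join_def)
    ultimately show "{q \<in> set M \<times> set M. \<not> adj (p # E) (fst q) (snd q)} \<subset> {q \<in> set M \<times> set M. \<not> adj E (fst q) (snd q)}"
      unfolding R join_def by blast
  qed simp
  ultimately show ?thesis using ban_preserves(2)[OF ab(1,2)] by (simp add: weight_def R)
qed

lemma elim_step:
  assumes "Inv (F, E, r)" "p \<in> set (elim_cands M E F)"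
  defines "G \<equiv> filter (\<lambda>w. \<not> (w = fst p \<or> w = snd p)) F" and "E' \<equiv> join_list M E F p"
  shows "Inv (G, E', 0 # r) \<and> weight (G, E', 0 # r) < weight (F, E, r)"
proof -
  note I = InvD[OF assms(1)]
  interpret instance_graph "adj E" "set M" "set F" by (rule I(2))
  obtain u v where p: "p = (u, v)" by fastforce
  let ?A = "NM (adj E) (set M) u \<union> (NF (adj E) (set F) u - {v})"
  let ?B = "NM (adj E) (set M) v \<union> (NF (adj E) (set F) v - {u})"
  have uv: "u \<in> set F" "v \<in> set F" "adj E u v" using assms(2) unfolding elim_cands_def p by auto
  have res: "full (adj E) (NM (adj E) (set M) u) (NM (adj E) (set M) v)"
    using assms(2) unfolding elim_cands_def p by (simp add: full_list_iff set_nm)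
  have dv: "card (NF (adj E) (set F) v) \<le> 2"
    using assms(2) unfolding elim_cands_def p nbl_Nil_iff[OF I(1)] by simp
  have du: "card (NF (adj E) (set F) u) \<le> 2 \<or> NM (adj E) (set M) v = {}"
    using assms(2) unfolding elim_cands_def p nbl_Nil_iff[OF I(1)] nm_Nil_iff by auto
  note hyps = uv res dv du
  have R: "adj E' = join (adj E) ?A ?B" by (simp add: E'_def p adj_join_list)
  have G: "set G = set F - {u, v}" by (auto simp: G_def p)
  \<comment> \<open>New edges run between neighbours of \<open>u\<close> and neighbours of
    \<open>v\<close>. Outside \<open>X\<close> all of these carry the common label of
    \<open>u\<close> and \<open>v\<close>, so the labelling survives.\<close>
  have Luv: "L u = L v" using I(3)[OF uv(1) _ uv(3)] uv(2) XM disj by blast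
  have LA: "L x = L u" if "x \<in> ?A" "x \<in> set M \<union> set F - X" for x
  proof -
    have "adj E u x" using that R_sym unfolding NM_def NF_def by blast
    then show ?thesis using I(3)[OF uv(1) that(2)] by simp
  qed
  have LB: "L x = L v" if "x \<in> ?B" "x \<in> set M \<union> set F - X" for x
  proof -
    have "adj E v x" using that R_sym unfolding NM_def NF_def by blast
    then show ?thesis using I(3)[OF uv(2) that(2)] by simp
  qed
  have "Inv (G, E', 0 # r)"
  proof (rule InvI)
    show "distinct G" using I(1) by (simp add: G_def)
    show "instance_graph (adj E') (set M) (set G)"
      using disj symp_adj[of E'] forest_eliminate[OF hyps] by unfold_locales (auto simp: R G)
    show "L x = L y" if xy: "x \<in> set G" "y \<in> set M \<union> set G - X" "adj E' x y" for x y
    proof -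
      have x: "x \<in> set F" "x \<in> set M \<union> set F - X" using xy(1) XM disj by (auto simp: G)
      have y: "y \<in> set M \<union> set F - X" using xy(2) by (auto simp: G)
      consider "adj E x y" | "x \<in> ?A" "y \<in> ?B" | "x \<in> ?B" "y \<in> ?A" using xy(3) unfolding R join_def by blast
      then show ?thesis
      proof cases
        case 1
        then show ?thesis using I(3)[OF x(1) y] by blast
      next
        case 2
        then show ?thesis using LA[of x] LB[of y] x y Luv by simp
      next
        case 3
        then show ?thesis using LB[of x] LA[of y] x y Luv by simp
      qed
    qed
    show "a0 = alp (adj E') (set M \<union> set G) + length (0 # r)"
      using alp_eliminate[OF hyps] I(4) by (simp add: R G)
  qed
  moreover have "e2 (adj E') (set G) \<le> e2 (adj E) (set F)"
    using e2_eliminate_le[OF hyps] by (simp add: R G)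
  moreover have "nonadj (set M) (adj E') \<le> nonadj (set M) (adj E)"
    by (rule nonadj_mono) (simp_all add: R join_def)
  moreover have "card (set G) < card (set F)" using uv(1) by (intro psubset_card_mono) (auto simp: G)
  ultimately show ?thesis by (simp add: weight_def)
qed

lemma leaf_of_iff: "distinct F \<Longrightarrow> u \<in> set F \<Longrightarrow> leaf_of E F u v \<longleftrightarrow> NF (adj E) (set F) v = {u}"
proof -
  assume F: "distinct F" "u \<in> set F"
  have c: "finite (NF (adj E) (set F) v)" by (simp add: NF_def)
  have m: "adj E v u \<longleftrightarrow> u \<in> NF (adj E) (set F) v" using F by (simp add: NF_def)
  show ?thesis unfolding leaf_of_def nbl_Nil_iff[OF F(1)] m
    using c by (auto simp: card_le_Suc0_iff_eq)
qed

lemma unlink_step: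
  assumes "Inv (F, E, r)" "p \<in> set (unlink_cands M E F)"
  shows "Inv (F, remove_edge E p, r) \<and> weight (F, remove_edge E p, r) < weight (F, E, r)"
proof -
  note I = InvD[OF assms(1)]
  interpret instance_graph "adj E" "set M" "set F" by (rule I(2))
  obtain u u' where p: "p = (u, u')" by fastforce
  have u: "u \<in> set F" "u' \<in> set F" "adj E u u'" using assms(2) unfolding unlink_cands_def p by auto
  obtain v v' where v: "v \<in> set F" "v' \<in> set F" "NF (adj E) (set F) v = {u}" "NF (adj E) (set F) v' = {u'}"
    "v \<noteq> u'" "v' \<noteq> u" "full (adj E) (NM (adj E) (set M) v) (NM (adj E) (set M) v')"
    using assms(2) leaf_of_iff[OF I(1) u(1)] leaf_of_iff[OF I(1) u(2)]
    unfolding unlink_cands_def p by (auto simp: list_ex_iff full_list_iff set_nm)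
  note hyps = u(1,2) v(1,2) u(3) v(3-7)
  have R: "adj (remove_edge E p) = unlink (adj E) u u'" by (simp add: adj_remove_edge p)
  have "Inv (F, remove_edge E p, r)"
  proof (rule InvI)
    show "instance_graph (adj (remove_edge E p)) (set M) (set F)"
      using disj symp_adj[of "remove_edge E p"] unlink_preserves(1)[OF hyps] by unfold_locales (auto simp: R)
    show "L x = L y" if "x \<in> set F" "y \<in> set M \<union> set F - X" "adj (remove_edge E p) x y" for x y
      using that I(3)[of x y] unfolding R unlink_def by blast
    show "a0 = alp (adj (remove_edge E p)) (set M \<union> set F) + length r"
      using alp_unlink[OF hyps] I(4) by (simp add: R)
  qed (rule I(1))
  moreover have "nonadj (set M) (adj (remove_edge E p)) \<le> nonadj (set M) (adj E)"
    using u disj by (intro nonadj_mono) (auto simp: R unlink_def doubleton_eq_iff)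
  ultimately show ?thesis using unlink_preserves(2)[OF hyps] by (simp add: weight_def R)
qed

lemma red_step:
  assumes "Inv s"
  shows "Inv (red_step M s) \<and> (stuck s \<or> weight (red_step M s) < weight s)"
proof -
  obtain F E r where s: "s = (F, E, r)" by (cases s) auto
  note I = assms[unfolded s]
  show ?thesis
  proof (cases "iso_cands M E F")
    case (Cons v vs)
    then show ?thesis using iso_step[OF I, of v] by (simp add: red_step_def s)
  next
    case iso: Nil
    show ?thesis
    proof (cases "ban_cands M E F")
      case (Cons p ps)
      then show ?thesis using ban_step[OF I, of p] iso by (simp add: red_step_def s)
    next
      case ban: Nil
      show ?thesis
      proof (cases "elim_cands M E F")
        case (Cons p ps)
        then show ?thesis using elim_step[OF I, of p] iso ban by (simp add: red_step_def s)
      next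
        case elim: Nil
        show ?thesis
        proof (cases "unlink_cands M E F")
          case (Cons p ps)
          then show ?thesis using unlink_step[OF I, of p] iso ban elim by (simp add: red_step_def s)
        next
          case Nil
          then show ?thesis using I iso ban elim by (simp add: red_step_def s stuck_def)
        qed
      qed
    qed
  qed
qed

lemma stuck_bound:
  assumes "Inv (F, E, r)" "stuck (F, E, r)"
  shows "card (set F) \<le> 24 * (card (set M) + 2 * card X * card (set M)) * card (set M)"
proof -
  note I = InvD[OF assms(1)]
  interpret instance_graph "adj E" "set M" "set F" by (rule I(2))
  have ps: "pseudo (adj E) (set F)" by (rule forest_pseudo[OF forest])
  have cands: "iso_cands M E F = []" "ban_cands M E F = []" "elim_cands M E F = []" "unlink_cands M E F = []"
    using assms(2) unfolding stuck_def by simp_all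
  interpret reduced_graph "adj E" "set M" "set F" X L
  proof (unfold_locales)
    show "X \<subseteq> set M" "inj_on L (set M - X)" by (rule XM, rule label_inj)
    show "L u = L w" if "u \<in> set F" "w \<in> set M \<union> set F - X" "adj E u w" for u w by (rule I(3)[OF that])
    show "NM (adj E) (set M) v \<noteq> {} \<or> NF (adj E) (set F) v \<noteq> {}" if "v \<in> set F" for v
      using cands(1) that unfolding iso_cands_def filter_empty_conv by (auto simp flip: set_nm set_nbl)
    show "alp (adj E) (set F) < alp (adj E) (set F - nbrs (adj E) {a, b}) + card (set M)"
      if ab: "a \<in> set M" "b \<in> set M" "\<not> adj E a a" "\<not> adj E b b" "\<not> adj E a b" for a b
    proof -
      have "(a, b) \<in> set (List.product M M)" using ab by simp
      then have "\<not> length (greedy E (rem E [a, b] F) @ M) \<le> length (greedy E F)"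
        using cands(2) ab unfolding ban_cands_def filter_empty_conv by fastforce
      moreover have "length (greedy E (rem E [a, b] F)) = alp (adj E) (set F - nbrs (adj E) {a, b})"
        using greedy_correct[OF distinct_rem[OF I(1)], of E E "[a, b]"] pseudo_subset[OF ps] by (simp add: set_rem)
      ultimately show ?thesis using greedy_correct[OF I(1) ps] distinct_card[OF dM] by simp
    qed
    show False if uv: "u \<in> set F" "v \<in> set F" "adj E u v"
      "full (adj E) (NM (adj E) (set M) u) (NM (adj E) (set M) v)" "card (NF (adj E) (set F) v) \<le> 2"
      "card (NF (adj E) (set F) u) \<le> 2 \<or> NM (adj E) (set M) v = {}" for u v
    proof -
      have "(u, v) \<in> set (elim_cands M E F)"
        using uv unfolding elim_cands_def nbl_Nil_iff[OF I(1)] nm_Nil_iff by (auto simp: full_list_iff set_nm)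
      then show False using cands(3) by simp
    qed
    show False if uv: "u \<in> set F" "u' \<in> set F" "v \<in> set F" "v' \<in> set F" "adj E u u'"
      "NF (adj E) (set F) v = {u}" "NF (adj E) (set F) v' = {u'}" "v \<noteq> u'" "v' \<noteq> u"
      "full (adj E) (NM (adj E) (set M) v) (NM (adj E) (set M) v')" for u v u' v'
    proof -
      have "(u, u') \<in> set (unlink_cands M E F)"
        using uv leaf_of_iff[OF I(1) uv(1)] leaf_of_iff[OF I(1) uv(2)] unfolding unlink_cands_def
        by (auto simp: list_ex_iff full_list_iff set_nm)
      then show False using cands(4) by simp
    qed
  qed
  show ?thesis by (rule card_reduced)
qed

lemma reduce_correct:
  assumes "Inv (F, E, [])" "reduce M E F = (G, E', r)"
  shows "Inv (G, E', r)" "card (set G) \<le> 24 * (card (set M) + 2 * card X * card (set M)) * card (set M)"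
proof -
  note I = InvD[OF assms(1)]
  have "weight (F, E, []) \<le> length (fuel M F)"
  proof -
    have "e2 (adj E) (set F) \<le> 2 * card (set F)"
      using forest_pseudo[OF instance_graph.forest[OF I(2)]] unfolding pseudo_def by blast
    moreover have "nonadj (set M) (adj E) \<le> card (set M \<times> set M)" unfolding nonadj_def by (rule card_mono) auto
    ultimately have "weight (F, E, []) \<le> 3 * length F + length M * length M"
      using distinct_card[OF I(1)] distinct_card[OF dM] by (simp add: weight_def card_cartesian_product)
    also have "\<dots> \<le> length (fuel M F)" by (simp add: fuel_def algebra_simps)
    finally show ?thesis .
  qed
  moreover have "red_step M s = s" if "stuck s" for s
    using that by (cases s) (simp add: stuck_def red_step_def)
  ultimately have "Inv ((red_step M ^^ length (fuel M F)) (F, E, [])) \<and> stuck ((red_step M ^^ length (fuel M F)) (F, E, []))"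
    using assms(1) red_step by (intro iterate_stuck[where m=weight]) blast+
  then have "Inv (G, E', r)" "stuck (G, E', r)" using assms(2) unfolding reduce_def by simp_all
  then show "Inv (G, E', r)" "card (set G) \<le> 24 * (card (set M) + 2 * card X * card (set M)) * card (set M)"
    using stuck_bound by blast+
qed

end

text \<open>The handshake lemma; parity turns a surplus of one in \<open>e2\<close> into a whole
  surplus edge.\<close>

lemma even_e2: "finite U \<Longrightarrow> symp R \<Longrightarrow> (\<And>v. v \<in> U \<Longrightarrow> \<not> R v v) \<Longrightarrow> even (e2 R U)"
proof (induction U rule: finite_induct)
  case (insert x U)
  then show ?case using e2_insert[of U x R] by simp
qed (simp add: e2_def)

abbreviation edge :: "nat set set \<Rightarrow> nat \<Rightarrow> nat \<Rightarrow> bool" where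
  "edge E u v \<equiv> {u, v} \<in> E"

lemma edge_irrefl: "graph V E \<Longrightarrow> \<not> edge E v v"
proof
  assume "graph V E" "{v, v} \<in> E"
  then obtain a b where "a \<noteq> b" "{v, v} = {a, b}" unfolding graph_def by metis
  then show False by (auto simp: doubleton_eq_iff)
qed

lemma symp_edge: "symp (edge E)"
  by (rule sympI) (simp add: insert_commute)

section \<open>Cycles and density\<close>

text \<open>From a smallest dense set a vertex of degree at most one could be removed without loss
  of density. The set cannot become empty in this way, as a single vertex without a loop is not
  dense.\<close>

lemma dense_core:
  assumes "finite W" "symp R" "\<And>v. v \<in> W \<Longrightarrow> \<not> R v v" "W \<noteq> {}" "2 * card W \<le> e2 R W"
  obtains U where "U \<subseteq> W" "U \<noteq> {}" "\<And>u. u \<in> U \<Longrightarrow> 2 \<le> deg R U u"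
proof -
  define P where "P U \<longleftrightarrow> U \<subseteq> W \<and> U \<noteq> {} \<and> 2 * card U \<le> e2 R U" for U
  have "P W" using assms by (simp add: P_def)
  then obtain U where U: "P U" and min: "\<And>T. P T \<Longrightarrow> card U \<le> card T"
    using ex_has_least_nat[of P W card] by blast
  have f: "finite U" using U assms(1) finite_subset unfolding P_def by blast
  have "2 \<le> deg R U u" if u: "u \<in> U" for u
  proof (rule ccontr)
    assume "\<not> 2 \<le> deg R U u"
    have i: "insert u (U - {u}) = U" using u by auto
    have l: "\<not> R u u" using u U assms(3) unfolding P_def by blast
    have e: "e2 R U = e2 R (U - {u}) + 2 * deg R (U - {u}) u"
      using e2_insert[of "U - {u}" u R] f l assms(2) unfolding i by simp
    have "deg R (U - {u}) u \<le> deg R U u" unfolding deg_def using f by (intro card_mono) auto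
    moreover have c: "card U = Suc (card (U - {u}))" using card_Suc_Diff1[OF f u] by simp
    moreover have dU: "2 * card U \<le> e2 R U" "U \<subseteq> W" using U unfolding P_def by blast+
    ultimately have "2 * card (U - {u}) \<le> e2 R (U - {u})"
      using e \<open>\<not> 2 \<le> deg R U u\<close> by linarith
    moreover have "\<not> P (U - {u})" using min[of "U - {u}"] c by auto
    ultimately have "U - {u} = {}" using dU unfolding P_def by blast
    then have "e2 R (U - {u}) = 0" "deg R (U - {u}) u = 0" by (simp_all only: e2_def deg_def) simp_all
    then show False using e dU c by linarith
  qed
  then show ?thesis using that U unfolding P_def by blast
qed

text \<open>Both neighbours of the first vertex of a longest path lie on the path.\<close>

lemma min_degree_cycle:
  assumes fin: "finite U" and ne: "U \<noteq> {}" and irr: "\<And>u. u \<in> U \<Longrightarrow> \<not> edge E u u"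
    and d2: "\<And>u. u \<in> U \<Longrightarrow> 2 \<le> deg (edge E) U u"
  obtains c where "is_cycle E c" "set c \<subseteq> U"
proof -
  define P where "P p \<longleftrightarrow> distinct p \<and> set p \<subseteq> U \<and> p \<noteq> [] \<and> (\<forall>i. Suc i < length p \<longrightarrow> edge E (p ! i) (p ! Suc i))" for p
  obtain u0 where "u0 \<in> U" using ne by blast
  then have "P [u0]" by (simp add: P_def)
  moreover have "\<forall>p. P p \<longrightarrow> length p < Suc (card U)"
  proof (intro allI impI)
    fix p assume "P p"
    then have "distinct p" "set p \<subseteq> U" unfolding P_def by simp_all
    then show "length p < Suc (card U)" using card_mono[OF fin, of "set p"] distinct_card[of p] by simp
  qed
  ultimately have "\<exists>p. P p \<and> (\<forall>q. P q \<longrightarrow> length q \<le> length p)"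
    by (rule ex_has_greatest_nat)
  then obtain p where p: "P p" and max: "\<And>q. P q \<Longrightarrow> length q \<le> length p" by blast
  have pd: "distinct p" "set p \<subseteq> U" "p \<noteq> []" and pe: "\<And>i. Suc i < length p \<Longrightarrow> edge E (p ! i) (p ! Suc i)"
    using p unfolding P_def by simp_all
  define x where "x = p ! 0"
  have "x \<in> set p" using pd(3) by (simp add: x_def)
  then have x: "x \<in> U" using pd(2) by (rule subsetD[rotated])
  have on: "y \<in> set p" if y: "y \<in> U" "edge E x y" for y
  proof (rule ccontr)
    assume n: "y \<notin> set p"
    have "P (y # p)" unfolding P_def
    proof (intro conjI allI impI)
      fix i assume "Suc i < length (y # p)"
      then show "edge E ((y # p) ! i) ((y # p) ! Suc i)"
        using pe[of "i - 1"] y(2) by (cases i) (simp_all add: x_def insert_commute)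
    qed (use pd y n in auto)
    then show False using max[of "y # p"] by simp
  qed
  \<comment> \<open>Of two neighbours on the path only one can be the successor of \<open>x\<close>;
    the other one closes a cycle with at least three vertices.\<close>
  have "\<exists>j. 2 \<le> j \<and> j < length p \<and> edge E x (p ! j)"
  proof (rule ccontr)
    assume no: "\<not> ?thesis"
    have "{y \<in> U. edge E x y} \<subseteq> {p ! 1}"
    proof
      fix y assume y: "y \<in> {y \<in> U. edge E x y}"
      then obtain i where i: "i < length p" "p ! i = y" using on[of y] by (auto simp: in_set_conv_nth)
      have "i \<noteq> 0" using y irr[OF x] i unfolding x_def by (metis (mono_tags, lifting) mem_Collect_eq)
      moreover have "\<not> 2 \<le> i" using no i y by auto
      ultimately have "i = 1" by simp
      then show "y \<in> {p ! 1}" using i by simp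
    qed
    then have "card {y \<in> U. edge E x y} \<le> 1" using card_mono[of "{p ! 1}" "{y \<in> U. edge E x y}"] by simp
    then show False using d2[OF x] unfolding deg_def by simp
  qed
  then obtain j where j: "2 \<le> j" "j < length p" "edge E x (p ! j)" by blast
  let ?c = "take (Suc j) p"
  have len: "length ?c = Suc j" using j by simp
  have "is_cycle E ?c" unfolding is_cycle_def len
  proof (intro conjI allI impI)
    fix i assume i: "i < Suc j"
    show "edge E (?c ! i) (?c ! ((i + 1) mod Suc j))"
    proof (cases "i = j")
      case True
      then show ?thesis using j(3) by (simp add: x_def insert_commute)
    next
      case False
      then show ?thesis using i j pe[of i] by simp
    qed
  qed (use j pd in simp_all)
  moreover have "set ?c \<subseteq> U" using set_take_subset[of "Suc j" p] pd by blast
  ultimately show ?thesis by (rule that)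
qed

lemma dense_cycle:
  assumes "finite W" "\<And>v. v \<in> W \<Longrightarrow> \<not> edge E v v" "W \<noteq> {}" "2 * card W \<le> e2 (edge E) W"
  obtains c where "is_cycle E c" "set c \<subseteq> W"
proof -
  obtain U where U: "U \<subseteq> W" "U \<noteq> {}" "\<And>u. u \<in> U \<Longrightarrow> 2 \<le> deg (edge E) U u"
    using dense_core[OF assms(1) symp_edge assms(2-4)] by blast
  obtain c where "is_cycle E c" "set c \<subseteq> U"
    by (rule min_degree_cycle[OF finite_subset[OF U(1) assms(1)] U(2) assms(2)[OF subsetD[OF U(1)]] U(3)])
  then show ?thesis using that[of c] U(1) by simp
qed

text \<open>A minimal vertex set with more edges than vertices is connected and contains a cycle;
  without one edge of this cycle it still contains a cycle.\<close>

lemma pseudoforest_pseudo: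
  assumes "pseudoforest V E"
  shows "pseudo (edge E) V"
proof -
  have g: "graph V E" using assms by (simp add: pseudoforest_def)
  have fV: "finite V" using g by (simp add: graph_def)
  have irr: "\<not> edge E v v" for v by (rule edge_irrefl[OF g])
  have "e2 (edge E) U \<le> 2 * card U" if U: "U \<subseteq> V" for U
  proof (rule ccontr)
    assume neg: "\<not> ?thesis"
    define P where "P U \<longleftrightarrow> U \<subseteq> V \<and> 2 * card U < e2 (edge E) U" for U
    have "P U" using U neg by (simp add: P_def)
    then obtain W where W: "P W" and min: "\<And>T. P T \<Longrightarrow> card W \<le> card T"
      using ex_has_least_nat[of P U card] by blast
    have fW: "finite W" using W fV finite_subset unfolding P_def by blast
    have ne: "W \<noteq> {}" using W by (auto simp: P_def e2_def)
    have "2 * card W < e2 (edge E) W" using W by (simp add: P_def)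
    \<comment> \<open>By parity, exceeding \<open>2 * card W\<close> at all means exceeding it by
      two, that is, by one edge.\<close>
    moreover have "even (e2 (edge E) W)" using even_e2[OF fW symp_edge] irr by blast
    ultimately have dense: "2 * card W + 2 \<le> e2 (edge E) W" by (elim evenE) simp
    \<comment> \<open>A proper component and its complement are smaller than the minimal set
      \<open>W\<close>, so neither exceeds its bound; no edge runs between them, hence
      \<open>W\<close> would not exceed its bound either.\<close>
    have conn: "reach E a b" if ab: "a \<in> W" "b \<in> W" for a b
    proof -
      let ?C = "comp (edge E) W a"
      have sub: "?C \<subseteq> W" by (rule comp_subset[OF ab(1)])
      have "?C = W"
      proof (rule ccontr)
        assume "?C \<noteq> W"
        then have C: "?C \<subset> W" "W - ?C \<subset> W" using sub comp_self[of a "edge E" W] ab(1) by blast+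
        have "\<not> P T" if "T \<subset> W" for T using min[of T] psubset_card_mono[OF fW that] by auto
        then have "e2 (edge E) ?C \<le> 2 * card ?C" "e2 (edge E) (W - ?C) \<le> 2 * card (W - ?C)"
          using C W unfolding P_def by (meson leI order_trans psubset_imp_subset)+
        moreover have "e2 (edge E) (?C \<union> (W - ?C)) = e2 (edge E) ?C + e2 (edge E) (W - ?C) + 2 * (\<Sum>u\<in>?C. deg (edge E) (W - ?C) u)"
          using fW sub finite_subset[OF sub fW] by (intro e2_union) (auto simp: symp_edge)
        moreover have "deg (edge E) (W - ?C) u = 0" if u: "u \<in> ?C" for u
        proof -
          have "{v \<in> W - ?C. edge E u v} = {}" using comp_step[OF u] u sub by blast
          then show ?thesis unfolding deg_def by (simp only: card.empty)
        qed
        moreover have "?C \<union> (W - ?C) = W" "card W = card ?C + card (W - ?C)"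
          using sub fW card_Un_disjoint[of ?C "W - ?C"] finite_subset[OF sub fW] by (auto simp: Un_absorb1)
        ultimately show False using dense by simp
      qed
      then have "(\<lambda>x y. x \<in> W \<and> y \<in> W \<and> edge E x y)\<^sup>*\<^sup>* a b" using ab(2) unfolding comp_def by blast
      then show ?thesis unfolding reach_def by (rule rtranclp_mono[THEN predicate2D, rotated]) auto
    qed
    have dense0: "2 * card W \<le> e2 (edge E) W" using dense by simp
    obtain c where c: "is_cycle E c" "set c \<subseteq> W"
      by (rule dense_cycle[OF fW irr ne dense0])
    define f where "f = {c ! 0, c ! 1}"
    have l3: "3 \<le> length c" using c(1) by (simp add: is_cycle_def)
    have fc: "f \<in> cycle_edges c"
      unfolding f_def cycle_edges_def using l3 by (intro CollectI exI[of _ 0]) auto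
    \<comment> \<open>An edge counts twice in \<open>e2\<close>, so its removal uses up at most the
      surplus of two, and a cycle that avoids \<open>f\<close> remains.\<close>
    have dense': "2 * card W \<le> e2 (edge (E - {f})) W"
    proof -
      let ?S = "{(x, y). x \<in> W \<and> y \<in> W \<and> edge (E - {f}) x y}" and ?T = "{(c ! 0, c ! 1), (c ! 1, c ! 0)}"
      have sub: "{(x, y). x \<in> W \<and> y \<in> W \<and> edge E x y} \<subseteq> ?S \<union> ?T"
        by (auto simp: f_def doubleton_eq_iff)
      have "finite ?S" by (rule finite_subset[of _ "W \<times> W"]) (use fW in auto)
      then have "finite (?S \<union> ?T)" by simp
      then have "e2 (edge E) W \<le> card (?S \<union> ?T)" unfolding e2_pairs[OF fW] using sub by (rule card_mono)
      moreover have "card (?S \<union> ?T) \<le> card ?S + card ?T" by (rule card_Un_le)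
      moreover have "card ?S = e2 (edge (E - {f})) W" by (simp only: e2_pairs[OF fW])
      moreover have "card ?T \<le> 2" using card_length[of "[(c ! 0, c ! 1), (c ! 1, c ! 0)]"] by simp
      ultimately show ?thesis using dense by linarith
    qed
    obtain d where d: "is_cycle (E - {f}) d" "set d \<subseteq> W"
      by (rule dense_cycle[OF fW _ ne dense']) (use irr in simp)
    have "c \<noteq> []" "d \<noteq> []" using c(1) d(1) by (auto simp: is_cycle_def)
    then have "hd c \<in> W" "hd d \<in> W" using c(2) d(2) by auto
    then have "reach E (hd c) (hd d)" by (rule conn)
    moreover have "is_cycle E d" using d(1) by (simp add: is_cycle_def)
    ultimately have "cycle_edges c = cycle_edges d" using assms c(1) unfolding pseudoforest_def by blast
    moreover have "f \<notin> cycle_edges d" using d(1) unfolding is_cycle_def cycle_edges_def by auto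
    ultimately show False using fc by simp
  qed
  then show ?thesis using irr unfolding pseudo_def by blast
qed

lemma pseudo_cong: "pseudo R W \<Longrightarrow> (\<And>u v. u \<in> W \<Longrightarrow> v \<in> W \<Longrightarrow> R' u v \<longleftrightarrow> R u v) \<Longrightarrow> pseudo R' W"
proof -
  assume p: "pseudo R W" and c: "\<And>u v. u \<in> W \<Longrightarrow> v \<in> W \<Longrightarrow> R' u v \<longleftrightarrow> R u v"
  have "e2 R' U = e2 R U" if "U \<subseteq> W" for U
  proof -
    have "{v \<in> U. R' u v} = {v \<in> U. R u v}" if "u \<in> U" for u using that \<open>U \<subseteq> W\<close> c by blast
    then show ?thesis unfolding e2_def deg_def by (intro sum.cong) auto
  qed
  then show ?thesis using p c unfolding pseudo_def by simp
qed

lemma valid_instance_pseudo: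
  assumes "valid_instance V E X k"
  shows "pseudo (edge E) (V - X)"
proof (rule pseudo_cong)
  show "pseudo (edge (del_verts_E E X)) (V - X)"
    using pseudoforest_pseudo assms unfolding valid_instance_def del_verts_V_def by blast
qed (auto simp: del_verts_E_def)

section \<open>The kernel\<close>

lemma edge_in: "graph V E \<Longrightarrow> edge E u v \<Longrightarrow> u \<in> V \<and> v \<in> V"
proof -
  assume "graph V E" "{u, v} \<in> E"
  then obtain a b where "a \<in> V" "b \<in> V" "{u, v} = {a, b}" unfolding graph_def by metis
  then show ?thesis by (auto simp: doubleton_eq_iff)
qed

lemma set_edge_list: "graph V E \<Longrightarrow> set (edge_list E) = {(u, v). edge E u v \<and> u < v}"
proof -
  assume g: "graph V E"
  have "{(u, v). edge E u v \<and> u < v} \<subseteq> V \<times> V" using edge_in[OF g] by auto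
  then have "finite {(u, v). edge E u v \<and> u < v}" using g finite_subset unfolding graph_def by blast
  then show ?thesis by (simp add: edge_list_def)
qed

lemma adj_edge_list:
  assumes g: "graph V E"
  shows "adj (rev (edge_list E)) = edge E"
proof (intro ext)
  fix u v
  have "edge E v u = edge E u v" by (simp only: insert_commute)
  moreover have "u < v \<or> v < u" if "edge E u v" using that edge_irrefl[OF g, of u] by (cases "u = v") auto
  ultimately show "adj (rev (edge_list E)) u v = edge E u v"
    unfolding adj_iff set_rev set_edge_list[OF g] mem_Collect_eq case_prod_conv by blast
qed

lemma has_indep_set_iff:
  assumes f: "finite V"
  shows "has_indep_set V E k \<longleftrightarrow> k \<le> alp (edge E) V"
proof -
  have i: "independent_set V E S \<longleftrightarrow> S \<subseteq> V \<and> indep (edge E) S" for S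
    by (simp only: independent_set_def indep_def)
  obtain S where S: "S \<subseteq> V" "indep (edge E) S" "card S = alp (edge E) V" by (rule alp_obtain[OF f])
  show ?thesis unfolding has_indep_set_def i
  proof
    assume "\<exists>S. (S \<subseteq> V \<and> indep (edge E) S) \<and> k \<le> card S"
    then show "k \<le> alp (edge E) V" using alp_ge[OF f] le_trans by blast
  next
    assume "k \<le> alp (edge E) V"
    then show "\<exists>S. (S \<subseteq> V \<and> indep (edge E) S) \<and> k \<le> card S" using S by (intro exI[of _ S]) simp
  qed
qed

lemma valid_instance_all:
  assumes "graph V E"
  shows "valid_instance V E V k"
proof -
  have e: "e \<inter> V \<noteq> {}" if "e \<in> E" for e using that assms unfolding graph_def by blast
  then have "del_verts_E E V = {}" unfolding del_verts_E_def by blast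
  moreover have "\<not> is_cycle {} c" for c by (auto simp: is_cycle_def intro!: exI[of _ 0])
  ultimately show ?thesis
    using assms by (simp add: valid_instance_def del_verts_V_def pseudoforest_def graph_def)
qed

lemma sorted_product:
  fixes xs ys :: "nat list"
  assumes "sorted_wrt (<) xs" "sorted_wrt (<) ys"
  shows "sorted_wrt (<) (List.product xs ys)"
  using assms(1)
proof (induction xs)
  case (Cons x xs)
  then show ?case using assms(2) by (auto simp: sorted_wrt_append sorted_wrt_map)
qed simp

lemma sorted_list_of_set_strict: "sorted_wrt (<) l \<Longrightarrow> sorted_list_of_set (set l) = l"
  for l :: "'a::linorder list"
  by (simp add: strict_sorted_iff sorted_list_of_set.idem_if_sorted_distinct)

definition induced :: "nat list \<Rightarrow> (nat \<times> nat) list \<Rightarrow> nat set set" where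
  "induced l E = {{u, v} | u v. u \<in> set l \<and> v \<in> set l \<and> adj E u v}"

lemma edge_induced: "edge (induced l E) u v \<longleftrightarrow> u \<in> set l \<and> v \<in> set l \<and> adj E u v"
proof -
  have "adj E v u \<longleftrightarrow> adj E u v" by (simp only: adj_iff disj_commute)
  then show ?thesis unfolding induced_def mem_Collect_eq doubleton_eq_iff by blast
qed

lemma graph_induced:
  assumes "\<And>v. v \<in> set l \<Longrightarrow> \<not> adj E v v"
  shows "graph (set l) (induced l E)"
  unfolding graph_def
proof (intro conjI ballI)
  fix e assume "e \<in> induced l E"
  then obtain u v where e: "e = {u, v}" "u \<in> set l" "v \<in> set l" "adj E u v" unfolding induced_def by blast
  moreover have "u \<noteq> v" using e assms[of u] by metis
  ultimately show "\<exists>u v. u \<noteq> v \<and> e = {u, v} \<and> u \<in> set l \<and> v \<in> set l" by blast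
qed simp

lemma encode_induced:
  assumes l: "sorted_wrt (<) l"
  shows "map tsym (enc_instance (set l) (induced l E) (set l) k) = encode_graph k l E"
proof -
  have "set (edges_of l E) = {(u, v). edge (induced l E) u v \<and> u < v}"
    by (auto simp: edges_of_def edge_induced)
  moreover have "sorted_wrt (<) (edges_of l E)"
    unfolding edges_of_def by (intro sorted_wrt_filter sorted_product l)
  ultimately have "edge_list (induced l E) = edges_of l E"
    unfolding edge_list_def by (metis sorted_list_of_set_strict)
  moreover have "distinct l" using l by (simp add: strict_sorted_iff)
  ultimately show ?thesis unfolding enc_instance_def enc_nats_eq encode_graph_def
    by (simp add: sorted_list_of_set_strict[OF l] distinct_card case_prod_beta')
qed

lemma alp_unlooped: "finite W \<Longrightarrow> alp R {v \<in> W. \<not> R v v} = alp R W"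
proof (rule antisym)
  assume f: "finite W"
  show "alp R {v \<in> W. \<not> R v v} \<le> alp R W" using f by (intro alp_mono) auto
  show "alp R W \<le> alp R {v \<in> W. \<not> R v v}"
    using f by (intro alp_le alp_ge) (auto simp: indep_def)
qed

lemma red_step_subset: "set (fst (red_step M s)) \<subseteq> set (fst s)"
  unfolding red_step_def by (auto split: list.split)

lemma reduce_subset: "reduce M E F = (G, E', r) \<Longrightarrow> set G \<subseteq> set F"
proof -
  assume g: "reduce M E F = (G, E', r)"
  have "set (fst ((red_step M ^^ n) s)) \<subseteq> set (fst s)" for n s
    by (induction n) (use red_step_subset in fastforce)+
  from this[of "length (fuel M F)" "(F, E, [])"] show ?thesis using g unfolding reduce_def by simp
qed

text \<open>With \<open>n = x + 1\<close>, \<open>m \<le> 2 * n ^ 5\<close> and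
  \<open>1 + 2 * x \<le> 2 * n\<close> give \<open>g \<le> 192 * n ^ 11\<close>; the remaining two
  units of 194 pay for \<open>m\<close>.\<close>

lemma kernel_size:
  fixes x y m g :: nat
  assumes "y \<le> x ^ 5" "m = x + y" "g \<le> 24 * (m + 2 * x * m) * m"
  shows "m + g \<le> 194 * (x + 1) ^ 12"
proof -
  let ?n = "x + 1"
  have pow: "24 * ((2 * n ^ 5) * (2 * n ^ 5) * (2 * n)) = 192 * n ^ 11" for n :: nat
    by (simp add: power_numeral_reduce)
  have "x ^ 5 \<le> ?n ^ 5" by (rule power_mono) auto
  moreover have "x \<le> ?n ^ 5" using self_le_power[of ?n 5] by simp
  ultimately have m: "m \<le> 2 * ?n ^ 5" using assms by linarith
  have "24 * (m + 2 * x * m) * m = 24 * (m * m * (1 + 2 * x))" by (simp add: algebra_simps)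
  also have "\<dots> \<le> 24 * ((2 * ?n ^ 5) * (2 * ?n ^ 5) * (2 * ?n))" by (intro mult_le_mono m le_refl) simp
  also have "\<dots> = 192 * ?n ^ 11" by (rule pow)
  also have "\<dots> \<le> 192 * ?n ^ 12" by (intro mult_le_mono le_refl power_increasing) auto
  finally have "g \<le> 192 * ?n ^ 12" using assms(3) by simp
  moreover have "?n ^ 5 \<le> ?n ^ 12" by (rule power_increasing) auto
  ultimately show ?thesis using m by linarith
qed

lemma shrink_correct:
  assumes valid: "valid_instance V E X k"
  obtains V' E' k' where "graph V' E'" "has_indep_set V E k \<longleftrightarrow> has_indep_set V' E' k'"
    "card V' \<le> 194 * (card X + 1) ^ 12"
    "shrink k (sorted_list_of_set V) (sorted_list_of_set X) (rev (edge_list E)) = map tsym (enc_instance V' E' V' k')"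
proof -
  have g: "graph V E" and XV: "X \<subseteq> V" using valid by (simp_all add: valid_instance_def)
  have fV: "finite V" using g by (simp add: graph_def)
  then have fX: "finite X" using XV finite_subset by blast
  define V0 X0 El where "V0 = sorted_list_of_set V" and "X0 = sorted_list_of_set X" and "El = rev (edge_list E)"
  have V0: "set V0 = V" "distinct V0" "sorted_wrt (<) V0" using fV by (simp_all add: V0_def)
  have X0: "set X0 = X" "distinct X0" using fX by (simp_all add: X0_def)
  have adj: "adj El = edge E" unfolding El_def by (rule adj_edge_list[OF g])
  define F0 where "F0 = minus_list V0 X0"
  define F1 where "F1 = del_components El X0 F0"
  define Y where "Y = peel El F1"
  define M where "M = X0 @ Y"
  define F2 where "F2 = minus_list F1 M"
  define r1 where "r1 = drop (length (greedy El F1)) (greedy El F0)"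
  obtain G E2 r where red: "reduce M El F2 = (G, E2, r)" by (cases "reduce M El F2") auto
  define l where "l = kept V0 M (G, E2, r)"
  define k' where "k' = k - length r1 - length r"
  have F0: "distinct F0" "set F0 = V - X" by (simp_all add: F0_def distinct_minus_list set_minus_list V0 X0)
  have ps0: "pseudo (adj El) (set F0)" unfolding adj F0(2) by (rule valid_instance_pseudo[OF valid])
  have XF0: "set X0 \<inter> set F0 = {}" by (auto simp: F0(2) X0)
  note del = del_components_correct[OF F0(1) X0(2) ps0 XF0, folded F1_def]
  have ps1: "pseudo (adj El) (set F1)" by (rule pseudo_subset[OF ps0 del(2)])
  have "length (greedy El F0) = alp (adj El) (set F0)" by (rule greedy_correct[OF F0(1) ps0])
  moreover have "length (greedy El F1) = alp (adj El) (set F1)" by (rule greedy_correct[OF del(1) ps1])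
  moreover have "alp (adj El) (set F1) \<le> alp (adj El) (set F0)" by (rule alp_mono[OF _ del(2)]) simp
  moreover have "set X0 \<union> set F0 = V" using XV by (auto simp: F0(2) X0)
  ultimately have alp1: "alp (adj El) V = alp (adj El) (X \<union> set F1) + length r1"
    using del(3) X0(1) by (simp add: r1_def)
  note peel = peel_correct[OF del(1) ps1, folded Y_def]
  have YF: "set Y \<subseteq> set F1" using peel_invD(2)[OF peel(1)] by blast
  have XF1: "X \<inter> set F1 = {}" using del(2) by (auto simp: F0(2))
  have M: "set M = X \<union> set Y" "distinct M" using X0 peel(2) YF XF1 by (auto simp: M_def)
  have F2: "set F2 = set F1 - set Y" "distinct F2"
    using XF1 by (auto simp: F2_def set_minus_list M intro!: distinct_minus_list del(1))
  have MF: "set M \<union> set F2 = X \<union> set F1" using YF by (auto simp: M F2)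
  \<comment> \<open>The label of a vertex is its component in the surviving pseudoforest, which
    contains at most one recorded vertex.\<close>
  interpret reduction M X "comp (adj El) (set F1)" "alp (adj El) (X \<union> set F1)"
  proof unfold_locales
    have "set M - X = set Y" using YF XF1 by (auto simp: M)
    then show "inj_on (comp (adj El) (set F1)) (set M - X)" using peel_invD(6)[OF peel(1)] by simp
  qed (use M in auto)
  have inv: "Inv (F2, El, [])"
  proof (rule InvI)
    have "forest (adj El) (set F2)" unfolding F2(1) by (rule peel_inv_end[OF peel(1)])
    then show "instance_graph (adj El) (set M) (set F2)"
      using XF1 by unfold_locales (auto simp: M F2 symp_adj fX)
    show "comp (adj El) (set F1) u = comp (adj El) (set F1) w"
      if u: "u \<in> set F2" and w: "w \<in> set M \<union> set F2 - X" and uw: "adj El u w" for u w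
    proof -
      have uF: "u \<in> set F1" using u unfolding F2(1) by blast
      have wF: "w \<in> set F1" using w unfolding MF by blast
      have "w \<in> comp (adj El) (set F1) u" by (rule comp_step[where R="adj El", OF comp_self uF wF uw])
      then show ?thesis by (rule comp_eq[OF symp_adj, symmetric])
    qed
    show "alp (adj El) (X \<union> set F1) = alp (adj El) (set M \<union> set F2) + length []" by (simp add: MF del: set_append)
  qed (rule F2(2))
  note out = reduce_correct[OF inv red]
  have GV: "set G \<subseteq> V" using reduce_subset[OF red] del(2) by (auto simp: F2 F0(2))
  have MV: "set M \<subseteq> V" using XV YF del(2) by (auto simp: M F0(2))
  have l: "set l = {v \<in> set M \<union> set G. \<not> adj E2 v v}"
    using GV MV by (auto simp: l_def kept_def V0)
  have "sorted_wrt (<) l" unfolding l_def kept_def by (rule sorted_wrt_filter[OF V0(3)])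
  then have enc: "map tsym (enc_instance (set l) (induced l E2) (set l) k') = encode_graph k' l E2"
    by (rule encode_induced)
  \<comment> \<open>Loops stand for banned vertices. These vertices are dropped only now, since the
    output graph has to be simple.\<close>
  have "alp (adj E2) (set M \<union> set G) = alp (adj E2) (set l)" unfolding l by (rule alp_unlooped[symmetric]) simp
  also have "\<dots> = alp (edge (induced l E2)) (set l)" by (rule alp_cong) (simp_all add: edge_induced)
  finally have "alp (edge E) V = alp (edge (induced l E2)) (set l) + length r + length r1"
    using alp1 InvD(4)[OF out(1)] adj by simp
  \<comment> \<open>Subtraction in \<open>k'\<close> is truncated: if the committed vertices already
    reach \<open>k\<close>, then \<open>k' = 0\<close> and both sides are true.\<close>
  then have "has_indep_set V E k \<longleftrightarrow> has_indep_set (set l) (induced l E2) k'"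
    using has_indep_set_iff[OF fV] has_indep_set_iff[of "set l"] by (auto simp: k'_def)
  moreover have "card (set l) \<le> 194 * (card X + 1) ^ 12"
  proof -
    have "card (set l) \<le> card (set M \<union> set G)" unfolding l by (rule card_mono) auto
    also have "\<dots> \<le> card (set M) + card (set G)" by (rule card_Un_le)
    also have "\<dots> \<le> 194 * (card X + 1) ^ 12"
    proof (rule kernel_size)
      show "card (set Y) \<le> card X ^ 5"
        using peel_bound[OF del(1) X0(2) ps1 del(4)] by (simp add: Y_def X0)
      show "card (set M) = card X + card (set Y)"
        unfolding M(1) using fX YF XF1 by (intro card_Un_disjoint) auto
    qed (rule out(2))
    finally show ?thesis .
  qed
  moreover have "graph (set l) (induced l E2)" by (rule graph_induced) (simp add: l)
  moreover have "shrink k V0 X0 El = map tsym (enc_instance (set l) (induced l E2) (set l) k')"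
    unfolding enc by (simp add: shrink_def finish_def emit_def red l_def k'_def
      flip: F0_def F1_def Y_def M_def F2_def r1_def)
  ultimately show ?thesis using that V0_def X0_def El_def by blast
qed

lemma kernel_instance:
  assumes "valid_instance V E X k"
  shows "kernel (map tsym (enc_instance V E X k))
    = shrink k (sorted_list_of_set V) (sorted_list_of_set X) (rev (edge_list E))"
  using parse_instance[of k "sorted_list_of_set V" "sorted_list_of_set X"]
  unfolding kernel_def enc_instance_def enc_nats_eq tparse_tenc by simp

theorem theorem1:
  "\<exists>Q S delta (c::nat) (d::nat) (C::nat). tm_ok Q S delta \<and>
     (\<forall>V E X k. valid_instance V E X k \<longrightarrow>
        (\<exists>t V' E' X' k'.
           t \<le> c * (length (enc_instance V E X k) + 1) ^ d \<and>
           halts_with delta (enc_instance V E X k) t (enc_instance V' E' X' k') \<and>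
           valid_instance V' E' X' k' \<and>
           (has_indep_set V E k \<longleftrightarrow> has_indep_set V' E' k') \<and>
           card V' \<le> C * (card X + 1) ^ 12))"
proof -
  obtain Q S delta c d where ok: "tm_ok Q S delta"
    and run: "\<And>w out. set w \<subseteq> {1,2,3} \<Longrightarrow> set out \<subseteq> {1,2,3} \<Longrightarrow> kernel (map tsym w) = map tsym out \<Longrightarrow>
      \<exists>t \<le> c * (length w + 1) ^ d. halts_with delta w t out"
    using PT_machine[OF PT_kernel] by blast
  have "\<exists>t V' E' X' k'. t \<le> c * (length (enc_instance V E X k) + 1) ^ d \<and>
      halts_with delta (enc_instance V E X k) t (enc_instance V' E' X' k') \<and> valid_instance V' E' X' k' \<and>
      (has_indep_set V E k \<longleftrightarrow> has_indep_set V' E' k') \<and> card V' \<le> 194 * (card X + 1) ^ 12"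
    if v: "valid_instance V E X k" for V E X k
  proof -
    obtain V' E' k' where out: "graph V' E'" "has_indep_set V E k \<longleftrightarrow> has_indep_set V' E' k'"
      "card V' \<le> 194 * (card X + 1) ^ 12"
      "shrink k (sorted_list_of_set V) (sorted_list_of_set X) (rev (edge_list E)) = map tsym (enc_instance V' E' V' k')"
      by (rule shrink_correct[OF v])
    have "set (enc_instance V E X k) \<subseteq> {1,2,3}" for V E X k unfolding enc_instance_def by (rule set_enc_nats)
    then obtain t where "t \<le> c * (length (enc_instance V E X k) + 1) ^ d"
      "halts_with delta (enc_instance V E X k) t (enc_instance V' E' V' k')"
      using run kernel_instance[OF v] out(4) by metis
    then show ?thesis using out(2,3) valid_instance_all[OF out(1)] by blast
  qed
  then show ?thesis using ok by blast
qed

end
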